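(* Let $n\ge1$ and $\ell\ge1$. (i) The module $U_{2n+1,\ell}$ is a free $R_{2n+1}$-module of rank $\binom{2n+1}{\ell}$ with $Bas_\ell^{o}$ as a basis. (ii) The generating function $\mathrm{ch}_{2n+1,\ell}=\sum_{Q\in Bas^o_\ell}q^{\deg_1Q}$ of the $\deg_1$-degrees of this basis is $$\mathrm{ch}_{2n+1,\ell}=\begin{bmatrix}2n+1\\ \ell\end{bmatrix}_q.$$
   Context: $\begin{bmatrix}m\\ \ell\end{bmatrix}_q=\frac{(q)_m}{(q)_\ell(q)_{m-\ell}}$ for $0\le\ell\le m$ (zero otherwise), with $(q)_m=\prod_{j=1}^m(1-q^j)$. $R_{2n+1}$ is the ring of symmetric polynomials in $x_1,\dots,x_{2n+1}$ over $\mathbb C$; $H^{(2n+1)}=\bigoplus_{k=0}^{2n}R_{2n+1}X^k$. $\wedge^\ell H^{(2n+1)}$ (over $R_{2n+1}$) is identified with the space of anti-symmetric polynomials $P(X_1,\dots,X_\ell|x_1,\dots,x_{2n+1})$ in $X_1,\dots,X_\ell$ of degree at most $2n$ in each $X_a$ with coefficients in $R_{2n+1}$, via $X^{i_1}\wedge\cdots\wedge X^{i_\ell}\mapsto\sum_{\sigma\in S_\ell}\operatorname{sgn}\sigma\,X_{\sigma(1)}^{i_1}\cdots X_{\sigma(\ell)}^{i_\ell}$. $U_{2n+1,\ell}$ is the $R_{2n+1}$-submodule of all $P\in\wedge^\ell H^{(2n+1)}$ with $P(X_1,\dots,X_{\ell-1},\pm x^{-1}|x_1,\dots,x_{2n-1},x,-x)=0$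 identically for both signs. The degree $\deg_1$ is defined by $\deg_1X_a=-1$, $\deg_1x_j=1$. $e_k$ is the $k$-th elementary symmetric polynomial in $x_1,\dots,x_{2n+1}$ ($e_k=0$ for $k<0$ or $k>2n+1$). For $1\le r\le n+1$, $s\in\mathbb Z$: $P_{1,s}=e_{2s-1}$, $P_{r,s}=P_{r-1,s+1}-e_{2s}P_{r-1,1}$ for $r\ge2$. Put $v_0=\sum_{j=0}^ne_{2j}X^{2j}$; $v_i=\sum_{j=1}^{n+1}P_{i,j}X^{2(j-1)}$ for $1\le i\le n$; $w_i=\sum_{j=1}^{n+1}P_{i+1,j}X^{2j-1}$ for $0\le i\le n$; and for $1\le k\le n$ $$2\xi_k(X_1,X_2)=\frac{X_1-X_2}{X_1+X_2}\big(v_0(X_1)w_{k-1}(X_2)+v_0(X_2)w_{k-1}(X_1)\big)+v_0(X_1)w_{k-1}(X_2)-v_0(X_2)w_{k-1}(X_1).$$ Then $v_0,v_i,w_i\in U_{2n+1,1}$ for $1\le i\le n$ and $\xi_k\in U_{2n+1,2}$. For $m\ge0$ let $Bas_m^{o-}$ be the family of elements $v_I\wedge w_J\wedge\xi_K$ (with $v_I=v_{i_1}\wedge\cdots\wedge v_{i_{\ell_1}}$, etc.; empty product $1$) where $I=(i_1,\dots,i_{\ell_1})$, $J=(j_1,\dots,j_{\ell_2})$, $K=(k_1,\dots,k_{\ell_3})$, $\ell_1,\ell_2,\ell_3\ge 0$, satisfy $1\le i_1<\cdots<i_{\ell_1}\le n$, $1\le j_1<\cdots<j_{\ell_2}\le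 n-\ell_1-\ell_3$, $1\le k_1\le\cdots\le k_{\ell_3}\le n-\ell_1-\ell_3+1$, $\ell_1+\ell_2+2\ell_3=m$. Put $Bas_\ell^{o+}=v_0\wedge Bas_{\ell-1}^{o-}$ and $Bas^o_\ell=Bas^{o+}_\ell\sqcup Bas^{o-}_\ell$. *)

theory Defs
  imports
    Complex_Main
    "HOL-Library.Poly_Mapping"
    "HOL-Combinatorics.Permutations"
    "HOL-Computational_Algebra.Polynomial"
    "HOL-Computational_Algebra.Fraction_Field"
begin

section \<open>Polynomials\<close>

text \<open>
  Polynomials in variables indexed by the natural numbers, as the monoid algebra of the exponent
  vectors; multiplication is the convolution product of Poly\_Mapping.
  An element of type Xpoly is a polynomial in \<open>X\<^sub>1, X\<^sub>2, \<dots>\<close> whose coefficients are complex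
  polynomials in \<open>x\<^sub>1, x\<^sub>2, \<dots>\<close>.  All variables are numbered from 1.
\<close>

type_synonym 'a mpoly = "(nat \<Rightarrow>\<^sub>0 nat) \<Rightarrow>\<^sub>0 'a"
type_synonym xpoly = "complex mpoly"
type_synonym Xpoly = "xpoly mpoly"

definition const :: "'a::zero \<Rightarrow> 'a mpoly" where
  "const c = Poly_Mapping.single 0 c"

definition var :: "nat \<Rightarrow> 'a::zero_neq_one mpoly" where
  "var i = Poly_Mapping.single (Poly_Mapping.single i 1) 1"

text \<open>
  The map sending a polynomial to its value when coefficients are mapped by \<open>h\<close> and the variable
  number \<open>i\<close> is replaced by \<open>f i\<close>.
\<close>

definition eval_with :: "('a::zero \<Rightarrow> 'b) \<Rightarrow> (nat \<Rightarrow> 'b) \<Rightarrow> 'a mpoly \<Rightarrow> 'b::comm_semiring_1" where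
  "eval_with h f p =
     (\<Sum>m\<in>Poly_Mapping.keys p.
        h (Poly_Mapping.lookup p m) *
        (\<Prod>i\<in>Poly_Mapping.keys m. f i ^ Poly_Mapping.lookup m i))"

definition rename :: "(nat \<Rightarrow> nat) \<Rightarrow> 'a::comm_semiring_1 mpoly \<Rightarrow> 'a mpoly" where
  "rename \<sigma> p = eval_with const (\<lambda>i. var (\<sigma> i)) p"

definition eval_Xx :: "(nat \<Rightarrow> complex) \<Rightarrow> (nat \<Rightarrow> complex) \<Rightarrow> Xpoly \<Rightarrow> complex" where
  "eval_Xx X x P = eval_with (eval_with (\<lambda>c. c) x) X P"

definition sym_polys :: "nat \<Rightarrow> xpoly set" where
  "sym_polys N = {p. (\<forall>m\<in>Poly_Mapping.keys p. Poly_Mapping.keys m \<subseteq> {1..N}) \<and>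
                     (\<forall>\<sigma>. \<sigma> permutes {1..N} \<longrightarrow> rename \<sigma> p = p)}"

text \<open>\<open>elem_sym N k\<close> is the elementary symmetric polynomial \<open>e\<^sub>k\<close> in \<open>x\<^sub>1, \<dots>, x\<^sub>N\<close>; the sum is
  empty for \<open>k > N\<close>.\<close>

definition elem_sym :: "nat \<Rightarrow> int \<Rightarrow> xpoly" where
  "elem_sym N k =
     (if k < 0 then 0 else \<Sum>S | S \<subseteq> {1..N} \<and> card S = nat k. \<Prod>j\<in>S. var j)"


section \<open>Exterior powers and the modules U\<close>

text \<open>\<open>ext_power n l\<close> is the \<open>l\<close>-th exterior power of \<open>H\<^sup>(\<^sup>2\<^sup>n\<^sup>+\<^sup>1\<^sup>)\<close> over the ring of symmetric
  polynomials in \<open>x\<^sub>1, \<dots>, x\<^sub>2\<^sub>n\<^sub>+\<^sub>1\<close>, realised by antisymmetric polynomials.\<close>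

definition ext_power :: "nat \<Rightarrow> nat \<Rightarrow> Xpoly set" where
  "ext_power n l = {P.
     (\<forall>m\<in>Poly_Mapping.keys P.
        Poly_Mapping.keys m \<subseteq> {1..l} \<and> (\<forall>a. Poly_Mapping.lookup m a \<le> 2 * n)) \<and>
     (\<forall>m. Poly_Mapping.lookup P m \<in> sym_polys (2 * n + 1)) \<and>
     (\<forall>\<sigma>. \<sigma> permutes {1..l} \<longrightarrow> rename \<sigma> P = of_int (sign \<sigma>) * P)}"

text \<open>
  The product of \<open>P\<close> in the \<open>p\<close>-th and \<open>Q\<close> in the \<open>q\<close>-th exterior power.  Under
  \<open>X\<^sup>i\<^sup>1 \<and> \<dots> \<and> X\<^sup>i\<^sup>l \<mapsto> \<Sum>\<^sub>\<sigma> sgn \<sigma> X\<^bsub>\<sigma>(1)\<^esub>\<^sup>i\<^sup>1 \<cdots> X\<^bsub>\<sigma>(l)\<^esub>\<^sup>i\<^sup>l\<close> the images of two wedges of monomials have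
  \<open>p!\<close> and \<open>q!\<close> terms, and in the sum below each term of the image of their product occurs
  \<open>p! q!\<close> times; hence the normalisation.
\<close>

definition wedge :: "nat \<Rightarrow> nat \<Rightarrow> Xpoly \<Rightarrow> Xpoly \<Rightarrow> Xpoly" where
  "wedge p q P Q =
     const (const (1 / (fact p * fact q))) *
     (\<Sum>\<sigma> | \<sigma> permutes {1..p + q}.
        of_int (sign \<sigma>) * rename \<sigma> P * rename (\<lambda>b. \<sigma> (p + b)) Q)"

text \<open>The product of a list of elements, each of them in the \<open>d\<close>-th exterior power.\<close>

primrec wedge_list :: "nat \<Rightarrow> Xpoly list \<Rightarrow> Xpoly" where
  "wedge_list d [] = 1"
| "wedge_list d (P # Ps) = wedge d (d * length Ps) P (wedge_list d Ps)"

text \<open>The vanishing condition ``identically'' is vanishing at all complex arguments with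
  \<open>x \<noteq> 0\<close>.  It is meant for \<open>n \<ge> 1\<close> and \<open>l \<ge> 1\<close>.\<close>

definition U :: "nat \<Rightarrow> nat \<Rightarrow> Xpoly set" where
  "U n l = {P \<in> ext_power n l.
     \<forall>X y x s. x \<noteq> 0 \<longrightarrow> s \<in> {1, -1} \<longrightarrow>
       eval_Xx (X(l := s * inverse x)) (y(2 * n := x, 2 * n + 1 := - x)) P = 0}"


section \<open>The elements v, w, xi\<close>

text \<open>The polynomials \<open>P\<^sub>r\<^sub>,\<^sub>s\<close> are only meant for \<open>r \<ge> 1\<close>.\<close>

fun Prs :: "nat \<Rightarrow> nat \<Rightarrow> int \<Rightarrow> xpoly" where
  "Prs n 0 s = 0"
| "Prs n (Suc 0) s = elem_sym (2 * n + 1) (2 * s - 1)"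
| "Prs n (Suc (Suc r)) s = Prs n (Suc r) (s + 1) - elem_sym (2 * n + 1) (2 * s) * Prs n (Suc r) 1"

text \<open>\<open>v n i a\<close> and \<open>w n i a\<close> are \<open>v\<^sub>i(X\<^sub>a)\<close> and \<open>w\<^sub>i(X\<^sub>a)\<close>.\<close>

definition v :: "nat \<Rightarrow> nat \<Rightarrow> nat \<Rightarrow> Xpoly" where
  "v n i a =
     (if i = 0 then \<Sum>j=0..n. const (elem_sym (2 * n + 1) (2 * int j)) * var a ^ (2 * j)
      else \<Sum>j=1..n+1. const (Prs n i (int j)) * var a ^ (2 * (j - 1)))"

definition w :: "nat \<Rightarrow> nat \<Rightarrow> nat \<Rightarrow> Xpoly" where
  "w n i a = (\<Sum>j=1..n+1. const (Prs n (i + 1) (int j)) * var a ^ (2 * j - 1))"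

text \<open>The defining formula of \<open>\<xi>\<^sub>k\<close> multiplied by \<open>X\<^sub>1 + X\<^sub>2\<close>.\<close>

definition is_xi :: "nat \<Rightarrow> nat \<Rightarrow> Xpoly \<Rightarrow> bool" where
  "is_xi n k Q \<longleftrightarrow>
     (var 1 + var 2) * (2 * Q) =
       (var 1 - var 2) * (v n 0 1 * w n (k - 1) 2 + v n 0 2 * w n (k - 1) 1) +
       (var 1 + var 2) * (v n 0 1 * w n (k - 1) 2 - v n 0 2 * w n (k - 1) 1)"

definition xi :: "nat \<Rightarrow> nat \<Rightarrow> Xpoly" where
  "xi n k = (THE Q. is_xi n k Q)"

lemma is_xi_ex1: "\<exists>!Q. is_xi n k Q"
proof -
  let ?x = "var 1 :: Xpoly" and ?y = "var 2 :: Xpoly"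
  have diff: "a - b dvd a ^ m - b ^ m" for a b :: Xpoly and m
    unfolding power_diff_sumr2 by (rule dvd_triv_left)
  have even: "?x + ?y dvd ?x ^ (2 * j) - ?y ^ (2 * j)" for j
  proof -
    have "?x - (- ?y) dvd ?x ^ (2 * j) - (- ?y) ^ (2 * j)" by (rule diff)
    then show ?thesis by simp
  qed
  have odd: "?x + ?y dvd ?x ^ m + ?y ^ m" if "odd m" for m
  proof -
    have "?x - (- ?y) dvd ?x ^ m - (- ?y) ^ m" by (rule diff)
    then show ?thesis using that by simp
  qed
  have step: "?x + ?y dvd ?x ^ (2 * j) * ?y ^ m + ?y ^ (2 * j) * ?x ^ m" if "odd m" for j m
  proof -
    have "?x ^ (2 * j) * ?y ^ m + ?y ^ (2 * j) * ?x ^ m =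
          (?x ^ (2 * j) - ?y ^ (2 * j)) * ?y ^ m + ?y ^ (2 * j) * (?x ^ m + ?y ^ m)"
      by (simp add: algebra_simps)
    also have "?x + ?y dvd \<dots>"
      by (intro dvd_add dvd_mult dvd_mult2 even odd that)
    finally show ?thesis .
  qed
  define V W D :: Xpoly
    where "V = v n 0 1 * w n (k - 1) 2 + v n 0 2 * w n (k - 1) 1"
      and "W = v n 0 1 * w n (k - 1) 2 - v n 0 2 * w n (k - 1) 1"
      and "D = ?x + ?y"
  have "V = (\<Sum>j=0..n. \<Sum>i=1..n+1. const (elem_sym (2 * n + 1) (2 * int j)) *
         const (Prs n (k - 1 + 1) (int i)) *
         (?x ^ (2 * j) * ?y ^ (2 * i - 1) + ?y ^ (2 * j) * ?x ^ (2 * i - 1)))"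
    unfolding V_def v_def w_def if_P[OF refl] sum_product sum.distrib[symmetric]
    by (intro sum.cong refl) (simp only: distrib_left mult_ac)
  moreover have "D dvd \<dots>"
    unfolding D_def
  proof (intro dvd_sum dvd_mult step)
    fix i assume "i \<in> {1..n + 1}"
    then have "2 * i - 1 = Suc (2 * (i - 1))" by auto
    then show "odd (2 * i - 1)" by simp
  qed
  ultimately obtain Q where Q: "V = D * Q" by auto
  let ?h = "const (const (1/2)) :: Xpoly"
  have "(2 :: Xpoly) = const (const 2)"
    unfolding const_def by simp
  then have half: "2 * ?h = 1"
    by (simp only: const_def mult_single) simp
  have D: "D \<noteq> 0"
  proof
    assume "D = 0"
    then have "Poly_Mapping.lookup D (Poly_Mapping.single 1 1) = 0" by simp
    moreover have "Poly_Mapping.single (2::nat) (1::nat) \<noteq> Poly_Mapping.single 1 1"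
    proof
      assume "Poly_Mapping.single (2::nat) (1::nat) = Poly_Mapping.single 1 1"
      then have "Poly_Mapping.lookup (Poly_Mapping.single (2::nat) (1::nat)) 2 =
                 Poly_Mapping.lookup (Poly_Mapping.single (1::nat) (1::nat)) 2" by (simp only:)
      then show False by (simp add: lookup_single)
    qed
    ultimately show False
      by (simp add: D_def var_def lookup_add lookup_single when_def)
  qed
  have *: "is_xi n k R \<longleftrightarrow> D * (2 * R) = D * ((?x - ?y) * Q + W)" for R
  proof -
    have "is_xi n k R \<longleftrightarrow> D * (2 * R) = (?x - ?y) * V + D * W"
      unfolding is_xi_def V_def W_def D_def ..
    also have "(?x - ?y) * V + D * W = D * ((?x - ?y) * Q + W)"
      unfolding Q by (simp only: distrib_left mult_ac)
    finally show ?thesis .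
  qed
  show ?thesis
  proof
    have "2 * (?h * ((?x - ?y) * Q + W)) = (?x - ?y) * Q + W"
      by (simp only: mult.assoc[symmetric] half mult_1_left)
    then show "is_xi n k (?h * ((?x - ?y) * Q + W))"
      unfolding * by (rule arg_cong)
  next
    fix R assume "is_xi n k R"
    then have "2 * R = (?x - ?y) * Q + W"
      unfolding * using D by (simp only: mult_cancel_left simp_thms)
    moreover have "R = ?h * (2 * R)"
      by (simp only: mult.assoc[symmetric] mult.commute[of ?h 2] half mult_1_left)
    ultimately show "R = ?h * ((?x - ?y) * Q + W)" by simp
  qed
qed


section \<open>The family Bas\<close>

text \<open>Index triples \<open>(I, J, K)\<close> of the elements \<open>v\<^sub>I \<and> w\<^sub>J \<and> \<xi>\<^sub>K\<close>.  The upper bounds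
  \<open>n - |I| - |K|\<close> and \<open>n - |I| - |K| + 1\<close> are written additively, because subtraction of natural
  numbers is truncated.\<close>

definition bas_minus_index :: "nat \<Rightarrow> nat \<Rightarrow> (nat list \<times> nat list \<times> nat list) set" where
  "bas_minus_index n m = {(I, J, K).
     sorted_wrt (<) I \<and> (\<forall>i\<in>set I. 1 \<le> i \<and> i \<le> n) \<and>
     sorted_wrt (<) J \<and> (\<forall>j\<in>set J. 1 \<le> j \<and> j + length I + length K \<le> n) \<and>
     sorted_wrt (\<le>) K \<and> (\<forall>k\<in>set K. 1 \<le> k \<and> k + length I + length K \<le> n + 1) \<and>
     length I + length J + 2 * length K = m}"

definition bas_minus :: "nat \<Rightarrow> nat list \<times> nat list \<times> nat list \<Rightarrow> Xpoly" where
  "bas_minus n = (\<lambda>(I, J, K).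
     wedge (length I) (length J + 2 * length K) (wedge_list 1 (map (\<lambda>i. v n i 1) I))
       (wedge (length J) (2 * length K) (wedge_list 1 (map (\<lambda>j. w n j 1) J))
          (wedge_list 2 (map (xi n) K))))"

text \<open>The left summand indexes the elements \<open>v\<^sub>0 \<and> b\<close> with \<open>b\<close> of degree \<open>l - 1\<close>.\<close>

definition bas_index ::
  "nat \<Rightarrow> nat \<Rightarrow> ((nat list \<times> nat list \<times> nat list) + (nat list \<times> nat list \<times> nat list)) set" where
  "bas_index n l = bas_minus_index n (l - 1) <+> bas_minus_index n l"

definition bas ::
  "nat \<Rightarrow> nat \<Rightarrow> (nat list \<times> nat list \<times> nat list) + (nat list \<times> nat list \<times> nat list) \<Rightarrow> Xpoly" where
  "bas n l = case_sum (\<lambda>t. wedge 1 (l - 1) (v n 0 1) (bas_minus n t)) (bas_minus n)"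


section \<open>Finite bases over a subring\<close>

text \<open>The finite family \<open>b\<close> indexed by \<open>A\<close> is a basis of \<open>M\<close> as a module over the ring with
  underlying set \<open>R\<close> and scalar multiplication \<open>scl\<close>: it spans \<open>M\<close> and is linearly independent.\<close>

definition is_module_basis ::
  "'r::comm_ring_1 set \<Rightarrow> ('r \<Rightarrow> 'm \<Rightarrow> 'm) \<Rightarrow> 'm::ab_group_add set \<Rightarrow> 'i set \<Rightarrow> ('i \<Rightarrow> 'm) \<Rightarrow> bool" where
  "is_module_basis R scl M A b \<longleftrightarrow>
     finite A \<and>
     M = {(\<Sum>i\<in>A. scl (c i) (b i)) | c. \<forall>i\<in>A. c i \<in> R} \<and>
     (\<forall>c. (\<forall>i\<in>A. c i \<in> R) \<longrightarrow> (\<Sum>i\<in>A. scl (c i) (b i)) = 0 \<longrightarrow> (\<forall>i\<in>A. c i = 0))"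


section \<open>Degree and Gaussian binomials\<close>

definition mdeg :: "(nat \<Rightarrow>\<^sub>0 nat) \<Rightarrow> int" where
  "mdeg m = (\<Sum>i\<in>Poly_Mapping.keys m. int (Poly_Mapping.lookup m i))"

definition deg1_homogeneous :: "int \<Rightarrow> Xpoly \<Rightarrow> bool" where
  "deg1_homogeneous d P \<longleftrightarrow>
     (\<forall>m\<in>Poly_Mapping.keys P. \<forall>m'\<in>Poly_Mapping.keys (Poly_Mapping.lookup P m). mdeg m' - mdeg m = d)"

text \<open>The degree is unique for a nonzero homogeneous element.\<close>

definition deg1 :: "Xpoly \<Rightarrow> int" where
  "deg1 P = (THE d. deg1_homogeneous d P)"

definition qfact :: "'a::field \<Rightarrow> nat \<Rightarrow> 'a" where
  "qfact q m = (\<Prod>j=1..m. 1 - q ^ j)"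

definition qbinomial :: "'a::field \<Rightarrow> nat \<Rightarrow> nat \<Rightarrow> 'a" where
  "qbinomial q m l = (if l \<le> m then qfact q m / (qfact q l * qfact q (m - l)) else 0)"

text \<open>The indeterminate of the field of rational functions, in which the generating function
  lives.\<close>

definition q_indet :: "rat poly fract" where
  "q_indet = Fract [:0, 1:] 1"

definition ch :: "nat \<Rightarrow> nat \<Rightarrow> rat poly fract" where
  "ch n l = (\<Sum>t\<in>bas_index n l. q_indet powi deg1 (bas n l t))"

end

(* Put N = 2 n + 1.  Replacing X_a by -1/x_a for a = 1..l turns P in U into a polynomial that is
   antisymmetric in x_1, ..., x_l and symmetric in the other variables; by interpolation nothing is
   lost, as P has degree at most 2 n in each X_a.  The vanishing condition says that the result is
   divisible by x_a + x_b for all a <= l and b <> a.  By Artin's basis of the polynomials over the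
   symmetric polynomials, the quotients are combinations of the antisymmetrised monomials in
   x_1, ..., x_l whose exponents form an l-subset of {0, ..., 2 n}.  So U embeds into a module with
   a homogeneous spanning family whose degrees are, up to a shift, the sums of these subsets.

   The elements of Bas are independent already where x_1, ..., x_N are chosen such that
   prod (1 + x_j X) = 1 + X^N.  There the v_i and w_i become monomials, and functionals on the
   powers of X_1, ..., X_l separate the products v_I w_J xi_K, starting with the longest K.

   An independent homogeneous family with as many elements of each degree as a homogeneous spanning
   family spans as well.  The numbers agree by part (ii): the generating function in t of
   Bas-minus, multiplied by 1 + t to account for v_0, satisfies the recursion in n that leads from
   one odd N to the next for the Rogers-Szego polynomials sum_l [N, l]_q t^l. *)

theory Submission
  imports
    Defs
    "HOL-Library.FuncSet"
    "HOL-Library.Function_Algebras"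
    "HOL-Computational_Algebra.Fundamental_Theorem_Algebra"
    "HOL-Computational_Algebra.Formal_Power_Series"
begin

section \<open>Evaluation homomorphisms\<close>

text \<open>Spanning is not shown by reducing elements of \<open>U n l\<close>. As in graded
  Nakayama arguments, each degree gives a square system modulo lower degrees, which independence
  makes invertible. The obstacle to independence is xi_k: at the special point it stays a sum of
  products of an even power of one variable and an odd power of another, so it overlaps with
  products of v_i and w_j. The functionals therefore evaluate even powers at points z_i and send the
  odd powers in each pair to the coefficients of an interpolation polynomial L. The sum collapses to
  z_i^k L(z_i), which vanishes unless the two variables are partners. With a = |I| and c = |K| the
  degree of L is below a + c; the bound on K lets the sum contain all coefficients of L, and the
  bound on J places w_j beyond the degree of L. Longer K must be excluded beforehand because their
  odd variables could occupy the places of the w_j. Independence at one point suffices, since a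
  relation over the ring has lowest terms along a line through that point. The degree shifts of the
  two families differ by C(l, 2), the least sum of an l-subset of {0, ..., 2n} for l at most 2n +
  1.\<close>

locale rhom =
  fixes h :: "'a::comm_ring_1 \<Rightarrow> 'b::comm_ring_1"
  assumes add: "h (x + y) = h x + h y"
    and mult: "h (x * y) = h x * h y"
    and one: "h 1 = 1"
begin

lemma zero: "h 0 = 0"
  using add[of 0 0] by simp

lemma uminus: "h (- x) = - h x"
proof -
  have "h (- x) + h x = 0" using add[of "- x" x] zero by simp
  then show ?thesis by (simp add: eq_neg_iff_add_eq_0)
qed

lemma diff: "h (x - y) = h x - h y"
  using add[of x "- y"] uminus[of y] by simp

lemma sum: "h (sum f A) = (\<Sum>i\<in>A. h (f i))"
  by (induction A rule: infinite_finite_induct) (simp_all add: zero add)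

lemma prod: "h (prod f A) = (\<Prod>i\<in>A. h (f i))"
  by (induction A rule: infinite_finite_induct) (simp_all add: one mult)

lemma power: "h (x ^ k) = h x ^ k"
  by (induction k) (simp_all add: one mult)

lemma of_nat: "h (of_nat k) = of_nat k"
  by (induction k) (simp_all add: zero one add)

lemma of_int: "h (of_int k) = of_int k"
  by (cases k) (simp_all add: of_nat uminus one diff del: of_nat_Suc)

lemma numeral: "h (numeral k) = numeral k"
  using of_nat[of "numeral k"] by simp

lemmas hom_simps = zero uminus diff add mult one sum prod power of_nat of_int numeral

end

lemma rhom_comp: "rhom g \<Longrightarrow> rhom h \<Longrightarrow> rhom (\<lambda>x. g (h x))"
  by (simp add: rhom_def)

lemma rhom_ident: "rhom (\<lambda>x. x)"
  by (simp add: rhom_def)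

section \<open>Polynomials as sums of monomials, and substitution homomorphisms\<close>

lemma poly_mapping_sum_single:
  fixes p :: "'k \<Rightarrow>\<^sub>0 'a::comm_monoid_add"
  assumes "finite S" "Poly_Mapping.keys p \<subseteq> S"
  shows "p = (\<Sum>m\<in>S. Poly_Mapping.single m (Poly_Mapping.lookup p m))"
proof (rule poly_mapping_eqI)
  fix k
  have "Poly_Mapping.lookup p k = (if k \<in> S then Poly_Mapping.lookup p k else 0)"
    using assms(2) by (auto simp: in_keys_iff)
  then show "Poly_Mapping.lookup p k =
      Poly_Mapping.lookup (\<Sum>m\<in>S. Poly_Mapping.single m (Poly_Mapping.lookup p m)) k"
    using assms(1) by (simp add: lookup_sum lookup_single when_def)
qed

lemma keys_add_nat:
  fixes m m' :: "nat \<Rightarrow>\<^sub>0 nat"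
  shows "Poly_Mapping.keys (m + m') = Poly_Mapping.keys m \<union> Poly_Mapping.keys m'"
  by (auto simp: in_keys_iff lookup_add)

definition mono :: "(nat \<Rightarrow> 'b) \<Rightarrow> (nat \<Rightarrow>\<^sub>0 nat) \<Rightarrow> 'b::comm_semiring_1" where
  "mono f m = (\<Prod>i\<in>Poly_Mapping.keys m. f i ^ Poly_Mapping.lookup m i)"

lemma mono_superset:
  assumes "finite S" "Poly_Mapping.keys m \<subseteq> S"
  shows "mono f m = (\<Prod>i\<in>S. f i ^ Poly_Mapping.lookup m i)"
  unfolding mono_def
  by (rule prod.mono_neutral_left) (use assms in \<open>auto simp: in_keys_iff\<close>)

lemma mono_add: "mono f (m + m') = mono f m * mono f m'"
proof -
  let ?S = "Poly_Mapping.keys m \<union> Poly_Mapping.keys m'"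
  have "mono f (m + m') = (\<Prod>i\<in>?S. f i ^ Poly_Mapping.lookup (m + m') i)"
    by (rule mono_superset) (auto simp: keys_add_nat)
  also have "\<dots> = mono f m * mono f m'"
    by (simp add: lookup_add power_add prod.distrib mono_superset[of ?S])
  finally show ?thesis .
qed

lemma mono_0 [simp]: "mono f 0 = 1"
  by (simp add: mono_def)

lemma mono_single [simp]: "mono f (Poly_Mapping.single i k) = f i ^ k"
  by (cases "k = 0") (simp_all add: mono_def)

lemma mono_sum: "mono f (sum g A) = (\<Prod>i\<in>A. mono f (g i))"
  by (induction A rule: infinite_finite_induct) (simp_all add: mono_add)

lemma (in rhom) mono: "h (mono f m) = mono (\<lambda>i. h (f i)) m"
  by (simp add: mono_def hom_simps)

lemma eval_with_mono:
  assumes "rhom h" "finite S" "Poly_Mapping.keys p \<subseteq> S"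
  shows "eval_with h f p = (\<Sum>m\<in>S. h (Poly_Mapping.lookup p m) * mono f m)"
  unfolding eval_with_def mono_def[symmetric]
  by (rule sum.mono_neutral_left) (use assms rhom.zero[OF assms(1)] in \<open>auto simp: in_keys_iff\<close>)

lemma eval_with_add:
  assumes "rhom h"
  shows "eval_with h f (p + q) = eval_with h f p + eval_with h f q"
proof -
  let ?S = "Poly_Mapping.keys p \<union> Poly_Mapping.keys q"
  have "eval_with h f (p + q) = (\<Sum>m\<in>?S. h (Poly_Mapping.lookup (p + q) m) * mono f m)"
    by (rule eval_with_mono[OF assms]) (use Poly_Mapping.keys_add[of p q] in auto)
  also have "\<dots> = eval_with h f p + eval_with h f q"
    by (simp add: lookup_add rhom.add[OF assms] ring_distribs sum.distrib eval_with_mono[OF assms, of ?S])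
  finally show ?thesis .
qed

lemma eval_with_0: "rhom h \<Longrightarrow> eval_with h f 0 = 0"
  by (simp add: eval_with_def)

lemma eval_with_sum: "rhom h \<Longrightarrow> eval_with h f (sum g A) = (\<Sum>i\<in>A. eval_with h f (g i))"
  by (induction A rule: infinite_finite_induct) (simp_all add: eval_with_0 eval_with_add)

lemma eval_with_single:
  assumes "rhom h"
  shows "eval_with h f (Poly_Mapping.single m c) = h c * mono f m"
  by (subst eval_with_mono[OF assms, of "{m}"]) auto

lemma eval_with_mult:
  assumes "rhom h"
  shows "eval_with h f (p * q) = eval_with h f p * eval_with h f q"
proof -
  let ?s = "\<lambda>p m. Poly_Mapping.single m (Poly_Mapping.lookup p m)"
  have "p * q = (\<Sum>m\<in>Poly_Mapping.keys p. ?s p m) * (\<Sum>m\<in>Poly_Mapping.keys q. ?s q m)"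
    by (simp flip: poly_mapping_sum_single)
  also have "\<dots> = (\<Sum>m\<in>Poly_Mapping.keys p. \<Sum>m'\<in>Poly_Mapping.keys q.
      Poly_Mapping.single (m + m') (Poly_Mapping.lookup p m * Poly_Mapping.lookup q m'))"
    by (simp add: sum_product mult_single)
  finally have "eval_with h f (p * q) = (\<Sum>m\<in>Poly_Mapping.keys p. \<Sum>m'\<in>Poly_Mapping.keys q.
      (h (Poly_Mapping.lookup p m) * mono f m) * (h (Poly_Mapping.lookup q m') * mono f m'))"
    by (simp add: eval_with_sum[OF assms] eval_with_single[OF assms] rhom.mult[OF assms] mono_add mult_ac)
  also have "\<dots> = eval_with h f p * eval_with h f q"
    by (simp add: eval_with_def sum_product flip: mono_def)
  finally show ?thesis .
qed

lemma const_0 [simp]: "const 0 = 0"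
  by (simp add: const_def)

lemma const_1: "const (1 :: 'a::zero_neq_one) = 1"
  by (simp add: const_def)

lemma rhom_const: "rhom (const :: 'a::comm_ring_1 \<Rightarrow> 'a mpoly)"
  by (simp add: rhom_def const_def single_add mult_single)

lemmas const_simps = rhom.hom_simps[OF rhom_const]

lemma eval_with_const: "rhom h \<Longrightarrow> eval_with h f (const c) = h c"
  by (simp add: const_def eval_with_single)

lemma eval_with_var: "rhom h \<Longrightarrow> eval_with h f (var i) = f i"
  by (simp add: var_def eval_with_single rhom.one)

lemma rhom_eval_with: 
  assumes "rhom h"
  shows "rhom (eval_with h f)"
proof
  show "eval_with h f 1 = 1"
    using eval_with_const[OF assms, of f 1] by (simp add: rhom.one[OF assms] const_1)
qed (rule eval_with_add[OF assms] eval_with_mult[OF assms])+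

lemma single_eq_mono: "Poly_Mapping.single m c = const c * mono var m"
proof -
  have "mono var m = Poly_Mapping.single m (1::'a)" for m
  proof -
    have *: "var i ^ k = Poly_Mapping.single (Poly_Mapping.single i k) (1::'a)" for i k
      by (induction k) (simp_all add: var_def mult_single add.commute flip: single_add)
    have "(\<Prod>i\<in>A. Poly_Mapping.single (g i) (1::'a)) = Poly_Mapping.single (\<Sum>i\<in>A. g i) 1"
      for A and g :: "nat \<Rightarrow> nat \<Rightarrow>\<^sub>0 nat"
      by (induction A rule: infinite_finite_induct) (simp_all add: mult_single)
    then show ?thesis
      by (simp add: mono_def * flip: poly_mapping_sum_single)
  qed
  then show ?thesis by (simp add: const_def mult_single)
qed

lemma mono_var: "mono var m = Poly_Mapping.single m 1"
  by (simp add: single_eq_mono const_1)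

lemma var_power: "var i ^ k = Poly_Mapping.single (Poly_Mapping.single i k) (1::'a::comm_semiring_1)"
  using mono_var[of "Poly_Mapping.single i k"] by simp

lemma mpoly_induct [case_names const var add mult]:
  fixes p :: "'a::comm_ring_1 mpoly"
  assumes "\<And>c. P (const c)" "\<And>i. P (var i)" "\<And>p q. P p \<Longrightarrow> P q \<Longrightarrow> P (p + q)"
    "\<And>p q. P p \<Longrightarrow> P q \<Longrightarrow> P (p * q)"
  shows "P p"
proof -
  have 0: "P 0" and 1: "P 1" using assms(1)[of 0] assms(1)[of 1] by (simp_all add: const_1)
  have pow: "P (var i ^ k)" for i k
    by (induction k) (simp_all add: 1 assms)
  have pr: "P (\<Prod>i\<in>A. var i ^ g i)" for A g
    by (induction A rule: infinite_finite_induct) (simp_all add: 1 assms pow)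
  have s: "P (Poly_Mapping.single m c)" for m c
    by (simp add: single_eq_mono mono_def assms pr)
  have "P (\<Sum>m\<in>A. Poly_Mapping.single m (Poly_Mapping.lookup p m))" for A
    by (induction A rule: infinite_finite_induct) (simp_all add: 0 assms s)
  from this[of "Poly_Mapping.keys p"] show ?thesis
    by (simp flip: poly_mapping_sum_single)
qed

text \<open>Constants and variables generate the polynomial ring. Identities between compositions of
  substitutions are reduced to these generators.\<close>

lemma mpoly_hom_eqI:
  assumes "rhom g" "rhom h" "\<And>c. g (const c) = h (const c)" "\<And>i. g (var i) = h (var i)"
  shows "g p = h p"
  by (induction p rule: mpoly_induct) (simp_all add: assms rhom.add[of g] rhom.add[of h] rhom.mult[of g] rhom.mult[of h])

lemma rhom_rename: "rhom (rename s)"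
  unfolding rename_def[abs_def] by (rule rhom_eval_with[OF rhom_const])

lemmas rename_simps = rhom.hom_simps[OF rhom_rename]

lemma rename_const [simp]: "rename s (const c) = const (c::'a::comm_ring_1)"
  by (simp add: rename_def eval_with_const[OF rhom_const])

lemma rename_var [simp]: "rename s (var i) = (var (s i) :: 'a::comm_ring_1 mpoly)"
  by (simp add: rename_def eval_with_var[OF rhom_const])

lemma eval_with_rename:
  assumes "rhom h"
  shows "eval_with h f (rename s p) = eval_with h (\<lambda>i. f (s i)) p"
  by (rule mpoly_hom_eqI[OF rhom_comp[OF rhom_eval_with[OF assms] rhom_rename] rhom_eval_with[OF assms]])
    (simp_all add: eval_with_const eval_with_var assms)

lemma rename_rename: "rename s (rename t p) = rename (\<lambda>i. s (t i)) (p :: 'a::comm_ring_1 mpoly)"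
  by (rule mpoly_hom_eqI[OF rhom_comp[OF rhom_rename rhom_rename] rhom_rename]) simp_all

lemma rename_ident [simp]: "rename (\<lambda>i. i) p = (p :: 'a::comm_ring_1 mpoly)"
  by (rule mpoly_hom_eqI[OF rhom_rename rhom_ident]) simp_all

section \<open>Polynomials in a prescribed set of variables\<close>

definition vars_in :: "nat set \<Rightarrow> 'a::zero mpoly \<Rightarrow> bool" where
  "vars_in S p \<longleftrightarrow> (\<forall>m\<in>Poly_Mapping.keys p. Poly_Mapping.keys m \<subseteq> S)"

lemma vars_in_mono: "vars_in S p \<Longrightarrow> S \<subseteq> T \<Longrightarrow> vars_in T p"
  by (auto simp: vars_in_def)

lemma vars_in_UNIV: "vars_in UNIV p"
  by (simp add: vars_in_def)

lemma eval_with_cong_vars: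
  assumes "vars_in S p" "\<And>i. i \<in> S \<Longrightarrow> f i = g i"
  shows "eval_with h f p = eval_with h g p"
  unfolding eval_with_def
proof (intro sum.cong prod.cong refl arg_cong2[where f = "(*)"])
  fix m i assume "m \<in> Poly_Mapping.keys p" "i \<in> Poly_Mapping.keys m"
  then have "i \<in> S" using assms(1) by (auto simp: vars_in_def)
  then show "f i ^ Poly_Mapping.lookup m i = g i ^ Poly_Mapping.lookup m i" by (simp add: assms(2))
qed

lemma rename_cong_vars:
  assumes "vars_in S p" "\<And>i. i \<in> S \<Longrightarrow> s i = t i"
  shows "rename s p = rename t p"
  unfolding rename_def by (rule eval_with_cong_vars) (use assms in auto)

lemma vars_in_const [simp]: "vars_in S (const c)"
  by (simp add: vars_in_def const_def)

lemma vars_in_0 [simp]: "vars_in S 0"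
  by (simp add: vars_in_def)

lemma vars_in_1 [simp]: "vars_in S (1::'a::zero_neq_one mpoly)"
  using vars_in_const[of S "1::'a"] by (simp only: const_1)

lemma vars_in_var [simp]: "vars_in S (var i :: 'a::zero_neq_one mpoly) \<longleftrightarrow> i \<in> S"
  by (simp add: vars_in_def var_def)

lemma vars_in_add: "vars_in S p \<Longrightarrow> vars_in S q \<Longrightarrow> vars_in S (p + q)"
  using Poly_Mapping.keys_add[of p q] by (fastforce simp: vars_in_def)

lemma vars_in_mult: 
  fixes p q :: "'a::comm_semiring_1 mpoly"
  shows "vars_in S p \<Longrightarrow> vars_in S q \<Longrightarrow> vars_in S (p * q)"
  using keys_mult[of p q] by (fastforce simp: vars_in_def keys_add_nat)

lemma vars_in_uminus [simp]: "vars_in S (- p) = vars_in S (p :: 'a::ab_group_add mpoly)"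
  by (simp add: vars_in_def in_keys_iff)

lemma vars_in_diff: "vars_in S p \<Longrightarrow> vars_in S q \<Longrightarrow> vars_in S (p - q :: 'a::ab_group_add mpoly)"
  using vars_in_add[of S p "- q"] by simp

lemma vars_in_sum: "(\<And>i. i \<in> A \<Longrightarrow> vars_in S (f i)) \<Longrightarrow> vars_in S (sum f A)"
  by (induction A rule: infinite_finite_induct) (auto intro: vars_in_add)

lemma vars_in_prod: "(\<And>i. i \<in> A \<Longrightarrow> vars_in S (f i)) \<Longrightarrow> vars_in S (prod f A :: 'a::comm_semiring_1 mpoly)"
  by (induction A rule: infinite_finite_induct) (auto intro: vars_in_mult)

lemma vars_in_power: "vars_in S p \<Longrightarrow> vars_in S (p ^ k :: 'a::comm_semiring_1 mpoly)"
  by (induction k) (auto intro: vars_in_mult)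

lemma vars_in_of_int [simp]: "vars_in S (of_int k :: 'a::comm_ring_1 mpoly)"
  using vars_in_const[of S "of_int k :: 'a"] by (simp only: const_simps)

lemma vars_in_eval_with:
  fixes p :: "'a::comm_ring_1 mpoly" and f :: "nat \<Rightarrow> 'b::comm_ring_1 mpoly"
  assumes "vars_in S p" "\<And>i. i \<in> S \<Longrightarrow> vars_in T (f i)" "\<And>c. vars_in T (h c)"
  shows "vars_in T (eval_with h f p)"
  unfolding eval_with_def
  by (intro vars_in_sum vars_in_mult vars_in_prod vars_in_power) (use assms in \<open>auto simp: vars_in_def[of S]\<close>)

lemma vars_in_rename:
  fixes p :: "'a::comm_ring_1 mpoly"
  assumes "vars_in S p" "s ` S \<subseteq> T"
  shows "vars_in T (rename s p)"
  unfolding rename_def by (rule vars_in_eval_with[OF assms(1)]) (use assms in auto)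

section \<open>Evaluation at complex arguments\<close>

abbreviation ev :: "(nat \<Rightarrow> complex) \<Rightarrow> xpoly \<Rightarrow> complex" where
  "ev x \<equiv> eval_with (\<lambda>c. c) x"

lemma rhom_ev: "rhom (ev x)"
  by (rule rhom_eval_with[OF rhom_ident])

lemma ev_const [simp]: "ev x (const c) = c"
  by (simp add: eval_with_const[OF rhom_ident])

lemma ev_var [simp]: "ev x (var i) = x i"
  by (simp add: eval_with_var[OF rhom_ident])

lemma ev_rename: "ev x (rename s p) = ev (\<lambda>i. x (s i)) p"
  by (rule eval_with_rename[OF rhom_ident])

lemmas ev_simps = rhom.hom_simps[OF rhom_ev]

lemma rhom_eval_Xx: "rhom (eval_Xx X x)"
  unfolding eval_Xx_def[abs_def] by (rule rhom_eval_with[OF rhom_ev])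

lemma eval_Xx_const [simp]: "eval_Xx X x (const c) = ev x c"
  by (simp add: eval_Xx_def eval_with_const[OF rhom_ev])

lemma eval_Xx_var [simp]: "eval_Xx X x (var i) = X i"
  by (simp add: eval_Xx_def eval_with_var[OF rhom_ev])

lemma eval_Xx_rename: "eval_Xx X x (rename s p) = eval_Xx (\<lambda>i. X (s i)) x p"
  unfolding eval_Xx_def by (rule eval_with_rename[OF rhom_ev])

lemmas eval_Xx_simps = rhom.hom_simps[OF rhom_eval_Xx]

subsection \<open>Polynomials vanishing at generic points\<close>

text \<open>Uniqueness of base \<open>B\<close> digits, with the lowest digit recovered modulo
  \<open>B\<close>; it makes the exponent code of Kronecker's substitution injective.\<close>

lemma digits_inj:
  fixes f g :: "nat \<Rightarrow> nat"
  assumes "\<And>i. f i < B" "\<And>i. g i < B" "(\<Sum>i<V. f i * B ^ i) = (\<Sum>i<V. g i * B ^ i)" "i < V"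
  shows "f i = g i"
  using assms
proof (induction V arbitrary: f g i)
  case (Suc V)
  have *: "(\<Sum>i<Suc V. f i * B ^ i) = f 0 + B * (\<Sum>i<V. f (Suc i) * B ^ i)" for f :: "nat \<Rightarrow> nat"
    by (subst sum.lessThan_Suc_shift) (simp add: sum_distrib_left mult_ac)
  have eq: "f 0 + B * (\<Sum>i<V. f (Suc i) * B ^ i) = g 0 + B * (\<Sum>i<V. g (Suc i) * B ^ i)"
    using Suc.prems(3) by (simp only: *)
  have 0: "f 0 = g 0"
    using arg_cong[OF eq, of "\<lambda>x. x mod B"] Suc.prems(1,2) by simp
  have "B > 0" using Suc.prems(1)[of 0] by simp
  with eq 0 have "(\<Sum>i<V. f (Suc i) * B ^ i) = (\<Sum>i<V. g (Suc i) * B ^ i)"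
    by simp
  from Suc.IH[OF Suc.prems(1,2) this] Suc.prems(4) 0 show ?case
    by (cases i) auto
qed simp

text \<open>Kronecker's substitution \<open>x\<^sub>i = t ^ (B ^ i)\<close> reduces this to polynomials in one variable.\<close>

lemma ev_generic_eq_0:
  assumes "\<And>x. inj x \<Longrightarrow> (\<forall>i. \<exists>r>0. x i = of_real r) \<Longrightarrow> ev x p = 0"
  shows "p = 0"
proof -
  define V where "V = Suc (Max (insert 0 (\<Union>m\<in>Poly_Mapping.keys p. Poly_Mapping.keys m)))"
  \<comment> \<open>Exceeds every exponent; the summand 2 also gives \<open>B > 1\<close>, so that
    the points \<open>t ^ (B ^ i)\<close> are distinct for \<open>t \<ge> 2\<close>.\<close>
  define B where "B = 2 + Max (insert 0 (\<Union>m\<in>Poly_Mapping.keys p. Poly_Mapping.lookup m ` Poly_Mapping.keys m))"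
  have V: "i < V" if "m \<in> Poly_Mapping.keys p" "i \<in> Poly_Mapping.keys m" for m i
    unfolding V_def less_Suc_eq_le by (rule Max_ge) (use that in auto)
  have B: "Poly_Mapping.lookup m i < B" if "m \<in> Poly_Mapping.keys p" for m i
  proof (cases "i \<in> Poly_Mapping.keys m")
    case True
    have "Poly_Mapping.lookup m i \<le> Max (insert 0 (\<Union>m\<in>Poly_Mapping.keys p. Poly_Mapping.lookup m ` Poly_Mapping.keys m))"
      by (rule Max_ge) (use that True in auto)
    then show ?thesis by (simp add: B_def)
  qed (simp add: in_keys_iff B_def)
  define code where "code m = (\<Sum>i<V. Poly_Mapping.lookup m i * B ^ i)" for m :: "nat \<Rightarrow>\<^sub>0 nat"
  have inj: "m = m'" if "m \<in> Poly_Mapping.keys p" "m' \<in> Poly_Mapping.keys p" "code m = code m'" for m m'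
  proof (rule poly_mapping_eqI)
    fix i
    show "Poly_Mapping.lookup m i = Poly_Mapping.lookup m' i"
    proof (cases "i < V")
      case True
      then show ?thesis
        using digits_inj[of "Poly_Mapping.lookup m" B "Poly_Mapping.lookup m'" V i] B that
        by (auto simp: code_def)
    next
      case False
      then have "i \<notin> Poly_Mapping.keys m" "i \<notin> Poly_Mapping.keys m'" using V that by blast+
      then show ?thesis by (simp add: in_keys_iff)
    qed
  qed
  define q :: "complex poly" where "q = (\<Sum>m\<in>Poly_Mapping.keys p. monom (Poly_Mapping.lookup p m) (code m))"
  have root: "poly q (of_nat t) = 0" if "t \<ge> 2" for t
  proof -
    define x :: "nat \<Rightarrow> complex" where "x i = of_nat t ^ (B ^ i)" for i
    have "ev x p = poly q (of_nat t)"
    proof -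
      have "mono x m = of_nat t ^ code m" if "m \<in> Poly_Mapping.keys p" for m
      proof -
        have "mono x m = (\<Prod>i<V. x i ^ Poly_Mapping.lookup m i)"
          by (rule mono_superset) (use V that in auto)
        also have "\<dots> = of_nat t ^ code m"
          by (simp add: x_def code_def power_sum mult.commute flip: power_mult)
        finally show ?thesis .
      qed
      then show ?thesis
        unfolding eval_with_def mono_def[symmetric] q_def poly_sum poly_monom
        by (intro sum.cong) auto
    qed
    moreover have "ev x p = 0"
    proof (rule assms)
      show "\<forall>i. \<exists>r>0. x i = of_real r"
        using that by (auto simp: x_def intro!: exI[of _ "real t ^ (B ^ _)"])
      show "inj x"
      proof (rule injI)
        fix i j assume "x i = x j"
        then have "t ^ (B ^ i) = t ^ (B ^ j)" by (simp add: x_def flip: of_nat_power)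
        then have "B ^ i = B ^ j" using that by (simp add: power_inject_exp)
        moreover have "B > 1" by (simp add: B_def)
        ultimately show "i = j" by (simp add: power_inject_exp)
      qed
    qed
    ultimately show ?thesis by simp
  qed
  have "q = 0"
  proof (rule ccontr)
    assume "q \<noteq> 0"
    then have "finite {z. poly q z = 0}" by (rule poly_roots_finite)
    moreover have "of_nat ` {2..} \<subseteq> {z. poly q z = 0}" using root by auto
    ultimately have "finite ((of_nat :: nat \<Rightarrow> complex) ` {2..})" by (rule finite_subset[rotated])
    then have "finite {2::nat..}" by (rule finite_imageD) (simp add: inj_on_def)
    then show False by (simp add: infinite_Ici)
  qed
  show ?thesis
  proof (rule poly_mapping_eqI)
    fix m
    show "Poly_Mapping.lookup p m = Poly_Mapping.lookup 0 m"
    proof (cases "m \<in> Poly_Mapping.keys p")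
      case True
      have "coeff q (code m) = (\<Sum>m'\<in>Poly_Mapping.keys p. if m' = m then Poly_Mapping.lookup p m' else 0)"
        unfolding q_def coeff_sum coeff_monom
        by (rule sum.cong) (use inj True in auto)
      also have "\<dots> = Poly_Mapping.lookup p m" using True by simp
      finally show ?thesis using \<open>q = 0\<close> by simp
    qed (simp add: in_keys_iff)
  qed
qed

text \<open>Positivity makes all coordinates and all sums \<open>x i + x j\<close> nonzero, so a
  generic point avoids the zeros of the factors in the divisibility argument.\<close>

definition generic :: "(nat \<Rightarrow> complex) \<Rightarrow> bool" where
  "generic x \<longleftrightarrow> inj x \<and> (\<forall>i. \<exists>r>0. x i = of_real r)"

lemma generic_eq: "generic x \<Longrightarrow> x i = x j \<longleftrightarrow> i = j"
  by (auto simp: generic_def inj_def)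

lemma generic_sum_nz: assumes "generic x" shows "x i + x j \<noteq> 0"
proof -
  obtain r s where "r > 0" "x i = of_real r" "s > 0" "x j = of_real s"
    using assms unfolding generic_def by metis
  then have "x i + x j = of_real (r + s)" "r + s \<noteq> 0" by auto
  then show ?thesis by (metis of_real_eq_0_iff)
qed

lemma generic_nz: "generic x \<Longrightarrow> x i \<noteq> 0"
  using generic_sum_nz[of x i i] by auto

lemma generic_exists: "\<exists>x. generic x"
  by (rule exI[of _ "\<lambda>i. of_nat (Suc i)"])
    (auto simp: generic_def inj_def simp del: of_nat_Suc intro!: exI[of _ "real (Suc _)"])

text \<open>Lets polynomial identities be verified by computation with complex numbers at points
  where the inverses of all coordinates exist.\<close>

lemma xpoly_eqI:
  assumes "\<And>x. generic x \<Longrightarrow> ev x p = ev x q"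
  shows "p = q"
  using ev_generic_eq_0[of "p - q"] assms by (simp add: ev_simps generic_def)

section \<open>Symmetric polynomials\<close>

lemma sym_polys_iff:
  "p \<in> sym_polys N \<longleftrightarrow> vars_in {1..N} p \<and> (\<forall>s. s permutes {1..N} \<longrightarrow> rename s p = p)"
  by (simp add: sym_polys_def vars_in_def)

lemma sym_0 [simp]: "0 \<in> sym_polys N"
  by (simp add: sym_polys_iff rename_simps)

lemma sym_const [simp]: "const c \<in> sym_polys N"
  by (simp add: sym_polys_iff)

lemma sym_1 [simp]: "1 \<in> sym_polys N"
  by (simp add: sym_polys_iff rename_simps)

lemma sym_add: "p \<in> sym_polys N \<Longrightarrow> q \<in> sym_polys N \<Longrightarrow> p + q \<in> sym_polys N"
  by (simp add: sym_polys_iff rename_simps vars_in_add)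

lemma sym_mult: "p \<in> sym_polys N \<Longrightarrow> q \<in> sym_polys N \<Longrightarrow> p * q \<in> sym_polys N"
  by (simp add: sym_polys_iff rename_simps vars_in_mult)

lemma sym_uminus: "p \<in> sym_polys N \<Longrightarrow> - p \<in> sym_polys N"
  by (simp add: sym_polys_iff rename_simps)

lemma sym_diff: "p \<in> sym_polys N \<Longrightarrow> q \<in> sym_polys N \<Longrightarrow> p - q \<in> sym_polys N"
  using sym_add[of p N "- q"] sym_uminus[of q N] by simp

lemma sym_of_int [simp]: "of_int k \<in> sym_polys N"
  using sym_const[of "of_int k" N] by (simp only: const_simps)

lemma sym_sum: "(\<And>i. i \<in> A \<Longrightarrow> f i \<in> sym_polys N) \<Longrightarrow> sum f A \<in> sym_polys N"
  by (induction A rule: infinite_finite_induct) (auto intro: sym_add)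

text \<open>Over arbitrary sets of variables rather than \<open>{1..N}\<close>: generating functions
  are proved by inserting one variable, and Artin's basis needs the variables that remain after the
  first \<open>k\<close>.\<close>

definition esym :: "nat set \<Rightarrow> nat \<Rightarrow> xpoly" where
  "esym S k = (\<Sum>B | B \<subseteq> S \<and> card B = k. \<Prod>j\<in>B. var j)"

lemma elem_sym_esym: "elem_sym N k = (if k < 0 then 0 else esym {1..N} (nat k))"
  by (simp add: elem_sym_def esym_def)

lemma rename_esym:
  assumes "s permutes S"
  shows "rename s (esym S k) = esym S k"
proof -
  have inj: "inj s" using assms by (rule permutes_inj)
  have "rename s (esym S k) = (\<Sum>B | B \<subseteq> S \<and> card B = k. \<Prod>j\<in>B. var (s j))"
    by (simp add: esym_def rename_simps)
  also have "\<dots> = (\<Sum>B | B \<subseteq> S \<and> card B = k. \<Prod>j\<in>s ` B. var j)"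
    by (intro sum.cong refl) (simp add: prod.reindex inj_on_subset[OF inj])
  also have "\<dots> = esym S k"
    unfolding esym_def
  proof (rule sum.reindex_bij_betw)
    show "bij_betw ((`) s) {B. B \<subseteq> S \<and> card B = k} {B. B \<subseteq> S \<and> card B = k}"
    proof (rule bij_betw_byWitness[where f' = "(`) (inv s)"])
      show "\<forall>a\<in>{B. B \<subseteq> S \<and> card B = k}. inv s ` s ` a = a"
        by (simp add: image_comp inj o_def)
      show "\<forall>a\<in>{B. B \<subseteq> S \<and> card B = k}. s ` inv s ` a = a"
        using permutes_surj[OF assms] by (simp add: image_comp o_def surj_f_inv_f)
      show "(`) s ` {B. B \<subseteq> S \<and> card B = k} \<subseteq> {B. B \<subseteq> S \<and> card B = k}"
        using permutes_in_image[OF assms] by (auto simp: card_image inj_on_subset[OF inj])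
      show "(`) (inv s) ` {B. B \<subseteq> S \<and> card B = k} \<subseteq> {B. B \<subseteq> S \<and> card B = k}"
        using permutes_in_image[OF permutes_inv[OF assms]] permutes_inj[OF permutes_inv[OF assms]]
        by (auto simp: card_image inj_on_subset)
    qed
  qed
  finally show ?thesis .
qed

lemma vars_in_esym: "vars_in S (esym S k)"
  unfolding esym_def by (intro vars_in_sum vars_in_prod) auto

lemma sym_elem_sym [simp]: "elem_sym N k \<in> sym_polys N"
  by (auto simp: elem_sym_esym sym_polys_iff rename_esym vars_in_esym rename_simps)

lemma esym_eq_0: "finite S \<Longrightarrow> card S < k \<Longrightarrow> esym S k = 0"
  unfolding esym_def by (rule sum.neutral) (auto dest: card_mono)

lemma elem_sym_eq_0: "k > int N \<Longrightarrow> elem_sym N k = 0"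
  by (simp add: elem_sym_esym esym_eq_0)

lemma esym_0 [simp]: "esym S 0 = (1::xpoly)" if "finite S"
proof -
  have "{B. B \<subseteq> S \<and> card B = 0} = {{}}" using that by (auto dest: finite_subset)
  then show ?thesis by (simp add: esym_def)
qed

lemma esym_insert:
  assumes "finite S" "i \<notin> S"
  shows "esym (insert i S) (Suc k) = esym S (Suc k) + var i * esym S k"
proof -
  have fin: "finite {B. B \<subseteq> T \<and> P B}" if "finite T" for T :: "nat set" and P
    using that by simp
  have "{B. B \<subseteq> insert i S \<and> card B = Suc k} =
      {B. B \<subseteq> S \<and> card B = Suc k} \<union> insert i ` {B. B \<subseteq> S \<and> card B = k}" (is "?L = ?A \<union> ?B")
  proof (intro set_eqI iffI)
    fix B assume B: "B \<in> ?L"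
    show "B \<in> ?A \<union> ?B"
    proof (cases "i \<in> B")
      case True
      then have "B = insert i (B - {i})" by auto
      moreover have "finite B" using B assms by (auto dest: finite_subset)
      ultimately show ?thesis using B True by (auto intro!: image_eqI[of _ _ "B - {i}"])
    qed (use B in auto)
  next
    fix B assume "B \<in> ?A \<union> ?B"
    then show "B \<in> ?L"
    proof
      assume "B \<in> ?B"
      then obtain C where C: "B = insert i C" "C \<subseteq> S" "card C = k" by auto
      then have "finite C" "i \<notin> C" using assms by (auto dest: finite_subset)
      then show ?thesis using C by auto
    qed auto
  qed
  moreover have "?A \<inter> ?B = {}" using assms by auto
  moreover have "finite ?A" "finite ?B" using assms by auto
  ultimately have "esym (insert i S) (Suc k) = esym S (Suc k) + (\<Sum>B\<in>?B. \<Prod>j\<in>B. var j)"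
    by (simp add: esym_def sum.union_disjoint)
  also have "(\<Sum>B\<in>?B. \<Prod>j\<in>B. var j) = (\<Sum>B | B \<subseteq> S \<and> card B = k. \<Prod>j\<in>insert i B. var j :: xpoly)"
    by (rule sum.reindex_cong[of "insert i"]) (use assms in \<open>auto simp: inj_on_def\<close>)
  also have "\<dots> = var i * esym S k"
    unfolding esym_def sum_distrib_left
    by (intro sum.cong refl prod.insert) (use assms in \<open>auto dest: finite_subset\<close>)
  finally show ?thesis .
qed

text \<open>The generating function of the elementary symmetric polynomials, under a homomorphism to a
  ring that contains an additional element.\<close>

lemma prod_esym:
  assumes "rhom h" "finite S"
  shows "(\<Prod>j\<in>S. 1 + h (var j) * t) = (\<Sum>k\<le>card S. h (esym S k) * t ^ k)"
  using assms(2)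
proof (induction S rule: finite_induct)
  case empty
  then show ?case by (simp add: rhom.one[OF assms(1)])
next
  case (insert i S)
  let ?e = "\<lambda>k. h (esym S k)"
  have "(\<Sum>k\<le>card (insert i S). h (esym (insert i S) k) * t ^ k) =
      1 + (\<Sum>k\<le>card S. h (esym (insert i S) (Suc k)) * t ^ Suc k)"
    unfolding card_insert_disjoint[OF insert(1,2)] sum.atMost_Suc_shift
    using insert by (simp add: rhom.one[OF assms(1)])
  also have "\<dots> = 1 + (\<Sum>k\<le>card S. ?e (Suc k) * t ^ Suc k) + h (var i) * t * (\<Sum>k\<le>card S. ?e k * t ^ k)"
    using insert by (simp add: esym_insert rhom.hom_simps[OF assms(1)] sum_distrib_left
      algebra_simps sum.distrib)
  also have "1 + (\<Sum>k\<le>card S. ?e (Suc k) * t ^ Suc k) = (\<Sum>k\<le>Suc (card S). ?e k * t ^ k)"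
    unfolding sum.atMost_Suc_shift using insert by (simp add: rhom.one[OF assms(1)])
  also have "\<dots> = (\<Sum>k\<le>card S. ?e k * t ^ k)"
    using insert by (simp add: esym_eq_0 rhom.zero[OF assms(1)])
  finally show ?case using insert by (simp add: algebra_simps)
qed

text \<open>Vieta's formula. If \<open>t\<close> is the image of one of the variables, the product
  vanishes and a monic relation results, which is the source of Artin's basis.\<close>

lemma prod_esym_rev:
  assumes "rhom h" "finite S"
  shows "(\<Prod>j\<in>S. t - h (var j)) = (\<Sum>k\<le>card S. (-1) ^ k * h (esym S k) * t ^ (card S - k))"
  using assms(2)
proof (induction S rule: finite_induct)
  case empty
  then show ?case by (simp add: rhom.one[OF assms(1)])
next
  case (insert i S)
  let ?e = "\<lambda>k. (-1) ^ k * h (esym S k)"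
  have "(\<Sum>k\<le>card (insert i S). (-1) ^ k * h (esym (insert i S) k) * t ^ (card (insert i S) - k)) =
      t ^ Suc (card S) + (\<Sum>k\<le>card S. (-1) ^ Suc k * h (esym (insert i S) (Suc k)) * t ^ (card S - k))"
    unfolding card_insert_disjoint[OF insert(1,2)] sum.atMost_Suc_shift
    using insert by (simp add: rhom.one[OF assms(1)])
  also have "\<dots> = t ^ Suc (card S) + (\<Sum>k\<le>card S. ?e (Suc k) * t ^ (card S - k)) -
      h (var i) * (\<Sum>k\<le>card S. ?e k * t ^ (card S - k))"
    using insert by (simp add: esym_insert rhom.hom_simps[OF assms(1)] sum_distrib_left
      algebra_simps sum.distrib sum_negf sum_subtractf)
  also have "t ^ Suc (card S) + (\<Sum>k\<le>card S. ?e (Suc k) * t ^ (card S - k)) =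
      (\<Sum>k\<le>Suc (card S). ?e k * t ^ (Suc (card S) - k))"
    unfolding sum.atMost_Suc_shift using insert by (simp add: rhom.one[OF assms(1)])
  also have "\<dots> = (\<Sum>k\<le>card S. ?e k * t ^ (Suc (card S) - k))"
    using insert by (simp add: esym_eq_0 rhom.zero[OF assms(1)])
  also have "\<dots> = t * (\<Sum>k\<le>card S. ?e k * t ^ (card S - k))"
    by (simp add: sum_distrib_left Suc_diff_le mult_ac)
  finally show ?case using insert by (simp add: algebra_simps)
qed

section \<open>Antisymmetrisation\<close>

text \<open>No division by the number of permutations: a wedge of monomials is represented by
  \<open>alt\<close> of their product in separate variables, with coefficient 1.\<close>

definition alt :: "nat set \<Rightarrow> 'a::comm_ring_1 mpoly \<Rightarrow> 'a mpoly" where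
  "alt S P = (\<Sum>\<sigma> | \<sigma> permutes S. of_int (sign \<sigma>) * rename \<sigma> P)"

definition shift :: "nat \<Rightarrow> 'a::comm_ring_1 mpoly \<Rightarrow> 'a mpoly" where
  "shift p Q = rename (\<lambda>b. p + b) Q"

lemma rhom_shift: "rhom (shift p)"
  unfolding shift_def[abs_def] by (rule rhom_rename)

lemmas shift_simps = rhom.hom_simps[OF rhom_shift]

lemma alt_add: "alt S (P + Q) = alt S P + alt S Q"
  by (simp add: alt_def rename_simps distrib_left sum.distrib)

lemma alt_0 [simp]: "alt S 0 = 0"
  by (simp add: alt_def rename_simps)

lemma alt_sum: "alt S (sum f A) = (\<Sum>i\<in>A. alt S (f i))"
  by (induction A rule: infinite_finite_induct) (simp_all add: alt_add)

lemma alt_mult_invariant: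
  assumes "\<And>\<sigma>. \<sigma> permutes S \<Longrightarrow> rename \<sigma> c = c"
  shows "alt S (c * P) = c * alt S P"
  unfolding alt_def sum_distrib_left
  by (intro sum.cong refl) (simp add: rename_simps assms mult_ac)

lemma alt_of_int: "alt S (of_int c * P) = of_int c * alt S P"
  by (rule alt_mult_invariant) (simp add: rename_simps)

lemma permutes_permutation: "finite S \<Longrightarrow> \<sigma> permutes S \<Longrightarrow> permutation \<sigma>"
  by (auto simp: permutation_permutes)

lemma alt_rename:
  fixes P :: "'a::comm_ring_1 mpoly"
  assumes "finite S" "\<tau> permutes S"
  shows "alt S (rename \<tau> P) = of_int (sign \<tau>) * alt S P"
proof -
  have "of_int (sign \<tau>) * alt S P = (\<Sum>\<sigma> | \<sigma> permutes S. of_int (sign \<tau>) * (of_int (sign (\<sigma> \<circ> \<tau>)) * rename (\<sigma> \<circ> \<tau>) P))"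
    unfolding alt_def sum_distrib_left[symmetric]
    by (subst sum_permutations_compose_right[OF assms(2)]) (rule refl)
  also have "\<dots> = alt S (rename \<tau> P)"
    unfolding alt_def
  proof (rule sum.cong[OF refl])
    fix \<sigma> assume \<sigma>: "\<sigma> \<in> {\<sigma>. \<sigma> permutes S}"
    then have "sign (\<sigma> \<circ> \<tau>) = sign \<sigma> * sign \<tau>"
      using assms by (intro sign_compose) (auto intro: permutes_permutation)
    then have "of_int (sign \<tau>) * of_int (sign (\<sigma> \<circ> \<tau>)) = (of_int (sign \<sigma>) :: 'a mpoly)"
      by (metis mult.commute sign_left_idempotent of_int_mult)
    then show "of_int (sign \<tau>) * (of_int (sign (\<sigma> \<circ> \<tau>)) * rename (\<sigma> \<circ> \<tau>) P) = of_int (sign \<sigma>) * rename \<sigma> (rename \<tau> P)"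
      by (simp add: rename_rename o_def flip: mult.assoc)
  qed
  finally show ?thesis by simp
qed

lemma rename_alt:
  fixes P :: "'a::comm_ring_1 mpoly"
  assumes "finite S" "\<tau> permutes S"
  shows "rename \<tau> (alt S P) = of_int (sign \<tau>) * alt S P"
proof -
  have "of_int (sign \<tau>) * alt S P = (\<Sum>\<sigma> | \<sigma> permutes S. of_int (sign \<tau>) * (of_int (sign (\<tau> \<circ> \<sigma>)) * rename (\<tau> \<circ> \<sigma>) P))"
    unfolding alt_def sum_distrib_left[symmetric]
    by (subst setum_permutations_compose_left[OF assms(2)]) (rule refl)
  also have "\<dots> = rename \<tau> (alt S P)"
    unfolding alt_def rename_simps
  proof (rule sum.cong[OF refl])
    fix \<sigma> assume \<sigma>: "\<sigma> \<in> {\<sigma>. \<sigma> permutes S}"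
    then have "sign (\<tau> \<circ> \<sigma>) = sign \<tau> * sign \<sigma>"
      using assms by (intro sign_compose) (auto intro: permutes_permutation)
    then have "of_int (sign \<tau>) * of_int (sign (\<tau> \<circ> \<sigma>)) = (of_int (sign \<sigma>) :: 'a mpoly)"
      by (metis sign_left_idempotent of_int_mult)
    then show "of_int (sign \<tau>) * (of_int (sign (\<tau> \<circ> \<sigma>)) * rename (\<tau> \<circ> \<sigma>) P) = of_int (sign \<sigma>) * rename \<tau> (rename \<sigma> P)"
      by (simp add: rename_rename o_def flip: mult.assoc)
  qed
  finally show ?thesis by simp
qed

lemma alt_antisym:
  assumes "finite S" "\<And>\<sigma>. \<sigma> permutes S \<Longrightarrow> rename \<sigma> P = of_int (sign \<sigma>) * P"
  shows "alt S P = of_nat (fact (card S)) * P"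
proof -
  have "alt S P = (\<Sum>\<sigma> | \<sigma> permutes S. P)"
    unfolding alt_def
  proof (rule sum.cong[OF refl])
    fix \<sigma> assume "\<sigma> \<in> {\<sigma>. \<sigma> permutes S}"
    then show "of_int (sign \<sigma>) * rename \<sigma> P = P"
      by (simp add: assms(2) flip: mult.assoc of_int_mult)
  qed
  then show ?thesis using card_permutations[OF refl assms(1)] by simp
qed

text \<open>Permutations \<tau> and \<tau>' of the two blocks of variables extend to the whole set
  and change the antisymmetrisation only by their signs. All \<open>fact p * fact q\<close> terms
  therefore agree and cancel the normalisation of \<open>wedge\<close>. Iterated wedges become a
  single antisymmetrisation of a product in disjoint variables.\<close>

lemma wedge_alt:
  assumes "vars_in {1..p} P" "vars_in {1..q} Q"
  shows "wedge p q (alt {1..p} P) (alt {1..q} Q) = alt {1..p + q} (P * shift p Q)"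
proof -
  let ?A = "alt {1..p + q} (P * shift p Q)"
  have fin: "finite {\<sigma>. \<sigma> permutes {1..k::nat}}" for k by (simp add: finite_permutations)
  have 1: "alt {1..p + q} (rename \<tau> P * shift p (rename \<tau>' Q)) = of_int (sign \<tau>) * of_int (sign \<tau>') * ?A"
    if \<tau>: "\<tau> permutes {1..p}" and \<tau>': "\<tau>' permutes {1..q}" for \<tau> \<tau>'
  proof -
    \<comment> \<open>\<tau>' transported to the second block, with the same sign.\<close>
    define \<rho> where "\<rho> = map_permutation {1..q} ((+) p) \<tau>'"
    have inj: "inj_on ((+) p) {1..q}" by simp
    have bij: "bij_betw ((+) p) {1..q} {p+1..p+q}"
      by (simp add: bij_betw_def add.commute)
    have \<rho>: "\<rho> permutes {p+1..p+q}" "sign \<rho> = sign \<tau>'"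
      unfolding \<rho>_def by (rule map_permutation_permutes[OF bij \<tau>'] sign_map_permutation[OF inj \<tau>'] | simp)+
    have \<rho>_app: "\<rho> (p + b) = p + \<tau>' b" if "b \<in> {1..q}" for b
      unfolding \<rho>_def by (rule map_permutation_apply) (use that in auto)
    have \<tau>l: "\<tau> permutes {1..p+q}" by (rule permutes_subset[OF \<tau>]) auto
    have \<rho>l: "\<rho> permutes {1..p+q}" by (rule permutes_subset[OF \<rho>(1)]) auto
    have "rename \<tau> P * shift p (rename \<tau>' Q) = rename \<tau> (rename \<rho> (P * shift p Q))"
    proof -
      have "rename \<rho> P = rename (\<lambda>i. i) P"
        by (rule rename_cong_vars[OF assms(1)]) (use permutes_not_in[OF \<rho>(1)] in auto)
      moreover have "rename \<tau> (rename \<rho> (shift p Q)) = shift p (rename \<tau>' Q)"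
        unfolding shift_def rename_rename
      proof (rule rename_cong_vars[OF assms(2)])
        fix i assume i: "i \<in> {1..q}"
        then have "\<tau>' i \<ge> 1" using permutes_in_image[OF \<tau>', of i] by auto
        then have "\<tau> (p + \<tau>' i) = p + \<tau>' i" by (intro permutes_not_in[OF \<tau>]) auto
        then show "\<tau> (\<rho> (p + i)) = p + \<tau>' i" using \<rho>_app[OF i] by simp
      qed
      ultimately show ?thesis by (simp add: rename_simps)
    qed
    then show ?thesis
      by (simp only: alt_rename[OF finite_atLeastAtMost \<tau>l] alt_rename[OF finite_atLeastAtMost \<rho>l] \<rho>(2) mult.assoc)
  qed
  have "(\<Sum>\<sigma> | \<sigma> permutes {1..p + q}. of_int (sign \<sigma>) * rename \<sigma> (alt {1..p} P) * rename (\<lambda>b. \<sigma> (p + b)) (alt {1..q} Q)) =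
      alt {1..p + q} (alt {1..p} P * shift p (alt {1..q} Q))"
    unfolding alt_def[of "{1..p+q}"] by (simp only: rename_simps(5) shift_def rename_rename mult.assoc)
  also have "alt {1..p} P * shift p (alt {1..q} Q) = (\<Sum>\<tau> | \<tau> permutes {1..p}. \<Sum>\<tau>' | \<tau>' permutes {1..q}.
      (of_int (sign \<tau> * sign \<tau>')) * (rename \<tau> P * shift p (rename \<tau>' Q)))"
    unfolding alt_def shift_simps sum_product by (intro sum.cong refl) (simp add: mult_ac)
  also have "alt {1..p + q} \<dots> = (\<Sum>\<tau> | \<tau> permutes {1..p}. \<Sum>\<tau>' | \<tau>' permutes {1..q}. ?A)"
    unfolding alt_sum
  proof (intro sum.cong refl)
    fix \<tau> \<tau>' :: "nat \<Rightarrow> nat"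
    assume "\<tau> \<in> {\<tau>. \<tau> permutes {1..p}}" "\<tau>' \<in> {\<tau>'. \<tau>' permutes {1..q}}"
    then have *: "alt {1..p + q} (rename \<tau> P * shift p (rename \<tau>' Q)) = of_int (sign \<tau> * sign \<tau>') * ?A"
      using 1 by simp
    have sq: "(sign \<tau> * sign \<tau>') * (sign \<tau> * sign \<tau>') = (1::int)"
      by (cases \<tau> rule: sign_cases; cases \<tau>' rule: sign_cases) simp_all
    have "alt {1..p + q} (of_int (sign \<tau> * sign \<tau>') * (rename \<tau> P * shift p (rename \<tau>' Q))) =
        of_int (sign \<tau> * sign \<tau>') * (of_int (sign \<tau> * sign \<tau>') * ?A)"
      by (simp only: alt_of_int *)
    also have "\<dots> = of_int ((sign \<tau> * sign \<tau>') * (sign \<tau> * sign \<tau>')) * ?A"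
      by (subst of_int_mult) (rule mult.assoc[symmetric])
    also have "\<dots> = ?A" by (simp only: sq of_int_1 mult_1_left)
    finally show "alt {1..p + q} (of_int (sign \<tau> * sign \<tau>') * (rename \<tau> P * shift p (rename \<tau>' Q))) = ?A" .
  qed
  also have "\<dots> = of_nat (fact p * fact q) * ?A"
    using card_permutations[of "{1..p}" p] card_permutations[of "{1..q}" q] by (simp add: mult.assoc)
  also have "of_nat (fact p * fact q) = (const (const (fact p * fact q)) :: Xpoly)"
  proof -
    have "(const (const (of_nat k)) :: Xpoly) = of_nat k" for k
      by (simp only: const_simps)
    from this[of "fact p * fact q"] show ?thesis by simp
  qed
  finally show ?thesis
    unfolding wedge_def by (simp add: const_1 flip: mult.assoc const_simps(5))
qed

section \<open>Closure properties\<close>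

definition rename_exp :: "(nat \<Rightarrow> nat) \<Rightarrow> (nat \<Rightarrow>\<^sub>0 nat) \<Rightarrow> (nat \<Rightarrow>\<^sub>0 nat)" where
  "rename_exp s m = (\<Sum>i\<in>Poly_Mapping.keys m. Poly_Mapping.single (s i) (Poly_Mapping.lookup m i))"

lemma rename_single:
  "rename s (Poly_Mapping.single m c) = Poly_Mapping.single (rename_exp s m) (c :: 'a::comm_ring_1)"
proof -
  have "mono (\<lambda>i. var (s i)) m = (mono var (rename_exp s m) :: 'a mpoly)"
    unfolding rename_exp_def mono_sum mono_single by (simp only: mono_def)
  then show ?thesis
    by (simp add: single_eq_mono rename_simps rhom.mono[OF rhom_rename])
qed

lemma lookup_rename:
  fixes P :: "'a::comm_ring_1 mpoly"
  shows "Poly_Mapping.lookup (rename s P) k =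
    (\<Sum>m\<in>Poly_Mapping.keys P. if rename_exp s m = k then Poly_Mapping.lookup P m else 0)"
proof -
  have "rename s P = rename s (\<Sum>m\<in>Poly_Mapping.keys P. Poly_Mapping.single m (Poly_Mapping.lookup P m))"
    by (simp flip: poly_mapping_sum_single)
  then show ?thesis
    by (simp add: rename_simps rename_single lookup_sum lookup_single when_def)
qed

lemma lookup_mult':
  fixes P Q :: "'a::comm_ring_1 mpoly"
  shows "Poly_Mapping.lookup (P * Q) k =
    (\<Sum>m\<in>Poly_Mapping.keys P. \<Sum>m'\<in>Poly_Mapping.keys Q.
      if m + m' = k then Poly_Mapping.lookup P m * Poly_Mapping.lookup Q m' else 0)"
proof -
  let ?s = "\<lambda>p m. Poly_Mapping.single m (Poly_Mapping.lookup p m)"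
  have "P * Q = (\<Sum>m\<in>Poly_Mapping.keys P. ?s P m) * (\<Sum>m\<in>Poly_Mapping.keys Q. ?s Q m)"
    by (simp flip: poly_mapping_sum_single)
  also have "\<dots> = (\<Sum>m\<in>Poly_Mapping.keys P. \<Sum>m'\<in>Poly_Mapping.keys Q.
      Poly_Mapping.single (m + m') (Poly_Mapping.lookup P m * Poly_Mapping.lookup Q m'))"
    by (simp add: sum_product mult_single)
  finally show ?thesis by (simp add: lookup_sum lookup_single when_def)
qed

lemma keys_rename: "Poly_Mapping.keys (rename s P) \<subseteq> rename_exp s ` Poly_Mapping.keys (P :: 'a::comm_ring_1 mpoly)"
proof
  fix k assume "k \<in> Poly_Mapping.keys (rename s P)"
  then have "(\<Sum>m\<in>Poly_Mapping.keys P. if rename_exp s m = k then Poly_Mapping.lookup P m else 0) \<noteq> 0"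
    by (simp add: in_keys_iff lookup_rename)
  then obtain m where "m \<in> Poly_Mapping.keys P" "rename_exp s m = k"
    by (rule sum.not_neutral_contains_not_neutral) (auto split: if_splits)
  then show "k \<in> rename_exp s ` Poly_Mapping.keys P" by auto
qed

lemma lookup_rename_exp:
  assumes "inj_on s S" "Poly_Mapping.keys m \<subseteq> S" "i \<in> S"
  shows "Poly_Mapping.lookup (rename_exp s m) (s i) = Poly_Mapping.lookup m i"
proof -
  have "Poly_Mapping.lookup (rename_exp s m) (s i) = (\<Sum>j\<in>Poly_Mapping.keys m. if j = i then Poly_Mapping.lookup m j else 0)"
    unfolding rename_exp_def lookup_sum
    by (rule sum.cong) (use assms in \<open>auto simp: lookup_single when_def inj_on_eq_iff subset_iff\<close>)
  then show ?thesis by (simp add: in_keys_iff)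
qed

lemma keys_rename_exp: "Poly_Mapping.keys (rename_exp s m) \<subseteq> s ` Poly_Mapping.keys m"
proof
  fix k assume "k \<in> Poly_Mapping.keys (rename_exp s m)"
  then have "(\<Sum>i\<in>Poly_Mapping.keys m. Poly_Mapping.lookup (Poly_Mapping.single (s i) (Poly_Mapping.lookup m i)) k) \<noteq> 0"
    by (simp add: in_keys_iff rename_exp_def lookup_sum)
  then obtain i where "i \<in> Poly_Mapping.keys m" "Poly_Mapping.lookup (Poly_Mapping.single (s i) (Poly_Mapping.lookup m i)) k \<noteq> 0"
    by (rule sum.not_neutral_contains_not_neutral)
  then show "k \<in> s ` Poly_Mapping.keys m" by (auto simp: lookup_single when_def split: if_splits)
qed

section \<open>Total degree, homogeneous polynomials and \<open>deg1\<close>\<close>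

lemma mdeg_superset:
  assumes "finite S" "Poly_Mapping.keys m \<subseteq> S"
  shows "mdeg m = (\<Sum>i\<in>S. int (Poly_Mapping.lookup m i))"
  unfolding mdeg_def by (rule sum.mono_neutral_left) (use assms in \<open>auto simp: in_keys_iff\<close>)

lemma mdeg_add: "mdeg (m + m') = mdeg m + mdeg m'"
proof -
  let ?S = "Poly_Mapping.keys m \<union> Poly_Mapping.keys m'"
  have "mdeg (m + m') = (\<Sum>i\<in>?S. int (Poly_Mapping.lookup (m + m') i))"
    by (rule mdeg_superset) (auto simp: keys_add_nat)
  also have "\<dots> = mdeg m + mdeg m'"
    by (simp add: lookup_add sum.distrib mdeg_superset[of ?S])
  finally show ?thesis .
qed

lemma mdeg_0 [simp]: "mdeg 0 = 0"
  by (simp add: mdeg_def)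

lemma mdeg_single [simp]: "mdeg (Poly_Mapping.single i k) = int k"
  by (cases "k = 0") (simp_all add: mdeg_def)

lemma mdeg_sum: "mdeg (sum g A) = (\<Sum>i\<in>A. mdeg (g i))"
  by (induction A rule: infinite_finite_induct) (simp_all add: mdeg_add)

lemma mdeg_rename_exp [simp]: "mdeg (rename_exp s m) = mdeg m"
  by (simp add: rename_exp_def mdeg_sum) (simp add: mdeg_def)

lemma mdeg_nonneg: "mdeg m \<ge> 0"
  by (simp add: mdeg_def sum_nonneg)

definition xhom :: "int \<Rightarrow> 'a::zero mpoly \<Rightarrow> bool" where
  "xhom d p \<longleftrightarrow> (\<forall>m\<in>Poly_Mapping.keys p. mdeg m = d)"

lemma xhom_0 [simp]: "xhom d 0"
  by (simp add: xhom_def)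

lemma xhom_add: "xhom d p \<Longrightarrow> xhom d q \<Longrightarrow> xhom d (p + q)"
  using Poly_Mapping.keys_add[of p q] by (fastforce simp: xhom_def)

lemma xhom_uminus [simp]: "xhom d (- p) \<longleftrightarrow> xhom d (p :: 'a::ab_group_add mpoly)"
  by (simp add: xhom_def in_keys_iff)

lemma xhom_diff: "xhom d p \<Longrightarrow> xhom d q \<Longrightarrow> xhom d (p - q :: 'a::ab_group_add mpoly)"
  using xhom_add[of d p "- q"] by simp

lemma xhom_sum: "(\<And>i. i \<in> A \<Longrightarrow> xhom d (f i)) \<Longrightarrow> xhom d (sum f A)"
  by (induction A rule: infinite_finite_induct) (auto intro: xhom_add)

lemma xhom_mult: "xhom d p \<Longrightarrow> xhom e q \<Longrightarrow> xhom (d + e) (p * q :: 'a::comm_ring_1 mpoly)"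
  using keys_mult[of p q] by (fastforce simp: xhom_def mdeg_add)

lemma xhom_const [simp]: "xhom 0 (const c)"
  by (simp add: xhom_def const_def)

lemma xhom_1 [simp]: "xhom 0 (1 :: 'a::comm_ring_1 mpoly)"
  using xhom_const[of "1::'a"] by (simp add: const_1)

lemma xhom_of_int [simp]: "xhom 0 (of_int k :: 'a::comm_ring_1 mpoly)"
  using xhom_const[of "of_int k::'a"] by (simp only: const_simps)

lemma xhom_var [simp]: "xhom 1 (var i :: 'a::comm_ring_1 mpoly)"
  by (simp add: xhom_def var_def)

lemma xhom_power: "xhom d p \<Longrightarrow> xhom (int k * d) (p ^ k :: 'a::comm_ring_1 mpoly)"
proof (induction k)
  case (Suc k)
  then show ?case using xhom_mult[of d p "int k * d" "p ^ k"] by (simp add: algebra_simps)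
qed simp

lemma xhom_prod: "(\<And>i. i \<in> A \<Longrightarrow> xhom (d i) (f i)) \<Longrightarrow> xhom (\<Sum>i\<in>A. d i) (prod f A :: 'a::comm_ring_1 mpoly)"
  by (induction A rule: infinite_finite_induct) (auto intro: xhom_mult)

lemma xhom_rename: "xhom d p \<Longrightarrow> xhom d (rename s p :: 'a::comm_ring_1 mpoly)"
  using keys_rename[of s p] by (fastforce simp: xhom_def)

lemma xhom_alt: "xhom d p \<Longrightarrow> xhom d (alt S p :: 'a::comm_ring_1 mpoly)"
  unfolding alt_def using xhom_mult[OF xhom_of_int xhom_rename] by (auto intro!: xhom_sum)

lemma xhom_esym: "xhom (int k) (esym S k)"
proof -
  have "xhom (\<Sum>i\<in>B. 1) (\<Prod>j\<in>B. var j :: xpoly)" for B :: "nat set"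
    by (rule xhom_prod) simp
  then show ?thesis unfolding esym_def by (intro xhom_sum) (auto simp del: One_nat_def)
qed

lemma xhom_elem_sym: "xhom k (elem_sym N k)"
  using xhom_esym[of "nat k"] by (auto simp: elem_sym_esym)

lemma deg1_homogeneous_iff:
  "deg1_homogeneous d P \<longleftrightarrow> (\<forall>m. xhom (d + mdeg m) (Poly_Mapping.lookup P m))"
  by (fastforce simp: deg1_homogeneous_def xhom_def in_keys_iff)

lemma deg1_homogeneous_0: "deg1_homogeneous d 0"
  by (simp add: deg1_homogeneous_iff)

lemma deg1_homogeneous_add: "deg1_homogeneous d P \<Longrightarrow> deg1_homogeneous d Q \<Longrightarrow> deg1_homogeneous d (P + Q)"
  by (simp add: deg1_homogeneous_iff lookup_add xhom_add)

lemma deg1_homogeneous_sum: "(\<And>i. i \<in> A \<Longrightarrow> deg1_homogeneous d (f i)) \<Longrightarrow> deg1_homogeneous d (sum f A)"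
  by (induction A rule: infinite_finite_induct) (auto intro: deg1_homogeneous_add deg1_homogeneous_0)

lemma deg1_homogeneous_mult:
  assumes "deg1_homogeneous d P" "deg1_homogeneous e Q"
  shows "deg1_homogeneous (d + e) (P * Q)"
  unfolding deg1_homogeneous_iff lookup_mult'
proof (intro allI xhom_sum)
  fix k m m'
  have "xhom ((d + mdeg m) + (e + mdeg m')) (Poly_Mapping.lookup P m * Poly_Mapping.lookup Q m')"
    using assms by (intro xhom_mult) (auto simp: deg1_homogeneous_iff)
  then show "xhom (d + e + mdeg k) (if m + m' = k then Poly_Mapping.lookup P m * Poly_Mapping.lookup Q m' else 0)"
    by (auto simp: mdeg_add algebra_simps)
qed

lemma deg1_homogeneous_const: "xhom d p \<Longrightarrow> deg1_homogeneous d (const p)"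
  by (auto simp: deg1_homogeneous_iff const_def lookup_single when_def)

lemma deg1_homogeneous_1: "deg1_homogeneous 0 1"
  using deg1_homogeneous_const[of 0 1] by (simp add: const_1)

lemma deg1_homogeneous_of_int: "deg1_homogeneous 0 (of_int k)"
  using deg1_homogeneous_const[OF xhom_of_int[of k]] by (simp only: const_simps)

lemma deg1_homogeneous_uminus: "deg1_homogeneous d P \<Longrightarrow> deg1_homogeneous d (- P)"
  by (simp add: deg1_homogeneous_iff)

lemma deg1_homogeneous_diff: "deg1_homogeneous d P \<Longrightarrow> deg1_homogeneous d Q \<Longrightarrow> deg1_homogeneous d (P - Q)"
  using deg1_homogeneous_add[of d P "- Q"] deg1_homogeneous_uminus[of d Q] by simp

lemma deg1_homogeneous_var_power: "deg1_homogeneous (- int k) (var i ^ k)"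
  by (auto simp: deg1_homogeneous_iff var_power lookup_single when_def)

lemma deg1_homogeneous_rename: "deg1_homogeneous d P \<Longrightarrow> deg1_homogeneous d (rename s P)"
  unfolding deg1_homogeneous_iff lookup_rename by (intro allI xhom_sum) auto

lemma deg1_homogeneous_alt: "deg1_homogeneous d P \<Longrightarrow> deg1_homogeneous d (alt S P)"
  unfolding alt_def using deg1_homogeneous_mult[OF deg1_homogeneous_of_int, of d]
  by (auto intro!: deg1_homogeneous_sum deg1_homogeneous_rename)

lemma deg1_eqI:
  assumes "deg1_homogeneous d P" "P \<noteq> 0"
  shows "deg1 P = d"
  unfolding deg1_def
proof (rule the_equality[where a = d])
  obtain m where "Poly_Mapping.lookup P m \<noteq> 0"
    using assms(2) by (metis lookup_zero poly_mapping_eqI)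
  then obtain m' where "Poly_Mapping.lookup (Poly_Mapping.lookup P m) m' \<noteq> 0"
    by (metis lookup_zero poly_mapping_eqI)
  then have m': "m' \<in> Poly_Mapping.keys (Poly_Mapping.lookup P m)" by (simp add: in_keys_iff)
  fix e assume "deg1_homogeneous e P"
  with assms(1) m' show "e = d" unfolding deg1_homogeneous_iff xhom_def
    by (metis add_right_cancel)
qed (rule assms)

section \<open>Polynomials with symmetric coefficients\<close>

definition coeffs_in :: "'a set \<Rightarrow> 'a::zero mpoly \<Rightarrow> bool" where
  "coeffs_in R P \<longleftrightarrow> (\<forall>m. Poly_Mapping.lookup P m \<in> R)"

lemma coeffs_in_add: "coeffs_in (sym_polys N) P \<Longrightarrow> coeffs_in (sym_polys N) Q \<Longrightarrow> coeffs_in (sym_polys N) (P + Q)"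
  by (simp add: coeffs_in_def lookup_add sym_add)

lemma coeffs_in_0 [simp]: "coeffs_in (sym_polys N) 0"
  by (simp add: coeffs_in_def)

lemma coeffs_in_diff: "coeffs_in (sym_polys N) P \<Longrightarrow> coeffs_in (sym_polys N) Q \<Longrightarrow> coeffs_in (sym_polys N) (P - Q)"
  by (simp add: coeffs_in_def lookup_minus sym_diff)

lemma coeffs_in_sum: "(\<And>i. i \<in> A \<Longrightarrow> coeffs_in (sym_polys N) (f i)) \<Longrightarrow> coeffs_in (sym_polys N) (sum f A)"
  by (induction A rule: infinite_finite_induct) (auto intro: coeffs_in_add)

lemma coeffs_in_mult: "coeffs_in (sym_polys N) P \<Longrightarrow> coeffs_in (sym_polys N) Q \<Longrightarrow> coeffs_in (sym_polys N) (P * Q)"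
  unfolding coeffs_in_def lookup_mult' by (auto intro!: sym_sum sym_mult)

lemma coeffs_in_const [simp]: "coeffs_in (sym_polys N) (const p) \<longleftrightarrow> p \<in> sym_polys N"
  by (auto simp: coeffs_in_def const_def lookup_single when_def)

lemma coeffs_in_1 [simp]: "coeffs_in (sym_polys N) 1"
  using coeffs_in_const[of N 1] by (simp add: const_1)

lemma coeffs_in_of_int [simp]: "coeffs_in (sym_polys N) (of_int k)"
  using coeffs_in_const[of N "of_int k"] sym_of_int[of k N] by (simp only: const_simps)

lemma coeffs_in_var_power [simp]: "coeffs_in (sym_polys N) (var i ^ k)"
  by (auto simp: coeffs_in_def var_power lookup_single when_def)

lemma coeffs_in_rename: "coeffs_in (sym_polys N) P \<Longrightarrow> coeffs_in (sym_polys N) (rename s P)"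
  unfolding coeffs_in_def lookup_rename by (auto intro!: sym_sum)

section \<open>Bounds for the degree in each single variable\<close>

definition deg_le :: "nat \<Rightarrow> 'a::zero mpoly \<Rightarrow> bool" where
  "deg_le d P \<longleftrightarrow> (\<forall>m\<in>Poly_Mapping.keys P. \<forall>a. Poly_Mapping.lookup m a \<le> d)"

lemma deg_le_0 [simp]: "deg_le d 0"
  by (simp add: deg_le_def)

lemma deg_le_add: "deg_le d P \<Longrightarrow> deg_le d Q \<Longrightarrow> deg_le d (P + Q)"
  using Poly_Mapping.keys_add[of P Q] by (fastforce simp: deg_le_def)

lemma deg_le_uminus [simp]: "deg_le d (- P) = deg_le d (P :: 'a::ab_group_add mpoly)"
  by (simp add: deg_le_def in_keys_iff)

lemma deg_le_diff: "deg_le d P \<Longrightarrow> deg_le d Q \<Longrightarrow> deg_le d (P - Q :: 'a::ab_group_add mpoly)"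
  using deg_le_add[of d P "- Q"] by simp

lemma deg_le_sum: "(\<And>i. i \<in> A \<Longrightarrow> deg_le d (f i)) \<Longrightarrow> deg_le d (sum f A)"
  by (induction A rule: infinite_finite_induct) (auto intro: deg_le_add)

lemma deg_le_const [simp]: "deg_le d (const c)"
  by (simp add: deg_le_def const_def)

lemma deg_le_1 [simp]: "deg_le d (1 :: 'a::comm_ring_1 mpoly)"
  using deg_le_const[of d "1::'a"] by (simp add: const_1)

lemma deg_le_var_power: "k \<le> d \<Longrightarrow> deg_le d (var i ^ k :: 'a::comm_ring_1 mpoly)"
  by (auto simp: deg_le_def var_power lookup_single when_def)

text \<open>Each variable occurs in only one of the factors, so the bounds do not add up. This keeps
  products over separate blocks of variables within degree \<open>2 * n\<close>.\<close>

lemma deg_le_mult_disjoint: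
  fixes P Q :: "'a::comm_ring_1 mpoly"
  assumes "deg_le d P" "deg_le d Q" "vars_in S P" "vars_in T Q" "S \<inter> T = {}"
  shows "deg_le d (P * Q)"
  unfolding deg_le_def
proof (intro ballI allI)
  fix k a assume "k \<in> Poly_Mapping.keys (P * Q)"
  then obtain m m' where m: "k = m + m'" "m \<in> Poly_Mapping.keys P" "m' \<in> Poly_Mapping.keys Q"
    using keys_mult[of P Q] by auto
  then have "Poly_Mapping.keys m \<inter> Poly_Mapping.keys m' = {}"
    using assms unfolding vars_in_def by blast
  then have "Poly_Mapping.lookup m a = 0 \<or> Poly_Mapping.lookup m' a = 0"
    by (auto simp: in_keys_iff)
  then show "Poly_Mapping.lookup k a \<le> d"
    using m assms by (auto simp: lookup_add deg_le_def)
qed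

lemma deg_le_const_mult: "deg_le d P \<Longrightarrow> deg_le d (const c * P :: 'a::comm_ring_1 mpoly)"
  by (rule deg_le_mult_disjoint[of _ _ _ "{}" UNIV]) (auto simp: vars_in_UNIV)

lemma deg_le_of_int_mult: "deg_le d P \<Longrightarrow> deg_le d (of_int c * P :: 'a::comm_ring_1 mpoly)"
  using deg_le_const_mult[of d P "of_int c"] by (simp only: const_simps)

lemma deg_le_rename:
  fixes P :: "'a::comm_ring_1 mpoly"
  assumes "deg_le d P" "inj s"
  shows "deg_le d (rename s P)"
  unfolding deg_le_def
proof (intro ballI allI)
  fix k a assume "k \<in> Poly_Mapping.keys (rename s P)"
  then obtain m where m: "m \<in> Poly_Mapping.keys P" "k = rename_exp s m"
    using keys_rename[of s P] by auto
  show "Poly_Mapping.lookup k a \<le> d"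
  proof (cases "a \<in> Poly_Mapping.keys k")
    case True
    then obtain i where "a = s i" using keys_rename_exp[of s m] m by auto
    then show ?thesis using assms m lookup_rename_exp[of s UNIV m i] by (auto simp: deg_le_def)
  qed (simp add: in_keys_iff)
qed

text \<open>Elements whose antisymmetrisation lies in \<open>U n l\<close>.\<close>

definition pre_U :: "nat \<Rightarrow> nat \<Rightarrow> Xpoly \<Rightarrow> bool" where
  "pre_U n l P \<longleftrightarrow> vars_in {1..l} P \<and> deg_le (2 * n) P \<and> coeffs_in (sym_polys (2 * n + 1)) P \<and>
     (\<forall>X y x s a. a \<in> {1..l} \<longrightarrow> x \<noteq> 0 \<longrightarrow> s \<in> {1, -1} \<longrightarrow> X a = s * inverse x \<longrightarrow>
       eval_Xx X (y(2 * n := x, 2 * n + 1 := - x)) P = 0)"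

lemma pre_U_vars: "pre_U n l P \<Longrightarrow> vars_in {1..l} P"
  by (simp add: pre_U_def)

text \<open>\<open>pre_U\<close> asks for vanishing in every variable, not only in the last one,
  because the term of \<sigma> puts the value of \<open>X_l\<close> into the variable
  \<open>a\<close> with \<open>\<sigma> a = l\<close>.\<close>

lemma alt_in_U:
  assumes "pre_U n l P" "l \<ge> 1"
  shows "alt {1..l} P \<in> U n l"
proof -
  note P = assms(1)[unfolded pre_U_def]
  let ?Q = "alt {1..l} P"
  have "vars_in {1..l} ?Q"
    unfolding alt_def
    by (intro vars_in_sum vars_in_mult vars_in_of_int vars_in_rename[of "{1..l}"]) (use P permutes_image in auto)
  moreover have "deg_le (2 * n) ?Q"
    unfolding alt_def
    by (intro deg_le_sum deg_le_of_int_mult deg_le_rename) (use P permutes_inj in auto)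
  moreover have "coeffs_in (sym_polys (2 * n + 1)) ?Q"
    unfolding alt_def
    by (intro coeffs_in_sum coeffs_in_mult coeffs_in_of_int coeffs_in_rename) (use P in auto)
  ultimately have "?Q \<in> ext_power n l"
    by (auto simp: ext_power_def vars_in_def deg_le_def coeffs_in_def rename_alt)
  moreover have "eval_Xx (X(l := s * inverse x)) (y(2 * n := x, 2 * n + 1 := - x)) ?Q = 0"
    if "x \<noteq> 0" "s \<in> {1, -1}" for X y x s
    unfolding alt_def eval_Xx_simps eval_Xx_rename
  proof (rule sum.neutral, intro ballI)
    fix \<sigma> assume "\<sigma> \<in> {\<sigma>. \<sigma> permutes {1..l}}"
    then have \<sigma>: "\<sigma> permutes {1..l}" by simp
    define a where "a = inv \<sigma> l"
    have a: "a \<in> {1..l}" "\<sigma> a = l"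
      using assms(2) permutes_in_image[OF permutes_inv[OF \<sigma>], of l] permutes_surj[OF \<sigma>]
      by (auto simp: a_def surj_f_inv_f)
    have "eval_Xx (\<lambda>i. (X(l := s * inverse x)) (\<sigma> i)) (y(2 * n := x, 2 * n + 1 := - x)) P = 0"
      using P a that by auto
    then show "of_int (sign \<sigma>) * eval_Xx (\<lambda>i. (X(l := s * inverse x)) (\<sigma> i)) (y(2 * n := x, 2 * n + 1 := - x)) P = 0"
      by simp
  qed
  ultimately show ?thesis unfolding U_def mem_Collect_eq by blast
qed

lemma vars_in_shift_mult:
  fixes P Q :: "'a::comm_ring_1 mpoly"
  assumes "vars_in {1..p} P" "vars_in {1..q} Q"
  shows "vars_in {1..p + q} (P * shift p Q)"
  unfolding shift_def
  by (intro vars_in_mult vars_in_mono[OF assms(1)] vars_in_rename[OF assms(2)]) auto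

lemma pre_U_vanish:
  assumes "pre_U n l P" "a \<in> {1..l}" "x \<noteq> 0" "s \<in> {1, -1}" "X a = s * inverse x"
  shows "eval_Xx X (y(2 * n := x, 2 * n + 1 := - x)) P = 0"
  using assms unfolding pre_U_def by metis

lemma pre_U_1: "pre_U n 0 1"
  by (simp add: pre_U_def)

text \<open>The special value belongs to a variable of one of the two blocks, and the factor in that
  block vanishes.\<close>

lemma pre_U_shift_mult:
  assumes P: "pre_U n p P" and Q: "pre_U n q Q"
  shows "pre_U n (p + q) (P * shift p Q)"
  unfolding pre_U_def
proof (intro conjI allI impI)
  show "vars_in {1..p + q} (P * shift p Q)"
    using P Q by (intro vars_in_shift_mult) (auto simp: pre_U_def)
  have inj: "inj ((+) p)" by simp
  show "deg_le (2 * n) (P * shift p Q)"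
  proof (rule deg_le_mult_disjoint[of _ _ _ "{1..p}" "{p+1..p+q}"])
    show "vars_in {p + 1..p + q} (shift p Q)"
      unfolding shift_def by (rule vars_in_rename[of "{1..q}"]) (use Q in \<open>auto simp: pre_U_def\<close>)
  qed (use P Q deg_le_rename[OF _ inj] in \<open>auto simp: pre_U_def shift_def\<close>)
  show "coeffs_in (sym_polys (2 * n + 1)) (P * shift p Q)"
    unfolding shift_def using P Q by (intro coeffs_in_mult coeffs_in_rename) (auto simp: pre_U_def)
  fix X y :: "nat \<Rightarrow> complex" and x s :: complex and a
  assume *: "a \<in> {1..p + q}" "x \<noteq> 0" "s \<in> {1, -1}" "X a = s * inverse x"
  show "eval_Xx X (y(2 * n := x, 2 * n + 1 := - x)) (P * shift p Q) = 0"
  proof (cases "a \<le> p")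
    case True
    then have "a \<in> {1..p}" using * by auto
    from pre_U_vanish[where X = X, OF P this *(2-4)] show ?thesis by (simp add: eval_Xx_simps)
  next
    case False
    then have "a - p \<in> {1..q}" "X (p + (a - p)) = s * inverse x" using * by auto
    from pre_U_vanish[where X = "\<lambda>b. X (p + b)", OF Q this(1) *(2-3) this(2)]
    show ?thesis by (simp add: eval_Xx_simps shift_def eval_Xx_rename)
  qed
qed

section \<open>The elements of the basis\<close>

lemma Prs_Suc: "r \<ge> 1 \<Longrightarrow> Prs n (Suc r) s = Prs n r (s + 1) - elem_sym (2 * n + 1) (2 * s) * Prs n r 1"
  by (cases r) simp_all

lemma sym_Prs [simp]: "Prs n r s \<in> sym_polys (2 * n + 1)"
  using sym_elem_sym[of "2 * n + 1"]
  by (induction n r s rule: Prs.induct) (auto intro!: sym_diff sym_mult simp del: sym_elem_sym)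

lemma sym_Prs' [simp]: "Prs n r s \<in> sym_polys (Suc (2 * n))"
  using sym_Prs[of n r s] by (simp only: Suc_eq_plus1)

lemma v_pos: "i \<ge> 1 \<Longrightarrow> v n i a = (\<Sum>j=1..n+1. const (Prs n i (int j)) * var a ^ (2 * (j - 1)))"
  and v_0: "v n 0 a = (\<Sum>j=0..n. const (elem_sym (2 * n + 1) (2 * int j)) * var a ^ (2 * j))"
  unfolding v_def by simp_all

text \<open>The first term of the recursion preserves \<open>r + s\<close>; in the second one the
  factor \<open>elem_sym\<close> makes up for the difference.\<close>

lemma xhom_Prs: "xhom (2 * (int r + s) - 3) (Prs n r s)"
proof (induction n r s rule: Prs.induct)
  case (2 n s)
  then show ?case using xhom_elem_sym[of "2 * s - 1" "2 * n + 1"] by (simp add: algebra_simps)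
next
  case (3 n r s)
  have "xhom (2 * s + (2 * (int (Suc r) + 1) - 3)) (elem_sym (2 * n + 1) (2 * s) * Prs n (Suc r) 1)"
    by (rule xhom_mult[OF xhom_elem_sym]) (use 3 in simp)
  then show ?case using 3 by (auto intro!: xhom_diff simp: algebra_simps)
qed simp

text \<open>The recursion either raises \<open>s\<close> or multiplies by \<open>elem_sym\<close> of
  index \<open>2 * s\<close>, which is zero beyond \<open>2 * n + 1\<close>. This closes the sums
  after the shift of index in \<open>var_mult_w\<close>.\<close>

lemma Prs_eq_0: "s \<ge> int n + 2 \<Longrightarrow> Prs n r s = 0"
  by (induction n r s rule: Prs.induct) (simp_all add: elem_sym_eq_0)

lemma sum_even_odd: "(\<Sum>k\<le>2 * n + 1. g k) = (\<Sum>j=0..n. g (2 * j)) + (\<Sum>j=1..n+1. g (2 * j - 1))"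
  for g :: "nat \<Rightarrow> 'a::comm_monoid_add"
  by (induction n) (simp_all add: add_ac)

text \<open>The even and the odd part of the product of all \<open>1 + x\<^sub>j X\<close>.\<close>

lemma eval_v_w_0:
  "eval_Xx X x (v n 0 a) + eval_Xx X x (w n 0 a) = (\<Prod>j=1..2*n+1. 1 + x j * X a)" (is ?plus)
  "eval_Xx X x (v n 0 a) - eval_Xx X x (w n 0 a) = (\<Prod>j=1..2*n+1. 1 - x j * X a)" (is ?minus)
proof -
  let ?e = "\<lambda>k. ev x (elem_sym (2 * n + 1) (int k))"
  have v: "eval_Xx X x (v n 0 a) = (\<Sum>j=0..n. ?e (2 * j) * X a ^ (2 * j))"
    by (simp add: v_def eval_Xx_simps)
  have w: "eval_Xx X x (w n 0 a) = (\<Sum>j=1..n+1. ?e (2 * j - 1) * X a ^ (2 * j - 1))"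
    unfolding w_def by (simp add: eval_Xx_simps of_nat_diff cong: sum.cong_simp del: sum.cl_ivl_Suc)
  have *: "(\<Prod>j=1..2*n+1. 1 + x j * t) = (\<Sum>k\<le>2 * n + 1. ?e k * t ^ k)" for t
    using prod_esym[OF rhom_ev, of "{1..2*n+1}" x t] by (simp add: elem_sym_esym)
  show ?plus unfolding * sum_even_odd v w ..
  have "(\<Prod>j=1..2*n+1. 1 + x j * (- X a)) = (\<Sum>j=0..n. ?e (2 * j) * X a ^ (2 * j)) + (\<Sum>j=1..n+1. - (?e (2 * j - 1) * X a ^ (2 * j - 1)))"
    unfolding * sum_even_odd
    by (intro arg_cong2[where f = "(+)"] sum.cong refl) (auto simp: power_minus' )
  then show ?minus by (simp add: v w sum_negf del: sum.cl_ivl_Suc)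
qed

lemma var_mult_v: "var a * v n (Suc i) a = w n i a"
proof -
  have "var a * v n (Suc i) a = (\<Sum>j=1..n+1. var a * (const (Prs n (Suc i) (int j)) * var a ^ (2 * (j - 1))))"
    by (simp only: v_pos sum_distrib_left)
  also have "\<dots> = w n i a"
    unfolding w_def
  proof (intro sum.cong refl)
    fix j assume "j \<in> {1..n+1}"
    then have "2 * j - 1 = Suc (2 * (j - 1))" by auto
    then show "var a * (const (Prs n (Suc i) (int j)) * var a ^ (2 * (j - 1))) =
        const (Prs n (i + 1) (int j)) * var a ^ (2 * j - 1)"
      by (simp add: mult_ac)
  qed
  finally show ?thesis .
qed

text \<open>The recursion of \<open>Prs\<close> as an identity of polynomials in \<open>X_a\<close>.
  Together with \<open>var_mult_v\<close> it generates all \<open>v\<close> and \<open>w\<close>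
  from \<open>v_0\<close> and \<open>w_0\<close>, up to division by \<open>X_a\<close>.\<close>

lemma var_mult_w:
  assumes "i \<ge> 1"
  shows "var a * w n i a = v n i a - const (Prs n i 1) * v n 0 a"
proof -
  let ?t = "\<lambda>j. const (Prs n i (int j)) * var a ^ (2 * (j - 1)) :: Xpoly"
  have "var a * w n i a = (\<Sum>j=1..n+1. const (Prs n (i + 1) (int j)) * var a ^ (2 * j))"
    unfolding w_def sum_distrib_left
    by (intro sum.cong refl) (auto simp: mult_ac simp flip: power_Suc)
  also have "\<dots> = (\<Sum>j=1..n+1. ?t (Suc j)) -
      const (Prs n i 1) * (\<Sum>j=1..n+1. const (elem_sym (2 * n + 1) (2 * int j)) * var a ^ (2 * j))"
    unfolding sum_distrib_left sum_subtractf[symmetric]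
    by (intro sum.cong refl) (use assms in \<open>auto simp: Prs_Suc const_simps algebra_simps\<close>)
  also have "(\<Sum>j=1..n+1. ?t (Suc j)) = v n i a - const (Prs n i 1)"
  proof -
    have "?t 1 + (\<Sum>j=1..n+1. ?t (Suc j)) = (\<Sum>j=1..n+2. ?t j)"
      using sum.atLeast_Suc_atMost[of 1 "n + 2" ?t] sum.shift_bounds_cl_Suc_ivl[of ?t 1 "n + 1"]
      by (simp del: sum.cl_ivl_Suc)
    also have "\<dots> = (\<Sum>j=1..n+1. ?t j) + ?t (n + 2)" by simp
    also have "?t (n + 2) = 0" by (simp add: Prs_eq_0)
    finally show ?thesis using assms by (simp add: v_def algebra_simps del: sum.cl_ivl_Suc)
  qed
  also have "(\<Sum>j=1..n+1. const (elem_sym (2 * n + 1) (2 * int j)) * var a ^ (2 * j)) = v n 0 a - 1"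
  proof -
    have "v n 0 a = (\<Sum>j=0..n+1. const (elem_sym (2 * n + 1) (2 * int j)) * var a ^ (2 * j))"
      by (simp add: v_def elem_sym_eq_0)
    also have "\<dots> = 1 + (\<Sum>j=1..n+1. const (elem_sym (2 * n + 1) (2 * int j)) * var a ^ (2 * j))"
      by (subst sum.atLeast_Suc_atMost) (simp_all add: elem_sym_esym const_1)
    finally show ?thesis by simp
  qed
  finally show ?thesis by (simp add: algebra_simps)
qed

text \<open>The sum and the difference of \<open>v_0\<close> and \<open>w_0\<close> are products
  over all \<open>x_j\<close>, and each contains a zero factor because both \<open>x\<close> and
  \<open>- x\<close> occur among the \<open>x_j\<close>. The remaining elements follow by
  \<open>var_mult_v\<close> and \<open>var_mult_w\<close>, as the value of \<open>X_a\<close> is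
  nonzero.\<close>

lemma eval_v_w_vanish:
  fixes X y :: "nat \<Rightarrow> complex" and x s :: complex
  assumes "n \<ge> 1" "x \<noteq> 0" "s \<in> {1, -1}" "X a = s * inverse x"
  defines "z \<equiv> y(2 * n := x, 2 * n + 1 := - x)"
  shows "eval_Xx X z (v n i a) = 0" "eval_Xx X z (w n i a) = 0"
proof -
  have z: "z (2 * n) = x" "z (2 * n + 1) = - x" by (simp_all add: z_def)
  have "(\<Prod>j=1..2*n+1. 1 + z j * X a) = 0"
    by (rule prod_zero, simp, rule bexI[of _ "if s = -1 then 2 * n else 2 * n + 1"])
      (use assms z in auto)
  moreover have "(\<Prod>j=1..2*n+1. 1 - z j * X a) = 0"
    by (rule prod_zero, simp, rule bexI[of _ "if s = 1 then 2 * n else 2 * n + 1"])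
      (use assms z in auto)
  ultimately have "eval_Xx X z (v n 0 a) + eval_Xx X z (w n 0 a) = 0"
      "eval_Xx X z (v n 0 a) - eval_Xx X z (w n 0 a) = 0"
    by (simp_all only: eval_v_w_0)
  then have 0: "eval_Xx X z (v n 0 a) = 0" "eval_Xx X z (w n 0 a) = 0"
    by (simp_all add: eq_neg_iff_add_eq_0)
  have X: "X a \<noteq> 0" using assms by auto
  have *: "eval_Xx X z (v n (Suc i) a) = 0" if "eval_Xx X z (w n i a) = 0" for i
    using arg_cong[OF var_mult_v[of a n i], of "eval_Xx X z"] that X by (simp add: eval_Xx_simps)
  have "eval_Xx X z (v n i a) = 0 \<and> eval_Xx X z (w n i a) = 0"
  proof (induction i)
    case (Suc i)
    then have "eval_Xx X z (v n (Suc i) a) = 0" using * by auto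
    moreover from this have "eval_Xx X z (w n (Suc i) a) = 0"
      using arg_cong[OF var_mult_w[of "Suc i" a n], of "eval_Xx X z"] 0 X by (simp add: eval_Xx_simps)
    ultimately show ?case by simp
  qed (use 0 in simp)
  then show "eval_Xx X z (v n i a) = 0" "eval_Xx X z (w n i a) = 0" by auto
qed

lemma vars_in_v: "vars_in {a} (v n i a)" and vars_in_w: "vars_in {a} (w n i a)"
  unfolding v_def w_def by (auto intro!: vars_in_sum vars_in_mult vars_in_power simp del: sum.cl_ivl_Suc power_Suc)

lemma pre_U_v: "n \<ge> 1 \<Longrightarrow> pre_U n 1 (v n i 1)"
  unfolding pre_U_def
proof (intro conjI allI impI)
  show "deg_le (2 * n) (v n i 1)"
    unfolding v_def by (auto intro!: deg_le_sum deg_le_const_mult deg_le_var_power simp del: sum.cl_ivl_Suc)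
  show "coeffs_in (sym_polys (2 * n + 1)) (v n i 1)"
    unfolding v_def by (auto intro!: coeffs_in_sum coeffs_in_mult simp del: sum.cl_ivl_Suc)
qed (use vars_in_v[of 1] eval_v_w_vanish in auto)

text \<open>The term with \<open>j = n + 1\<close> has degree \<open>2 * n + 1\<close> in
  \<open>X\<close>. Its coefficient is \<open>elem_sym\<close> of index \<open>2 * n + 1\<close> for
  \<open>i = 0\<close>, which excludes \<open>w_0\<close>, and zero for
  \<open>i \<ge> 1\<close>.\<close>

lemma pre_U_w: "n \<ge> 1 \<Longrightarrow> i \<ge> 1 \<Longrightarrow> pre_U n 1 (w n i 1)"
  unfolding pre_U_def
proof (intro conjI allI impI)
  assume i: "i \<ge> 1"
  have "deg_le (2 * n) (const (Prs n (i + 1) (int j)) * var 1 ^ (2 * j - 1))" if "j \<in> {1..n+1}" for j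
  proof (cases "j = n + 1")
    case True
    then have "Prs n (i + 1) (int j) = 0" using i by (simp add: Prs_Suc Prs_eq_0 elem_sym_eq_0)
    then show ?thesis by simp
  qed (use that in \<open>auto intro!: deg_le_const_mult deg_le_var_power\<close>)
  then show "deg_le (2 * n) (w n i 1)" unfolding w_def by (rule deg_le_sum)
  show "coeffs_in (sym_polys (2 * n + 1)) (w n i 1)"
    unfolding w_def by (auto intro!: coeffs_in_sum coeffs_in_mult simp del: sum.cl_ivl_Suc)
qed (use vars_in_w[of 1] eval_v_w_vanish in auto)

lemma deg1_homogeneous_v: "i \<ge> 1 \<Longrightarrow> deg1_homogeneous (2 * int i - 1) (v n i a)"
  unfolding v_def
proof (subst if_not_P, simp, rule deg1_homogeneous_sum)
  fix j assume "i \<ge> 1" "j \<in> {1..n+1}"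
  then have "2 * int i - 1 = (2 * (int i + int j) - 3) + (- int (2 * (j - 1)))" by (simp add: of_nat_diff)
  then show "deg1_homogeneous (2 * int i - 1) (const (Prs n i (int j)) * var a ^ (2 * (j - 1)))"
    by (simp only:) (rule deg1_homogeneous_mult[OF deg1_homogeneous_const[OF xhom_Prs] deg1_homogeneous_var_power])
qed

lemma deg1_homogeneous_v_0: "deg1_homogeneous 0 (v n 0 a)"
  unfolding v_def
proof (subst if_P, simp, rule deg1_homogeneous_sum)
  fix j
  show "deg1_homogeneous 0 (const (elem_sym (2 * n + 1) (2 * int j)) * var a ^ (2 * j))"
    using deg1_homogeneous_mult[OF deg1_homogeneous_const[OF xhom_elem_sym[of "2 * int j" "2 * n + 1"]]
      deg1_homogeneous_var_power[of "2 * j" a]] by simp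
qed

lemma deg1_homogeneous_w: "deg1_homogeneous (2 * int i) (w n i a)"
  unfolding w_def
proof (rule deg1_homogeneous_sum)
  fix j assume "j \<in> {1..n+1}"
  then have "2 * int i = (2 * (int (i + 1) + int j) - 3) + (- int (2 * j - 1))" by (simp add: of_nat_diff)
  then show "deg1_homogeneous (2 * int i) (const (Prs n (i + 1) (int j)) * var a ^ (2 * j - 1))"
    by (simp only:) (rule deg1_homogeneous_mult[OF deg1_homogeneous_const[OF xhom_Prs] deg1_homogeneous_var_power])
qed

text \<open>The part of \<open>\<xi>\<^sub>k\<close> that is even in \<open>X\<^sub>1\<close> and odd in \<open>X\<^sub>2\<close>; \<open>\<xi>\<^sub>k\<close> is its antisymmetrisation.\<close>

definition zeta_term :: "nat \<Rightarrow> nat \<Rightarrow> 'a::comm_ring_1 mpoly" where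
  "zeta_term j i = (\<Sum>c<j + 1 - i. var 1 ^ (2 * (j - c)) * var 2 ^ (2 * (i + c) - 1))"

text \<open>At most one of the two inner sums is nonempty, since subtraction of natural numbers
  empties the other one. Their difference is the quotient of a telescoping sum by
  \<open>X_1^2 - X_2^2\<close>, with the sign that belongs to \<open>i \<le> j\<close> or
  \<open>i > j + 1\<close>.\<close>

definition zeta :: "nat \<Rightarrow> nat \<Rightarrow> Xpoly" where
  "zeta n k = (\<Sum>j=0..n. \<Sum>i=1..n+1. const (elem_sym (2 * n + 1) (2 * int j) * Prs n k (int i)) *
     (zeta_term j i - zeta_term (i - 1) (j + 1)))"

text \<open>A geometric sum in the squares, of length \<open>m = j + 1 - i\<close>.\<close>

lemma telescope_even_odd:
  fixes x y :: "'a::comm_ring_1"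
  assumes "1 \<le> i" "i \<le> j + 1"
  shows "(x\<^sup>2 - y\<^sup>2) * (\<Sum>c<j + 1 - i. x ^ (2 * (j - c)) * y ^ (2 * (i + c) - 1)) =
    x ^ (2 * j + 2) * y ^ (2 * i - 1) - x ^ (2 * i) * y ^ (2 * j + 1)"
proof -
  define m where "m = j + 1 - i"
  have "(\<Sum>c<m. x ^ (2 * (j - c)) * y ^ (2 * (i + c) - 1)) =
      x ^ (2 * i) * y ^ (2 * i - 1) * (\<Sum>c<m. (x\<^sup>2) ^ (m - Suc c) * (y\<^sup>2) ^ c)"
    unfolding sum_distrib_left
  proof (intro sum.cong refl)
    fix c assume c: "c \<in> {..<m}"
    have "2 * (j - c) = 2 * i + 2 * (m - Suc c)" "2 * (i + c) - 1 = 2 * i - 1 + 2 * c"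
      using assms c by (auto simp: m_def)
    then show "x ^ (2 * (j - c)) * y ^ (2 * (i + c) - 1) =
        x ^ (2 * i) * y ^ (2 * i - 1) * ((x\<^sup>2) ^ (m - Suc c) * (y\<^sup>2) ^ c)"
      by (simp add: power_add mult_ac flip: power_mult)
  qed
  then have "(x\<^sup>2 - y\<^sup>2) * (\<Sum>c<m. x ^ (2 * (j - c)) * y ^ (2 * (i + c) - 1)) =
      x ^ (2 * i) * y ^ (2 * i - 1) * ((x\<^sup>2 - y\<^sup>2) * (\<Sum>c<m. (x\<^sup>2) ^ (m - Suc c) * (y\<^sup>2) ^ c))"
    by (simp only: mult_ac)
  also have "(x\<^sup>2 - y\<^sup>2) * (\<Sum>c<m. (x\<^sup>2) ^ (m - Suc c) * (y\<^sup>2) ^ c) = (x\<^sup>2) ^ m - (y\<^sup>2) ^ m"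
    using power_diff_sumr2[of "y\<^sup>2" m "x\<^sup>2"] by (simp add: algebra_simps)
  also have "x ^ (2 * i) * y ^ (2 * i - 1) * ((x\<^sup>2) ^ m - (y\<^sup>2) ^ m) =
      x ^ (2 * i + 2 * m) * y ^ (2 * i - 1) - x ^ (2 * i) * y ^ (2 * i - 1 + 2 * m)"
    by (simp add: power_add algebra_simps flip: power_mult)
  also have "2 * i + 2 * m = 2 * j + 2" 
    using assms by (auto simp: m_def)
  also have "2 * i - 1 + 2 * m = 2 * j + 1"
    using assms by (auto simp: m_def)
  finally show ?thesis by (simp add: m_def)
qed

lemma zeta_term_diff:
  assumes "1 \<le> i"
  shows "((var 1)\<^sup>2 - (var 2)\<^sup>2) * (zeta_term j i - zeta_term (i - 1) (j + 1)) =
    (var 1)\<^sup>2 * (var 1 ^ (2 * j) * var 2 ^ (2 * i - 1)) - var 1 * var 2 * (var 2 ^ (2 * j) * var 1 ^ (2 * i - 1) :: 'a::comm_ring_1 mpoly)"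
proof -
  obtain i' where i: "i = Suc i'" using assms by (cases i) auto
  show ?thesis
  proof (cases "i \<le> j + 1")
    case True
    then have 0: "zeta_term i' (j + 1) = (0 :: 'a mpoly)" by (simp add: zeta_term_def i)
    have "((var 1)\<^sup>2 - (var 2)\<^sup>2) * (zeta_term j i :: 'a mpoly) =
        var 1 ^ (2 * j + 2) * var 2 ^ (2 * i - 1) - var 1 ^ (2 * i) * var 2 ^ (2 * j + 1 :: nat)"
      unfolding zeta_term_def by (rule telescope_even_odd[OF assms True])
    with 0 show ?thesis by (simp add: i power_add power2_eq_square mult_ac)
  next
    case False
    then have 0: "zeta_term j i = (0 :: 'a mpoly)" by (simp add: zeta_term_def)
    have "((var 1)\<^sup>2 - (var 2)\<^sup>2) * (zeta_term i' (j + 1) :: 'a mpoly) =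
        var 1 ^ (2 * i' + 2) * var 2 ^ (2 * (j + 1) - 1) - var 1 ^ (2 * (j + 1)) * var 2 ^ (2 * i' + 1)"
      unfolding zeta_term_def by (rule telescope_even_odd) (use False i in auto)
    then have "((var 1)\<^sup>2 - (var 2)\<^sup>2) * (0 - zeta_term i' (j + 1)) =
        var 1 ^ (2 * (j + 1)) * var 2 ^ (2 * i' + 1) - var 1 ^ (2 * i' + 2) * (var 2 :: 'a mpoly) ^ (2 * (j + 1) - 1)"
      by (simp only: diff_0 mult_minus_right minus_diff_eq)
    with 0 show ?thesis by (simp add: i power_add power2_eq_square mult_ac)
  qed
qed

text \<open>With A = v_0(X_1) w_{k-1}(X_2) and B = v_0(X_2) w_{k-1}(X_1), the definition of xi_k
  reads (X_1 + X_2) xi_k = X_1 A - X_2 B. After multiplication by X_1 - X_2, the part of the right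
  side that is even in X_1 and odd in X_2 is X_1^2 A - X_1 X_2 B.\<close>

lemma zeta_eq:
  assumes "k \<ge> 1"
  shows "((var 1)\<^sup>2 - (var 2)\<^sup>2) * zeta n k =
    (var 1)\<^sup>2 * (v n 0 1 * w n (k - 1) 2) - var 1 * var 2 * (v n 0 2 * w n (k - 1) 1)"
proof -
  let ?c = "\<lambda>j i. const (elem_sym (2 * n + 1) (2 * int j)) * const (Prs n k (int i)) :: Xpoly"
  have *: "v n 0 a * w n (k - 1) b = (\<Sum>j=0..n. \<Sum>i=1..n+1. ?c j i * (var a ^ (2 * j) * var b ^ (2 * i - 1)))" for a b
    unfolding v_0 w_def sum_product using assms by (intro sum.cong refl) (simp add: mult_ac)
  have "((var 1)\<^sup>2 - (var 2)\<^sup>2) * zeta n k = (\<Sum>j=0..n. \<Sum>i=1..n+1. ?c j i * (((var 1)\<^sup>2 - (var 2)\<^sup>2) * (zeta_term j i - zeta_term (i - 1) (j + 1))))"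
    unfolding zeta_def sum_distrib_left const_simps by (intro sum.cong refl) (simp only: mult_ac)
  also have "\<dots> = (\<Sum>j=0..n. \<Sum>i=1..n+1. (var 1)\<^sup>2 * (?c j i * (var 1 ^ (2 * j) * var 2 ^ (2 * i - 1))) -
      var 1 * var 2 * (?c j i * (var 2 ^ (2 * j) * var 1 ^ (2 * i - 1))))"
  proof (intro sum.cong refl)
    fix j i assume "i \<in> {1..n+1}"
    then have "1 \<le> i" by simp
    show "?c j i * (((var 1)\<^sup>2 - (var 2)\<^sup>2) * (zeta_term j i - zeta_term (i - 1) (j + 1))) =
      (var 1)\<^sup>2 * (?c j i * (var 1 ^ (2 * j) * var 2 ^ (2 * i - 1))) -
      var 1 * var 2 * (?c j i * (var 2 ^ (2 * j) * var 1 ^ (2 * i - 1)))"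
      unfolding zeta_term_diff[OF \<open>1 \<le> i\<close>] by (simp only: right_diff_distrib mult_ac)
  qed
  also have "\<dots> = (var 1)\<^sup>2 * (v n 0 1 * w n (k - 1) 2) - var 1 * var 2 * (v n 0 2 * w n (k - 1) 1)"
    unfolding * sum_distrib_left sum_subtractf ..
  finally show ?thesis .
qed

lemma alt_pair: "alt {1..2} P = P - rename (transpose 1 2) (P :: 'a::comm_ring_1 mpoly)"
proof -
  have "{1..2::nat} = {1, 2}" by auto
  then have "{\<sigma>. \<sigma> permutes {1..2::nat}} = {id, transpose 1 2}"
    by (auto simp: permutes_doubleton_iff)
  moreover have "id \<noteq> transpose 1 (2::nat)"
    by (auto simp: fun_eq_iff transpose_def)
  ultimately show ?thesis
    by (simp add: alt_def sign_swap_id id_def)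
qed

lemma var_diff_nz: "i \<noteq> j \<Longrightarrow> var i - var j \<noteq> (0 :: 'a::comm_ring_1 mpoly)"
proof
  assume ij: "i \<noteq> j" and "var i - var j = (0 :: 'a mpoly)"
  then have "Poly_Mapping.lookup (var i :: 'a mpoly) (Poly_Mapping.single i 1) = Poly_Mapping.lookup (var j) (Poly_Mapping.single i 1)"
    by simp
  moreover have "Poly_Mapping.single j (1::nat) \<noteq> Poly_Mapping.single i 1"
    using ij by (metis lookup_single_eq lookup_single_not_eq zero_neq_one)
  ultimately show False by (simp add: var_def lookup_single when_def)
qed

lemma rename_v: "rename s (v n i a) = v n i (s a)" and rename_w: "rename s (w n i a) = w n i (s a)"
  by (simp_all add: v_def w_def rename_simps del: sum.cl_ivl_Suc)

text \<open>\<open>zeta_eq\<close> and its image under the exchange of the two variables combine to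
  the defining equation of \<open>xi\<close> times \<open>X_1 - X_2\<close>, which is cancelled; the
  solution of that equation is unique.\<close>

lemma xi_eq_alt:
  assumes "k \<ge> 1"
  shows "xi n k = alt {1..2} (zeta n k)"
proof -
  let ?x = "var 1 :: Xpoly" and ?y = "var 2 :: Xpoly"
  let ?S = "rename (transpose 1 2) (zeta n k)"
  define A B where "A = v n 0 1 * w n (k - 1) 2" and "B = v n 0 2 * w n (k - 1) 1"
  have Z: "(?x\<^sup>2 - ?y\<^sup>2) * zeta n k = ?x\<^sup>2 * A - ?x * ?y * B"
    unfolding A_def B_def by (rule zeta_eq[OF assms])
  have "rename (transpose 1 2) ((?x\<^sup>2 - ?y\<^sup>2) * zeta n k) = rename (transpose 1 2) (?x\<^sup>2 * A - ?x * ?y * B)"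
    by (simp only: Z)
  then have S: "(?y\<^sup>2 - ?x\<^sup>2) * ?S = ?y\<^sup>2 * B - ?y * ?x * A"
    by (simp add: A_def B_def rename_simps rename_v rename_w)
  have "(?x - ?y) * ((?x + ?y) * (2 * (zeta n k - ?S))) =
      2 * ((?x\<^sup>2 - ?y\<^sup>2) * zeta n k) + 2 * ((?y\<^sup>2 - ?x\<^sup>2) * ?S)"
    by (simp add: algebra_simps power2_eq_square)
  also have "\<dots> = (?x - ?y) * ((?x - ?y) * (A + B) + (?x + ?y) * (A - B))"
    unfolding Z S by (simp add: algebra_simps power2_eq_square)
  finally have "(?x + ?y) * (2 * (zeta n k - ?S)) = (?x - ?y) * (A + B) + (?x + ?y) * (A - B)"
    using var_diff_nz[of 1 2, where 'a = xpoly] by simp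
  then have "is_xi n k (alt {1..2} (zeta n k))"
    unfolding is_xi_def alt_pair A_def B_def .
  then show ?thesis
    unfolding xi_def by (rule the1_equality[OF is_xi_ex1])
qed

lemma vars_in_zeta: "vars_in {1..2} (zeta n k)"
  unfolding zeta_def zeta_term_def
  by (intro vars_in_sum vars_in_mult vars_in_diff vars_in_power vars_in_const) auto

lemma deg1_homogeneous_zeta:
  assumes "k \<ge> 1"
  shows "deg1_homogeneous (2 * int k - 2) (zeta n k)"
  unfolding zeta_def
proof (intro deg1_homogeneous_sum)
  fix j i assume i: "i \<in> {1..n+1}"
  have t: "deg1_homogeneous (- 2 * int j - 2 * int i + 1) (zeta_term j i)" if "i \<ge> 1" for j i
    unfolding zeta_term_def
  proof (rule deg1_homogeneous_sum)
    fix c assume "c \<in> {..<j + 1 - i}"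
    then have "- 2 * int j - 2 * int i + 1 = - int (2 * (j - c)) + - int (2 * (i + c) - 1)"
      using that by (simp add: of_nat_diff)
    then show "deg1_homogeneous (- 2 * int j - 2 * int i + 1) (var 1 ^ (2 * (j - c)) * var 2 ^ (2 * (i + c) - 1))"
      by (simp only:) (rule deg1_homogeneous_mult[OF deg1_homogeneous_var_power deg1_homogeneous_var_power])
  qed
  have "deg1_homogeneous (- 2 * int j - 2 * int i + 1) (zeta_term j i - zeta_term (i - 1) (j + 1))"
    using t[of i j] t[of "j + 1" "i - 1"] i by (intro deg1_homogeneous_diff) (auto simp: of_nat_diff algebra_simps)
  moreover have "deg1_homogeneous (2 * int j + (2 * (int k + int i) - 3)) (const (elem_sym (2 * n + 1) (2 * int j) * Prs n k (int i)))"
    by (intro deg1_homogeneous_const xhom_mult xhom_elem_sym xhom_Prs)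
  ultimately have "deg1_homogeneous (2 * int j + (2 * (int k + int i) - 3) + (- 2 * int j - 2 * int i + 1))
     (const (elem_sym (2 * n + 1) (2 * int j) * Prs n k (int i)) * (zeta_term j i - zeta_term (i - 1) (j + 1)))"
    by (intro deg1_homogeneous_mult)
  then show "deg1_homogeneous (2 * int k - 2)
     (const (elem_sym (2 * n + 1) (2 * int j) * Prs n k (int i)) * (zeta_term j i - zeta_term (i - 1) (j + 1)))"
    by (simp add: algebra_simps)
qed

text \<open>Vanishing of \<open>\<zeta>\<^sub>k\<close> where \<open>X\<^sub>1\<^sup>2 = X\<^sub>2\<^sup>2\<close> is obtained by keeping one of the two variables as an
  indeterminate.\<close>

lemma eval_zeta_vanish:
  fixes X y :: "nat \<Rightarrow> complex" and x s :: complex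
  assumes "n \<ge> 1" "k \<ge> 1" "a \<in> {1..2}" "x \<noteq> 0" "s \<in> {1, -1}" "X a = s * inverse x"
  defines "z \<equiv> y(2 * n := x, 2 * n + 1 := - x)"
  shows "eval_Xx X z (zeta n k) = 0"
proof -
  define b where "b = 3 - a"
  have "a = 1 \<or> a = 2" using assms(3) by auto
  then have ab: "a \<noteq> b" "{a, b} = {1, 2}" by (auto simp: b_def)
  define \<phi> where "\<phi> = eval_with (\<lambda>r. [:ev z r:]) (\<lambda>i. if i = b then [:0, 1:] else [:X i:])"
  have h: "rhom (\<lambda>r. [:ev z r:])"
    by (simp add: rhom_def ev_simps one_pCons)
  have \<phi>: "rhom \<phi>" unfolding \<phi>_def by (rule rhom_eval_with[OF h])
  have const_poly: "rhom (\<lambda>c::complex. [:c:])" by (simp add: rhom_def one_pCons)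
  have p1: "\<phi> p = [:eval_Xx X z p:]" if "vars_in {a} p" for p
  proof -
    have "\<phi> p = eval_with (\<lambda>r. [:ev z r:]) (\<lambda>i. [:X i:]) p"
      unfolding \<phi>_def by (rule eval_with_cong_vars[OF that]) (use ab in auto)
    also have "\<dots> = [:eval_Xx X z p:]"
      by (rule mpoly_hom_eqI[OF rhom_eval_with[OF h] rhom_comp[OF const_poly rhom_eval_Xx]])
        (simp_all add: eval_with_const eval_with_var h)
    finally show ?thesis .
  qed
  have p2: "poly (\<phi> p) (X b) = eval_Xx X z p" for p
  proof -
    have pe: "rhom (\<lambda>q::complex poly. poly q (X b))" by (simp add: rhom_def)
    show ?thesis
      by (rule mpoly_hom_eqI[OF rhom_comp[OF pe \<phi>] rhom_eval_Xx])
        (simp_all add: \<phi>_def eval_with_const eval_with_var h)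
  qed
  have v: "\<phi> (v n i a) = 0" and w: "\<phi> (w n i a) = 0" for i
    using eval_v_w_vanish[of n x s X a y i] assms by (simp_all add: p1[OF vars_in_v] p1[OF vars_in_w])
  have "\<phi> (v n 0 1 * w n (k - 1) 2) = 0" "\<phi> (v n 0 2 * w n (k - 1) 1) = 0"
    using ab v w by (auto simp: rhom.mult[OF \<phi>] doubleton_eq_iff)
  then have "\<phi> (((var 1)\<^sup>2 - (var 2)\<^sup>2) * zeta n k) = 0"
    unfolding zeta_eq[OF assms(2)] 
    by (simp only: rhom.diff[OF \<phi>] rhom.mult[OF \<phi>, of "(var 1)\<^sup>2"] rhom.mult[OF \<phi>, of "var 1 * var 2"]
        mult_zero_right diff_self)
  then have "((\<phi> (var 1))\<^sup>2 - (\<phi> (var 2))\<^sup>2) * \<phi> (zeta n k) = 0"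
    by (simp add: rhom.hom_simps[OF \<phi>])
  moreover have "(\<phi> (var 1))\<^sup>2 - (\<phi> (var 2))\<^sup>2 \<noteq> 0"
  proof -
    have "\<phi> (var a) = [:X a:]" "\<phi> (var b) = [:0, 1:]"
      using ab by (simp_all add: \<phi>_def eval_with_var h)
    moreover have "[:X a:]\<^sup>2 - [:0, 1:]\<^sup>2 \<noteq> (0 :: complex poly)" 
      by (simp add: power2_eq_square)
    moreover from this have "[:0, 1:]\<^sup>2 - [:X a:]\<^sup>2 \<noteq> (0 :: complex poly)" by auto
    ultimately show ?thesis using ab by (auto simp: doubleton_eq_iff)
  qed
  ultimately have "\<phi> (zeta n k) = 0" by simp
  with p2[of "zeta n k"] show ?thesis by simp
qed

lemma pre_U_zeta:
  assumes "n \<ge> 1" "k \<ge> 1"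
  shows "pre_U n 2 (zeta n k)"
  unfolding pre_U_def
proof (intro conjI allI impI)
  have d: "deg_le (2 * n) (zeta_term j i :: Xpoly)" if "j \<le> n" for j i
    unfolding zeta_term_def
  proof (rule deg_le_sum)
    fix c assume "c \<in> {..<j + 1 - i}"
    then show "deg_le (2 * n) (var 1 ^ (2 * (j - c)) * var 2 ^ (2 * (i + c) - 1) :: Xpoly)"
      using that by (intro deg_le_mult_disjoint[of _ _ _ "{1}" "{2}"] deg_le_var_power vars_in_power) auto
  qed
  show "deg_le (2 * n) (zeta n k)"
    unfolding zeta_def by (intro deg_le_sum deg_le_const_mult deg_le_diff d) auto
  show "coeffs_in (sym_polys (2 * n + 1)) (zeta n k)"
    unfolding zeta_def zeta_term_def
    by (intro coeffs_in_sum coeffs_in_mult coeffs_in_diff coeffs_in_var_power)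
      (simp add: sym_mult del: sym_Prs' sym_elem_sym add: sym_Prs[simplified] sym_elem_sym)
qed (use vars_in_zeta eval_zeta_vanish assms in auto)

text \<open>\<open>wedge_list\<close> before antisymmetrisation: the factors occupy consecutive
  blocks of \<open>d\<close> variables.\<close>

primrec shift_prod :: "nat \<Rightarrow> 'a::comm_ring_1 mpoly list \<Rightarrow> 'a mpoly" where
  "shift_prod d [] = 1"
| "shift_prod d (P # Ps) = P * shift d (shift_prod d Ps)"

lemma vars_in_shift_prod:
  "(\<And>P. P \<in> set Ps \<Longrightarrow> vars_in {1..d} P) \<Longrightarrow> vars_in {1..d * length Ps} (shift_prod d Ps)"
proof (induction Ps)
  case (Cons P Ps)
  then show ?case using vars_in_shift_mult[of d P "d * length Ps" "shift_prod d Ps"] by simp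
qed simp

lemma alt_empty [simp]: "alt {} P = (P :: 'a::comm_ring_1 mpoly)"
proof -
  have "{\<sigma>. \<sigma> permutes ({}::nat set)} = {id}" by auto
  then show ?thesis by (simp add: alt_def id_def)
qed

lemma alt_singleton: "alt {i} P = (P :: 'a::comm_ring_1 mpoly)"
proof -
  have "{\<sigma>. \<sigma> permutes {i}} = {id}" by (auto simp: permutes_sing)
  then show ?thesis by (simp add: alt_def id_def)
qed

lemma wedge_list_alt:
  "(\<And>P. P \<in> set Ps \<Longrightarrow> vars_in {1..d} P) \<Longrightarrow>
    wedge_list d (map (alt {1..d}) Ps) = alt {1..d * length Ps} (shift_prod d Ps)"
proof (induction Ps)
  case (Cons P Ps)
  then show ?case
    using wedge_alt[of d P "d * length Ps" "shift_prod d Ps"] vars_in_shift_prod[of Ps d] by simp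
qed simp

lemma pre_U_shift_prod:
  "(\<And>P. P \<in> set Ps \<Longrightarrow> pre_U n d P) \<Longrightarrow> pre_U n (d * length Ps) (shift_prod d Ps)"
proof (induction Ps)
  case (Cons P Ps)
  then show ?case using pre_U_shift_mult[of n d P "d * length Ps" "shift_prod d Ps"] by simp
qed (simp add: pre_U_1)

lemma deg1_homogeneous_shift_prod:
  "(\<And>i. i \<in> set xs \<Longrightarrow> deg1_homogeneous (e i) (f i)) \<Longrightarrow>
    deg1_homogeneous (\<Sum>i\<leftarrow>xs. e i) (shift_prod d (map f xs))"
  by (induction xs) (auto intro!: deg1_homogeneous_mult deg1_homogeneous_rename simp: shift_def deg1_homogeneous_1)

type_synonym index = "nat list \<times> nat list \<times> nat list"

text \<open>Representatives whose antisymmetrisation is \<open>bas_minus\<close>. Vanishing, degrees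
  and values of functionals are computed on them factor by factor, in disjoint variables.\<close>

fun pre_bas_minus :: "nat \<Rightarrow> index \<Rightarrow> Xpoly" where
  "pre_bas_minus n (I, J, K) =
     shift_prod 1 (map (\<lambda>i. v n i 1) I) * shift (length I)
       (shift_prod 1 (map (\<lambda>j. w n j 1) J) * shift (length J) (shift_prod 2 (map (zeta n) K)))"

definition pre_bas :: "nat \<Rightarrow> index + index \<Rightarrow> Xpoly" where
  "pre_bas n = case_sum (\<lambda>t. v n 0 1 * shift 1 (pre_bas_minus n t)) (pre_bas_minus n)"

text \<open>The \<open>deg1\<close> degrees of \<open>v_i\<close>, \<open>w_j\<close> and
  \<open>xi_k\<close> are \<open>2 * i - 1\<close>, \<open>2 * j\<close> and
  \<open>2 * k - 2\<close>. As \<open>v_0\<close> has degree 0, one function serves both summands of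
  \<open>bas_index\<close>.\<close>

fun index_deg :: "index \<Rightarrow> nat" where
  "index_deg (I, J, K) = (\<Sum>i\<leftarrow>I. 2 * i - 1) + (\<Sum>j\<leftarrow>J. 2 * j) + (\<Sum>k\<leftarrow>K. 2 * (k - 1))"

lemma sum_list_of_nat: "int (\<Sum>i\<leftarrow>xs. g i) = (\<Sum>i\<leftarrow>xs. int (g i))"
  by (induction xs) auto

lemma bas_minus_props:
  assumes n: "n \<ge> 1" and t: "t \<in> bas_minus_index n m"
  shows "bas_minus n t = alt {1..m} (pre_bas_minus n t)" "pre_U n m (pre_bas_minus n t)"
    "deg1_homogeneous (int (index_deg t)) (pre_bas_minus n t)"
proof -
  obtain I J K where IJK: "t = (I, J, K)" by (cases t)
  have I: "\<And>i. i \<in> set I \<Longrightarrow> i \<ge> 1" and J: "\<And>i. i \<in> set J \<Longrightarrow> i \<ge> 1" and K: "\<And>i. i \<in> set K \<Longrightarrow> i \<ge> 1"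
    and m: "m = length I + (length J + 2 * length K)"
    using t by (auto simp: IJK bas_minus_index_def)
  let ?I = "shift_prod 1 (map (\<lambda>i. v n i 1) I)" and ?J = "shift_prod 1 (map (\<lambda>j. w n j 1) J)"
    and ?K = "shift_prod 2 (map (zeta n) K)"
  have pI: "pre_U n (length I) ?I" using pre_U_shift_prod[of "map (\<lambda>i. v n i 1) I" n 1] pre_U_v[OF n] by auto
  have pJ: "pre_U n (length J) ?J" using pre_U_shift_prod[of "map (\<lambda>i. w n i 1) J" n 1] pre_U_w[OF n] J by auto
  have pK: "pre_U n (2 * length K) ?K" using pre_U_shift_prod[of "map (zeta n) K" n 2] pre_U_zeta[OF n] K by auto
  note pJK = pre_U_shift_mult[OF pJ pK]
  show "pre_U n m (pre_bas_minus n t)"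
    unfolding m IJK pre_bas_minus.simps by (rule pre_U_shift_mult[OF pI pJK])
  have eI: "wedge_list 1 (map (\<lambda>i. v n i 1) I) = alt {1..length I} ?I"
    using wedge_list_alt[of "map (\<lambda>i. v n i 1) I" 1] vars_in_v by (auto simp: o_def alt_singleton)
  have eJ: "wedge_list 1 (map (\<lambda>i. w n i 1) J) = alt {1..length J} ?J"
    using wedge_list_alt[of "map (\<lambda>i. w n i 1) J" 1] vars_in_w by (auto simp: o_def alt_singleton)
  have "map (xi n) K = map (alt {1..2}) (map (zeta n) K)"
    unfolding map_map o_def by (intro map_cong refl xi_eq_alt K)
  moreover have "wedge_list 2 (map (alt {1..2}) (map (zeta n) K)) = alt {1..2 * length (map (zeta n) K)} ?K"
    by (rule wedge_list_alt) (use vars_in_zeta in auto)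
  ultimately have eK: "wedge_list 2 (map (xi n) K) = alt {1..2 * length K} ?K"
    by (simp only: length_map)
  show "bas_minus n t = alt {1..m} (pre_bas_minus n t)"
    by (simp only: bas_minus_def IJK prod.case pre_bas_minus.simps eI eJ eK m
        wedge_alt[OF pre_U_vars[OF pJ] pre_U_vars[OF pK]] wedge_alt[OF pre_U_vars[OF pI] pre_U_vars[OF pJK]])
  have "deg1_homogeneous ((\<Sum>i\<leftarrow>I. 2 * int i - 1) + ((\<Sum>j\<leftarrow>J. 2 * int j) + (\<Sum>k\<leftarrow>K. 2 * int k - 2))) (pre_bas_minus n t)"
    unfolding IJK pre_bas_minus.simps shift_def
    by (intro deg1_homogeneous_mult deg1_homogeneous_rename deg1_homogeneous_shift_prod
        deg1_homogeneous_v deg1_homogeneous_w deg1_homogeneous_zeta I K)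
  moreover have "(\<Sum>i\<leftarrow>I. 2 * int i - 1) = int (\<Sum>i\<leftarrow>I. 2 * i - 1)"
    unfolding sum_list_of_nat by (intro arg_cong[of _ _ sum_list] map_cong refl) (use I in \<open>auto simp: of_nat_diff\<close>)
  moreover have "(\<Sum>j\<leftarrow>J. 2 * int j) = int (\<Sum>j\<leftarrow>J. 2 * j)"
    by (simp add: sum_list_of_nat)
  moreover have "(\<Sum>k\<leftarrow>K. 2 * int k - 2) = int (\<Sum>k\<leftarrow>K. 2 * (k - 1))"
    unfolding sum_list_of_nat by (intro arg_cong[of _ _ sum_list] map_cong refl) (use K in \<open>auto simp: of_nat_diff\<close>)
  ultimately show "deg1_homogeneous (int (index_deg t)) (pre_bas_minus n t)"
    by (simp add: IJK add.assoc)
qed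

lemma bas_props:
  assumes n: "n \<ge> 1" and l: "l \<ge> 1" and t: "t \<in> bas_index n l"
  shows "bas n l t = alt {1..l} (pre_bas n t)" "pre_U n l (pre_bas n t)" "bas n l t \<in> U n l"
    "deg1_homogeneous (int (case_sum index_deg index_deg t)) (bas n l t)"
proof -
  have *: "bas n l t = alt {1..l} (pre_bas n t) \<and> pre_U n l (pre_bas n t) \<and>
      deg1_homogeneous (int (case_sum index_deg index_deg t)) (pre_bas n t)"
  proof (cases t)
    case (Inl u)
    then have u: "u \<in> bas_minus_index n (l - 1)" using t by (auto simp: bas_index_def)
    note pu = bas_minus_props[OF n u]
    have l': "1 + (l - 1) = l" using l by simp
    have "bas n l t = wedge 1 (l - 1) (alt {1..1} (v n 0 1)) (alt {1..l - 1} (pre_bas_minus n u))"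
      by (simp add: bas_def Inl pu(1) alt_singleton)
    also have "\<dots> = alt {1..l} (pre_bas n t)"
      using wedge_alt[OF pre_U_vars[OF pre_U_v[OF n, of 0]] pre_U_vars[OF pu(2)]]
      by (simp only: l' pre_bas_def Inl sum.case)
    finally have "bas n l t = alt {1..l} (pre_bas n t)" .
    moreover have "pre_U n l (pre_bas n t)"
      using pre_U_shift_mult[OF pre_U_v[OF n, of 0] pu(2)] by (simp only: l' pre_bas_def Inl sum.case)
    moreover have "deg1_homogeneous (0 + int (index_deg u)) (pre_bas n t)"
      unfolding pre_bas_def Inl sum.case shift_def
      by (intro deg1_homogeneous_mult deg1_homogeneous_v_0 deg1_homogeneous_rename pu)
    ultimately show ?thesis by (simp add: Inl)
  next
    case (Inr u)
    then have u: "u \<in> bas_minus_index n l" using t by (auto simp: bas_index_def)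
    show ?thesis using bas_minus_props[OF n u] by (simp add: bas_def pre_bas_def Inr)
  qed
  then show "bas n l t = alt {1..l} (pre_bas n t)" "pre_U n l (pre_bas n t)"
    "deg1_homogeneous (int (case_sum index_deg index_deg t)) (bas n l t)"
    by (auto intro: deg1_homogeneous_alt)
  with alt_in_U[OF this(2) l] show "bas n l t \<in> U n l" by simp
qed

section \<open>Linear functionals\<close>

text \<open>Extends values on the monomials in the \<open>X_a\<close> linearly over the
  coefficients. The two uses are \<open>inverted\<close>, with polynomial values, and
  \<open>slots\<close>, with complex values.\<close>

definition lin :: "('a::comm_ring_1 \<Rightarrow> 'b::comm_ring_1) \<Rightarrow> ((nat \<Rightarrow>\<^sub>0 nat) \<Rightarrow> 'b) \<Rightarrow> 'a mpoly \<Rightarrow> 'b" where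
  "lin h B P = (\<Sum>m\<in>Poly_Mapping.keys P. h (Poly_Mapping.lookup P m) * B m)"

lemma lin_superset:
  assumes "rhom h" "finite S" "Poly_Mapping.keys P \<subseteq> S"
  shows "lin h B P = (\<Sum>m\<in>S. h (Poly_Mapping.lookup P m) * B m)"
  unfolding lin_def
  by (rule sum.mono_neutral_left) (use assms rhom.zero[OF assms(1)] in \<open>auto simp: in_keys_iff\<close>)

lemma lin_0 [simp]: "lin h B 0 = 0"
  by (simp add: lin_def)

lemma lin_add:
  assumes "rhom h"
  shows "lin h B (P + Q) = lin h B P + lin h B Q"
proof -
  let ?S = "Poly_Mapping.keys P \<union> Poly_Mapping.keys Q"
  have "lin h B (P + Q) = (\<Sum>m\<in>?S. h (Poly_Mapping.lookup (P + Q) m) * B m)"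
    by (rule lin_superset[OF assms]) (use Poly_Mapping.keys_add[of P Q] in auto)
  then show ?thesis
    by (simp add: lookup_add rhom.add[OF assms] ring_distribs sum.distrib lin_superset[OF assms, of ?S])
qed

lemma lin_sum: "rhom h \<Longrightarrow> lin h B (sum f A) = (\<Sum>i\<in>A. lin h B (f i))"
  by (induction A rule: infinite_finite_induct) (simp_all add: lin_add)

lemma lin_single: "rhom h \<Longrightarrow> lin h B (Poly_Mapping.single m c) = h c * B m"
  by (subst lin_superset[of _ "{m}"]) auto

lemma lookup_const_mult: "Poly_Mapping.lookup (const c * P) m = c * Poly_Mapping.lookup P m"
  for P :: "'a::comm_ring_1 mpoly"
proof -
  have "const c * P = const c * (\<Sum>m\<in>Poly_Mapping.keys P. Poly_Mapping.single m (Poly_Mapping.lookup P m))"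
    by (simp flip: poly_mapping_sum_single)
  also have "\<dots> = (\<Sum>m\<in>Poly_Mapping.keys P. Poly_Mapping.single m (c * Poly_Mapping.lookup P m))"
    by (simp add: sum_distrib_left const_def mult_single)
  finally show ?thesis
    by (simp add: lookup_sum lookup_single when_def in_keys_iff)
qed

lemma lin_const_mult:
  assumes "rhom h"
  shows "lin h B (const c * P) = h c * lin h B P"
proof -
  have "Poly_Mapping.keys (const c * P) \<subseteq> Poly_Mapping.keys P"
    by (auto simp: in_keys_iff lookup_const_mult)
  then have "lin h B (const c * P) = (\<Sum>m\<in>Poly_Mapping.keys P. h (Poly_Mapping.lookup (const c * P) m) * B m)"
    by (intro lin_superset[OF assms]) auto
  then show ?thesis
    by (simp add: lookup_const_mult rhom.mult[OF assms] lin_def sum_distrib_left mult.assoc)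
qed

section \<open>Passing to the inverse variables\<close>

text \<open>For \<open>P \<in> ext_power n l\<close> this is the polynomial
  \<open>(x\<^sub>1 \<cdots> x\<^sub>l)\<^sup>2\<^sup>n P(-1/x\<^sub>1, \<dots>, -1/x\<^sub>l | x\<^sub>1, \<dots>, x\<^sub>2\<^sub>n\<^sub>+\<^sub>1)\<close>.\<close>

definition inverted :: "nat \<Rightarrow> nat \<Rightarrow> Xpoly \<Rightarrow> xpoly" where
  "inverted n l = lin (\<lambda>r. r)
     (\<lambda>m. \<Prod>a\<in>{1..l}. (-1) ^ Poly_Mapping.lookup m a * var a ^ (2 * n - Poly_Mapping.lookup m a))"

lemma ext_powerD:
  assumes "P \<in> ext_power n l"
  shows "vars_in {1..l} P" "deg_le (2 * n) P" "coeffs_in (sym_polys (2 * n + 1)) P"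
    "\<And>\<sigma>. \<sigma> permutes {1..l} \<Longrightarrow> rename \<sigma> P = of_int (sign \<sigma>) * P"
  using assms by (auto simp: ext_power_def vars_in_def deg_le_def coeffs_in_def)

lemma ev_inverted:
  assumes P: "vars_in {1..l} P" "deg_le (2 * n) P" and x: "\<And>a. a \<in> {1..l} \<Longrightarrow> x a \<noteq> 0"
  shows "ev x (inverted n l P) = (\<Prod>a=1..l. x a ^ (2 * n)) * eval_Xx (\<lambda>a. - inverse (x a)) x P"
proof -
  let ?X = "\<lambda>a. - inverse (x a)"
  have "ev x (\<Prod>a\<in>{1..l}. (-1) ^ Poly_Mapping.lookup m a * var a ^ (2 * n - Poly_Mapping.lookup m a)) =
      (\<Prod>a=1..l. x a ^ (2 * n)) * mono ?X m" if m: "m \<in> Poly_Mapping.keys P" for m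
  proof -
    have "mono ?X m = (\<Prod>a=1..l. ?X a ^ Poly_Mapping.lookup m a)"
      by (rule mono_superset) (use P m in \<open>auto simp: vars_in_def\<close>)
    moreover have "(-1) ^ k * x a ^ (2 * n - k) = x a ^ (2 * n) * ?X a ^ k" if "a \<in> {1..l}" "k \<le> 2 * n" for a k
    proof -
      have "x a ^ (2 * n) = x a ^ (2 * n - k) * x a ^ k" using that by (simp flip: power_add)
      moreover have "?X a ^ k = (-1) ^ k * inverse (x a ^ k)"
        by (simp add: power_minus[of "inverse (x a)"] power_inverse)
      ultimately show ?thesis using x[OF that(1)] by simp
    qed
    ultimately show ?thesis
      using P m by (simp add: ev_simps deg_le_def flip: prod.distrib cong: prod.cong_simp)
  qed
  note * = this
  have "ev x (inverted n l P) = (\<Sum>m\<in>Poly_Mapping.keys P. ev x (Poly_Mapping.lookup P m) *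
      ev x (\<Prod>a\<in>{1..l}. (-1) ^ Poly_Mapping.lookup m a * var a ^ (2 * n - Poly_Mapping.lookup m a)))"
    by (simp only: inverted_def lin_def rhom.sum[OF rhom_ev] rhom.mult[OF rhom_ev])
  also have "\<dots> = (\<Sum>m\<in>Poly_Mapping.keys P. (\<Prod>a=1..l. x a ^ (2 * n)) * (ev x (Poly_Mapping.lookup P m) * mono ?X m))"
    by (intro sum.cong refl, subst *) (simp_all only: mult_ac)
  also have "\<dots> = (\<Prod>a=1..l. x a ^ (2 * n)) * eval_Xx ?X x P"
    by (simp only: sum_distrib_left eval_Xx_def eval_with_def[of "ev x"] mono_def)
  finally show ?thesis .
qed

lemma inverted_add: "inverted n l (P + Q) = inverted n l P + inverted n l Q"
  and inverted_sum: "inverted n l (sum f A) = (\<Sum>i\<in>A. inverted n l (f i))"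
  and inverted_const_mult: "inverted n l (const r * P) = r * inverted n l P"
  by (simp_all add: inverted_def lin_add lin_sum lin_const_mult rhom_ident)

lemma vars_in_lookup: "coeffs_in (sym_polys N) P \<Longrightarrow> vars_in {1..N} (Poly_Mapping.lookup P m)"
  by (auto simp: coeffs_in_def sym_polys_iff)

lemma vars_in_inverted:
  assumes "coeffs_in (sym_polys (2 * n + 1)) P" "l \<le> 2 * n + 1"
  shows "vars_in {1..2*n+1} (inverted n l P)"
  unfolding inverted_def lin_def
  by (intro vars_in_sum vars_in_mult vars_in_prod vars_in_power vars_in_lookup[OF assms(1)])
    (use assms(2) in auto)

text \<open>Both \<open>X_a\<close> and \<open>-1/x_a\<close> have degree -1; the factor that clears
  denominators contributes \<open>2 * n * l\<close>.\<close>

lemma xhom_inverted: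
  assumes P: "vars_in {1..l} P" "deg_le (2 * n) P" and d: "deg1_homogeneous d P"
  shows "xhom (d + int (2 * n * l)) (inverted n l P)"
  unfolding inverted_def lin_def
proof (rule xhom_sum)
  fix m assume m: "m \<in> Poly_Mapping.keys P"
  have "xhom (0 + int (2 * n - Poly_Mapping.lookup m a) * 1) ((-1) ^ Poly_Mapping.lookup m a * var a ^ (2 * n - Poly_Mapping.lookup m a) :: xpoly)" for a
    by (intro xhom_mult xhom_power xhom_var) (use xhom_of_int[of "(-1) ^ Poly_Mapping.lookup m a"] in simp)
  then have "xhom (\<Sum>a=1..l. int (2 * n - Poly_Mapping.lookup m a)) (\<Prod>a=1..l. (-1) ^ Poly_Mapping.lookup m a * var a ^ (2 * n - Poly_Mapping.lookup m a) :: xpoly)"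
    by (intro xhom_prod) simp
  moreover have "(\<Sum>a=1..l. int (2 * n - Poly_Mapping.lookup m a)) = int (2 * n * l) - mdeg m"
  proof -
    have "mdeg m = (\<Sum>a=1..l. int (Poly_Mapping.lookup m a))"
      by (rule mdeg_superset) (use P m in \<open>auto simp: vars_in_def\<close>)
    moreover have "(\<Sum>a=1..l. int (2 * n - Poly_Mapping.lookup m a)) = (\<Sum>a=1..l. int (2 * n) - int (Poly_Mapping.lookup m a))"
      by (intro sum.cong refl) (use P m in \<open>auto simp: deg_le_def of_nat_diff\<close>)
    ultimately show ?thesis by (simp add: sum_subtractf)
  qed
  moreover have "xhom (d + mdeg m) (Poly_Mapping.lookup P m)" using d by (simp add: deg1_homogeneous_iff)
  ultimately show "xhom (d + int (2 * n * l)) (Poly_Mapping.lookup P m *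
      (\<Prod>a=1..l. (-1) ^ Poly_Mapping.lookup m a * var a ^ (2 * n - Poly_Mapping.lookup m a)))"
    using xhom_mult[of "d + mdeg m" _ "int (2 * n * l) - mdeg m"] by fastforce
qed

lemma eval_Xx_permute_coeffs:
  assumes "coeffs_in (sym_polys N) P" "\<tau> permutes {1..N}"
  shows "eval_Xx X (\<lambda>i. x (\<tau> i)) P = eval_Xx X x P"
proof -
  have "ev (\<lambda>i. x (\<tau> i)) (Poly_Mapping.lookup P m) = ev x (Poly_Mapping.lookup P m)" for m
    using assms by (auto simp: coeffs_in_def sym_polys_iff simp flip: ev_rename)
  then show ?thesis by (simp add: eval_Xx_def eval_with_def)
qed

lemma eval_Xx_permute_X:
  assumes "P \<in> ext_power n l" "\<tau> permutes {1..l}"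
  shows "eval_Xx (\<lambda>i. X (\<tau> i)) x P = of_int (sign \<tau>) * eval_Xx X x P"
  using ext_powerD(4)[OF assms] by (simp add: eval_Xx_simps flip: eval_Xx_rename)

text \<open>A permutation of the \<open>x_i\<close> does not change the symmetric coefficients.
  Among the first \<open>l\<close> it permutes the arguments \<open>-1/x_a\<close>, so the
  antisymmetry of \<open>P\<close> applies; among the others it leaves these arguments
  fixed.\<close>

lemma rename_inverted:
  assumes P: "P \<in> ext_power n l" and l: "l \<le> 2 * n + 1"
  shows "\<tau> permutes {1..l} \<Longrightarrow> rename \<tau> (inverted n l P) = of_int (sign \<tau>) * inverted n l P" (is "_ \<Longrightarrow> ?anti")
    and "\<tau> permutes {l+1..2*n+1} \<Longrightarrow> rename \<tau> (inverted n l P) = inverted n l P" (is "_ \<Longrightarrow> ?sym")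
proof -
  note PD = ext_powerD[OF P]
  have *: "ev x (rename \<tau> (inverted n l P)) =
      (\<Prod>a=1..l. x (\<tau> a) ^ (2 * n)) * eval_Xx (\<lambda>a. - inverse (x (\<tau> a))) x P"
    if "generic x" "\<tau> permutes {1..2*n+1}" for x \<tau>
    using that ev_inverted[OF PD(1,2), of "\<lambda>i. x (\<tau> i)"] eval_Xx_permute_coeffs[OF PD(3), of \<tau>]
    by (simp add: ev_rename generic_nz)
  show ?anti if \<tau>: "\<tau> permutes {1..l}"
  proof (rule xpoly_eqI)
    fix x assume x: "generic x"
    have "\<tau> permutes {1..2*n+1}" by (rule permutes_subset[OF \<tau>]) (use l in auto)
    moreover have "(\<Prod>a=1..l. x (\<tau> a) ^ (2 * n)) = (\<Prod>a=1..l. x a ^ (2 * n))"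
      using prod.permute[OF \<tau>, of "\<lambda>a. x a ^ (2 * n)"] by (simp add: o_def)
    ultimately show "ev x (rename \<tau> (inverted n l P)) = ev x (of_int (sign \<tau>) * inverted n l P)"
      using *[OF x] eval_Xx_permute_X[OF P \<tau>, of "\<lambda>a. - inverse (x a)" x] ev_inverted[OF PD(1,2), of x] x
      by (simp add: ev_simps generic_nz)
  qed
  show ?sym if \<tau>: "\<tau> permutes {l+1..2*n+1}"
  proof (rule xpoly_eqI)
    fix x assume x: "generic x"
    have t: "\<tau> permutes {1..2*n+1}" by (rule permutes_subset[OF \<tau>]) auto
    have fx: "\<tau> a = a" if "a \<in> {1..l}" for a by (rule permutes_not_in[OF \<tau>]) (use that in auto)
    have "eval_Xx (\<lambda>a. - inverse (x (\<tau> a))) x P = eval_Xx (\<lambda>a. - inverse (x a)) x P"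
      unfolding eval_Xx_def by (rule eval_with_cong_vars[OF PD(1)]) (simp add: fx)
    then show "ev x (rename \<tau> (inverted n l P)) = ev x (inverted n l P)"
      using *[OF x t] ev_inverted[OF PD(1,2), of x] x by (simp add: generic_nz fx cong: prod.cong_simp)
  qed
qed

subsection \<open>Divisibility by the sums of two variables\<close>

abbreviation subst_neg :: "nat \<Rightarrow> nat \<Rightarrow> xpoly \<Rightarrow> xpoly" where
  "subst_neg a j \<equiv> eval_with const (var(a := - var j))"

lemma rhom_subst_neg: "rhom (subst_neg a j)"
  by (rule rhom_eval_with[OF rhom_const])

lemma ev_subst_neg: "ev x (subst_neg a j p) = ev (x(a := - x j)) p"
  by (rule mpoly_hom_eqI[OF rhom_comp[OF rhom_ev rhom_subst_neg] rhom_ev])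
    (simp_all add: eval_with_const eval_with_var rhom_const ev_simps)

text \<open>The factor theorem: \<open>p - subst_neg a j p\<close> is always divisible, which is
  shown by induction on \<open>p\<close>.\<close>

lemma dvd_if_subst_neg_eq_0:
  assumes "subst_neg a j p = 0"
  shows "var a + var j dvd p"
proof -
  have "var a + var j dvd p - subst_neg a j p"
  proof (induction p rule: mpoly_induct)
    case (mult p q)
    have "p * q - subst_neg a j (p * q) = (p - subst_neg a j p) * q + subst_neg a j p * (q - subst_neg a j q)"
      by (simp add: rhom.mult[OF rhom_subst_neg] algebra_simps)
    then show ?case using mult by (simp only: dvd_add dvd_mult dvd_mult2)
  next
    case (add p q)
    have "p + q - subst_neg a j (p + q) = (p - subst_neg a j p) + (q - subst_neg a j q)"
      by (simp add: rhom.add[OF rhom_subst_neg] algebra_simps)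
    then show ?case using add by (simp only: dvd_add)
  qed (simp_all add: eval_with_const eval_with_var rhom_const)
  with assms show ?thesis by simp
qed

lemma U_vanish:
  "P \<in> U n l \<Longrightarrow> x \<noteq> 0 \<Longrightarrow> s \<in> {1, -1} \<Longrightarrow>
    eval_Xx (X(l := s * inverse x)) (y(2 * n := x, 2 * n + 1 := - x)) P = 0"
  unfolding U_def mem_Collect_eq by metis

text \<open>The definition of \<open>U\<close> speaks only of the last \<open>X_l\<close> and of the
  last two \<open>x_i\<close>. Symmetry of the coefficients moves \<open>a\<close> and
  \<open>j\<close> to these two places, antisymmetry moves \<open>X_a\<close> to
  \<open>X_l\<close>.\<close>

lemma subst_neg_inverted:
  assumes P: "P \<in> U n l" and n: "n \<ge> 1" and l: "l \<le> 2 * n + 1"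
    and a: "a \<in> {1..l}" and j: "j \<in> {1..2*n+1}" and ne: "a \<noteq> j"
  shows "subst_neg a j (inverted n l P) = 0"
proof (rule xpoly_eqI)
  fix x assume x: "generic x"
  have ext: "P \<in> ext_power n l" using P by (simp add: U_def)
  note PD = ext_powerD[OF ext]
  define x' where "x' = x(a := - x j)"
  have nz: "x' i \<noteq> 0" for i using generic_nz[OF x] by (simp add: x'_def)
  \<comment> \<open>\<pi> sends \<open>2 * n\<close> to \<open>a\<close> and
    \<open>2 * n + 1\<close> to \<open>j\<close>. As \<pi>1 may already move \<open>j\<close>, the
    second transposition is taken at \<open>\<pi>1 j\<close>.\<close>
  define \<pi>1 where "\<pi>1 = transpose (2 * n) a"
  define \<pi> where "\<pi> = \<pi>1 \<circ> transpose (2 * n + 1) (\<pi>1 j)"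
  have 1: "\<pi>1 permutes {1..2*n+1}"
    unfolding \<pi>1_def by (rule permutes_swap_id) (use a l n in auto)
  have \<pi>: "\<pi> permutes {1..2*n+1}"
    unfolding \<pi>_def by (intro permutes_compose[OF _ 1] permutes_swap_id) (use permutes_in_image[OF 1, of j] j in auto)
  have "\<pi>1 (\<pi>1 j) = j" by (simp add: \<pi>1_def)
  moreover have "\<pi>1 j \<noteq> 2 * n" using ne by (auto simp: \<pi>1_def transpose_def split: if_splits)
  ultimately have \<pi>_vals: "\<pi> (2 * n) = a" "\<pi> (2 * n + 1) = j"
    by (simp_all add: \<pi>_def \<pi>1_def transpose_apply_other)
  let ?t = "transpose a l"
  have t: "?t permutes {1..l}" by (rule permutes_swap_id) (use a in auto)
  let ?X = "\<lambda>i. - inverse (x' (?t i))" and ?y = "\<lambda>i. x' (\<pi> i)"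
  \<comment> \<open>The vanishing condition is applied with \<open>- x j\<close> in place of
    \<open>x\<close> and with the sign \<open>-1\<close>; coordinate \<open>j\<close> of
    \<open>x'\<close> is then \<open>- (- x j)\<close>.\<close>
  have "?X l = - inverse (- x j)" by (simp add: x'_def)
  then have e1: "?X = ?X(l := (-1) * inverse (- x j))" by (auto simp: fun_eq_iff)
  have e2: "?y = ?y(2 * n := - x j, 2 * n + 1 := - (- x j))"
    using \<pi>_vals ne by (auto simp: x'_def fun_eq_iff)
  have e3: "eval_Xx (?X(l := (-1) * inverse (- x j))) (?y(2 * n := - x j, 2 * n + 1 := - (- x j))) P = 0"
    by (rule U_vanish[OF P]) (use generic_nz[OF x, of j] in auto)
  have "eval_Xx ?X ?y P = 0"
    by (rule trans[OF arg_cong2[OF e1 e2, of "\<lambda>X y. eval_Xx X y P"] e3])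
  then have "eval_Xx (\<lambda>i. - inverse (x' i)) x' P = 0"
    using eval_Xx_permute_coeffs[OF PD(3) \<pi>] eval_Xx_permute_X[OF ext t, of "\<lambda>i. - inverse (x' i)"] by simp
  then have "ev x' (inverted n l P) = 0"
    using ev_inverted[OF PD(1,2), of x'] nz by simp
  then show "ev x (subst_neg a j (inverted n l P)) = ev x 0"
    by (simp add: ev_subst_neg x'_def ev_simps)
qed

text \<open>Sets rather than ordered pairs, so that a sum \<open>x_a + x_b\<close> with both indices
  at most \<open>l\<close> is counted once.\<close>

definition edges :: "nat \<Rightarrow> nat \<Rightarrow> nat set set" where
  "edges N l = {e. e \<subseteq> {1..N} \<and> card e = 2 \<and> e \<inter> {1..l} \<noteq> {}}"

definition edge_prod :: "nat \<Rightarrow> nat \<Rightarrow> xpoly" where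
  "edge_prod N l = (\<Prod>e\<in>edges N l. \<Sum>i\<in>e. var i)"

lemma finite_edges: "finite (edges N l)"
  by (rule finite_subset[of _ "Pow {1..N}"]) (auto simp: edges_def)

lemma edge_prod_nz: "edge_prod N l \<noteq> 0"
proof -
  have "(\<Sum>i\<in>e. var i :: xpoly) \<noteq> 0" if "card e = 2" for e :: "nat set"
  proof -
    from that obtain b c where e: "e = {b, c}" "b \<noteq> c" by (auto simp: card_2_iff)
    obtain x where x: "generic x" using generic_exists by blast
    have "ev x (\<Sum>i\<in>e. var i) = x b + x c" using e by (simp add: ev_simps)
    also have "\<dots> \<noteq> 0" by (rule generic_sum_nz[OF x])
    finally have "ev x (\<Sum>i\<in>e. var i) \<noteq> ev x 0" by (simp add: ev_simps(1))
    then show ?thesis by metis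
  qed
  then show ?thesis by (auto simp: edge_prod_def finite_edges edges_def)
qed

text \<open>One factor is split off at a time. Setting \<open>x_a = - x_j\<close> kills the
  polynomial and none of the earlier factors, hence the cofactor, since the ring has no zero
  divisors.\<close>

lemma edge_prod_dvd:
  assumes P: "P \<in> U n l" and n: "n \<ge> 1" and l: "l \<le> 2 * n + 1"
  shows "edge_prod (2 * n + 1) l dvd inverted n l P"
proof -
  let ?f = "\<lambda>e. \<Sum>i\<in>e. var i :: xpoly"
  have "F \<subseteq> edges (2 * n + 1) l \<Longrightarrow> prod ?f F dvd inverted n l P" if "finite F" for F
    using that
  proof (induction F rule: finite_induct)
    case (insert e F)
    then obtain G where G: "inverted n l P = prod ?f F * G" by auto
    obtain a j where aj: "a \<in> {1..l}" "j \<in> {1..2*n+1}" "a \<noteq> j" "e = {a, j}"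
    proof -
      have "e \<in> edges (2 * n + 1) l" using insert by auto
      then have e: "card e = 2" "e \<subseteq> {1..2*n+1}" "e \<inter> {1..l} \<noteq> {}"
        unfolding edges_def by auto
      from e(1) obtain b c where "e = {b, c}" "b \<noteq> c" by (auto simp: card_2_iff)
      moreover from this e have "b \<in> {1..2*n+1}" "c \<in> {1..2*n+1}" "b \<in> {1..l} \<or> c \<in> {1..l}"
        by blast+
      ultimately have "\<exists>b c. e = {b, c} \<and> b \<noteq> c \<and> b \<in> {1..2*n+1} \<and> c \<in> {1..2*n+1} \<and> (b \<in> {1..l} \<or> c \<in> {1..l})"
        by blast
      then obtain b c where "e = {b, c}" "b \<noteq> c" "b \<in> {1..2*n+1}" "c \<in> {1..2*n+1}" "b \<in> {1..l} \<or> c \<in> {1..l}"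
        by blast
      then show thesis using that[of b c] that[of c b] by auto
    qed
    \<comment> \<open>Away from the edge \<open>{a, j}\<close> the substitution turns
      \<open>x_b + x_c\<close> into a sum or a difference of distinct generic coordinates.\<close>
    have nz: "subst_neg a j (?f e') \<noteq> 0" if "e' \<in> F" for e'
    proof -
      have "card e' = 2" "e' \<noteq> {a, j}" using that insert aj by (auto simp: edges_def)
      then obtain b c where bc: "e' = {b, c}" "b \<noteq> c" by (auto simp: card_2_iff)
      obtain x where x: "generic x" using generic_exists by blast
      have neq: "x b \<noteq> x c" "x i = x k \<longleftrightarrow> i = k" for i k using generic_eq[OF x] bc by auto
      have "ev x (subst_neg a j (?f e')) = (x(a := - x j)) b + (x(a := - x j)) c"
        using bc by (simp add: ev_subst_neg ev_simps)
      also have "\<dots> \<noteq> 0"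
        using generic_sum_nz[OF x, of b c] \<open>e' \<noteq> {a, j}\<close> bc neq(2)[of j] neq(2)[of _ j]
        by (auto simp: insert_commute add_eq_0_iff)
      finally show ?thesis by (auto simp: ev_simps)
    qed
    have "subst_neg a j (prod ?f F) * subst_neg a j G = 0"
      using subst_neg_inverted[OF P n l aj(1-3)] by (simp add: G rhom.mult[OF rhom_subst_neg])
    moreover have "subst_neg a j (prod ?f F) \<noteq> 0"
      using nz insert.hyps(1) by (simp add: rhom.prod[OF rhom_subst_neg])
    ultimately have "subst_neg a j G = 0" by simp
    then have "?f e dvd G" using dvd_if_subst_neg_eq_0[of a j G] aj by simp
    then show ?case using insert.hyps by (simp add: G mult.commute mult_dvd_mono)
  qed simp
  from this[OF finite_edges] show ?thesis by (simp add: edge_prod_def)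
qed

lemma rename_edge_prod:
  assumes \<tau>: "\<tau> permutes {1..N}" and l: "\<tau> ` {1..l} = {1..l}"
  shows "rename \<tau> (edge_prod N l) = edge_prod N l"
proof -
  have inj: "inj \<tau>" using \<tau> by (rule permutes_inj)
  have "rename \<tau> (edge_prod N l) = (\<Prod>e\<in>edges N l. \<Sum>i\<in>\<tau> ` e. var i)"
    by (simp add: edge_prod_def rename_simps sum.reindex inj_on_subset[OF inj])
  also have "\<dots> = edge_prod N l"
    unfolding edge_prod_def
  proof (rule prod.reindex_bij_betw)
    have "inj_on ((`) \<tau>) (edges N l)" by (auto simp: inj_on_def inj_image_eq_iff[OF inj])
    moreover have "(`) \<tau> ` edges N l \<subseteq> edges N l"
    proof
      fix e' assume "e' \<in> (`) \<tau> ` edges N l"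
      then obtain e where e: "e' = \<tau> ` e" "e \<subseteq> {1..N}" "card e = 2" "e \<inter> {1..l} \<noteq> {}" by (auto simp: edges_def)
      then have "\<tau> ` e \<inter> \<tau> ` {1..l} \<noteq> {}" by blast
      then show "e' \<in> edges N l"
        using e l permutes_image[OF \<tau>] by (auto simp: edges_def card_image inj_on_subset[OF inj])
    qed
    ultimately show "bij_betw ((`) \<tau>) (edges N l) (edges N l)"
      using endo_inj_surj[OF finite_edges] by (auto simp: bij_betw_def)
  qed
  finally show ?thesis .
qed

text \<open>The cofactor inherits variables and symmetries by cancelling \<open>edge_prod\<close>,
  which is nonzero and invariant under both groups of permutations.\<close>

lemma inverted_factor:
  assumes P: "P \<in> U n l" and n: "n \<ge> 1" and l: "l \<le> 2 * n + 1"
  obtains G where "inverted n l P = edge_prod (2 * n + 1) l * G" "vars_in {1..2*n+1} G"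
    "\<And>\<tau>. \<tau> permutes {1..l} \<Longrightarrow> rename \<tau> G = of_int (sign \<tau>) * G"
    "\<And>\<tau>. \<tau> permutes {l+1..2*n+1} \<Longrightarrow> rename \<tau> G = G"
proof -
  let ?N = "2 * n + 1" and ?E = "edge_prod (2 * n + 1) l" and ?A = "inverted n l P"
  have ext: "P \<in> ext_power n l" using P by (simp add: U_def)
  from edge_prod_dvd[OF assms] obtain G where G: "?A = ?E * G" by auto
  have cancel: "?E * p = ?E * q \<Longrightarrow> p = q" for p q using edge_prod_nz[of ?N l] by simp
  \<comment> \<open>Sets the variables outside \<open>{1..2 * n + 1}\<close> to zero; it fixes the
    product and one factor, hence the other.\<close>
  let ?\<rho> = "eval_with const (\<lambda>i. if i \<in> {1..?N} then var i else 0) :: xpoly \<Rightarrow> xpoly"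
  have \<rho>: "rhom ?\<rho>" by (rule rhom_eval_with[OF rhom_const])
  have \<rho>_id: "?\<rho> p = p" if "vars_in {1..?N} p" for p
  proof -
    have "?\<rho> p = eval_with const var p"
      by (rule eval_with_cong_vars[OF that]) auto
    also have "\<dots> = p"
      by (rule mpoly_hom_eqI[OF rhom_eval_with[OF rhom_const] rhom_ident])
        (simp_all add: eval_with_const eval_with_var rhom_const)
    finally show ?thesis .
  qed
  have vE: "vars_in {1..?N} ?E"
    unfolding edge_prod_def by (intro vars_in_prod vars_in_sum) (auto simp: edges_def)
  have vA: "vars_in {1..?N} ?A" by (rule vars_in_inverted[OF ext_powerD(3)[OF ext] l])
  have "?E * ?\<rho> G = ?\<rho> (?E * G)" by (simp only: rhom.mult[OF \<rho>] \<rho>_id[OF vE])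
  also have "\<dots> = ?E * G" using \<rho>_id[OF vA] by (simp only: G)
  finally have "?E * ?\<rho> G = ?E * G" .
  then have "G = ?\<rho> G" by (rule cancel[symmetric])
  also have "vars_in {1..?N} \<dots>" by (rule vars_in_eval_with[OF vars_in_UNIV]) auto
  finally have "vars_in {1..?N} G" .
  moreover have "rename \<tau> G = of_int (sign \<tau>) * G" if \<tau>: "\<tau> permutes {1..l}" for \<tau>
  proof (rule cancel)
    have "rename \<tau> ?E = ?E"
      by (rule rename_edge_prod[OF permutes_subset[OF \<tau>]]) (use l permutes_image[OF \<tau>] in auto)
    then show "?E * rename \<tau> G = ?E * (of_int (sign \<tau>) * G)"
      using rename_inverted(1)[OF ext l \<tau>] by (simp add: G rename_simps mult_ac)
  qed
  moreover have "rename \<tau> G = G" if \<tau>: "\<tau> permutes {l+1..?N}" for \<tau>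
  proof (rule cancel)
    have "\<tau> a = a" if "a \<in> {1..l}" for a by (rule permutes_not_in[OF \<tau>]) (use that in auto)
    then have "rename \<tau> ?E = ?E"
      by (intro rename_edge_prod[OF permutes_subset[OF \<tau>]]) auto
    then show "?E * rename \<tau> G = ?E * G"
      using rename_inverted(2)[OF ext l \<tau>] by (simp add: G rename_simps mult_ac)
  qed
  ultimately show thesis using that G by blast
qed

section \<open>Polynomials as a module over the symmetric polynomials\<close>

text \<open>Linear combinations without an index set; for a finite family the coefficients are
  recovered in \<open>rspan_sumE\<close>.\<close>

inductive_set rspan :: "nat \<Rightarrow> xpoly set \<Rightarrow> xpoly set" for N B where
  zero: "0 \<in> rspan N B"
| step: "r \<in> sym_polys N \<Longrightarrow> b \<in> B \<Longrightarrow> p \<in> rspan N B \<Longrightarrow> r * b + p \<in> rspan N B"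

lemma rspan_base: "b \<in> B \<Longrightarrow> b \<in> rspan N B"
  using rspan.step[of 1 N b B 0] rspan.zero by simp

lemma rspan_add: "p \<in> rspan N B \<Longrightarrow> q \<in> rspan N B \<Longrightarrow> p + q \<in> rspan N B"
  by (induction p rule: rspan.induct) (auto simp: add.assoc intro: rspan.step)

lemma rspan_mult: "p \<in> rspan N B \<Longrightarrow> r \<in> sym_polys N \<Longrightarrow> r * p \<in> rspan N B"
proof (induction p rule: rspan.induct)
  case (step s b p)
  then have "r * s * b + r * p \<in> rspan N B" by (intro rspan.step sym_mult) auto
  then show ?case by (simp add: algebra_simps)
qed (simp add: rspan.zero)

lemma rspan_uminus: "p \<in> rspan N B \<Longrightarrow> - p \<in> rspan N B"
  using rspan_mult[of p N B "-1"] sym_of_int[of "-1" N] by simp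

lemma rspan_sum: "(\<And>i. i \<in> A \<Longrightarrow> f i \<in> rspan N B) \<Longrightarrow> sum f A \<in> rspan N B"
  by (induction A rule: infinite_finite_induct) (auto intro: rspan.zero rspan_add)

lemma rspan_linear_image:
  assumes "p \<in> rspan N B" "\<And>b. b \<in> B \<Longrightarrow> \<phi> b \<in> rspan N C"
    "\<And>p q. \<phi> (p + q) = \<phi> p + \<phi> q" "\<And>r p. r \<in> sym_polys N \<Longrightarrow> \<phi> (r * p) = r * \<phi> p"
  shows "\<phi> p \<in> rspan N C"
  using assms(1)
proof (induction rule: rspan.induct)
  case zero
  have "\<phi> 0 = 0" using assms(4)[of 0 0] by simp
  then show ?case by (simp add: rspan.zero)
next
  case (step r b p)
  then show ?case by (simp add: assms rspan_add rspan_mult)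
qed

lemma rspan_trans: "p \<in> rspan N B \<Longrightarrow> B \<subseteq> rspan N C \<Longrightarrow> p \<in> rspan N C"
  using rspan_linear_image[of p N B "\<lambda>p. p" C] by auto

lemma rspan_const_cancel: "const c * p \<in> rspan N B \<Longrightarrow> c \<noteq> 0 \<Longrightarrow> p \<in> rspan N B"
  using rspan_mult[of "const c * p" N B "const (inverse c)"]
  by (simp add: const_1 flip: mult.assoc const_simps(5))

text \<open>The span of Artin's basis, restricted to the variables \<open>x\<^sub>1, \<dots>, x\<^sub>k\<close>.\<close>

fun artin :: "nat \<Rightarrow> nat \<Rightarrow> xpoly set" where
  "artin N 0 = sym_polys N"
| "artin N (Suc k) = {(\<Sum>j<N - k. c j * var (Suc k) ^ j) | c. \<forall>j. c j \<in> artin N k}"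

definition subring :: "'a::comm_ring_1 set \<Rightarrow> bool" where
  "subring S \<longleftrightarrow> 0 \<in> S \<and> 1 \<in> S \<and> (\<forall>x\<in>S. \<forall>y\<in>S. x + y \<in> S) \<and> (\<forall>x\<in>S. - x \<in> S) \<and> (\<forall>x\<in>S. \<forall>y\<in>S. x * y \<in> S)"

lemma subringD:
  assumes "subring S"
  shows "0 \<in> S" "1 \<in> S" "x \<in> S \<Longrightarrow> y \<in> S \<Longrightarrow> x + y \<in> S" "x \<in> S \<Longrightarrow> - x \<in> S"
    "x \<in> S \<Longrightarrow> y \<in> S \<Longrightarrow> x * y \<in> S" "x \<in> S \<Longrightarrow> y \<in> S \<Longrightarrow> x - y \<in> S"
proof -
  show "x \<in> S \<Longrightarrow> y \<in> S \<Longrightarrow> x - y \<in> S"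
    using assms unfolding subring_def by (metis add_uminus_conv_diff)
qed (use assms in \<open>auto simp: subring_def\<close>)

lemma subring_sum: "subring S \<Longrightarrow> (\<And>i. i \<in> A \<Longrightarrow> f i \<in> S) \<Longrightarrow> sum f A \<in> S"
  by (induction A rule: infinite_finite_induct) (auto intro: subringD)

lemma subring_prod: "subring S \<Longrightarrow> (\<And>i. i \<in> A \<Longrightarrow> f i \<in> S) \<Longrightarrow> prod f A \<in> S"
  by (induction A rule: infinite_finite_induct) (auto intro: subringD)

lemma subring_power: "subring S \<Longrightarrow> x \<in> S \<Longrightarrow> x ^ k \<in> S"
  by (induction k) (auto intro: subringD)

text \<open>The monic relation rewrites \<open>y ^ d\<close>, so the combinations of lower powers
  are closed under multiplication by \<open>y\<close>, hence under all products.\<close>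

lemma subring_adjoin:
  fixes y :: "'a::comm_ring_1"
  assumes S: "subring S" and d: "d \<ge> 1" and g: "\<And>j. g j \<in> S" "y ^ d = (\<Sum>j<d. g j * y ^ j)"
  defines "T \<equiv> {(\<Sum>j<d. c j * y ^ j) | c. \<forall>j. c j \<in> S}"
  shows "subring T" "S \<subseteq> T" "y \<in> T"
proof -
  note SD = subringD[OF S]
  have T_I: "(\<Sum>j<d. c j * y ^ j) \<in> T" if "\<And>j. c j \<in> S" for c using that by (auto simp: T_def)
  show ST: "S \<subseteq> T"
  proof
    fix s assume "s \<in> S"
    then have "(\<Sum>j<d. (if j = 0 then s else 0) * y ^ j) \<in> T" using SD by (intro T_I) auto
    also have "(\<Sum>j<d. (if j = 0 then s else 0) * y ^ j) = (\<Sum>j<d. if j = 0 then s else 0)"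
      by (intro sum.cong refl) auto
    also have "\<dots> = s" using d by (simp add: sum.delta)
    finally show "s \<in> T" .
  qed
  have add: "p + q \<in> T" if "p \<in> T" "q \<in> T" for p q
  proof -
    from that obtain c e where "p = (\<Sum>j<d. c j * y ^ j)" "q = (\<Sum>j<d. e j * y ^ j)" "\<And>j. c j \<in> S" "\<And>j. e j \<in> S"
      by (auto simp: T_def)
    then show ?thesis using T_I[of "\<lambda>j. c j + e j"] SD by (simp add: ring_distribs sum.distrib)
  qed
  have scale: "s * p \<in> T" if "p \<in> T" "s \<in> S" for p s
  proof -
    from that obtain c where "p = (\<Sum>j<d. c j * y ^ j)" "\<And>j. c j \<in> S" by (auto simp: T_def)
    then show ?thesis using T_I[of "\<lambda>j. s * c j"] SD that by (simp add: sum_distrib_left mult.assoc)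
  qed
  have sum: "sum f A \<in> T" if "\<And>i. i \<in> A \<Longrightarrow> f i \<in> T" for f :: "nat \<Rightarrow> 'a" and A
    using that by (induction A rule: infinite_finite_induct) (auto intro: add subsetD[OF ST] SD)
  have yT: "y ^ j \<in> T" if "j \<le> d" for j
  proof (cases "j = d")
    case True
    then show ?thesis using g T_I[of g] by simp
  next
    case False
    then have "(\<Sum>i<d. (if i = j then 1 else 0) * y ^ i) = y ^ j" using that by (simp add: if_distrib[of "\<lambda>x. x * _"] cong: if_cong)
    then show ?thesis using T_I[of "\<lambda>i. if i = j then 1 else 0"] SD by simp
  qed
  have ymult: "y * p \<in> T" if "p \<in> T" for p
  proof -
    from that obtain c where c: "p = (\<Sum>j<d. c j * y ^ j)" "\<And>j. c j \<in> S" by (auto simp: T_def)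
    have "y * p = (\<Sum>j<d. c j * y ^ Suc j)" by (simp add: c sum_distrib_left mult_ac)
    also have "\<dots> \<in> T" by (intro sum scale yT) (use c in auto)
    finally show ?thesis .
  qed
  have powmult: "y ^ j * p \<in> T" if "p \<in> T" for p j
    using that by (induction j) (auto simp: mult.assoc intro: ymult)
  have mult: "p * q \<in> T" if "p \<in> T" "q \<in> T" for p q
  proof -
    from that obtain c where c: "p = (\<Sum>j<d. c j * y ^ j)" "\<And>j. c j \<in> S" by (auto simp: T_def)
    have "p * q = (\<Sum>j<d. c j * (y ^ j * q))" unfolding c(1) sum_distrib_right mult.assoc ..
    also have "\<dots> \<in> T" by (intro sum scale powmult) (use c that in auto)
    finally show ?thesis .
  qed
  show "subring T"
    unfolding subring_def using add mult scale[of _ "-1"] ST SD by auto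
  show "y \<in> T" using ymult[of 1] ST SD by auto
qed

lemma subring_sym_polys: "subring (sym_polys N)"
  by (simp add: subring_def sym_add sym_mult sym_uminus)

text \<open>The next variable is a root of the product of \<open>t - x_j\<close> over the remaining
  variables, which is monic of degree \<open>N - k\<close> with coefficients in
  \<open>artin N k\<close>. The statement on \<open>esym\<close> is carried along for this
  reason.\<close>

lemma artin_props:
  assumes "k \<le> N"
  shows "subring (artin N k) \<and> sym_polys N \<subseteq> artin N k \<and> (\<forall>i\<in>{1..k}. var i \<in> artin N k) \<and>
    (\<forall>i. esym {k+1..N} i \<in> artin N k)"
  using assms
proof (induction k)
  case 0
  have "esym {1..N} i \<in> sym_polys N" for i
    using sym_elem_sym[of N "int i"] by (simp add: elem_sym_esym)
  then show ?case by (simp add: subring_sym_polys)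
next
  case (Suc k)
  then have k: "k < N" and IH: "subring (artin N k)" "sym_polys N \<subseteq> artin N k"
    "\<And>i. i \<in> {1..k} \<Longrightarrow> var i \<in> artin N k" "\<And>i. esym {k+1..N} i \<in> artin N k" by auto
  define d where "d = N - k"
  let ?y = "var (Suc k) :: xpoly"
  let ?g = "\<lambda>j. - ((-1) ^ (d - j) * esym {k+1..N} (d - j))"
  have d: "d \<ge> 1" "card {k+1..N} = d" using k by (auto simp: d_def)
  have "0 = (\<Prod>j\<in>{k+1..N}. ?y - var j)"
    by (rule prod_zero[symmetric]) (use k in auto)
  also have "\<dots> = (\<Sum>i\<le>d. (-1) ^ i * esym {k+1..N} i * ?y ^ (d - i))"
    by (simp only: prod_esym_rev[OF rhom_ident finite_atLeastAtMost] d(2))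
  also have "\<dots> = (\<Sum>j\<le>d. (-1) ^ (d - j) * esym {k+1..N} (d - j) * ?y ^ j)"
    by (rule sum.reindex_bij_witness[of _ "\<lambda>j. d - j" "\<lambda>j. d - j"]) auto
  also have "\<dots> = ?y ^ d - (\<Sum>j<d. ?g j * ?y ^ j)"
    by (simp add: sum_negf flip: lessThan_Suc_atMost)
  finally have rel: "?y ^ d = (\<Sum>j<d. ?g j * ?y ^ j)" by simp
  have g: "?g j \<in> artin N k" for j
    by (intro subringD[OF IH(1)] subring_power[OF IH(1)] IH)
  have eq: "artin N (Suc k) = {(\<Sum>j<d. c j * ?y ^ j) | c. \<forall>j. c j \<in> artin N k}"
    by (simp add: d_def)
  note adj = subring_adjoin[OF IH(1) d(1) g rel, folded eq]
  have "esym {Suc k + 1..N} i \<in> artin N (Suc k)" for i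
  proof (induction i)
    case 0
    then show ?case using subringD(2)[OF adj(1)] by (simp del: artin.simps)
  next
    case (Suc i)
    \<comment> \<open>The insertion formula, solved for the symmetric functions of one variable
      less.\<close>
    have "{k+1..N} = insert (Suc k) {Suc k + 1..N}" using k by auto
    then have "esym {Suc k + 1..N} (Suc i) = esym {k+1..N} (Suc i) - ?y * esym {Suc k + 1..N} i"
      using esym_insert[of "{Suc k + 1..N}" "Suc k" i] by simp
    also have "\<dots> \<in> artin N (Suc k)"
      by (intro subringD(5,6)[OF adj(1)] Suc adj(3) subsetD[OF adj(2) IH(4)])
    finally show ?case .
  qed
  moreover have "var i \<in> artin N (Suc k)" if "i \<in> {1..Suc k}" for i
    using that adj(3) IH(3) adj(2) by (cases "i = Suc k") (auto simp del: artin.simps)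
  ultimately show ?case using adj IH(2) by (auto simp del: artin.simps)
qed

lemma artin_complete:
  assumes "vars_in {1..N} p"
  shows "p \<in> artin N N"
proof -
  note A = artin_props[of N N, simplified]
  have "Poly_Mapping.single m c \<in> artin N N" if "Poly_Mapping.keys m \<subseteq> {1..N}" for m c
    unfolding single_eq_mono mono_def
    by (intro subringD(5) subring_prod subring_power) (use A that sym_const[of c N] in auto)
  then have "(\<Sum>m\<in>Poly_Mapping.keys p. Poly_Mapping.single m (Poly_Mapping.lookup p m)) \<in> artin N N"
    by (intro subring_sum) (use A assms in \<open>auto simp: vars_in_def\<close>)
  then show ?thesis by (simp flip: poly_mapping_sum_single)
qed

lemma artin_rspan:
  assumes "k \<le> N" "p \<in> artin N k"
  shows "p \<in> rspan N {(\<Prod>i=1..k. var i ^ a i) | a. \<forall>i\<in>{1..k}. a i \<le> N - i}"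
  using assms
proof (induction k arbitrary: p)
  case 0
  then have "p * 1 + 0 \<in> rspan N {1}" by (intro rspan.intros) auto
  then show ?case by simp
next
  case (Suc k)
  let ?M = "\<lambda>k. {(\<Prod>i=1..k. var i ^ a i) | a. \<forall>i\<in>{1..k}. a i \<le> N - i} :: xpoly set"
  from Suc.prems obtain c where c: "p = (\<Sum>j<N - k. c j * var (Suc k) ^ j)" "\<And>j. c j \<in> artin N k" by auto
  show ?case unfolding c(1)
  proof (rule rspan_sum)
    fix j assume j: "j \<in> {..<N - k}"
    have "c j \<in> rspan N (?M k)" using Suc c by simp
    then show "c j * var (Suc k) ^ j \<in> rspan N (?M (Suc k))"
    proof (rule rspan_linear_image[where \<phi> = "\<lambda>p. p * var (Suc k) ^ j"])
      fix b assume "b \<in> ?M k"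
      then obtain a where a: "b = (\<Prod>i=1..k. var i ^ a i)" "\<forall>i\<in>{1..k}. a i \<le> N - i" by auto
      have "b * var (Suc k) ^ j = (\<Prod>i=1..Suc k. var i ^ (a(Suc k := j)) i)"
        using a(1) by simp
      moreover have "\<forall>i\<in>{1..Suc k}. (a(Suc k := j)) i \<le> N - i" using a(2) j by auto
      ultimately have "b * var (Suc k) ^ j \<in> ?M (Suc k)" by blast
      then show "b * var (Suc k) ^ j \<in> rspan N (?M (Suc k))" by (rule rspan_base)
    qed (simp_all add: algebra_simps)
  qed
qed

subsection \<open>Antisymmetrised monomials\<close>

lemma rename_monomial:
  assumes "\<tau> permutes S" "finite S"
  shows "rename \<tau> (\<Prod>i\<in>S. var i ^ a (\<tau> i)) = (\<Prod>i\<in>S. var i ^ a i :: 'a::comm_ring_1 mpoly)"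
proof -
  have "rename \<tau> (\<Prod>i\<in>S. var i ^ a (\<tau> i)) = (\<Prod>i\<in>S. var (\<tau> i) ^ a (\<tau> i) :: 'a mpoly)" by (simp add: rename_simps)
  also have "\<dots> = (\<Prod>i\<in>S. var i ^ a i)"
    using prod.permute[OF assms(1), of "\<lambda>i. var i ^ a i :: 'a mpoly"] by (simp add: o_def)
  finally show ?thesis .
qed

lemma alt_monomial_permute:
  assumes "\<tau> permutes S" "finite S"
  shows "alt S (\<Prod>i\<in>S. var i ^ a (\<tau> i)) = of_int (sign \<tau>) * alt S (\<Prod>i\<in>S. var i ^ a i :: 'a::comm_ring_1 mpoly)"
proof -
  have "alt S (\<Prod>i\<in>S. var i ^ a i) = of_int (sign \<tau>) * alt S (\<Prod>i\<in>S. var i ^ a (\<tau> i) :: 'a mpoly)"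
    using alt_rename[OF assms(2,1), of "\<Prod>i\<in>S. var i ^ a (\<tau> i) :: 'a mpoly"]
    by (simp only: rename_monomial[OF assms])
  then show ?thesis by (simp flip: mult.assoc of_int_mult)
qed

text \<open>Swapping two variables with equal exponents fixes the monomial and negates its
  antisymmetrisation.\<close>

lemma alt_monomial_not_inj:
  assumes "finite S" "\<not> inj_on a S"
  shows "alt S (\<Prod>i\<in>S. var i ^ a i) = (0 :: xpoly)"
proof -
  obtain i j where ij: "i \<in> S" "j \<in> S" "i \<noteq> j" "a i = a j" using assms(2) by (auto simp: inj_on_def)
  let ?t = "transpose i j"
  have "a (?t k) = a k" for k using ij by (auto simp: transpose_def)
  then have "alt S (\<Prod>i\<in>S. var i ^ a i) = - alt S (\<Prod>i\<in>S. var i ^ a i :: xpoly)"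
    using alt_monomial_permute[OF permutes_swap_id[OF ij(1,2)] assms(1), of a, where 'a = complex] ij(3)
    by (simp add: sign_swap_id)
  then have "2 * alt S (\<Prod>i\<in>S. var i ^ a i :: xpoly) = 0" by (simp only: mult_2 eq_neg_iff_add_eq_0)
  then show ?thesis by simp
qed

definition enum :: "nat set \<Rightarrow> nat \<Rightarrow> nat" where
  "enum A i = sorted_list_of_set A ! (i - 1)"

lemma bij_betw_enum:
  assumes "finite A"
  shows "bij_betw (enum A) {1..card A} A"
proof -
  have "bij_betw ((!) (sorted_list_of_set A)) {..<card A} A"
    using assms by (intro bij_betw_nth) auto
  moreover have "bij_betw (\<lambda>i. i - 1) {1..card A} {..<card A}"
    by (rule bij_betw_byWitness[of _ Suc]) auto
  ultimately show ?thesis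
    using bij_betw_trans unfolding enum_def[abs_def] by (fastforce simp: o_def)
qed

text \<open>The alternant with exponents \<open>A\<close>, that is, a Vandermonde determinant times
  a Schur polynomial; the increasing enumeration fixes the sign.\<close>

definition schur_alt :: "nat \<Rightarrow> nat set \<Rightarrow> xpoly" where
  "schur_alt l A = alt {1..l} (\<Prod>i=1..l. var i ^ enum A i)"

lemma alt_monomial_schur:
  assumes "inj_on a {1..l}"
  obtains c where "alt {1..l} (\<Prod>i=1..l. var i ^ a i) = of_int c * schur_alt l (a ` {1..l})"
proof -
  let ?A = "a ` {1..l}" and ?S = "{1..l}"
  have card: "card ?A = l" using assms by (simp add: card_image)
  have en: "bij_betw (enum ?A) ?S ?A" using bij_betw_enum[of ?A] card by simp
  have ba: "bij_betw a ?S ?A" using assms by (simp add: bij_betw_def)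
  define \<tau> where "\<tau> i = (if i \<in> ?S then inv_into ?S (enum ?A) (a i) else i)" for i
  have "bij_betw (inv_into ?S (enum ?A) \<circ> a) ?S ?S"
    using bij_betw_trans[OF ba bij_betw_inv_into[OF en]] .
  then have "bij_betw \<tau> ?S ?S"
    by (rule bij_betw_cong[THEN iffD1, rotated]) (auto simp: \<tau>_def)
  then have \<tau>: "\<tau> permutes ?S" by (rule bij_imp_permutes) (auto simp: \<tau>_def)
  have "enum ?A (\<tau> i) = a i" if "i \<in> ?S" for i
    using that f_inv_into_f[of "a i" "enum ?A" ?S] en by (auto simp: \<tau>_def bij_betw_def)
  then have "(\<Prod>i=1..l. var i ^ a i) = (\<Prod>i=1..l. var i ^ enum ?A (\<tau> i) :: xpoly)"
    by (intro prod.cong) auto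
  then have "alt ?S (\<Prod>i=1..l. var i ^ a i) = of_int (sign \<tau>) * schur_alt l ?A"
    using alt_monomial_permute[OF \<tau>, of "enum ?A", where 'a = complex] by (simp add: schur_alt_def)
  then show thesis by (rule that)
qed

lemma xhom_schur_alt:
  assumes "finite A" "card A = l"
  shows "xhom (int (\<Sum>A)) (schur_alt l A)"
proof -
  have "xhom (\<Sum>i=1..l. int (enum A i) * 1) (\<Prod>i=1..l. var i ^ enum A i :: xpoly)"
    by (intro xhom_prod xhom_power xhom_var)
  moreover have "(\<Sum>i=1..l. int (enum A i) * 1) = int (\<Sum>A)"
    using sum.reindex_bij_betw[OF bij_betw_enum[OF assms(1)], of int] assms(2) by simp
  ultimately show ?thesis unfolding schur_alt_def by (simp add: xhom_alt)
qed

text \<open>A polynomial that is antisymmetric in the first \<open>l\<close> and symmetric in the last variables, by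
  Artin's basis and multiplication with the Vandermonde determinant of the last variables.\<close>

lemma antisym_sym_rspan:
  assumes vars: "vars_in {1..N} G" and l: "l \<le> N"
    and anti: "\<And>\<tau>. \<tau> permutes {1..l} \<Longrightarrow> rename \<tau> G = of_int (sign \<tau>) * G"
    and sym: "\<And>\<tau>. \<tau> permutes {l+1..N} \<Longrightarrow> rename \<tau> G = G"
  shows "G \<in> rspan N (schur_alt l ` {A. A \<subseteq> {..<N} \<and> card A = l})"
proof -
  let ?S1 = "{1..l}" and ?S2 = "{l+1..N}"
  let ?D = "\<Prod>i\<in>?S2. var i ^ (N - i) :: xpoly"
  define V where "V = alt ?S2 ?D"
  let ?M = "{(\<Prod>i=1..l. var i ^ a i) | a. \<forall>i\<in>{1..l}. a i < N} :: xpoly set"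
  have union: "{1..N} = ?S1 \<union> ?S2" "?S1 \<inter> ?S2 = {}" using l by auto
  have sym_inv: "rename \<tau> r = r" if "r \<in> sym_polys N" "\<tau> permutes S" "S \<subseteq> {1..N}" for r \<tau> S
    using that(1) permutes_subset[OF that(2,3)] by (auto simp: sym_polys_iff)
  have V_nz: "V \<noteq> 0"
  proof
    \<comment> \<open>The coefficient of \<open>m\<close> in \<open>V\<close> is 1: the exponents
      \<open>N - i\<close> on the last block are pairwise distinct, so only the identity fixes
      them.\<close>
    assume V0: "V = 0"
    define m where "m = (\<Sum>i\<in>?S2. Poly_Mapping.single i (N - i))"
    have lookup_m: "Poly_Mapping.lookup m i = (if i \<in> ?S2 then N - i else 0)" for i
      by (simp add: m_def lookup_sum lookup_single when_def)
    have D: "?D = Poly_Mapping.single m 1"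
      unfolding mono_var[symmetric] m_def mono_sum by simp
    have "rename_exp \<sigma> m = m \<longleftrightarrow> \<sigma> = id" if \<sigma>: "\<sigma> permutes ?S2" for \<sigma>
    proof
      assume eq: "rename_exp \<sigma> m = m"
      show "\<sigma> = id"
      proof (rule ext)
        fix i
        show "\<sigma> i = id i"
        proof (cases "i \<in> ?S2")
          case True
          have "Poly_Mapping.lookup m (\<sigma> i) = Poly_Mapping.lookup m i"
            using lookup_rename_exp[OF permutes_inj[OF \<sigma>], of m i] eq by simp
          then show ?thesis using True permutes_in_image[OF \<sigma>, of i] by (auto simp: lookup_m)
        qed (use permutes_not_in[OF \<sigma>] in auto)
      qed
    next
      assume "\<sigma> = id"
      then show "rename_exp \<sigma> m = m" by (simp add: rename_exp_def flip: poly_mapping_sum_single)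
    qed
    then have "(\<Sum>\<sigma> | \<sigma> permutes ?S2. of_int (sign \<sigma>) * (if rename_exp \<sigma> m = m then 1 else 0)) =
        (\<Sum>\<sigma> | \<sigma> permutes ?S2. if \<sigma> = id then 1 else (0::complex))"
      by (intro sum.cong refl) auto
    also have "\<dots> = 1" by (simp add: finite_permutations permutes_id)
    also have "(\<Sum>\<sigma> | \<sigma> permutes ?S2. of_int (sign \<sigma>) * (if rename_exp \<sigma> m = m then 1 else (0::complex))) =
        Poly_Mapping.lookup V m"
      unfolding V_def alt_def D rename_single lookup_sum
    proof (intro sum.cong refl)
      fix \<sigma> :: "nat \<Rightarrow> nat"
      have "of_int (sign \<sigma>) = (const (of_int (sign \<sigma>)) :: xpoly)" by (simp only: const_simps)
      then show "of_int (sign \<sigma>) * (if rename_exp \<sigma> m = m then 1 else (0::complex)) =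
        Poly_Mapping.lookup (of_int (sign \<sigma>) * Poly_Mapping.single (rename_exp \<sigma> m) 1) m"
        by (simp only: lookup_const_mult lookup_single) (simp add: when_def)
    qed
    finally show False using V0 by simp
  qed
  have fact_const: "of_nat k = (const (of_nat k) :: xpoly)" for k by (simp only: const_simps)
  have vV: "vars_in {1..N} V"
    unfolding V_def alt_def
    by (intro vars_in_sum vars_in_mult vars_in_of_int vars_in_rename[of "?S2"] vars_in_prod vars_in_power)
      (auto simp: permutes_image)
  \<comment> \<open>\<open>G * V\<close> is antisymmetric in the last variables and so agrees with
    its antisymmetrisation up to a factorial; it suffices to antisymmetrise Artin's
    monomials.\<close>
  have "G * V \<in> rspan N {(\<Prod>i=1..N. var i ^ a i) | a. \<forall>i\<in>{1..N}. a i \<le> N - i}"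
    by (rule artin_rspan[OF order_refl artin_complete[OF vars_in_mult[OF vars vV]]])
  then have "alt ?S2 (G * V) \<in> rspan N ((\<lambda>b. b * V) ` ?M)"
  proof (rule rspan_linear_image)
    fix b :: xpoly assume "b \<in> {(\<Prod>i=1..N. var i ^ a i) | a. \<forall>i\<in>{1..N}. a i \<le> N - i}"
    then obtain a where a: "b = (\<Prod>i=1..N. var i ^ a i)" "\<forall>i\<in>{1..N}. a i \<le> N - i" by auto
    have "b = (\<Prod>i=1..l. var i ^ a i) * (\<Prod>i\<in>?S2. var i ^ a i)"
      unfolding a(1) union(1) by (rule prod.union_disjoint) (use union in auto)
    then have alt: "alt ?S2 b = (\<Prod>i=1..l. var i ^ a i) * alt ?S2 (\<Prod>i\<in>?S2. var i ^ a i)"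
    proof (simp only:, intro alt_mult_invariant)
      fix \<sigma> assume \<sigma>: "\<sigma> permutes ?S2"
      have "\<sigma> i = i" if "i \<in> {1..l}" for i by (rule permutes_not_in[OF \<sigma>]) (use that in auto)
      then show "rename \<sigma> (\<Prod>i=1..l. var i ^ a i) = (\<Prod>i=1..l. var i ^ a i :: xpoly)"
        by (simp add: rename_simps cong: prod.cong_simp)
    qed
    show "alt ?S2 b \<in> rspan N ((\<lambda>b. b * V) ` ?M)"
    proof (cases "inj_on a ?S2")
      case False
      then show ?thesis unfolding alt by (subst alt_monomial_not_inj) (auto simp: rspan.zero)
    next
      case True
      \<comment> \<open>Injective exponents with \<open>a i \<le> N - i\<close> are forced: at
        \<open>N - d\<close> the bound is \<open>d\<close>, and all smaller values are taken at
        higher indices. Each surviving monomial thus contributes the factor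
        \<open>V\<close>.\<close>
      have ad: "a (N - d) = d" if "N - d \<in> ?S2" "d < N" for d
        using that
      proof (induction d rule: less_induct)
        case (less d)
        have "N - d \<in> {1..N}" "N - (N - d) = d" using less.prems by auto
        then have le: "a (N - d) \<le> d" using a(2) by fastforce
        have "a (N - d) \<noteq> e" if "e < d" for e
        proof
          assume "a (N - d) = e"
          moreover have "a (N - e) = e" "N - e \<in> ?S2" using less that by auto
          ultimately have "N - d = N - e" using True less.prems by (auto dest: inj_onD)
          then show False using that less.prems by auto
        qed
        with le show ?case by (metis nat_less_le)
      qed
      have "a i = N - i" if "i \<in> ?S2" for i
        using ad[of "N - i"] that by auto
      then have "(\<Prod>i\<in>?S2. var i ^ a i) = ?D" by (intro prod.cong) auto
      then have "alt ?S2 b = (\<Prod>i=1..l. var i ^ a i) * V" by (simp only: alt V_def)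
      moreover have "(\<Prod>i=1..l. var i ^ a i) \<in> ?M" 
      proof -
        have "a i < N" if "i \<in> {1..l}" for i using a(2)[rule_format, of i] that l by auto
        then show ?thesis by blast
      qed
      ultimately show ?thesis by (auto intro!: rspan_base)
    qed
  next
    fix r p assume "r \<in> sym_polys N"
    then show "alt ?S2 (r * p) = r * alt ?S2 p"
      by (intro alt_mult_invariant sym_inv) auto
  qed (rule alt_add)
  also have "alt ?S2 (G * V) = of_nat (fact (card ?S2)) * (G * V)"
  proof (rule alt_antisym)
    fix \<sigma> assume \<sigma>: "\<sigma> permutes ?S2"
    then have "rename \<sigma> V = of_int (sign \<sigma>) * V" unfolding V_def by (intro rename_alt) auto
    then show "rename \<sigma> (G * V) = of_int (sign \<sigma>) * (G * V)" using sym[OF \<sigma>] by (simp add: rename_simps)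
  qed simp
  finally have "G * V \<in> rspan N ((\<lambda>b. b * V) ` ?M)"
    unfolding fact_const by (rule rspan_const_cancel) simp
  note GV = this
  have "\<exists>q. q \<in> rspan N ?M \<and> p = q * V" if "p \<in> rspan N ((\<lambda>b. b * V) ` ?M)" for p
    using that
  proof (induction rule: rspan.induct)
    case zero
    then show ?case by (auto intro!: exI[of _ 0] rspan.zero)
  next
    case (step r b p)
    then obtain q c where q: "q \<in> rspan N ?M" "p = q * V" "b = c * V" "c \<in> ?M" by blast
    have "r * c + q \<in> rspan N ?M" by (rule rspan.step[OF step(1) q(4,1)])
    moreover have "r * b + p = (r * c + q) * V" by (simp add: q algebra_simps)
    ultimately show ?case by blast
  qed
  from this[OF GV] obtain q where q: "q \<in> rspan N ?M" "G * V = q * V" by blast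
  from q(2) V_nz have "G = q" by (simp only: mult_cancel_right) simp
  with q(1) have G: "G \<in> rspan N ?M" by (simp only:)
  let ?B = "schur_alt l ` {A. A \<subseteq> {..<N} \<and> card A = l}"
  \<comment> \<open>After division by \<open>V\<close> only monomials in the first variables are
    left; antisymmetrising them gives alternants.\<close>
  have "alt ?S1 G \<in> rspan N ?B"
  proof (rule rspan_linear_image[OF G])
    fix b assume "b \<in> ?M"
    then obtain a where a: "b = (\<Prod>i=1..l. var i ^ a i)" "\<forall>i\<in>{1..l}. a i < N" by auto
    show "alt ?S1 b \<in> rspan N ?B"
    proof (cases "inj_on a ?S1")
      case False
      then show ?thesis unfolding a(1) by (subst alt_monomial_not_inj) (auto simp: rspan.zero)
    next
      case True
      then obtain c where "alt ?S1 b = of_int c * schur_alt l (a ` ?S1)"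
        unfolding a(1) by (rule alt_monomial_schur)
      moreover have "a ` ?S1 \<in> {A. A \<subseteq> {..<N} \<and> card A = l}" using True a(2) by (auto simp: card_image)
      ultimately show ?thesis
        by (simp only:) (intro rspan_mult rspan_base imageI sym_of_int)
    qed
  next
    fix r p assume "r \<in> sym_polys N"
    then show "alt ?S1 (r * p) = r * alt ?S1 p"
      using l by (intro alt_mult_invariant sym_inv) auto
  qed (rule alt_add)
  also have "alt ?S1 G = of_nat (fact (card ?S1)) * G"
    by (rule alt_antisym) (use anti in auto)
  finally show ?thesis
    unfolding fact_const by (rule rspan_const_cancel) simp
qed

definition schur_family :: "nat \<Rightarrow> nat \<Rightarrow> nat set \<Rightarrow> xpoly" where
  "schur_family N l A = edge_prod N l * schur_alt l A"

theorem inverted_rspan: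
  assumes "P \<in> U n l" "n \<ge> 1" "l \<le> 2 * n + 1"
  shows "inverted n l P \<in> rspan (2 * n + 1) (schur_family (2 * n + 1) l ` {A. A \<subseteq> {..<2 * n + 1} \<and> card A = l})"
proof -
  from inverted_factor[OF assms] obtain G where G: "inverted n l P = edge_prod (2 * n + 1) l * G" "vars_in {1..2*n+1} G"
    "\<And>\<tau>. \<tau> permutes {1..l} \<Longrightarrow> rename \<tau> G = of_int (sign \<tau>) * G"
    "\<And>\<tau>. \<tau> permutes {l+1..2*n+1} \<Longrightarrow> rename \<tau> G = G" by blast
  have "G \<in> rspan (2 * n + 1) (schur_alt l ` {A. A \<subseteq> {..<2 * n + 1} \<and> card A = l})"
    by (rule antisym_sym_rspan[OF G(2) assms(3) G(3,4)])
  then show ?thesis unfolding G(1)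
  proof (rule rspan_linear_image)
    fix b assume "b \<in> schur_alt l ` {A. A \<subseteq> {..<2 * n + 1} \<and> card A = l}"
    then obtain A where A: "b = schur_alt l A" "A \<in> {A. A \<subseteq> {..<2 * n + 1} \<and> card A = l}" by blast
    have "schur_family (2 * n + 1) l A \<in> rspan (2 * n + 1) (schur_family (2 * n + 1) l ` {A. A \<subseteq> {..<2 * n + 1} \<and> card A = l})"
      by (intro rspan_base imageI A)
    then show "edge_prod (2 * n + 1) l * b \<in> rspan (2 * n + 1) (schur_family (2 * n + 1) l ` {A. A \<subseteq> {..<2 * n + 1} \<and> card A = l})"
      by (simp only: schur_family_def A(1))
  qed (simp_all add: algebra_simps)
qed

text \<open>All pairs in \<open>{1..N}\<close> minus those that avoid \<open>{1..l}\<close>.\<close>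

lemma card_edges:
  assumes "l \<le> N"
  shows "card (edges N l) = l * (N - l) + (l choose 2)"
proof -
  have "{e. e \<subseteq> {1..N} \<and> card e = 2} = edges N l \<union> {e. e \<subseteq> {l+1..N} \<and> card e = 2}"
  proof -
    have "{1..N} = {1..l} \<union> {l+1..N}" using assms by auto
    then show ?thesis unfolding edges_def by blast
  qed
  moreover have "edges N l \<inter> {e. e \<subseteq> {l+1..N} \<and> card e = 2} = {}"
    by (auto simp: edges_def)
  ultimately have "card {e. e \<subseteq> {1..N} \<and> card e = 2} = card (edges N l) + card {e. e \<subseteq> {l+1..N} \<and> card e = 2}"
    using finite_edges by (simp add: card_Un_disjoint)
  then have "N choose 2 = card (edges N l) + (N - l choose 2)"
    using n_subsets[of "{1..N}" 2] n_subsets[of "{l+1..N}" 2] by simp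
  moreover have "N choose 2 = l * (N - l) + (l choose 2) + (N - l choose 2)"
    using assms
  proof (induction N rule: dec_induct)
    case (step N)
    then show ?case by (simp add: Suc_diff_le choose_two eval_nat_numeral)
  qed simp
  ultimately show ?thesis by simp
qed

lemma xhom_schur_family:
  assumes "A \<subseteq> {..<N}" "card A = l" "l \<le> N"
  shows "xhom (int (l * (N - l) + (l choose 2) + \<Sum>A)) (schur_family N l A)"
proof -
  have "xhom 1 (\<Sum>i\<in>e. var i :: xpoly)" for e :: "nat set" by (rule xhom_sum) simp
  then have "xhom (\<Sum>e\<in>edges N l. 1) (edge_prod N l)"
    unfolding edge_prod_def by (rule xhom_prod)
  moreover have "xhom (int (\<Sum>A)) (schur_alt l A)"
    by (rule xhom_schur_alt) (use assms in \<open>auto intro: finite_subset\<close>)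
  ultimately have "xhom ((\<Sum>e\<in>edges N l. 1) + int (\<Sum>A)) (schur_family N l A)"
    unfolding schur_family_def by (rule xhom_mult)
  then show ?thesis using card_edges[OF assms(3)] by simp
qed

section \<open>Interpolation\<close>

lemma lagrange_polys:
  fixes t :: "'i \<Rightarrow> 'a::field"
  assumes "finite S" "inj_on t S"
  obtains L where "\<And>i. i \<in> S \<Longrightarrow> degree (L i) < card S"
    "\<And>i j. i \<in> S \<Longrightarrow> j \<in> S \<Longrightarrow> poly (L i) (t j) = (if i = j then 1 else 0)"
proof
  define L where "L i = (\<Prod>j\<in>S - {i}. smult (inverse (t i - t j)) [:- t j, 1:])" for i
  fix i assume i: "i \<in> S"
  have deg: "degree (smult c [:- u, 1:]) \<le> 1" for c u :: 'a
    by (rule order_trans[OF degree_smult_le]) simp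
  have "degree (L i) \<le> sum (degree \<circ> (\<lambda>j. smult (inverse (t i - t j)) [:- t j, 1:])) (S - {i})"
    unfolding L_def by (rule degree_prod_sum_le) (use assms in auto)
  also have "\<dots> \<le> (\<Sum>j\<in>S - {i}. 1)"
    unfolding o_def by (intro sum_mono deg)
  also have "\<dots> < card S" using card_Diff1_less[OF assms(1) i] by simp
  finally show "degree (L i) < card S" .
  fix j assume j: "j \<in> S"
  have "poly (L i) (t j) = (\<Prod>k\<in>S - {i}. inverse (t i - t k) * (t j - t k))"
    by (simp add: L_def poly_prod algebra_simps)
  also have "\<dots> = (if i = j then 1 else 0)"
  proof (cases "i = j")
    case True
    then have "inverse (t i - t k) * (t j - t k) = 1" if "k \<in> S - {i}" for k
      using that i assms(2) by (auto simp: inj_on_eq_iff)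
    with True show ?thesis by simp
  next
    case False
    then show ?thesis using assms(1) j by (simp add: prod_zero_iff) blast
  qed
  finally show "poly (L i) (t j) = (if i = j then 1 else 0)" .
qed

text \<open>\<open>L e i\<close> is the coefficient of index \<open>e\<close> in the
  \<open>i\<close>-th Lagrange polynomial: interpolation reproduces the power of exponent
  \<open>k \<le> d\<close>, and coefficients are compared.\<close>

lemma inverse_vandermonde:
  fixes t :: "nat \<Rightarrow> 'a::field"
  assumes "inj_on t {..d}"
  obtains L where "\<And>e k. e \<le> d \<Longrightarrow> k \<le> d \<Longrightarrow> (\<Sum>i\<le>d. L e i * t i ^ k) = (if k = e then 1 else 0)"
proof -
  obtain P where P: "\<And>i. i \<in> {..d} \<Longrightarrow> degree (P i) < card {..d}"
    "\<And>i j. i \<in> {..d} \<Longrightarrow> j \<in> {..d} \<Longrightarrow> poly (P i) (t j) = (if i = j then 1 else 0)"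
    using lagrange_polys[OF finite_atMost assms] by blast
  show thesis
  proof (rule that[of "\<lambda>e i. coeff (P i) e"])
    fix e k assume ek: "e \<le> d" "k \<le> d"
    have "(\<Sum>i\<le>d. smult (t i ^ k) (P i)) = monom 1 k"
    proof (rule poly_eqI_degree[of "t ` {..d}"])
      fix x assume "x \<in> t ` {..d}"
      then obtain j where j: "x = t j" "j \<in> {..d}" by auto
      have "poly (\<Sum>i\<le>d. smult (t i ^ k) (P i)) x = (\<Sum>i\<le>d. if i = j then t i ^ k else 0)"
        unfolding poly_sum poly_smult by (intro sum.cong refl) (use P j in auto)
      also have "\<dots> = poly (monom 1 k) x" using j by (simp add: poly_monom)
      finally show "poly (\<Sum>i\<le>d. smult (t i ^ k) (P i)) x = poly (monom 1 k) x" .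
    next
      have "degree (\<Sum>i\<le>d. smult (t i ^ k) (P i)) \<le> d"
        by (rule degree_sum_le) (use P in \<open>auto intro!: order_trans[OF degree_smult_le] simp: less_Suc_eq_le\<close>)
      then show "degree (\<Sum>i\<le>d. smult (t i ^ k) (P i)) < card (t ` {..d})"
        using card_image[OF assms] by simp
      show "degree (monom (1::'a) k) < card (t ` {..d})"
        using card_image[OF assms] ek by (simp add: degree_monom_eq)
    qed
    from arg_cong[OF this, of "\<lambda>p. coeff p e"] show "(\<Sum>i\<le>d. coeff (P i) e * t i ^ k) = (if k = e then 1 else 0)"
      by (simp add: coeff_sum mult.commute)
  qed
qed

text \<open>On the grid, the tensor product of the functionals from
  \<open>inverse_vandermonde\<close> extracts a single coefficient.\<close>

lemma grid_zero:
  assumes P: "vars_in {1..l} P" "deg_le d P" and t: "inj_on t {..d}"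
    and zero: "\<And>s. s \<in> {1..l} \<rightarrow>\<^sub>E {..d} \<Longrightarrow> eval_Xx (\<lambda>a. t (s a)) x P = 0"
  shows "ev x (Poly_Mapping.lookup P m) = 0"
proof (cases "m \<in> Poly_Mapping.keys P")
  case True
  from inverse_vandermonde[OF t] obtain L where
    L: "\<And>e k. e \<le> d \<Longrightarrow> k \<le> d \<Longrightarrow> (\<Sum>i\<le>d. L e i * t i ^ k) = (if k = e then 1 else 0)" by blast
  let ?c = "\<lambda>m. ev x (Poly_Mapping.lookup P m)" and ?lk = "\<lambda>m a. Poly_Mapping.lookup m a"
  have eval: "eval_Xx (\<lambda>a. t (s a)) x P = (\<Sum>m'\<in>Poly_Mapping.keys P. ?c m' * (\<Prod>a=1..l. t (s a) ^ ?lk m' a))" for s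
    unfolding eval_Xx_def eval_with_def mono_def[symmetric]
    by (intro sum.cong refl arg_cong2[where f = "(*)"] mono_superset) (use P in \<open>auto simp: vars_in_def\<close>)
  have "0 = (\<Sum>s\<in>{1..l} \<rightarrow>\<^sub>E {..d}. (\<Prod>a=1..l. L (?lk m a) (s a)) * eval_Xx (\<lambda>a. t (s a)) x P)"
    by (simp add: zero)
  also have "\<dots> = (\<Sum>s\<in>{1..l} \<rightarrow>\<^sub>E {..d}. \<Sum>m'\<in>Poly_Mapping.keys P. ?c m' * (\<Prod>a=1..l. L (?lk m a) (s a) * t (s a) ^ ?lk m' a))"
    unfolding eval by (simp add: sum_distrib_left prod.distrib mult_ac)
  also have "\<dots> = (\<Sum>m'\<in>Poly_Mapping.keys P. ?c m' * (\<Sum>s\<in>{1..l} \<rightarrow>\<^sub>E {..d}. \<Prod>a=1..l. L (?lk m a) (s a) * t (s a) ^ ?lk m' a))"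
    by (subst sum.swap) (simp add: sum_distrib_left)
  also have "\<dots> = (\<Sum>m'\<in>Poly_Mapping.keys P. ?c m' * (\<Prod>a=1..l. \<Sum>i\<le>d. L (?lk m a) i * t i ^ ?lk m' a))"
    by (subst prod_sum_PiE) auto
  also have "\<dots> = (\<Sum>m'\<in>Poly_Mapping.keys P. if m' = m then ?c m' else 0)"
  proof (intro sum.cong refl)
    fix m' assume m': "m' \<in> Poly_Mapping.keys P"
    have "(\<Prod>a=1..l. \<Sum>i\<le>d. L (?lk m a) i * t i ^ ?lk m' a) = (\<Prod>a=1..l. if ?lk m' a = ?lk m a then 1 else 0)"
      by (intro prod.cong refl L) (use P True m' in \<open>auto simp: deg_le_def\<close>)
    also have "\<dots> = (if m' = m then 1 else 0)"
    proof (cases "m' = m")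
      case False
      then obtain a where a: "?lk m' a \<noteq> ?lk m a" by (metis poly_mapping_eqI)
      then have "a \<in> Poly_Mapping.keys m' \<union> Poly_Mapping.keys m" by (auto simp: in_keys_iff)
      then have "a \<in> {1..l}" using P True m' unfolding vars_in_def by blast
      then have "(\<Prod>a=1..l. if ?lk m' a = ?lk m a then 1 else 0 :: complex) = 0"
        by (intro prod_zero) (use a in auto)
      with False show ?thesis by simp
    qed simp
    finally show "?c m' * (\<Prod>a=1..l. \<Sum>i\<le>d. L (?lk m a) i * t i ^ ?lk m' a) = (if m' = m then ?c m' else 0)" by simp
  qed
  also have "\<dots> = ?c m" using True by simp
  finally show ?thesis by simp
qed (simp add: in_keys_iff ev_simps)

lemma inj_on_extends_permutes:
  assumes "inj_on s A" "s ` A \<subseteq> S" "A \<subseteq> S" "finite S"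
  obtains \<sigma> where "\<sigma> permutes S" "\<And>a. a \<in> A \<Longrightarrow> \<sigma> a = s a"
proof -
  have "card (S - A) = card (S - s ` A)"
    using assms finite_subset[OF assms(3,4)] by (simp add: card_Diff_subset card_image)
  then obtain g where g: "bij_betw g (S - A) (S - s ` A)"
    using finite_same_card_bij assms(4) by blast
  define \<sigma> where "\<sigma> i = (if i \<in> A then s i else if i \<in> S then g i else i)" for i
  have "bij_betw \<sigma> A (s ` A)"
    using assms(1) by (rule bij_betw_cong[THEN iffD1, rotated, OF inj_on_imp_bij_betw]) (simp add: \<sigma>_def)
  moreover have "bij_betw \<sigma> (S - A) (S - s ` A)"
    by (rule bij_betw_cong[THEN iffD1, rotated, OF g]) (simp add: \<sigma>_def)
  ultimately have "bij_betw \<sigma> (A \<union> (S - A)) (s ` A \<union> (S - s ` A))"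
    by (rule bij_betw_combine) auto
  then have "bij_betw \<sigma> S S" using assms by (simp add: Un_absorb1)
  then have "\<sigma> permutes S" by (rule bij_imp_permutes) (use assms in \<open>auto simp: \<sigma>_def\<close>)
  then show thesis by (rule that) (simp add: \<sigma>_def)
qed

text \<open>The grid consists of the \<open>2 * n + 1\<close> values \<open>-1/x_i\<close>, with the
  same \<open>x\<close> as in the coefficients. At distinct grid points the value of
  \<open>P\<close> is, up to a nonzero factor, a value of \<open>inverted\<close>, after a
  permutation of the \<open>x_i\<close>; at repeated ones antisymmetry makes it zero. If
  \<open>l > 2 * n + 1\<close>, every choice repeats a point, which is why the premise on
  \<open>inverted\<close> is restricted to the other case.\<close>

lemma inverted_eq_0D:
  assumes P: "P \<in> ext_power n l" and 0: "l \<le> 2 * n + 1 \<Longrightarrow> inverted n l P = 0"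
  shows "P = 0"
proof -
  note PD = ext_powerD[OF P]
  have "Poly_Mapping.lookup P m = 0" for m
  proof (rule xpoly_eqI)
    fix x assume x: "generic x"
    define t where "t i = - inverse (x (Suc i))" for i
    have "ev x (Poly_Mapping.lookup P m) = 0"
    proof (rule grid_zero[OF PD(1,2)])
      show "inj_on t {..2 * n}" by (auto simp: inj_on_def t_def generic_eq[OF x])
      fix s assume s: "s \<in> {1..l} \<rightarrow>\<^sub>E {..2 * n}"
      show "eval_Xx (\<lambda>a. t (s a)) x P = 0"
      proof (cases "inj_on s {1..l}")
        case True
        let ?N = "2 * n + 1"
        have inj: "inj_on (\<lambda>a. Suc (s a)) {1..l}" using True unfolding inj_on_def by blast
        have im: "(\<lambda>a. Suc (s a)) ` {1..l} \<subseteq> {1..?N}" using s by (auto simp: PiE_def Pi_def)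
        have l: "l \<le> ?N" using card_inj_on_le[OF inj im] by simp
        obtain \<sigma> where \<sigma>: "\<sigma> permutes {1..?N}" "\<And>a. a \<in> {1..l} \<Longrightarrow> \<sigma> a = Suc (s a)"
          by (rule inj_on_extends_permutes[OF inj im]) (use l in auto)
        have "eval_Xx (\<lambda>a. - inverse (x (\<sigma> a))) (\<lambda>i. x (\<sigma> i)) P = 0"
          using ev_inverted[OF PD(1,2), of "\<lambda>i. x (\<sigma> i)"] 0[OF l] generic_nz[OF x] by (simp add: ev_simps)
        then have "eval_Xx (\<lambda>a. - inverse (x (\<sigma> a))) x P = 0"
          by (simp only: eval_Xx_permute_coeffs[OF PD(3) \<sigma>(1)])
        also have "eval_Xx (\<lambda>a. - inverse (x (\<sigma> a))) x P = eval_Xx (\<lambda>a. t (s a)) x P"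
          unfolding eval_Xx_def by (rule eval_with_cong_vars[OF PD(1)]) (simp add: \<sigma>(2) t_def)
        finally show ?thesis .
      next
        case False
        then obtain i j where ij: "i \<in> {1..l}" "j \<in> {1..l}" "i \<noteq> j" "s i = s j" by (auto simp: inj_on_def)
        have "(\<lambda>a. t (s (transpose i j a))) = (\<lambda>a. t (s a))" using ij by (auto simp: transpose_def)
        then show ?thesis
          using eval_Xx_permute_X[OF P permutes_swap_id[OF ij(1,2)], of "\<lambda>a. t (s a)" x] ij(3)
          by (simp add: sign_swap_id)
      qed
    qed
    then show "ev x (Poly_Mapping.lookup P m) = ev x 0" by (simp add: ev_simps)
  qed
  then show ?thesis by (intro poly_mapping_eqI) simp
qed

section \<open>Specialisation at the roots of unity\<close>

text \<open>At the roots of unity \<open>\<Prod> (1 + x\<^sub>j X) = 1 + X\<^sup>2\<^sup>n\<^sup>+\<^sup>1\<close>, and all \<open>v\<^sub>i\<close> and \<open>w\<^sub>i\<close> become monomials.\<close>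

lemma special_point:
  assumes "odd N"
  obtains p where "\<And>k. ev p (elem_sym N k) = (if k = 0 \<or> k = int N then 1 else 0)"
proof -
  \<comment> \<open>Its roots serve as the \<open>x_j\<close>. The signs in Vieta's formula give
    \<open>(-1) ^ N * e_N = -1\<close>, so \<open>N\<close> odd makes
    \<open>e_N = 1\<close>.\<close>
  define q :: "complex poly" where "q = monom 1 N - 1"
  have N: "N > 0" using assms by (auto intro: Nat.gr0I)
  have cq: "coeff q k = (if k = N then 1 else if k = 0 then -1 else 0)" for k
    using N by (auto simp: q_def)
  have q0: "q \<noteq> 0" using cq[of N] by auto
  have "degree q = N"
    by (rule antisym) (use cq in \<open>auto intro!: degree_le le_degree\<close>)
  obtain A where A: "size A = N" "q = smult (lead_coeff q) (\<Prod>x\<in>#A. [:-x, 1:])"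
    using alg_closed_imp_factorization[OF q0] \<open>degree q = N\<close> by auto
  obtain xs where xs: "mset xs = A" using ex_mset by blast
  have len: "length xs = N" using A(1) xs by auto
  define p where "p j = xs ! (j - 1)" for j
  have "q = (\<Prod>x\<in>#A. [:-x, 1:])" using A(2) \<open>degree q = N\<close> cq by simp
  also have "\<dots> = (\<Prod>x\<leftarrow>xs. [:-x, 1:])" 
    unfolding xs[symmetric] by (simp flip: prod_mset_prod_list)
  also have "\<dots> = (\<Prod>i=0..<N. [:- (xs ! i), 1:])" by (simp add: prod.list_conv_set_nth len)
  also have "\<dots> = (\<Prod>j=1..N. [:- p j, 1:])"
    by (rule prod.reindex_bij_witness[of _ "\<lambda>j. j - 1" Suc]) (auto simp: p_def)
  finally have q1: "q = (\<Prod>j=1..N. [:- p j, 1:])" .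
  have h: "rhom (\<lambda>r. [:ev p r:])" by (simp add: rhom_def ev_simps one_pCons)
  have q2: "q = (\<Sum>k\<le>N. (-1) ^ k * [:ev p (esym {1..N} k):] * [:0, 1:] ^ (N - k))"
    using prod_esym_rev[OF h, of "{1..N}" "[:0, 1:]"] q1 by simp
  have tm: "(-1) ^ k * [:c:] * [:0, 1:] ^ (N - k) = monom ((-1) ^ k * c) (N - k)" for k and c :: complex
  proof -
    have "((-1) ^ k :: complex poly) = [:(-1) ^ k:]"
      by (induction k) (simp_all add: one_pCons)
    then show ?thesis by (simp add: monom_altdef mult.commute)
  qed
  have e: "(-1) ^ k * ev p (esym {1..N} k) = coeff q (N - k)" if "k \<le> N" for k
  proof -
    have "coeff q (N - k) = (\<Sum>i\<le>N. if i = k then (-1) ^ i * ev p (esym {1..N} i) else 0)"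
      unfolding q2 tm coeff_sum by (intro sum.cong refl) (use that in auto)
    then show ?thesis using that by simp
  qed
  have "ev p (elem_sym N k) = (if k = 0 \<or> k = int N then 1 else 0)" for k
  proof (cases "k < 0 \<or> k > int N")
    case True
    then show ?thesis by (auto simp: elem_sym_eq_0 ev_simps) (auto simp: elem_sym_def ev_simps)
  next
    case False
    then have "nat k \<le> N" by auto
    from e[OF this] have *: "(-1) ^ nat k * ev p (elem_sym N k) = coeff q (N - nat k)"
      using False by (simp add: elem_sym_esym)
    show ?thesis
    proof (cases "k = 0")
      case True
      then show ?thesis using * N by (simp add: cq)
    next
      case k0: False
      then have "N - nat k \<noteq> N" using N False by auto
      then have "(-1) ^ nat k * ev p (elem_sym N k) = (if k = int N then -1 else 0)"
        using * False by (auto simp: cq)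
      then show ?thesis using assms False k0 by (auto split: if_splits)
    qed
  qed
  then show thesis by (rule that)
qed

text \<open>A tensor product of linear functionals, one for each \<open>X_a\<close>. Arbitrary
  values on the powers are allowed, so that evaluation and extraction of a coefficient can be
  mixed.\<close>

definition slots :: "(nat \<Rightarrow> complex) \<Rightarrow> nat \<Rightarrow> (nat \<Rightarrow> nat \<Rightarrow> complex) \<Rightarrow> Xpoly \<Rightarrow> complex" where
  "slots p l \<mu> = lin (ev p) (\<lambda>m. \<Prod>a=1..l. \<mu> a (Poly_Mapping.lookup m a))"

lemma slots_add: "slots p l \<mu> (P + Q) = slots p l \<mu> P + slots p l \<mu> Q"
  and slots_sum: "slots p l \<mu> (sum f A) = (\<Sum>i\<in>A. slots p l \<mu> (f i))"
  and slots_const_mult: "slots p l \<mu> (const r * P) = ev p r * slots p l \<mu> P"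
  by (simp_all add: slots_def lin_add lin_sum lin_const_mult rhom_ev)

lemma slots_single: "slots p l \<mu> (Poly_Mapping.single m c) = ev p c * (\<Prod>a=1..l. \<mu> a (Poly_Mapping.lookup m a))"
  by (simp add: slots_def lin_single rhom_ev)

lemma slots_of_int_mult: "slots p l \<mu> (of_int k * P) = of_int k * slots p l \<mu> P"
  using slots_const_mult[of p l \<mu> "of_int k" P] by (simp only: const_simps ev_simps)

lemma slots_uminus: "slots p l \<mu> (- P) = - slots p l \<mu> P"
  using slots_of_int_mult[of p l \<mu> "-1" P] by simp

lemma slots_rename:
  assumes "\<sigma> permutes {1..l}"
  shows "slots p l \<mu> (rename \<sigma> P) = slots p l (\<lambda>a. \<mu> (\<sigma> a)) P"
proof -
  have *: "slots p l \<mu> (rename \<sigma> (Poly_Mapping.single m c)) = slots p l (\<lambda>a. \<mu> (\<sigma> a)) (Poly_Mapping.single m c)" for m c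
  proof -
    have "(\<Prod>a=1..l. \<mu> a (Poly_Mapping.lookup (rename_exp \<sigma> m) a)) =
        (\<Prod>a=1..l. \<mu> (\<sigma> a) (Poly_Mapping.lookup (rename_exp \<sigma> m) (\<sigma> a)))"
      using prod.permute[OF assms, of "\<lambda>a. \<mu> a (Poly_Mapping.lookup (rename_exp \<sigma> m) a)"] by (simp add: o_def)
    then show ?thesis
      by (simp add: rename_single slots_single lookup_rename_exp[OF permutes_inj[OF assms]])
  qed
  let ?s = "\<lambda>m. Poly_Mapping.single m (Poly_Mapping.lookup P m)"
  have "slots p l \<mu> (rename \<sigma> (\<Sum>m\<in>Poly_Mapping.keys P. ?s m)) = slots p l (\<lambda>a. \<mu> (\<sigma> a)) (\<Sum>m\<in>Poly_Mapping.keys P. ?s m)"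
    by (simp only: rename_simps slots_sum *)
  then show ?thesis by (simp flip: poly_mapping_sum_single)
qed

lemma slots_alt:
  "slots p l \<mu> (alt {1..l} P) = (\<Sum>\<sigma> | \<sigma> permutes {1..l}. of_int (sign \<sigma>) * slots p l (\<lambda>a. \<mu> (\<sigma> a)) P)"
  unfolding alt_def slots_sum by (intro sum.cong refl) (simp add: slots_of_int_mult slots_rename)

lemma slots_1: "slots p 0 \<mu> 1 = 1"
  using slots_single[of p 0 \<mu> 0 1] by (simp add: ev_simps)

text \<open>The two factors meet different functionals, so the value is multiplicative here although
  the single functionals are not.\<close>

lemma slots_shift_mult:
  assumes "vars_in {1..k} P" "vars_in {1..l} Q"
  shows "slots p (k + l) \<mu> (P * shift k Q) = slots p k \<mu> P * slots p l (\<lambda>a. \<mu> (k + a)) Q"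
proof -
  let ?s = "\<lambda>P m. Poly_Mapping.single m (Poly_Mapping.lookup P m)"
  let ?c = "\<lambda>P m. ev p (Poly_Mapping.lookup P m)"
  have *: "(\<Prod>a=1..k + l. \<mu> a (Poly_Mapping.lookup (m + rename_exp ((+) k) m') a)) =
      (\<Prod>a=1..k. \<mu> a (Poly_Mapping.lookup m a)) * (\<Prod>a=1..l. \<mu> (k + a) (Poly_Mapping.lookup m' a))"
    if m: "m \<in> Poly_Mapping.keys P" and m': "m' \<in> Poly_Mapping.keys Q" for m m'
  proof -
    have ks: "Poly_Mapping.keys m \<subseteq> {1..k}" "Poly_Mapping.keys m' \<subseteq> {1..l}"
      using assms m m' by (auto simp: vars_in_def)
    have l1: "Poly_Mapping.lookup (rename_exp ((+) k) m') a = 0" if "a \<in> {1..k}" for a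
    proof -
      have "a \<notin> Poly_Mapping.keys (rename_exp ((+) k) m')"
        using keys_rename_exp[of "(+) k" m'] ks(2) that by fastforce
      then show ?thesis by (simp add: in_keys_iff)
    qed
    have l2: "Poly_Mapping.lookup m (k + a) = 0" if "a \<in> {1..l}" for a
    proof -
      have "k + a \<notin> Poly_Mapping.keys m" using ks(1) that by auto
      then show ?thesis by (simp add: in_keys_iff)
    qed
    have l3: "Poly_Mapping.lookup (rename_exp ((+) k) m') (k + a) = Poly_Mapping.lookup m' a" for a
      by (rule lookup_rename_exp[of _ UNIV]) auto
    let ?f = "\<lambda>a. \<mu> a (Poly_Mapping.lookup (m + rename_exp ((+) k) m') a)"
    have "(\<Prod>a=1..k + l. ?f a) = (\<Prod>a=1..k. ?f a) * (\<Prod>a=k+1..k+l. ?f a)"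
      by (rule prod.ub_add_nat) simp
    also have "(\<Prod>a=k+1..k+l. ?f a) = (\<Prod>a=1..l. ?f (k + a))"
      using prod.shift_bounds_cl_nat_ivl[of ?f 1 k l] by (simp add: add_ac)
    finally show ?thesis by (simp add: lookup_add l1 l2 l3 cong: prod.cong_simp)
  qed
  have "slots p (k + l) \<mu> ((\<Sum>m\<in>Poly_Mapping.keys P. ?s P m) * shift k (\<Sum>m\<in>Poly_Mapping.keys Q. ?s Q m)) =
      (\<Sum>m\<in>Poly_Mapping.keys P. \<Sum>m'\<in>Poly_Mapping.keys Q. (?c P m * ?c Q m') *
        (\<Prod>a=1..k + l. \<mu> a (Poly_Mapping.lookup (m + rename_exp ((+) k) m') a)))"
    unfolding shift_def by (simp only: rename_simps rename_single sum_product mult_single slots_sum slots_single ev_simps)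
  also have "\<dots> = slots p k \<mu> P * slots p l (\<lambda>a. \<mu> (k + a)) Q"
    unfolding slots_def lin_def sum_product
    by (intro sum.cong refl) (simp only: * mult_ac)
  finally show ?thesis by (simp flip: poly_mapping_sum_single)
qed

lemma slots_shift_prod_1:
  assumes "\<And>x. x \<in> set xs \<Longrightarrow> vars_in {1..1} (f x)" "\<And>x \<mu>. x \<in> set xs \<Longrightarrow> slots p 1 \<mu> (f x) = F x (\<mu> 1)"
  shows "slots p (length xs) \<mu> (shift_prod 1 (map f xs)) = (\<Prod>r<length xs. F (xs ! r) (\<mu> (r + 1)))"
  using assms
proof (induction xs arbitrary: \<mu>)
  case (Cons x xs)
  have "vars_in {1..1 * length (map f xs)} (shift_prod 1 (map f xs))"
    by (rule vars_in_shift_prod) (use Cons.prems in auto)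
  then have vars: "vars_in {1..length xs} (shift_prod 1 (map f xs))" by simp
  have "slots p (length (x # xs)) \<mu> (shift_prod 1 (map f (x # xs))) = F x (\<mu> 1) * slots p (length xs) (\<lambda>a. \<mu> (1 + a)) (shift_prod 1 (map f xs))"
    using slots_shift_mult[OF Cons.prems(1)[of x] vars] Cons.prems by simp
  also have "slots p (length xs) (\<lambda>a. \<mu> (1 + a)) (shift_prod 1 (map f xs)) = (\<Prod>r<length xs. F (xs ! r) (\<mu> (1 + (r + 1))))"
    by (rule Cons.IH) (use Cons.prems in auto)
  finally show ?case by (simp only: length_Cons prod.lessThan_Suc_shift) simp
qed (simp add: slots_1)

lemma slots_shift_prod_2:
  assumes "\<And>x. x \<in> set xs \<Longrightarrow> vars_in {1..2} (f x)" "\<And>x \<mu>. x \<in> set xs \<Longrightarrow> slots p 2 \<mu> (f x) = F x (\<mu> 1) (\<mu> 2)"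
  shows "slots p (2 * length xs) \<mu> (shift_prod 2 (map f xs)) = (\<Prod>r<length xs. F (xs ! r) (\<mu> (2 * r + 1)) (\<mu> (2 * r + 2)))"
  using assms
proof (induction xs arbitrary: \<mu>)
  case (Cons x xs)
  have "vars_in {1..2 * length (map f xs)} (shift_prod 2 (map f xs))"
    by (rule vars_in_shift_prod) (use Cons.prems in auto)
  then have vars: "vars_in {1..2 * length xs} (shift_prod 2 (map f xs))" by simp
  have "slots p (2 * length (x # xs)) \<mu> (shift_prod 2 (map f (x # xs))) = F x (\<mu> 1) (\<mu> 2) * slots p (2 * length xs) (\<lambda>a. \<mu> (2 + a)) (shift_prod 2 (map f xs))"
    using slots_shift_mult[OF Cons.prems(1)[of x] vars] Cons.prems by simp
  also have "slots p (2 * length xs) (\<lambda>a. \<mu> (2 + a)) (shift_prod 2 (map f xs)) =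
      (\<Prod>r<length xs. F (xs ! r) (\<mu> (2 + (2 * r + 1))) (\<mu> (2 + (2 * r + 2))))"
    by (rule Cons.IH) (use Cons.prems in auto)
  finally show ?case by (simp only: length_Cons prod.lessThan_Suc_shift) (simp add: numeral_2_eq_2)
qed (simp add: slots_1)

text \<open>At the special point \<open>v_i\<close> with \<open>1 \<le> i \<le> n\<close> is
  \<open>X ^ (2 * (n + 1 - i))\<close>, \<open>w_j\<close> is \<open>X ^ (2 * (n - j) + 1)\<close>,
  and \<open>zeta n k\<close> is minus a sum of products of an even and an odd power. This
  definition and the next two apply functionals, given by their values on powers, to these.\<close>

definition v_pair :: "nat \<Rightarrow> nat \<Rightarrow> (nat \<Rightarrow> complex) \<Rightarrow> complex" where
  "v_pair n i \<mu> = \<mu> (2 * (n + 1 - i))"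

definition w_pair :: "nat \<Rightarrow> nat \<Rightarrow> (nat \<Rightarrow> complex) \<Rightarrow> complex" where
  "w_pair n j \<mu> = \<mu> (2 * (n - j) + 1)"

definition zeta_pair :: "nat \<Rightarrow> nat \<Rightarrow> (nat \<Rightarrow> complex) \<Rightarrow> (nat \<Rightarrow> complex) \<Rightarrow> complex" where
  "zeta_pair n k \<mu> \<nu> = - (\<Sum>s<n + 1 - k. \<mu> (2 * (n + 1 - k - s)) * \<nu> (2 * s + 1))"

locale special_point =
  fixes n :: nat and p :: "nat \<Rightarrow> complex"
  assumes n: "n \<ge> 1"
    and e: "\<And>k. ev p (elem_sym (2 * n + 1) k) = (if k = 0 \<or> k = int (2 * n + 1) then 1 else 0)"
begin

text \<open>All \<open>elem_sym\<close> of positive even index vanish at the point, so the recursion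
  is a mere shift of \<open>s\<close>. It moves the single nonzero value, at \<open>r = 1\<close>
  and \<open>s = n + 1\<close>, along the antidiagonal.\<close>

lemma ev_Prs: "r \<ge> 1 \<Longrightarrow> s \<ge> 1 \<Longrightarrow> ev p (Prs n r s) = (if int r + s = int n + 2 then 1 else 0)"
proof (induction r arbitrary: s rule: dec_induct)
  case base
  have "(2 * s - 1 = 0 \<or> 2 * s - 1 = int (2 * n + 1)) = (int 1 + s = int n + 2)" by presburger
  moreover have "Prs n 1 s = elem_sym (2 * n + 1) (2 * s - 1)" by simp
  ultimately show ?case by (simp only: e)
next
  case (step r)
  have "\<not> (2 * s = 0 \<or> 2 * s = int (2 * n + 1))" using step.prems by presburger
  then have "ev p (elem_sym (2 * n + 1) (2 * s)) = 0" by (simp only: e if_False)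
  then show ?case using step by (simp add: Prs_Suc ev_simps)
qed

lemma slots_var_power: "slots p 1 \<mu> (const r * var 1 ^ k) = ev p r * \<mu> 1 k"
  by (simp add: slots_const_mult var_power slots_single ev_simps)

lemma slots_v:
  assumes "1 \<le> i" "i \<le> n"
  shows "slots p 1 \<mu> (v n i 1) = v_pair n i (\<mu> 1)"
proof -
  have "slots p 1 \<mu> (v n i 1) = (\<Sum>j=1..n+1. if j = n + 2 - i then \<mu> 1 (2 * (j - 1)) else 0)"
    unfolding v_pos[OF assms(1)] slots_sum slots_var_power
    by (intro sum.cong refl) (use assms ev_Prs[of i] in auto)
  also have "\<dots> = \<mu> 1 (2 * (n + 2 - i - 1))"
  proof -
    have "n + 2 - i \<in> {1..n+1}" using assms by auto
    then show ?thesis by (simp only: sum.delta finite_atLeastAtMost if_True)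
  qed
  finally show ?thesis by (simp add: v_pair_def)
qed

lemma slots_v_0: "slots p 1 \<mu> (v n 0 1) = \<mu> 1 0"
proof -
  have "slots p 1 \<mu> (v n 0 1) = (\<Sum>j=0..n. if j = 0 then \<mu> 1 (2 * j) else 0)"
    unfolding v_0 slots_sum slots_var_power by (intro sum.cong refl) (subst e, auto)
  then show ?thesis by simp
qed

lemma slots_w:
  assumes "i \<le> n"
  shows "slots p 1 \<mu> (w n i 1) = w_pair n i (\<mu> 1)"
proof -
  have "slots p 1 \<mu> (w n i 1) = (\<Sum>j=1..n+1. if j = n + 1 - i then \<mu> 1 (2 * j - 1) else 0)"
    unfolding w_def slots_sum slots_var_power
    by (intro sum.cong refl) (use assms ev_Prs[of "i + 1"] in auto)
  also have "\<dots> = \<mu> 1 (2 * (n + 1 - i) - 1)"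
  proof -
    have "n + 1 - i \<in> {1..n+1}" using assms by auto
    then show ?thesis by (simp only: sum.delta finite_atLeastAtMost if_True)
  qed
  also have "2 * (n + 1 - i) - 1 = 2 * (n - i) + 1" using assms by auto
  finally show ?thesis by (simp add: w_pair_def)
qed

text \<open>Only the coefficient with \<open>j = 0\<close> and \<open>i = M + 1\<close> survives,
  where \<open>M = n + 1 - k\<close>. There \<open>zeta_term 0 (M + 1)\<close> is an empty sum, and
  minus \<open>zeta_term M 1\<close> remains.\<close>

lemma slots_zeta:
  assumes "1 \<le> k" "k \<le> n"
  shows "slots p 2 \<mu> (zeta n k) = zeta_pair n k (\<mu> 1) (\<mu> 2)"
proof -
  define M where "M = n + 1 - k"
  have "slots p 2 \<mu> (zeta n k) = (\<Sum>j=0..n. \<Sum>i=1..n+1.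
      if j = 0 then (if i = M + 1 then slots p 2 \<mu> (zeta_term j i - zeta_term (i - 1) (j + 1)) else 0) else 0)"
    unfolding zeta_def slots_sum slots_const_mult ev_simps
  proof (intro sum.cong refl)
    fix j i assume "j \<in> {0..n}" and i: "i \<in> {1..n+1}"
    then have "int k + int i = int n + 2 \<longleftrightarrow> i = M + 1" using assms by (auto simp: M_def)
    then have "ev p (Prs n k (int i)) = (if i = M + 1 then 1 else 0)"
      using ev_Prs[of k "int i"] assms i by simp
    moreover have "(2 * int j = 0 \<or> 2 * int j = int (2 * n + 1)) = (j = 0)" by presburger
    then have "ev p (elem_sym (2 * n + 1) (2 * int j)) = (if j = 0 then 1 else 0)" by (simp only: e)
    ultimately show "ev p (elem_sym (2 * n + 1) (2 * int j)) * ev p (Prs n k (int i)) * slots p 2 \<mu> (zeta_term j i - zeta_term (i - 1) (j + 1)) =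
      (if j = 0 then (if i = M + 1 then slots p 2 \<mu> (zeta_term j i - zeta_term (i - 1) (j + 1)) else 0) else 0)"
      by simp
  qed
  also have "\<dots> = (\<Sum>j=0..n. if j = 0 then slots p 2 \<mu> (zeta_term j (M + 1) - zeta_term M (j + 1)) else 0)"
  proof (intro sum.cong refl)
    fix j assume "j \<in> {0..n}"
    have "M + 1 \<in> {1..n+1}" using assms by (auto simp: M_def)
    then show "(\<Sum>i=1..n+1. if j = 0 then (if i = M + 1 then slots p 2 \<mu> (zeta_term j i - zeta_term (i - 1) (j + 1)) else 0) else 0) =
        (if j = 0 then slots p 2 \<mu> (zeta_term j (M + 1) - zeta_term M (j + 1)) else 0)"
      by (cases "j = 0") (simp_all only: sum.delta finite_atLeastAtMost if_True if_False sum.neutral_const refl, simp)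
  qed
  also have "\<dots> = slots p 2 \<mu> (zeta_term 0 (M + 1) - zeta_term M 1)" by simp
  also have "zeta_term 0 (M + 1) = (0 :: Xpoly)" by (simp add: zeta_term_def)
  also have "slots p 2 \<mu> (0 - zeta_term M 1) = - slots p 2 \<mu> (zeta_term M 1)" by (simp add: slots_uminus)
  also have "slots p 2 \<mu> (zeta_term M 1) = (\<Sum>s<M. \<mu> 1 (2 * (M - s)) * \<mu> 2 (2 * s + 1))"
    unfolding zeta_term_def slots_sum
  proof (intro sum.cong)
    fix s :: nat
    have "{1..2::nat} = {1, 2}" by auto
    moreover have "2 * (1 + s) - 1 = 2 * s + (1::nat)" by simp
    ultimately show "slots p 2 \<mu> (var 1 ^ (2 * (M - s)) * var 2 ^ (2 * (1 + s) - 1)) = \<mu> 1 (2 * (M - s)) * \<mu> 2 (2 * s + 1)"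
      unfolding var_power mult_single by (simp add: slots_single lookup_add lookup_single ev_simps)
  qed simp
  finally show ?thesis by (simp add: zeta_pair_def M_def)
qed

end

text \<open>The value of the functionals \<open>\<nu>\<close> at the product whose antisymmetrisation is \<open>v\<^sub>I \<and> w\<^sub>J \<and> \<xi>\<^sub>K\<close>,
  preceded by \<open>v\<^sub>0\<close> if \<open>\<epsilon> = 1\<close>.\<close>

definition bas_value :: "nat \<Rightarrow> nat \<Rightarrow> index \<Rightarrow> (nat \<Rightarrow> nat \<Rightarrow> complex) \<Rightarrow> complex" where
  "bas_value n \<epsilon> = (\<lambda>(I, J, K) \<nu>. (\<Prod>r<\<epsilon>. \<nu> (r + 1) 0) *
     (\<Prod>r<length I. v_pair n (I ! r) (\<nu> (\<epsilon> + r + 1))) *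
     (\<Prod>r<length J. w_pair n (J ! r) (\<nu> (\<epsilon> + length I + r + 1))) *
     (\<Prod>r<length K. zeta_pair n (K ! r) (\<nu> (\<epsilon> + length I + length J + 2 * r + 1))
        (\<nu> (\<epsilon> + length I + length J + 2 * r + 2))))"

definition bas_sum :: "index + index \<Rightarrow> nat \<times> index" where
  "bas_sum = case_sum (Pair 1) (Pair 0)"

context special_point
begin

lemma slots_pre_bas_minus:
  assumes t: "t \<in> bas_minus_index n m"
  shows "slots p m \<mu> (pre_bas_minus n t) = bas_value n 0 t \<mu>"
proof -
  obtain I J K where IJK: "t = (I, J, K)" by (cases t)
  have I: "\<And>i. i \<in> set I \<Longrightarrow> 1 \<le> i \<and> i \<le> n" and J: "\<And>i. i \<in> set J \<Longrightarrow> 1 \<le> i \<and> i \<le> n"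
    and m: "m = length I + (length J + 2 * length K)"
    using t by (auto simp: IJK bas_minus_index_def)
  have K: "1 \<le> k \<and> k \<le> n" if "k \<in> set K" for k
  proof -
    from that have "length K \<ge> 1" by (cases K) auto
    moreover have "k + length I + length K \<le> n + 1" "1 \<le> k" using t that by (auto simp: IJK bas_minus_index_def)
    ultimately show ?thesis by auto
  qed
  have vI: "vars_in {1..length I} (shift_prod 1 (map (\<lambda>i. v n i 1) I))"
    using vars_in_shift_prod[of "map (\<lambda>i. v n i 1) I" 1] vars_in_v[of 1] by auto
  have vJ: "vars_in {1..length J} (shift_prod 1 (map (\<lambda>i. w n i 1) J))"
    using vars_in_shift_prod[of "map (\<lambda>i. w n i 1) J" 1] vars_in_w[of 1] by auto
  have vK: "vars_in {1..2 * length K} (shift_prod 2 (map (zeta n) K))"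
    using vars_in_shift_prod[of "map (zeta n) K" 2] vars_in_zeta by auto
  have sI: "slots p (length I) \<mu> (shift_prod 1 (map (\<lambda>i. v n i 1) I)) = (\<Prod>r<length I. v_pair n (I ! r) (\<mu> (r + 1)))" for \<mu>
    by (rule slots_shift_prod_1) (use I slots_v vars_in_v[of 1] in auto)
  have sJ: "slots p (length J) \<mu> (shift_prod 1 (map (\<lambda>i. w n i 1) J)) = (\<Prod>r<length J. w_pair n (J ! r) (\<mu> (r + 1)))" for \<mu>
    by (rule slots_shift_prod_1) (use J slots_w vars_in_w[of 1] in auto)
  have sK: "slots p (2 * length K) \<mu> (shift_prod 2 (map (zeta n) K)) = (\<Prod>r<length K. zeta_pair n (K ! r) (\<mu> (2 * r + 1)) (\<mu> (2 * r + 2)))" for \<mu>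
    by (rule slots_shift_prod_2) (use K slots_zeta vars_in_zeta in auto)
  show ?thesis
    unfolding m IJK pre_bas_minus.simps slots_shift_mult[OF vI vars_in_shift_mult[OF vJ vK]]
      slots_shift_mult[OF vJ vK] sI sJ sK bas_value_def
    by (simp add: mult_ac add_ac)
qed

lemma slots_pre_bas:
  assumes t: "t \<in> bas_index n l" and l: "l \<ge> 1"
  shows "slots p l \<mu> (pre_bas n t) = bas_value n (fst (bas_sum t)) (snd (bas_sum t)) \<mu>"
proof (cases t)
  case (Inl u)
  then have u: "u \<in> bas_minus_index n (l - 1)" using t by (auto simp: bas_index_def)
  have "slots p (1 + (l - 1)) \<mu> (v n 0 1 * shift 1 (pre_bas_minus n u)) =
      \<mu> 1 0 * bas_value n 0 u (\<lambda>a. \<mu> (1 + a))"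
    by (simp only: slots_shift_mult[OF pre_U_vars[OF pre_U_v[OF n]] pre_U_vars[OF bas_minus_props(2)[OF n u]]]
        slots_v_0 slots_pre_bas_minus[OF u])
  then show ?thesis using l
    by (cases u) (simp add: Inl pre_bas_def bas_sum_def bas_value_def add_ac mult_ac)
next
  case (Inr u)
  then have u: "u \<in> bas_minus_index n l" using t by (auto simp: bas_index_def)
  then show ?thesis using slots_pre_bas_minus[OF u] by (simp add: Inr pre_bas_def bas_sum_def)
qed

end

section \<open>Linear independence at the roots of unity\<close>

text \<open>The kind of a position in \<open>v\<^sub>0\<^sup>\<epsilon> \<and> v\<^sub>I \<and> w\<^sub>J \<and> \<xi>\<^sub>K\<close> with \<open>|I| = a\<close> and \<open>|J| = b\<close>:
  0 for \<open>v\<^sub>0\<close>, 1 for the \<open>v\<^sub>i\<close> and the even variable of a \<open>\<xi>\<^sub>k\<close>,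
  2 for the \<open>w\<^sub>j\<close> and the odd variable of a \<open>\<xi>\<^sub>k\<close>.\<close>

definition kind :: "nat \<Rightarrow> nat \<Rightarrow> nat \<Rightarrow> nat \<Rightarrow> nat" where
  "kind \<epsilon> a b i = (if i \<le> \<epsilon> then 0 else if i \<le> \<epsilon> + a then 1 else if i \<le> \<epsilon> + a + b then 2
     else if odd (i - (\<epsilon> + a + b)) then 1 else 2)"

lemma position_cases:
  fixes i :: nat
  assumes "i \<in> {1..\<epsilon> + a + b + 2 * c}"
  obtains (O) r where "r < \<epsilon>" "i = r + 1" | (V) r where "r < a" "i = \<epsilon> + r + 1"
    | (W) r where "r < b" "i = \<epsilon> + a + r + 1" | (X) r where "r < c" "i = \<epsilon> + a + b + 2 * r + 1"
    | (Y) r where "r < c" "i = \<epsilon> + a + b + 2 * r + 2"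
proof -
  consider "i \<le> \<epsilon>" | "\<epsilon> < i" "i \<le> \<epsilon> + a" | "\<epsilon> + a < i" "i \<le> \<epsilon> + a + b" | "\<epsilon> + a + b < i" by atomize_elim arith
  then show thesis
  proof cases
    case 1
    then show ?thesis using O[of "i - 1"] assms by auto
  next
    case 2
    then show ?thesis using V[of "i - \<epsilon> - 1"] by auto
  next
    case 3
    then show ?thesis using W[of "i - \<epsilon> - a - 1"] by auto
  next
    case 4
    define d where "d = i - (\<epsilon> + a + b) - 1"
    have d: "i = \<epsilon> + a + b + d + 1" "d < 2 * c" using 4 assms by (auto simp: d_def)
    show ?thesis
    proof (cases "even d")
      case True
      then obtain r where "d = 2 * r" by (elim evenE)
      then show ?thesis using X[of r] d by auto
    next
      case False
      then obtain r where "d = 2 * r + 1" by (elim oddE)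
      then show ?thesis using Y[of r] d by auto
    qed
  qed
qed

lemma kind_simps [simp]:
  "r < \<epsilon> \<Longrightarrow> kind \<epsilon> a b (r + 1) = 0"
  "r < a \<Longrightarrow> kind \<epsilon> a b (\<epsilon> + r + 1) = 1"
  "r < b \<Longrightarrow> kind \<epsilon> a b (\<epsilon> + a + r + 1) = 2"
  "kind \<epsilon> a b (\<epsilon> + a + b + 2 * r + 1) = 1"
  "kind \<epsilon> a b (\<epsilon> + a + b + 2 * r + 2) = 2"
  by (auto simp: kind_def)

lemma card_kind_0: "card {i \<in> {1..\<epsilon> + a + b + 2 * c}. kind \<epsilon> a b i = 0} = \<epsilon>"
proof -
  have "{i \<in> {1..\<epsilon> + a + b + 2 * c}. kind \<epsilon> a b i = 0} = {1..\<epsilon>}"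
    by (auto simp: kind_def split: if_splits)
  then show ?thesis by simp
qed

lemma card_kind_1: "card {i \<in> {1..\<epsilon> + a + b + 2 * c}. kind \<epsilon> a b i = 1} = a + c"
proof -
  have "{i \<in> {1..\<epsilon> + a + b + 2 * c}. kind \<epsilon> a b i = 1} =
      (\<lambda>r. \<epsilon> + r + 1) ` {..<a} \<union> (\<lambda>r. \<epsilon> + a + b + 2 * r + 1) ` {..<c}" (is "?L = ?A \<union> ?B")
  proof (intro set_eqI iffI)
    fix i assume "i \<in> ?L"
    then have i: "i \<in> {1..\<epsilon> + a + b + 2 * c}" "kind \<epsilon> a b i = 1" by auto
    from i(1) show "i \<in> ?A \<union> ?B"
      by (cases rule: position_cases) (use i(2) kind_simps in auto)
  next
    fix i assume "i \<in> ?A \<union> ?B"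
    then show "i \<in> ?L" using kind_simps(2)[of _ a \<epsilon> b] kind_simps(4)[of \<epsilon> a b] by auto
  qed
  moreover have "?A \<inter> ?B = {}" by auto
  moreover have "card ?A = a" "card ?B = c" by (auto simp: card_image inj_on_def)
  ultimately show ?thesis by (simp add: card_Un_disjoint)
qed

text \<open>\<sigma> moves the pairs \<open>i, Suc i\<close> as blocks. It is the product of its
  action on \<open>X\<close> and a copy of this action on the successors, and the two signs are
  equal.\<close>

lemma sign_parallel:
  assumes \<sigma>: "\<sigma> permutes S" and X: "finite X" "X \<inter> Suc ` X = {}" "\<sigma> ` X = X"
    and par: "\<And>i. i \<in> X \<Longrightarrow> \<sigma> (Suc i) = Suc (\<sigma> i)" and fx: "\<And>i. i \<notin> X \<union> Suc ` X \<Longrightarrow> \<sigma> i = i"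
  shows "sign \<sigma> = 1"
proof -
  define \<alpha> where "\<alpha> i = (if i \<in> X then \<sigma> i else i)" for i
  have "bij_betw \<sigma> X X" using X(3) permutes_inj[OF \<sigma>] by (auto simp: bij_betw_def inj_on_def)
  then have "bij_betw \<alpha> X X" by (rule bij_betw_cong[THEN iffD1, rotated]) (simp add: \<alpha>_def)
  then have \<alpha>: "\<alpha> permutes X" by (rule bij_imp_permutes) (simp add: \<alpha>_def)
  define \<beta> where "\<beta> = map_permutation X Suc \<alpha>"
  have bij: "bij_betw Suc X (Suc ` X)" by (simp add: bij_betw_def)
  have \<beta>: "\<beta> permutes Suc ` X" unfolding \<beta>_def by (rule map_permutation_permutes[OF bij \<alpha>])
  have \<beta>_app: "\<beta> (Suc i) = Suc (\<alpha> i)" if "i \<in> X" for i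
    unfolding \<beta>_def by (rule map_permutation_apply) (use that in auto)
  have "sign \<beta> = sign \<alpha>" unfolding \<beta>_def by (rule sign_map_permutation[OF _ \<alpha> X(1)]) simp
  moreover have "\<sigma> = \<alpha> \<circ> \<beta>"
  proof
    fix i
    consider "i \<in> X" | j where "i = Suc j" "j \<in> X" | "i \<notin> X \<union> Suc ` X" by blast
    then show "\<sigma> i = (\<alpha> \<circ> \<beta>) i"
    proof cases
      case 1
      then have "\<beta> i = i" using X(2) by (intro permutes_not_in[OF \<beta>]) auto
      then show ?thesis using 1 by (simp add: \<alpha>_def)
    next
      case 2
      then have "Suc (\<sigma> j) \<notin> X" using X by blast
      then show ?thesis using 2 \<beta>_app[of j] par[of j] by (simp add: \<alpha>_def)
    next
      case 3
      then have "\<beta> i = i" by (intro permutes_not_in[OF \<beta>]) auto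
      then show ?thesis using 3 fx[of i] by (simp add: \<alpha>_def)
    qed
  qed
  moreover have "sign (\<alpha> \<circ> \<beta>) = sign \<alpha> * sign \<beta>"
    by (rule sign_compose) (use \<alpha> \<beta> X(1) in \<open>auto intro: permutes_permutation\<close>)
  ultimately show ?thesis by simp
qed

lemma distinct_lists_eq:
  assumes "sorted_wrt (<) xs" "sorted_wrt (<) ys" "length xs = length ys" "set xs \<subseteq> set ys"
  shows "xs = (ys :: nat list)"
proof -
  have d: "distinct xs" "distinct ys" "sorted xs" "sorted ys"
    using assms by (auto simp: strict_sorted_iff)
  have "set xs = set ys"
    by (rule card_subset_eq) (use assms d in \<open>auto simp: distinct_card\<close>)
  then show ?thesis using d by (metis sorted_distinct_set_unique)
qed

text \<open>The functionals that test for the indices \<open>I\<^sub>0\<close>, \<open>J\<^sub>0\<close>, \<open>K\<^sub>0\<close> with \<open>|I\<^sub>0| = a\<close>,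
  \<open>|K\<^sub>0| = c\<close>.  The \<open>v\<^sub>i\<close> are evaluated as powers of indeterminates \<open>z\<close>, and on
  \<open>w\<^sub>n, w\<^sub>n\<^sub>-\<^sub>1, \<dots>\<close> the functionals are dual to the interpolation points \<open>z\<close>.\<close>

locale test_slots =
  fixes n \<epsilon> a c l :: nat and J0 :: "nat list" and z :: "nat \<Rightarrow> complex" and L :: "nat \<Rightarrow> complex poly"
  assumes \<epsilon>: "\<epsilon> \<le> 1"
    and J0: "sorted_wrt (<) J0" "\<And>j. j \<in> set J0 \<Longrightarrow> j \<le> n"
    and l: "l = \<epsilon> + a + length J0 + 2 * c"
    and deg_L: "\<And>i. i \<in> {1..l} \<Longrightarrow> kind \<epsilon> a (length J0) i = 1 \<Longrightarrow> degree (L i) < a + c"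
    and L: "\<And>i j. i \<in> {1..l} \<Longrightarrow> j \<in> {1..l} \<Longrightarrow> kind \<epsilon> a (length J0) i = 1 \<Longrightarrow> kind \<epsilon> a (length J0) j = 1 \<Longrightarrow>
      poly (L i) (z j) = (if i = j then 1 else 0)"
begin

abbreviation "b \<equiv> length J0"
abbreviation "q \<equiv> \<epsilon> + a + b"
abbreviation "knd \<equiv> kind \<epsilon> a b"

text \<open>\<open>mu i E\<close> is the value on \<open>X_i ^ E\<close>. For \<open>v_0\<close> it
  picks the exponent 0. In the second case it is evaluation: \<open>E = 2 * (n + 1 - x)\<close>
  stands for \<open>v_x\<close> and gives \<open>z i ^ x\<close>. At the places of \<open>J0\<close>
  it picks the exponent of the prescribed \<open>w_j\<close>. At the odd variable of a pair it reads
  coefficients of \<open>L (i - 1)\<close>, the interpolation polynomial of its even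
  partner.\<close>

definition mu :: "nat \<Rightarrow> nat \<Rightarrow> complex" where
  "mu i E = (if knd i = 0 then (if E = 0 then 1 else 0)
     else if knd i = 1 then (if even E \<and> E > 0 then z i ^ (n + 1 - E div 2) else 0)
     else if i \<le> q then (if odd E \<and> E div 2 = n - J0 ! (i - (\<epsilon> + a + 1)) then 1 else 0)
     else if odd E then coeff (L (i - 1)) (E div 2) else 0)"

lemma mu_0: "mu i 0 = (if knd i = 0 then 1 else 0)"
  by (simp add: mu_def)

lemma v_pair_mu: "1 \<le> x \<Longrightarrow> x \<le> n \<Longrightarrow> v_pair n x (mu i) = (if knd i = 1 then z i ^ x else 0)"
  by (simp add: mu_def v_pair_def)

lemma w_pair_mu_kind: "w_pair n j (mu i) \<noteq> 0 \<Longrightarrow> knd i \<noteq> 0 \<and> knd i \<noteq> 1"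
  by (auto simp: mu_def w_pair_def split: if_splits)

lemma w_pair_mu_W: "r < b \<Longrightarrow> j \<le> n \<Longrightarrow> w_pair n j (mu (\<epsilon> + a + r + 1)) = (if j = J0 ! r then 1 else 0)"
  using J0(2)[of "J0 ! r"] by (auto simp: mu_def w_pair_def kind_def)

lemma w_pair_mu_Y: "w_pair n j (mu (q + 2 * r + 2)) = coeff (L (q + 2 * r + 1)) (n - j)"
  by (simp add: mu_def w_pair_def kind_def)

lemma zeta_pair_mu_kind:
  assumes "zeta_pair n k (mu i) (mu i') \<noteq> 0"
  shows "knd i = 1" "knd i' \<noteq> 0" "knd i' \<noteq> 1"
proof -
  obtain s where s: "s < n + 1 - k" "mu i (2 * (n + 1 - k - s)) * mu i' (2 * s + 1) \<noteq> 0"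
    using assms unfolding zeta_pair_def by (metis (no_types, lifting) lessThan_iff neg_equal_0_iff_equal sum.neutral)
  then have "2 * (n + 1 - k - s) > 0" "mu i (2 * (n + 1 - k - s)) \<noteq> 0" "mu i' (2 * s + 1) \<noteq> 0" by auto
  then show "knd i = 1" "knd i' \<noteq> 0" "knd i' \<noteq> 1" by (auto simp: mu_def split: if_splits)
qed

text \<open>The exponent \<open>2 * (n + 1 - k - s)\<close> is evaluated to
  \<open>z i ^ (k + s)\<close>, so the sum is \<open>z i ^ k\<close> times the value of
  \<open>L\<close> at \<open>z i\<close>. The bound on \<open>k\<close> makes the range of
  \<open>s\<close> contain all coefficients of \<open>L\<close>, whose degree is less than
  \<open>a + c\<close>.\<close>

lemma zeta_pair_mu:
  assumes i: "knd i = 1" "i \<in> {1..l}" and r: "r < c" and k: "1 \<le> k" "k + (a + c) \<le> n + 1"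
  shows "zeta_pair n k (mu i) (mu (q + 2 * r + 2)) = - (z i ^ k * (if i = q + 2 * r + 1 then 1 else 0))"
proof -
  let ?i' = "q + 2 * r + 1"
  have i': "?i' \<in> {1..l}" "knd ?i' = 1" using r by (auto simp: l kind_def)
  have "(\<Sum>s<n + 1 - k. mu i (2 * (n + 1 - k - s)) * mu (q + 2 * r + 2) (2 * s + 1)) =
      (\<Sum>s<n + 1 - k. z i ^ k * (coeff (L ?i') s * z i ^ s))"
  proof (intro sum.cong refl)
    fix s assume s: "s \<in> {..<n + 1 - k}"
    then have "n + 1 - (n + 1 - k - s) = k + s" using k by auto
    then show "mu i (2 * (n + 1 - k - s)) * mu (q + 2 * r + 2) (2 * s + 1) = z i ^ k * (coeff (L ?i') s * z i ^ s)"
      using i s by (simp add: mu_def kind_def[of _ _ _ "Suc (Suc _)"] power_add)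
  qed
  also have "\<dots> = z i ^ k * (\<Sum>s<n + 1 - k. coeff (L ?i') s * z i ^ s)" by (simp add: sum_distrib_left)
  also have "(\<Sum>s<n + 1 - k. coeff (L ?i') s * z i ^ s) = poly (L ?i') (z i)"
  proof -
    have d: "degree (L ?i') < n + 1 - k" using deg_L[OF i'] k by auto
    show ?thesis unfolding poly_altdef
      by (rule sum.mono_neutral_right) (use d in \<open>auto simp: coeff_eq_0\<close>)
  qed
  also have "\<dots> = (if i = ?i' then 1 else 0)" using L[OF i'(1) i(2) i'(2) i(1)] by auto
  finally show ?thesis by (simp add: zeta_pair_def)
qed

definition V_pos :: "nat set" where "V_pos = (\<lambda>r. \<epsilon> + r + 1) ` {..<a}"
definition X_pos :: "nat set" where "X_pos = (\<lambda>r. q + 2 * r + 1) ` {..<c}"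

text \<open>The permutations for which a nonzero value remains possible: \<open>v_0\<close> and the
  \<open>w_j\<close> stay in place, the \<open>v_i\<close> are permuted among themselves, and the
  variables of the \<open>xi_k\<close> are permuted as pairs.\<close>

definition good :: "(nat \<Rightarrow> nat) \<Rightarrow> bool" where
  "good \<sigma> \<longleftrightarrow> \<sigma> permutes {1..l} \<and> (\<forall>r<\<epsilon>. \<sigma> (r + 1) = r + 1) \<and> (\<forall>r<b. \<sigma> (\<epsilon> + a + r + 1) = \<epsilon> + a + r + 1) \<and>
     \<sigma> ` V_pos = V_pos \<and> \<sigma> ` X_pos = X_pos \<and> (\<forall>i\<in>X_pos. \<sigma> (Suc i) = Suc (\<sigma> i))"

lemma bas_value_good:
  assumes \<sigma>: "good \<sigma>" and len: "length I = a" "length K = c"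
    and I: "\<And>i. i \<in> set I \<Longrightarrow> 1 \<le> i \<and> i \<le> n" and K: "\<And>k. k \<in> set K \<Longrightarrow> 1 \<le> k \<and> k + (a + c) \<le> n + 1"
  shows "bas_value n \<epsilon> (I, J0, K) (\<lambda>i. mu (\<sigma> i)) =
    (\<Prod>r<a. z (\<sigma> (\<epsilon> + r + 1)) ^ (I ! r)) * (\<Prod>r<c. - (z (\<sigma> (q + 2 * r + 1)) ^ (K ! r)))"
proof -
  note G = \<sigma>[unfolded good_def]
  have "mu (\<sigma> (r + 1)) 0 = 1" if "r < \<epsilon>" for r using G that kind_simps(1)[OF that, of a b] by (simp add: mu_0)
  moreover have "v_pair n (I ! r) (mu (\<sigma> (\<epsilon> + r + 1))) = z (\<sigma> (\<epsilon> + r + 1)) ^ (I ! r)" if r: "r < a" for r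
  proof -
    have "\<sigma> (\<epsilon> + r + 1) \<in> V_pos" using G r by (auto simp: V_pos_def)
    then obtain r' where "r' < a" "\<sigma> (\<epsilon> + r + 1) = \<epsilon> + r' + 1" by (auto simp: V_pos_def)
    then have "knd (\<sigma> (\<epsilon> + r + 1)) = 1" by (simp only: kind_simps)
    then show ?thesis using I[of "I ! r"] r len by (simp add: v_pair_mu)
  qed
  moreover have "w_pair n (J0 ! r) (mu (\<sigma> (\<epsilon> + a + r + 1))) = 1" if "r < b" for r
  proof -
    have "\<sigma> (\<epsilon> + a + r + 1) = \<epsilon> + a + r + 1" using G that by blast
    then show ?thesis using w_pair_mu_W[OF that J0(2)[of "J0 ! r"]] that by simp
  qed
  moreover have "zeta_pair n (K ! r) (mu (\<sigma> (q + 2 * r + 1))) (mu (\<sigma> (q + 2 * r + 2))) = - (z (\<sigma> (q + 2 * r + 1)) ^ (K ! r))" if r: "r < c" for r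
  proof -
    have x: "q + 2 * r + 1 \<in> X_pos" using r by (auto simp: X_pos_def)
    then have "\<sigma> (q + 2 * r + 1) \<in> X_pos" using G by blast
    then obtain r' where r': "r' < c" "\<sigma> (q + 2 * r + 1) = q + 2 * r' + 1" by (auto simp: X_pos_def)
    have s: "\<sigma> (q + 2 * r + 2) = q + 2 * r' + 2" using G x r' by auto
    have "\<sigma> (q + 2 * r + 1) \<in> {1..l}" "knd (\<sigma> (q + 2 * r + 1)) = 1" using r' by (auto simp: l kind_def)
    then show ?thesis unfolding s using r r' K[of "K ! r"] len by (subst zeta_pair_mu) auto
  qed
  ultimately show ?thesis by (simp add: bas_value_def len)
qed

text \<open>Counting kinds determines \<epsilon> and \<open>|I| + |K|\<close>. The bound on
  \<open>J\<close> keeps every \<open>w_j\<close> at one of the places of \<open>J0\<close>, so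
  \<open>|J| \<le> b\<close>; together with \<open>|K| \<le> c\<close> all lengths agree. Then
  \<open>J\<close> and the places of its members are forced, and interpolation keeps the pairs
  together.\<close>

lemma bas_value_nonzeroD:
  assumes nz: "bas_value n \<epsilon>' (I, J, K) (\<lambda>i. mu (\<sigma> i)) \<noteq> 0" and \<sigma>: "\<sigma> permutes {1..l}"
    and l': "l = \<epsilon>' + length I + length J + 2 * length K" and cK: "length K \<le> c"
    and I: "\<And>i. i \<in> set I \<Longrightarrow> 1 \<le> i \<and> i \<le> n"
    and J: "sorted_wrt (<) J" "\<And>j. j \<in> set J \<Longrightarrow> 1 \<le> j \<and> j + length I + length K \<le> n"
    and K: "\<And>k. k \<in> set K \<Longrightarrow> 1 \<le> k \<and> k + length I + length K \<le> n + 1"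
  shows "\<epsilon>' = \<epsilon>" "length I = a" "length K = c" "J = J0" "good \<sigma>"
proof -
  let ?a = "length I" and ?b = "length J" and ?c = "length K"
  let ?q = "\<epsilon>' + ?a + ?b"
  have fO: "mu (\<sigma> (r + 1)) 0 \<noteq> 0" if "r < \<epsilon>'" for r
    using nz that by (auto simp: bas_value_def prod_zero_iff)
  have fV: "v_pair n (I ! r) (mu (\<sigma> (\<epsilon>' + r + 1))) \<noteq> 0" if "r < ?a" for r
    using nz that by (auto simp: bas_value_def prod_zero_iff)
  have fW: "w_pair n (J ! r) (mu (\<sigma> (\<epsilon>' + ?a + r + 1))) \<noteq> 0" if "r < ?b" for r
    using nz that by (auto simp: bas_value_def prod_zero_iff)
  have fX: "zeta_pair n (K ! r) (mu (\<sigma> (?q + 2 * r + 1))) (mu (\<sigma> (?q + 2 * r + 2))) \<noteq> 0" if "r < ?c" for r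
    using nz that by (auto simp: bas_value_def prod_zero_iff)
  have knd_le: "knd i = 0 \<or> knd i = 1 \<or> knd i = 2" for i by (auto simp: kind_def)
  \<comment> \<open>Each factor of the value is nonzero only at functionals of its own kind.\<close>
  have kinds: "knd (\<sigma> i) = kind \<epsilon>' ?a ?b i" if "i \<in> {1..l}" for i
    using that unfolding l'
  proof (cases rule: position_cases)
    case (O r)
    then show ?thesis using fO[of r] kind_simps(1)[of r \<epsilon>' ?a ?b] by (simp add: mu_0 split: if_splits)
  next
    case (V r)
    then have "knd (\<sigma> i) = 1" using fV[of r] I[of "I ! r"] by (auto simp: v_pair_mu split: if_splits)
    then show ?thesis using V kind_simps(2)[of r ?a \<epsilon>' ?b] by simp
  next
    case (W r)
    then have "knd (\<sigma> i) = 2" using w_pair_mu_kind[OF fW[of r]] knd_le[of "\<sigma> i"] by auto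
    then show ?thesis using W kind_simps(3)[of r ?b \<epsilon>' ?a] by simp
  next
    case (X r)
    then have "knd (\<sigma> i) = 1" using zeta_pair_mu_kind(1)[OF fX[of r]] by auto
    then show ?thesis using X kind_simps(4)[of \<epsilon>' ?a ?b r] by simp
  next
    case (Y r)
    then have "knd (\<sigma> i) = 2" using zeta_pair_mu_kind(2,3)[OF fX[of r]] knd_le[of "\<sigma> i"] by auto
    then show ?thesis using Y kind_simps(5)[of \<epsilon>' ?a ?b r] by simp
  qed
  have inj: "inj \<sigma>" using \<sigma> by (rule permutes_inj)
  have card: "card {i \<in> {1..l}. kind \<epsilon>' ?a ?b i = x} = card {i \<in> {1..l}. knd i = x}" for x
  proof -
    have "\<sigma> ` {i \<in> {1..l}. kind \<epsilon>' ?a ?b i = x} = {i \<in> {1..l}. knd i = x}"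
    proof (intro set_eqI iffI)
      fix j assume j: "j \<in> {i \<in> {1..l}. knd i = x}"
      then have "j \<in> \<sigma> ` {1..l}" using permutes_image[OF \<sigma>] by auto
      then obtain i where "j = \<sigma> i" "i \<in> {1..l}" by blast
      then show "j \<in> \<sigma> ` {i \<in> {1..l}. kind \<epsilon>' ?a ?b i = x}" using j kinds by auto
    qed (use permutes_in_image[OF \<sigma>] kinds in auto)
    then show ?thesis using card_image[OF inj_on_subset[OF inj subset_UNIV]] by metis
  qed
  show e: "\<epsilon>' = \<epsilon>"
    using card[of 0] card_kind_0[of \<epsilon>' ?a ?b ?c] card_kind_0[of \<epsilon> a b c] by (simp only: l'[symmetric] l[symmetric])
  have ac: "?a + ?c = a + c"
    using card[of 1] card_kind_1[of \<epsilon>' ?a ?b ?c] card_kind_1[of \<epsilon> a b c] by (simp only: l'[symmetric] l[symmetric])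
  have in_l: "\<epsilon>' + ?a + r + 1 \<in> {1..l}" if "r < ?b" for r using that l' by auto
  \<comment> \<open>A \<open>w_j\<close> cannot sit at the odd variable of a pair: its value there
    is the coefficient of \<open>L\<close> of index \<open>n - j\<close>, which is at least
    \<open>a + c\<close> and thus beyond the degree of \<open>L\<close>.\<close>
  have W_W: "\<exists>r'<b. \<sigma> (\<epsilon>' + ?a + r + 1) = \<epsilon> + a + r' + 1" if r: "r < ?b" for r
  proof -
    let ?i = "\<sigma> (\<epsilon>' + ?a + r + 1)"
    have "?i \<in> {1..\<epsilon> + a + b + 2 * c}" using permutes_in_image[OF \<sigma>] in_l[OF r] l by auto
    then show ?thesis
    proof (cases rule: position_cases)
      case (Y r')
      have "coeff (L (q + 2 * r' + 1)) (n - J ! r) = 0"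
      proof (rule coeff_eq_0)
        have "q + 2 * r' + 1 \<in> {1..l}" "knd (q + 2 * r' + 1) = 1" using Y by (auto simp: l kind_def)
        then have "degree (L (q + 2 * r' + 1)) < a + c" by (rule deg_L)
        also have "a + c \<le> n - J ! r" using J(2)[of "J ! r"] r ac by auto
        finally show "degree (L (q + 2 * r' + 1)) < n - J ! r" .
      qed
      then show ?thesis using fW[OF r] Y by (simp only: w_pair_mu_Y) simp
    qed (use kinds[OF in_l[OF r]] kind_simps r in auto)
  qed
  have "?b \<le> b"
  proof -
    have "(\<lambda>r. \<sigma> (\<epsilon>' + ?a + r + 1)) ` {..<?b} \<subseteq> (\<lambda>r. \<epsilon> + a + r + 1) ` {..<b}" using W_W by auto
    moreover have "inj_on (\<lambda>r. \<sigma> (\<epsilon>' + ?a + r + 1)) {..<?b}" by (rule inj_onI) (simp add: inj_eq[OF inj])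
    ultimately have "card {..<?b} \<le> card ((\<lambda>r. \<epsilon> + a + r + 1) ` {..<b})" using card_inj_on_le by blast
    also have "\<dots> \<le> b" using card_image_le[of "{..<b}"] by simp
    finally show ?thesis by simp
  qed
  \<comment> \<open>The total \<open>l\<close> and \<open>|I| + |K| = a + c\<close> give
    \<open>|J| + |K| = b + c\<close>; hence \<open>|J| \<le> b\<close> and
    \<open>|K| \<le> c\<close> are equalities.\<close>
  with ac cK l l' e have len: "?b = b" "?c = c" "?a = a" by auto
  from len show "length I = a" "length K = c" by auto
  have JJ0: "J ! r = J0 ! r'" if "r < b" "r' < b" "\<sigma> (\<epsilon> + a + r + 1) = \<epsilon> + a + r' + 1" for r r'
  proof (rule ccontr)
    assume "J ! r \<noteq> J0 ! r'"
    moreover have "J ! r \<le> n" using J(2)[of "J ! r"] that len by auto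
    ultimately have "w_pair n (J ! r) (mu (\<epsilon> + a + r' + 1)) = 0" using that by (simp only: w_pair_mu_W if_False)
    then show False using fW[of r] that len e by simp
  qed
  show J_eq: "J = J0"
  proof (rule distinct_lists_eq[OF J(1) J0(1) len(1)])
    show "set J \<subseteq> set J0"
    proof
      fix j assume "j \<in> set J"
      then obtain r where r: "r < ?b" "j = J ! r" by (auto simp: in_set_conv_nth)
      from W_W[OF r(1)] obtain r' where "r' < b" "\<sigma> (\<epsilon> + a + r + 1) = \<epsilon> + a + r' + 1" using e len by auto
      then show "j \<in> set J0" using JJ0[of r r'] r len by auto
    qed
  qed
  have dJ0: "distinct J0" using J0(1) by (simp add: strict_sorted_iff)
  have fixW: "\<sigma> (\<epsilon> + a + r + 1) = \<epsilon> + a + r + 1" if r: "r < b" for r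
  proof -
    obtain r' where r': "r' < b" "\<sigma> (\<epsilon> + a + r + 1) = \<epsilon> + a + r' + 1" using W_W[of r] r e len by auto
    then have "J0 ! r = J0 ! r'" using JJ0[of r r'] r J_eq by simp
    then show ?thesis using r' r dJ0 by (simp add: nth_eq_iff_index_eq)
  qed
  have fixO: "\<sigma> (r + 1) = r + 1" if "r < \<epsilon>" for r
  proof -
    have "mu (\<sigma> (r + 1)) 0 \<noteq> 0" using fO[of r] that e by auto
    then have "\<sigma> (r + 1) \<le> \<epsilon>" by (auto simp: mu_0 kind_def split: if_splits)
    moreover have "\<sigma> (r + 1) \<in> {1..l}" using permutes_in_image[OF \<sigma>, of "r + 1"] that l by auto
    ultimately show ?thesis using that \<epsilon> by auto
  qed
  \<comment> \<open>The places of the \<open>w_j\<close> are taken, so the odd variable of a pair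
    goes to the odd variable of a pair; interpolation then sends the even variable to its
    partner.\<close>
  have XY: "\<exists>r'<c. \<sigma> (q + 2 * r + 1) = q + 2 * r' + 1 \<and> \<sigma> (q + 2 * r + 2) = q + 2 * r' + 2" if r: "r < c" for r
  proof -
    let ?i = "\<sigma> (q + 2 * r + 2)" and ?j = "\<sigma> (q + 2 * r + 1)"
    have nz: "zeta_pair n (K ! r) (mu ?j) (mu ?i) \<noteq> 0" using fX[of r] r len e by simp
    note zk = zeta_pair_mu_kind[OF nz]
    have mem: "q + 2 * r + 1 \<in> {1..l}" "q + 2 * r + 2 \<in> {1..l}" using r l by auto
    have j: "?j \<in> {1..l}" using permutes_in_image[OF \<sigma>] mem by blast
    have "?i \<in> {1..\<epsilon> + a + b + 2 * c}" using permutes_in_image[OF \<sigma>] mem l by blast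
    then show ?thesis
    proof (cases rule: position_cases)
      case (W r')
      then have "?i = \<sigma> (\<epsilon> + a + r' + 1)" using fixW[of r'] by simp
      then have "q + 2 * r + 2 = \<epsilon> + a + r' + 1" using inj by (simp add: inj_eq)
      then show ?thesis using W by auto
    next
      case (Y r')
      have k: "1 \<le> K ! r" "K ! r + (a + c) \<le> n + 1" using K[of "K ! r"] r len by auto
      have "?j = q + 2 * r' + 1"
        using nz zeta_pair_mu[OF zk(1) j Y(1) k] unfolding Y(2) by (auto split: if_splits)
      then show ?thesis using Y by auto
    qed (use zk kind_simps in auto)
  qed
  have X_sub: "\<sigma> ` X_pos \<subseteq> X_pos" using XY by (fastforce simp: X_pos_def)
  have finX: "finite X_pos" by (simp add: X_pos_def)
  have X_eq: "\<sigma> ` X_pos = X_pos"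
    by (rule endo_inj_surj[OF finX X_sub]) (use inj in \<open>auto simp: inj_on_def\<close>)
  have V_sub: "\<sigma> ` V_pos \<subseteq> V_pos"
  proof
    fix j assume "j \<in> \<sigma> ` V_pos"
    then obtain r where r: "r < a" "j = \<sigma> (\<epsilon> + r + 1)" by (auto simp: V_pos_def)
    have mem: "\<epsilon> + r + 1 \<in> {1..l}" using r l by auto
    have k1: "knd j = 1" using kinds[OF mem] r e len kind_simps(2)[of r a \<epsilon> b] by simp
    have "j \<in> {1..\<epsilon> + a + b + 2 * c}" using permutes_in_image[OF \<sigma>] mem l r by blast
    then show "j \<in> V_pos"
    proof (cases rule: position_cases)
      case (X r')
      then have "j \<in> \<sigma> ` X_pos" using X_eq by (auto simp: X_pos_def)
      then obtain i where "i \<in> X_pos" "\<sigma> (\<epsilon> + r + 1) = \<sigma> i" using r by auto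
      then have "\<epsilon> + r + 1 \<in> X_pos" using inj by (simp add: inj_eq)
      then show ?thesis using r by (auto simp: X_pos_def)
    qed (use k1 kind_simps in \<open>auto simp: V_pos_def\<close>)
  qed
  have V_eq: "\<sigma> ` V_pos = V_pos"
    by (rule endo_inj_surj[OF _ V_sub]) (use inj in \<open>auto simp: inj_on_def V_pos_def\<close>)
  have "\<sigma> (Suc i) = Suc (\<sigma> i)" if "i \<in> X_pos" for i
    using that XY by (fastforce simp: X_pos_def)
  with fixO fixW V_eq X_eq \<sigma> show "good \<sigma>" unfolding good_def by blast
qed

end

section \<open>The index set, and the monomials in \<open>z\<close> that identify an index\<close>

lemma finite_bas_minus_index: "finite (bas_minus_index n m)"
proof (rule finite_subset)
  let ?S = "{xs. set xs \<subseteq> {..n + 1} \<and> length xs \<le> m}"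
  show "bas_minus_index n m \<subseteq> ?S \<times> ?S \<times> ?S"
    by (fastforce simp: bas_minus_index_def)
  have "finite ?S" by (rule finite_lists_length_le) simp
  then show "finite (?S \<times> ?S \<times> ?S)" by simp
qed

lemma finite_bas_index: "finite (bas_index n l)"
  by (simp add: bas_index_def finite_bas_minus_index)

lemma bas_index_sum:
  assumes "t \<in> bas_index n l" "l \<ge> 1" "bas_sum t = (\<epsilon>, I, J, K)"
  shows "\<epsilon> \<le> 1" "l = \<epsilon> + length I + length J + 2 * length K"
    "\<And>i. i \<in> set I \<Longrightarrow> 1 \<le> i \<and> i \<le> n" "sorted_wrt (<) I"
    "sorted_wrt (<) J" "\<And>j. j \<in> set J \<Longrightarrow> 1 \<le> j \<and> j + length I + length K \<le> n"
    "\<And>k. k \<in> set K \<Longrightarrow> 1 \<le> k \<and> k + length I + length K \<le> n + 1" "sorted K"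
  using assms by (auto simp: bas_index_def bas_minus_index_def bas_sum_def split: sum.splits)

lemma inj_bas_sum: "bas_sum t = bas_sum u \<Longrightarrow> t = u"
  by (auto simp: bas_sum_def split: sum.splits)

text \<open>Exponent vector of the monomial in \<open>z\<close> to which the value of
  \<open>v_I w_J xi_K\<close> reduces, up to sign, for a good permutation. Comparing monomials
  instead of numbers separates different \<open>I\<close> and \<open>K\<close>.\<close>

definition test_exp :: "nat \<Rightarrow> nat \<Rightarrow> nat list \<Rightarrow> nat list \<Rightarrow> (nat \<Rightarrow> nat) \<Rightarrow> (nat \<Rightarrow>\<^sub>0 nat)" where
  "test_exp \<epsilon> q I K \<sigma> = (\<Sum>r<length I. Poly_Mapping.single (\<sigma> (\<epsilon> + r + 1)) (I ! r)) +
     (\<Sum>r<length K. Poly_Mapping.single (\<sigma> (q + 2 * r + 1)) (K ! r))"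

lemma lookup_test_exp:
  assumes "inj \<sigma>"
  shows "Poly_Mapping.lookup (test_exp \<epsilon> q I K \<sigma>) (\<sigma> i) = Poly_Mapping.lookup (test_exp \<epsilon> q I K (\<lambda>i. i)) i"
  using assms by (simp add: test_exp_def lookup_add lookup_sum lookup_single inj_eq)

lemma lookup_test_exp_id:
  "r < length I \<Longrightarrow> \<epsilon> + length I \<le> q \<Longrightarrow> Poly_Mapping.lookup (test_exp \<epsilon> q I K (\<lambda>i. i)) (\<epsilon> + r + 1) = I ! r"
  "r < length K \<Longrightarrow> \<epsilon> + length I \<le> q \<Longrightarrow> Poly_Mapping.lookup (test_exp \<epsilon> q I K (\<lambda>i. i)) (q + 2 * r + 1) = K ! r"
proof -
  have *: "(\<Sum>r'<m. if r' = r then f r' else 0) = f r" if "r < m" for f :: "nat \<Rightarrow> nat" and r m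
    using that by simp
  show "Poly_Mapping.lookup (test_exp \<epsilon> q I K (\<lambda>i. i)) (\<epsilon> + r + 1) = I ! r" if "r < length I" "\<epsilon> + length I \<le> q"
  proof -
    have "(\<Sum>r'<length K. Poly_Mapping.lookup (Poly_Mapping.single (q + 2 * r' + 1) (K ! r')) (\<epsilon> + r + 1)) = 0"
      using that by (intro sum.neutral) (auto simp: lookup_single when_def)
    moreover have "(\<Sum>r'<length I. Poly_Mapping.lookup (Poly_Mapping.single (\<epsilon> + r' + 1) (I ! r')) (\<epsilon> + r + 1)) =
        (\<Sum>r'<length I. if r' = r then I ! r' else 0)"
      by (intro sum.cong refl) (auto simp: lookup_single when_def)
    ultimately show ?thesis using *[OF that(1)] by (simp only: test_exp_def lookup_add lookup_sum)
  qed
  show "Poly_Mapping.lookup (test_exp \<epsilon> q I K (\<lambda>i. i)) (q + 2 * r + 1) = K ! r" if "r < length K" "\<epsilon> + length I \<le> q"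
  proof -
    have "(\<Sum>r'<length I. Poly_Mapping.lookup (Poly_Mapping.single (\<epsilon> + r' + 1) (I ! r')) (q + 2 * r + 1)) = 0"
      using that by (intro sum.neutral) (auto simp: lookup_single when_def)
    moreover have "(\<Sum>r'<length K. Poly_Mapping.lookup (Poly_Mapping.single (q + 2 * r' + 1) (K ! r')) (q + 2 * r + 1)) =
        (\<Sum>r'<length K. if r' = r then K ! r' else 0)"
      by (intro sum.cong refl) (auto simp: lookup_single when_def)
    ultimately show ?thesis using *[OF that(1)] by (simp only: test_exp_def lookup_add lookup_sum)
  qed
qed

lemma mono_test_exp:
  "mono z (test_exp \<epsilon> q I K \<sigma>) = (\<Prod>r<length I. z (\<sigma> (\<epsilon> + r + 1)) ^ (I ! r)) * (\<Prod>r<length K. z (\<sigma> (q + 2 * r + 1)) ^ (K ! r))"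
  by (simp add: test_exp_def mono_add mono_sum)

context test_slots
begin

text \<open>A strictly increasing \<open>I\<close> has distinct exponents, which fixes the places of
  the \<open>v_i\<close>. The entries of \<open>K\<close> may repeat, so they are recovered only up
  to a permutation of the pairs; as such a permutation has sign 1, repeated \<open>xi_k\<close> do
  not cancel.\<close>

lemma test_exp_eqD:
  assumes \<sigma>: "good \<sigma>" and len: "length I = a" "length K = c" "length I0 = a" "length K0 = c"
    and sorted: "sorted_wrt (<) I" "sorted_wrt (<) I0" "sorted K" "sorted K0"
    and eq: "test_exp \<epsilon> q I K \<sigma> = test_exp \<epsilon> q I0 K0 (\<lambda>i. i)"
  shows "I = I0" "K = K0" "sign \<sigma> = 1"
proof -
  note G = \<sigma>[unfolded good_def]
  note perm_l = conjunct1[OF G]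
  note gO = conjunct1[OF conjunct2[OF G]]
  note gW = conjunct1[OF conjunct2[OF conjunct2[OF G]]]
  note gV = conjunct1[OF conjunct2[OF conjunct2[OF conjunct2[OF G]]]]
  note gX = conjunct1[OF conjunct2[OF conjunct2[OF conjunct2[OF conjunct2[OF G]]]]]
  note gP = conjunct2[OF conjunct2[OF conjunct2[OF conjunct2[OF conjunct2[OF G]]]]]
  have inj: "inj \<sigma>" by (rule permutes_inj[OF perm_l])
  have lk: "Poly_Mapping.lookup (test_exp \<epsilon> q I0 K0 (\<lambda>i. i)) (\<sigma> i) = Poly_Mapping.lookup (test_exp \<epsilon> q I K (\<lambda>i. i)) i" for i
    using lookup_test_exp[OF inj] by (simp flip: eq)
  have V: "\<exists>r'<a. \<sigma> (\<epsilon> + r + 1) = \<epsilon> + r' + 1" if "r < a" for r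
  proof -
    have "\<sigma> (\<epsilon> + r + 1) \<in> \<sigma> ` V_pos" using that unfolding V_pos_def by blast
    also note gV
    finally show ?thesis unfolding V_pos_def by blast
  qed
  have X: "\<exists>r'<c. \<sigma> (q + 2 * r + 1) = q + 2 * r' + 1" if "r < c" for r
  proof -
    have "\<sigma> (q + 2 * r + 1) \<in> \<sigma> ` X_pos" using that unfolding X_pos_def by blast
    also note gX
    finally show ?thesis unfolding X_pos_def by blast
  qed
  have I: "I ! r = I0 ! r'" if "r < a" "r' < a" "\<sigma> (\<epsilon> + r + 1) = \<epsilon> + r' + 1" for r r'
    using lk[of "\<epsilon> + r + 1"] lookup_test_exp_id(1)[of r I \<epsilon> q K] lookup_test_exp_id(1)[of r' I0 \<epsilon> q K0] that len by simp
  show I_eq: "I = I0"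
  proof (rule distinct_lists_eq[OF sorted(1,2)])
    show "set I \<subseteq> set I0"
    proof
      fix x assume "x \<in> set I"
      then obtain r where r: "r < a" "x = I ! r" using len by (auto simp: in_set_conv_nth)
      with V[OF r(1)] I show "x \<in> set I0" using len by auto
    qed
  qed (use len in simp)
  have fixV: "\<sigma> (\<epsilon> + r + 1) = \<epsilon> + r + 1" if r: "r < a" for r
  proof -
    obtain r' where r': "r' < a" "\<sigma> (\<epsilon> + r + 1) = \<epsilon> + r' + 1" using V[OF r] by blast
    then have "I0 ! r = I0 ! r'" using I[OF r] I_eq by simp
    moreover have "distinct I0" using sorted(2) by (simp add: strict_sorted_iff)
    ultimately show ?thesis using r r' len by (simp add: nth_eq_iff_index_eq)
  qed
  \<comment> \<open>The permutation of the pairs that \<sigma> induces.\<close>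
  define \<rho> where "\<rho> r = (if r < c then (\<sigma> (q + 2 * r + 1) - q - 1) div 2 else r)" for r
  have \<rho>: "\<rho> r < c \<and> \<sigma> (q + 2 * r + 1) = q + 2 * \<rho> r + 1" if "r < c" for r
    using X[OF that] that by (auto simp: \<rho>_def)
  have "inj_on \<rho> {..<c}"
  proof (rule inj_onI)
    fix r s assume "r \<in> {..<c}" "s \<in> {..<c}" "\<rho> r = \<rho> s"
    then have "\<sigma> (q + 2 * r + 1) = \<sigma> (q + 2 * s + 1)" using \<rho>[of r] \<rho>[of s] by simp
    then show "r = s" using inj by (simp add: inj_eq)
  qed
  moreover have "\<rho> ` {..<c} \<subseteq> {..<c}" using \<rho> by auto
  ultimately have "bij_betw \<rho> {..<c} {..<c}" by (simp add: bij_betw_def endo_inj_surj)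
  then have perm: "\<rho> permutes {..<length K0}" unfolding len by (rule bij_imp_permutes) (simp add: \<rho>_def)
  have "K = permute_list \<rho> K0"
  proof (rule nth_equalityI)
    fix r assume "r < length K"
    then have r: "r < c" using len by simp
    then have "K ! r = K0 ! \<rho> r"
      using lk[of "q + 2 * r + 1"] \<rho>[OF r] lookup_test_exp_id(2)[of r K \<epsilon> I q] lookup_test_exp_id(2)[of "\<rho> r" K0 \<epsilon> I0 q] len by simp
    then show "K ! r = permute_list \<rho> K0 ! r" using r len permute_list_nth[OF perm, of r] by simp
  qed (use len in simp)
  then have "mset K = mset K0" using mset_permute_list[OF perm] by simp
  then show "K = K0" using sorted(3,4) by (metis properties_for_sort)
  show "sign \<sigma> = 1"
  proof (rule sign_parallel[OF perm_l])
    show "\<sigma> ` X_pos = X_pos" by (rule gX)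
    show "\<sigma> (Suc i) = Suc (\<sigma> i)" if "i \<in> X_pos" for i using gP that by (rule bspec)
    show "finite X_pos" by (simp add: X_pos_def)
    show "X_pos \<inter> Suc ` X_pos = {}"
    proof -
      have "q + 2 * r + 1 \<noteq> Suc (q + 2 * s + 1)" for r s by presburger
      then show ?thesis unfolding X_pos_def by blast
    qed
    fix i assume i: "i \<notin> X_pos \<union> Suc ` X_pos"
    show "\<sigma> i = i"
    proof (cases "i \<in> {1..l}")
      case True
      then have "i \<in> {1..\<epsilon> + a + b + 2 * c}" by (simp add: l)
      then show ?thesis
      proof (cases rule: position_cases)
        case (Y r)
        then have "i \<in> Suc ` X_pos" by (auto simp: X_pos_def)
        then show ?thesis using i by blast
      qed (use gO gW fixV i in \<open>auto simp: X_pos_def\<close>)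
    qed (use permutes_not_in[OF perm_l] in auto)
  qed
qed

lemma good_id: "good (\<lambda>i. i)"
  using permutes_id[of "{1..l}"] by (simp add: good_def id_def)

end

context special_point
begin

text \<open>An index with nonzero coefficient and longest \<open>K\<close> is tested. The
  functionals leave only the indices with the same \<epsilon>, \<open>J\<close>, \<open>|I|\<close>
  and \<open>|K|\<close>, and the good permutations. The result is a polynomial in \<open>z\<close>
  that vanishes at all generic points, while its coefficient at the monomial of \<open>t0\<close> is
  a positive multiple of \<open>c t0\<close>.\<close>

lemma independent_at:
  assumes l1: "l \<ge> 1"
    and zero: "\<And>m. (\<Sum>t\<in>bas_index n l. c t * ev p (Poly_Mapping.lookup (bas n l t) m)) = 0"
    and t: "t \<in> bas_index n l"
  shows "c t = 0"
proof (rule ccontr)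
  let ?T = "bas_index n l"
  let ?cK = "\<lambda>t. case bas_sum t of (\<epsilon>, I, J, K) \<Rightarrow> length K"
  assume "c t \<noteq> 0"
  then have ne: "{t \<in> ?T. c t \<noteq> 0} \<noteq> {}" "finite {t \<in> ?T. c t \<noteq> 0}" using t finite_bas_index by auto
  then have "Max (?cK ` {t \<in> ?T. c t \<noteq> 0}) \<in> ?cK ` {t \<in> ?T. c t \<noteq> 0}" by (intro Max_in) auto
  then obtain t0 where t0': "t0 \<in> {t \<in> ?T. c t \<noteq> 0}" "?cK t0 = Max (?cK ` {t \<in> ?T. c t \<noteq> 0})"
    by (metis (no_types, lifting) imageE)
  then have t0: "t0 \<in> ?T" "c t0 \<noteq> 0" by auto
  have maxK: "?cK t \<le> ?cK t0" if "t \<in> ?T" "c t \<noteq> 0" for t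
    unfolding t0'(2) by (rule Max_ge) (use ne that in auto)
  obtain \<epsilon> I0 J0 K0 where s0: "bas_sum t0 = (\<epsilon>, I0, J0, K0)" by (metis prod_cases4)
  note B0 = bas_index_sum[OF t0(1) l1 s0]
  define a k q where "a = length I0" and "k = length K0" and "q = \<epsilon> + a + length J0"
  define T' where "T' = {t \<in> ?T. \<exists>I K. bas_sum t = (\<epsilon>, I, J0, K) \<and> length I = a \<and> length K = k}"
  \<comment> \<open>\<open>good\<close> depends neither on \<open>z\<close> nor on \<open>L\<close>,
    so \<open>G\<close> is the same set for all \<open>z\<close>.\<close>
  define G where "G = {\<sigma>. test_slots.good \<epsilon> a k l J0 \<sigma>}"
  define II where "II t = fst (snd (bas_sum t))" for t :: "index + index"
  define KK where "KK t = snd (snd (snd (bas_sum t)))" for t :: "index + index"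
  \<comment> \<open>The relation under the test functionals as a polynomial in \<open>z\<close>, up
    to the sign \<open>(-1) ^ k\<close>.\<close>
  define H where "H = (\<Sum>t\<in>T'. \<Sum>\<sigma>\<in>G. Poly_Mapping.single (test_exp \<epsilon> q (II t) (KK t) \<sigma>) (c t * of_int (sign \<sigma>)))"
  have T'D: "bas_sum t = (\<epsilon>, II t, J0, KK t)" "length (II t) = a" "length (KK t) = k" if "t \<in> T'" for t
    using that by (auto simp: T'_def II_def KK_def)
  let ?Z = "{i \<in> {1..l}. kind \<epsilon> a (length J0) i = 1}"
  have slots_ex: "\<exists>L. test_slots n \<epsilon> a k l J0 z L" if z: "generic z" for z
  proof -
    have "inj_on z ?Z" using z by (auto simp: generic_def inj_on_def inj_def)
    then obtain L where L: "\<And>i. i \<in> ?Z \<Longrightarrow> degree (L i) < card ?Z"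
      "\<And>i j. i \<in> ?Z \<Longrightarrow> j \<in> ?Z \<Longrightarrow> poly (L i) (z j) = (if i = j then 1 else 0)"
      using lagrange_polys[of ?Z z] by auto
    have "card ?Z = a + k"
      using card_kind_1[of \<epsilon> a "length J0" k] B0(2) by (simp add: a_def k_def)
    moreover have "j \<le> n" if "j \<in> set J0" for j using B0(6)[OF that] by simp
    ultimately have "test_slots n \<epsilon> a k l J0 z L"
      by unfold_locales (use B0 L in \<open>simp_all add: a_def k_def\<close>)
    then show "\<exists>L. test_slots n \<epsilon> a k l J0 z L" by blast
  qed
  have G_sub: "G \<subseteq> {\<sigma>. \<sigma> permutes {1..l}}" and id_G: "(\<lambda>i. i) \<in> G"
  proof -
    obtain z L where "test_slots n \<epsilon> a k l J0 z L" using slots_ex generic_exists by blast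
    then interpret test_slots n \<epsilon> a k l J0 z L .
    show "G \<subseteq> {\<sigma>. \<sigma> permutes {1..l}}" by (auto simp: G_def good_def)
    show "(\<lambda>i. i) \<in> G" by (simp add: G_def good_id)
  qed
  have fin: "finite T'" "finite G"
    using finite_bas_index G_sub finite_permutations[of "{1..l}"] by (auto simp: T'_def intro: finite_subset)
  have "H = 0"
  proof (rule xpoly_eqI)
    fix z assume z: "generic z"
    obtain L where "test_slots n \<epsilon> a k l J0 z L" using slots_ex[OF z] by blast
    then interpret test_slots n \<epsilon> a k l J0 z L .
    define F where "F = (\<Union>t\<in>?T. Poly_Mapping.keys (bas n l t))"
    let ?val = "\<lambda>t \<sigma>. bas_value n (fst (bas_sum t)) (snd (bas_sum t)) (\<lambda>i. mu (\<sigma> i))"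
    have "finite F" using finite_bas_index by (auto simp: F_def)
    have "0 = (\<Sum>m\<in>F. (\<Prod>a=1..l. mu a (Poly_Mapping.lookup m a)) * (\<Sum>t\<in>?T. c t * ev p (Poly_Mapping.lookup (bas n l t) m)))"
      by (simp add: zero)
    also have "\<dots> = (\<Sum>t\<in>?T. c t * (\<Sum>m\<in>F. ev p (Poly_Mapping.lookup (bas n l t) m) * (\<Prod>a=1..l. mu a (Poly_Mapping.lookup m a))))"
      unfolding sum_distrib_left by (subst sum.swap) (simp add: mult_ac)
    also have "\<dots> = (\<Sum>t\<in>?T. c t * slots p l mu (bas n l t))"
      unfolding slots_def
      by (intro sum.cong refl arg_cong2[where f = "(*)"] lin_superset[OF rhom_ev \<open>finite F\<close>, symmetric])
        (auto simp: F_def)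
    also have "\<dots> = (\<Sum>t\<in>?T. c t * (\<Sum>\<sigma> | \<sigma> permutes {1..l}. of_int (sign \<sigma>) * ?val t \<sigma>))"
      by (intro sum.cong refl) (simp add: bas_props(1)[OF n l1] slots_alt slots_pre_bas[OF _ l1] del: One_nat_def)
    also have "\<dots> = (\<Sum>t\<in>T'. c t * (\<Sum>\<sigma>\<in>G. of_int (sign \<sigma>) * ?val t \<sigma>))"
    proof (rule sum.mono_neutral_cong_right)
      have nz: "t \<in> T' \<and> good \<sigma>" if "t \<in> ?T" "c t \<noteq> 0" "\<sigma> permutes {1..l}" "?val t \<sigma> \<noteq> 0" for t \<sigma>
      proof -
        obtain \<epsilon>' I J K where s: "bas_sum t = (\<epsilon>', I, J, K)" by (metis prod_cases4)
        note Bt = bas_index_sum[OF that(1) l1 s]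
        \<comment> \<open>The maximal choice of \<open>t0\<close> enters here.\<close>
        have "length K \<le> k" using maxK[OF that(1,2)] s s0 by (simp add: k_def)
        moreover have "bas_value n \<epsilon>' (I, J, K) (\<lambda>i. mu (\<sigma> i)) \<noteq> 0" using that(4) s by simp
        ultimately have "\<epsilon>' = \<epsilon>" "length I = a" "length K = k" "J = J0" "good \<sigma>"
          using bas_value_nonzeroD[of \<epsilon>' I J K \<sigma>] that(3) Bt by auto
        then show ?thesis using that s by (auto simp: T'_def)
      qed
      show "\<forall>t\<in>?T - T'. c t * (\<Sum>\<sigma> | \<sigma> permutes {1..l}. of_int (sign \<sigma>) * ?val t \<sigma>) = 0"
      proof
        fix t assume t: "t \<in> ?T - T'"
        show "c t * (\<Sum>\<sigma> | \<sigma> permutes {1..l}. of_int (sign \<sigma>) * ?val t \<sigma>) = 0"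
        proof (cases "c t = 0")
          case False
          then have "?val t \<sigma> = 0" if "\<sigma> permutes {1..l}" for \<sigma> using nz[of t \<sigma>] t that by auto
          then show ?thesis by simp
        qed simp
      qed
      show "c t * (\<Sum>\<sigma> | \<sigma> permutes {1..l}. of_int (sign \<sigma>) * ?val t \<sigma>) = c t * (\<Sum>\<sigma>\<in>G. of_int (sign \<sigma>) * ?val t \<sigma>)"
        if t: "t \<in> T'" for t
      proof (cases "c t = 0")
        case False
        have "t \<in> ?T" using t by (simp add: T'_def)
        have "(\<Sum>\<sigma> | \<sigma> permutes {1..l}. of_int (sign \<sigma>) * ?val t \<sigma>) = (\<Sum>\<sigma>\<in>G. of_int (sign \<sigma>) * ?val t \<sigma>)"
        proof (rule sum.mono_neutral_right)
          show "finite {\<sigma>. \<sigma> permutes {1..l}}" by (simp add: finite_permutations)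
          show "\<forall>\<sigma>\<in>{\<sigma>. \<sigma> permutes {1..l}} - G. of_int (sign \<sigma>) * ?val t \<sigma> = 0"
            using nz[OF \<open>t \<in> ?T\<close> False] by (auto simp: G_def)
        qed (rule G_sub)
        then show ?thesis by simp
      qed simp
    qed (auto simp: finite_bas_index T'_def)
    also have "\<dots> = (\<Sum>t\<in>T'. c t * (\<Sum>\<sigma>\<in>G. of_int (sign \<sigma>) * ((-1) ^ k * mono z (test_exp \<epsilon> q (II t) (KK t) \<sigma>))))"
    proof (intro sum.cong refl arg_cong2[where f = "(*)"])
      fix t \<sigma> assume t: "t \<in> T'" and \<sigma>: "\<sigma> \<in> G"
      have "t \<in> ?T" using t by (simp add: T'_def)
      note Bt = bas_index_sum[OF this l1 T'D(1)[OF t]]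
      have len: "length (II t) = a" "length (KK t) = k" by (rule T'D[OF t])+
      have "?val t \<sigma> = bas_value n \<epsilon> (II t, J0, KK t) (\<lambda>i. mu (\<sigma> i))" by (simp add: T'D(1)[OF t])
      also have "\<dots> = (\<Prod>r<a. z (\<sigma> (\<epsilon> + r + 1)) ^ (II t ! r)) * (\<Prod>r<k. - (z (\<sigma> (\<epsilon> + a + length J0 + 2 * r + 1)) ^ (KK t ! r)))"
      proof (rule bas_value_good)
        show "1 \<le> j \<and> j + (a + k) \<le> n + 1" if "j \<in> set (KK t)" for j using Bt(7)[OF that] len by simp
      qed (use \<sigma> Bt len in \<open>auto simp: G_def\<close>)
      also have "\<dots> = (-1) ^ k * mono z (test_exp \<epsilon> q (II t) (KK t) \<sigma>)"
        by (simp add: mono_test_exp len prod_uminus q_def)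
      finally show "?val t \<sigma> = (-1) ^ k * mono z (test_exp \<epsilon> q (II t) (KK t) \<sigma>)" .
    qed
    also have "\<dots> = (-1) ^ k * ev z H"
      by (simp add: H_def ev_simps eval_with_single rhom_ident sum_distrib_left mult_ac)
    finally show "ev z H = ev z 0" by (simp add: ev_simps)
  qed
  then have "0 = Poly_Mapping.lookup H (test_exp \<epsilon> q I0 K0 (\<lambda>i. i))" by simp
  also have "\<dots> = (\<Sum>t\<in>T'. \<Sum>\<sigma>\<in>G. if t = t0 \<and> test_exp \<epsilon> q (II t) (KK t) \<sigma> = test_exp \<epsilon> q I0 K0 (\<lambda>i. i) then c t0 else 0)"
    unfolding H_def lookup_sum
  proof (intro sum.cong refl)
    fix t \<sigma> assume t: "t \<in> T'" and \<sigma>: "\<sigma> \<in> G"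
    have "t \<in> ?T" using t by (simp add: T'_def)
    note Bt = bas_index_sum[OF this l1 T'D(1)[OF t]]
    have "t = t0 \<and> sign \<sigma> = 1" if eq: "test_exp \<epsilon> q (II t) (KK t) \<sigma> = test_exp \<epsilon> q I0 K0 (\<lambda>i. i)"
    proof -
      obtain z L where "test_slots n \<epsilon> a k l J0 z L" using slots_ex generic_exists by blast
      then interpret test_slots n \<epsilon> a k l J0 z L .
      have g: "good \<sigma>" using \<sigma> by (simp only: G_def mem_Collect_eq)
      note eqD = test_exp_eqD[OF g T'D(2,3)[OF t] a_def[symmetric] k_def[symmetric] Bt(4) B0(4) Bt(8) B0(8) eq[unfolded q_def]]
      have "bas_sum t = bas_sum t0" by (simp only: T'D(1)[OF t] s0 eqD(1,2))
      then show ?thesis using eqD(3) inj_bas_sum by blast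
    qed
    then show "Poly_Mapping.lookup (Poly_Mapping.single (test_exp \<epsilon> q (II t) (KK t) \<sigma>) (c t * of_int (sign \<sigma>))) (test_exp \<epsilon> q I0 K0 (\<lambda>i. i)) =
        (if t = t0 \<and> test_exp \<epsilon> q (II t) (KK t) \<sigma> = test_exp \<epsilon> q I0 K0 (\<lambda>i. i) then c t0 else 0)"
      unfolding lookup_single when_def
      by (cases "test_exp \<epsilon> q (II t) (KK t) \<sigma> = test_exp \<epsilon> q I0 K0 (\<lambda>i. i)") (simp_all only: if_True if_False simp_thms of_int_1 mult_1_right)
  qed
  also have "\<dots> = (\<Sum>t\<in>T'. if t = t0 then (\<Sum>\<sigma>\<in>G. if test_exp \<epsilon> q I0 K0 \<sigma> = test_exp \<epsilon> q I0 K0 (\<lambda>i. i) then c t0 else 0) else 0)"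
    by (intro sum.cong refl) (auto simp: II_def KK_def s0)
  also have "\<dots> = (\<Sum>\<sigma>\<in>G. if test_exp \<epsilon> q I0 K0 \<sigma> = test_exp \<epsilon> q I0 K0 (\<lambda>i. i) then c t0 else 0)"
  proof -
    have "t0 \<in> T'" using t0 s0 by (auto simp: T'_def a_def k_def)
    then show ?thesis using fin by simp
  qed
  \<comment> \<open>All contributions come from \<open>t0\<close> with sign 1, so they cannot
    cancel; the identity is among the permutations counted.\<close>
  also have "\<dots> = of_nat (card {\<sigma> \<in> G. test_exp \<epsilon> q I0 K0 \<sigma> = test_exp \<epsilon> q I0 K0 (\<lambda>i. i)}) * c t0"
    using fin by (simp flip: sum.inter_filter)
  finally have "card {\<sigma> \<in> G. test_exp \<epsilon> q I0 K0 \<sigma> = test_exp \<epsilon> q I0 K0 (\<lambda>i. i)} = 0"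
    using t0(2) by simp
  then show False using id_G fin by auto
qed

end

text \<open>A linear relation is restricted to a line through the special point \<open>p\<close>; the lowest terms of its
  coefficients then satisfy a relation at \<open>p\<close>.\<close>

lemma independent_lift:
  fixes b :: "'i \<Rightarrow> Xpoly"
  assumes indep: "\<And>c t. (\<And>m. (\<Sum>t\<in>T. c t * ev p (Poly_Mapping.lookup (b t) m)) = 0) \<Longrightarrow> t \<in> T \<Longrightarrow> c t = 0"
    and rel: "(\<Sum>t\<in>T. const (r t) * b t) = 0" and t: "t \<in> T"
  shows "r t = 0"
proof (rule xpoly_eqI)
  fix y
  \<comment> \<open>Restriction to the line from \<open>p\<close> to \<open>y\<close>: the constant
    coefficient is the value at \<open>p\<close>, the value at 1 is the value at
    \<open>y\<close>.\<close>
  let ?\<psi> = "eval_with (\<lambda>c. [:c:]) (\<lambda>i. [:p i, y i - p i:])"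
  have c: "rhom (\<lambda>c::complex. [:c:])" by (simp add: rhom_def one_pCons)
  have \<psi>: "rhom ?\<psi>" by (rule rhom_eval_with[OF c])
  have pe: "rhom (\<lambda>q::complex poly. poly q u)" for u by (simp add: rhom_def)
  have p0: "coeff (?\<psi> s) 0 = ev p s" for s
    unfolding poly_0_coeff_0[symmetric]
    by (rule mpoly_hom_eqI[OF rhom_comp[OF pe \<psi>] rhom_ev]) (simp_all add: eval_with_const eval_with_var c)
  have p1: "poly (?\<psi> s) 1 = ev y s" for s
    by (rule mpoly_hom_eqI[OF rhom_comp[OF pe \<psi>] rhom_ev]) (simp_all add: eval_with_const eval_with_var c)
  have rel': "(\<Sum>t\<in>T. ?\<psi> (r t) * ?\<psi> (Poly_Mapping.lookup (b t) m)) = 0" for m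
  proof -
    have "Poly_Mapping.lookup (\<Sum>t\<in>T. const (r t) * b t) m = 0" by (simp add: rel)
    then have "(\<Sum>t\<in>T. r t * Poly_Mapping.lookup (b t) m) = 0" by (simp add: lookup_sum lookup_const_mult)
    from arg_cong[OF this, of ?\<psi>] show ?thesis by (simp add: rhom.hom_simps[OF \<psi>])
  qed
  have "\<forall>t\<in>T. coeff (?\<psi> (r t)) k = 0" for k
  proof (induction k rule: less_induct)
    case (less k)
    show ?case
    proof
      fix t assume t: "t \<in> T"
      show "coeff (?\<psi> (r t)) k = 0"
      proof (rule indep[OF _ t])
        fix m
        have "0 = coeff (\<Sum>t\<in>T. ?\<psi> (r t) * ?\<psi> (Poly_Mapping.lookup (b t) m)) k" by (simp add: rel')
        also have "\<dots> = (\<Sum>t\<in>T. \<Sum>i\<le>k. coeff (?\<psi> (r t)) i * coeff (?\<psi> (Poly_Mapping.lookup (b t) m)) (k - i))"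
          by (simp add: coeff_sum coeff_mult)
        also have "\<dots> = (\<Sum>t\<in>T. coeff (?\<psi> (r t)) k * ev p (Poly_Mapping.lookup (b t) m))"
        proof (rule sum.cong[OF refl])
          fix t assume "t \<in> T"
          then have "(\<Sum>i\<le>k. coeff (?\<psi> (r t)) i * coeff (?\<psi> (Poly_Mapping.lookup (b t) m)) (k - i)) =
              (\<Sum>i\<in>{k}. coeff (?\<psi> (r t)) i * coeff (?\<psi> (Poly_Mapping.lookup (b t) m)) (k - i))"
            by (intro sum.mono_neutral_right) (use less in auto)
          then show "(\<Sum>i\<le>k. coeff (?\<psi> (r t)) i * coeff (?\<psi> (Poly_Mapping.lookup (b t) m)) (k - i)) =
              coeff (?\<psi> (r t)) k * ev p (Poly_Mapping.lookup (b t) m)" by (simp add: p0)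
        qed
        finally show "(\<Sum>t\<in>T. coeff (?\<psi> (r t)) k * ev p (Poly_Mapping.lookup (b t) m)) = 0" by simp
      qed
    qed
  qed
  then have "?\<psi> (r t) = 0" using t by (intro poly_eqI) auto
  then show "ev y (r t) = ev y 0" using p1[of "r t"] by (simp add: ev_simps)
qed

theorem bas_independent:
  assumes "n \<ge> 1" "l \<ge> 1" "(\<Sum>t\<in>bas_index n l. const (r t) * bas n l t) = 0" "t \<in> bas_index n l"
  shows "r t = 0"
proof -
  obtain p where "\<And>k. ev p (elem_sym (2 * n + 1) k) = (if k = 0 \<or> k = int (2 * n + 1) then 1 else 0)"
    using special_point[of "2 * n + 1"] by auto
  then interpret special_point n p using assms(1) by unfold_locales
  show ?thesis
  proof (rule independent_lift[OF _ assms(3,4), of p])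
    fix c t
    assume "\<And>m. (\<Sum>t\<in>bas_index n l. c t * ev p (Poly_Mapping.lookup (bas n l t) m)) = 0" "t \<in> bas_index n l"
    then show "c t = 0" by (rule independent_at[OF assms(2)])
  qed
qed

section \<open>Spanning by counting degrees\<close>

definition hcomp :: "int \<Rightarrow> xpoly \<Rightarrow> xpoly" where
  "hcomp d p = (\<Sum>m | m \<in> Poly_Mapping.keys p \<and> mdeg m = d. Poly_Mapping.single m (Poly_Mapping.lookup p m))"

lemma lookup_hcomp: "Poly_Mapping.lookup (hcomp d p) m = (if mdeg m = d then Poly_Mapping.lookup p m else 0)"
proof -
  have "Poly_Mapping.lookup (hcomp d p) m = (\<Sum>m' | m' \<in> Poly_Mapping.keys p \<and> mdeg m' = d. if m' = m then Poly_Mapping.lookup p m' else 0)"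
    unfolding hcomp_def lookup_sum by (intro sum.cong refl) (auto simp: lookup_single when_def)
  then show ?thesis by (simp add: in_keys_iff)
qed

lemma hcomp_add: "hcomp d (p + q) = hcomp d p + hcomp d q"
  by (rule poly_mapping_eqI) (simp add: lookup_hcomp lookup_add)

lemma hcomp_0 [simp]: "hcomp d 0 = 0"
  by (rule poly_mapping_eqI) (simp add: lookup_hcomp)

lemma hcomp_sum: "hcomp d (sum f A) = (\<Sum>i\<in>A. hcomp d (f i))"
  by (induction A rule: infinite_finite_induct) (simp_all add: hcomp_add)

lemma hcomp_xhom: "xhom e p \<Longrightarrow> hcomp d p = (if d = e then p else 0)"
  by (rule poly_mapping_eqI) (auto simp: lookup_hcomp xhom_def in_keys_iff)

lemma xhom_single: "xhom (mdeg m) (Poly_Mapping.single m c)"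
  by (simp add: xhom_def)

lemma hcomp_mult:
  assumes q: "xhom e q"
  shows "hcomp d (p * q) = hcomp (d - e) p * q"
proof -
  have *: "hcomp d (Poly_Mapping.single m c * q) = hcomp (d - e) (Poly_Mapping.single m c) * q" for m c
    using hcomp_xhom[OF xhom_mult[OF xhom_single q], of d m c] hcomp_xhom[OF xhom_single, of "d - e" m c] by auto
  have "p * q = (\<Sum>m\<in>Poly_Mapping.keys p. Poly_Mapping.single m (Poly_Mapping.lookup p m)) * q"
    by (simp flip: poly_mapping_sum_single)
  then have "hcomp d (p * q) = hcomp (d - e) (\<Sum>m\<in>Poly_Mapping.keys p. Poly_Mapping.single m (Poly_Mapping.lookup p m)) * q"
    by (simp add: sum_distrib_right hcomp_sum *)
  then show ?thesis by (simp flip: poly_mapping_sum_single)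
qed

lemma hcomp_neg: "d < 0 \<Longrightarrow> hcomp d p = 0"
proof (rule poly_mapping_eqI)
  fix m
  assume "d < 0"
  then show "Poly_Mapping.lookup (hcomp d p) m = Poly_Mapping.lookup 0 m"
    using mdeg_nonneg[of m] by (simp add: lookup_hcomp)
qed

lemma mdeg_eq_0: "mdeg m = 0 \<longleftrightarrow> m = 0"
proof
  assume "mdeg m = 0"
  then have "\<forall>i\<in>Poly_Mapping.keys m. int (Poly_Mapping.lookup m i) = 0"
    unfolding mdeg_def by (subst (asm) sum_nonneg_eq_0_iff) auto
  then show "m = 0" by (intro poly_mapping_eqI) (auto simp: in_keys_iff)
qed simp

lemma hcomp_deg_0: "hcomp 0 p = const (Poly_Mapping.lookup p 0)"
  by (rule poly_mapping_eqI) (auto simp: lookup_hcomp const_def lookup_single when_def mdeg_eq_0)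

lemma rename_hcomp: "rename s (hcomp d p) = hcomp d (rename s p)"
proof -
  have *: "rename s (hcomp d (Poly_Mapping.single m c)) = hcomp d (rename s (Poly_Mapping.single m c))" for m c
    using hcomp_xhom[OF xhom_single, of d m c] hcomp_xhom[OF xhom_single, of d "rename_exp s m" c]
    by (simp add: rename_single rename_simps)
  have "rename s (hcomp d (\<Sum>m\<in>Poly_Mapping.keys p. Poly_Mapping.single m (Poly_Mapping.lookup p m))) =
      hcomp d (rename s (\<Sum>m\<in>Poly_Mapping.keys p. Poly_Mapping.single m (Poly_Mapping.lookup p m)))"
    by (simp only: rename_simps hcomp_sum *)
  then show ?thesis by (simp flip: poly_mapping_sum_single)
qed

lemma sym_hcomp:
  assumes "p \<in> sym_polys N"
  shows "hcomp d p \<in> sym_polys N"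
proof -
  have "vars_in {1..N} (hcomp d p)"
    using assms unfolding hcomp_def sym_polys_iff
    by (intro vars_in_sum) (auto simp: vars_in_def)
  then show ?thesis using assms by (auto simp: sym_polys_iff rename_hcomp)
qed

lemma rspan_sumE:
  assumes "p \<in> rspan N (f ` A)" "finite A"
  obtains r where "\<And>i. r i \<in> sym_polys N" "p = (\<Sum>i\<in>A. r i * f i)"
proof -
  have "\<exists>r. (\<forall>i. r i \<in> sym_polys N) \<and> p = (\<Sum>i\<in>A. r i * f i)"
    using assms(1)
  proof (induction rule: rspan.induct)
    case zero
    show ?case by (rule exI[of _ "\<lambda>_. 0"]) simp
  next
    case (step s b p)
    then obtain r i where r: "\<And>i. r i \<in> sym_polys N" "p = (\<Sum>i\<in>A. r i * f i)" "i \<in> A" "b = f i" by blast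
    have "(\<Sum>j\<in>A. (r(i := r i + s)) j * f j) = (\<Sum>j\<in>A. r j * f j + (if j = i then s * f j else 0))"
      by (intro sum.cong refl) (auto simp: algebra_simps)
    also have "\<dots> = s * b + p" using r assms(2) by (simp add: sum.distrib)
    finally have "s * b + p = (\<Sum>j\<in>A. (r(i := r i + s)) j * f j)" by simp
    moreover have "\<forall>j. (r(i := r i + s)) j \<in> sym_polys N" using r step by (auto intro: sym_add)
    ultimately show ?case by blast
  qed
  then show thesis using that by blast
qed

text \<open>If the unit vector \<open>D y\<close> were outside the span of the rows, there would be
  more independent vectors than there are unit vectors spanning the space.\<close>

lemma square_system:
  fixes m :: "'i \<Rightarrow> 'l \<Rightarrow> complex"
  assumes fin: "finite I" "finite \<Lambda>" "card I = card \<Lambda>"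
    and inj: "\<And>\<alpha> i. (\<And>x. x \<in> \<Lambda> \<Longrightarrow> (\<Sum>i\<in>I. \<alpha> i * m i x) = 0) \<Longrightarrow> i \<in> I \<Longrightarrow> \<alpha> i = 0"
    and y: "y \<in> \<Lambda>"
  obtains u where "\<And>x. x \<in> \<Lambda> \<Longrightarrow> (\<Sum>i\<in>I. u i * m i x) = (if x = y then 1 else 0)"
proof -
  define sc where "sc = (\<lambda>(a::complex) f (x::'l). a * f x :: complex)"
  interpret vs: vector_space sc
    by unfold_locales (auto simp: sc_def fun_eq_iff algebra_simps)
  define F where "F i = (\<lambda>x. if x \<in> \<Lambda> then m i x else 0)" for i
  define D where "D y = (\<lambda>x. if x = y then 1 else 0 :: complex)" for y :: 'l
  have sum_app: "(\<Sum>i\<in>A. g i) x = (\<Sum>i\<in>A. g i x)" for g :: "'a \<Rightarrow> 'l \<Rightarrow> complex" and A x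
    by (induction A rule: infinite_finite_induct) auto
  have injF: "inj_on F I"
  proof (rule inj_onI, rule ccontr)
    fix i j assume ij: "i \<in> I" "j \<in> I" "F i = F j" "i \<noteq> j"
    have "(\<Sum>k\<in>I. (if k = i then 1 else if k = j then -1 else 0) * m k x) = 0" if "x \<in> \<Lambda>" for x
    proof -
      have "(\<Sum>k\<in>I. (if k = i then 1 else if k = j then -1 else 0) * m k x) =
          (\<Sum>k\<in>I. (if k = i then m k x else 0)) - (\<Sum>k\<in>I. (if k = j then m k x else 0))"
        unfolding sum_subtractf[symmetric] by (intro sum.cong refl) (use ij in auto)
      moreover have "m i x = m j x" using fun_cong[OF ij(3), of x] that by (simp add: F_def)
      ultimately show ?thesis using ij fin by simp
    qed
    from inj[OF this ij(1)] show False by simp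
  qed
  have "vs.independent (F ` I)"
  proof
    assume "vs.dependent (F ` I)"
    then obtain u v where u: "v \<in> F ` I" "u v \<noteq> 0" "(\<Sum>v\<in>F ` I. sc (u v) v) = 0"
      using vs.dependent_finite[of "F ` I"] fin by auto
    have "(\<Sum>i\<in>I. u (F i) * m i x) = 0" if "x \<in> \<Lambda>" for x
    proof -
      have "(\<Sum>i\<in>I. sc (u (F i)) (F i)) x = 0" using u(3) by (simp add: sum.reindex[OF injF])
      then show ?thesis using that by (simp add: sum_app sc_def F_def)
    qed
    from inj[of "\<lambda>i. u (F i)", OF this] u show False by auto
  qed
  have span: "G \<in> vs.span (D ` \<Lambda>)" if "\<And>x. x \<notin> \<Lambda> \<Longrightarrow> G x = 0" for G
  proof -
    have "(\<Sum>y\<in>\<Lambda>. sc (G y) (D y)) x = G x" for x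
    proof -
      have "(\<Sum>y\<in>\<Lambda>. sc (G y) (D y)) x = (\<Sum>y\<in>\<Lambda>. if y = x then G y else 0)"
        unfolding sum_app sc_def D_def by (intro sum.cong refl) auto
      then show ?thesis using that fin by auto
    qed
    then have "G = (\<Sum>y\<in>\<Lambda>. sc (G y) (D y))" by auto
    also have "\<dots> \<in> vs.span (D ` \<Lambda>)" by (intro vs.span_sum vs.span_scale vs.span_base) auto
    finally show ?thesis .
  qed
  have "D y \<in> vs.span (F ` I)"
  proof (rule ccontr)
    assume D: "D y \<notin> vs.span (F ` I)"
    then have "vs.independent (insert (D y) (F ` I))"
      using \<open>vs.independent (F ` I)\<close> by (simp add: vs.independent_insert)
    moreover have "insert (D y) (F ` I) \<subseteq> vs.span (D ` \<Lambda>)"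
    proof -
      have "D y \<in> vs.span (D ` \<Lambda>)" by (rule span) (use y in \<open>auto simp: D_def\<close>)
      moreover have "F i \<in> vs.span (D ` \<Lambda>)" for i by (rule span) (simp add: F_def)
      ultimately show ?thesis by blast
    qed
    ultimately have "card (insert (D y) (F ` I)) \<le> card (D ` \<Lambda>)"
      using vs.independent_span_bound[of "D ` \<Lambda>"] fin by auto
    also have "\<dots> \<le> card I" using card_image_le fin by metis
    finally have "card (insert (D y) (F ` I)) \<le> card I" .
    moreover have "D y \<notin> F ` I" using D vs.span_base by blast
    ultimately show False using fin card_image[OF injF] by simp
  qed
  then obtain u where "D y = (\<Sum>v\<in>F ` I. sc (u v) v)"
    using vs.span_finite[of "F ` I"] fin by auto
  then have u: "D y = (\<Sum>i\<in>I. sc (u (F i)) (F i))" by (simp add: sum.reindex[OF injF])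
  have "(\<Sum>i\<in>I. u (F i) * m i x) = (if x = y then 1 else 0)" if "x \<in> \<Lambda>" for x
    using fun_cong[OF u, of x] that by (simp add: sum_app sc_def F_def D_def)
  then show thesis by (rule that)
qed

lemma rspan_mono: "p \<in> rspan N B \<Longrightarrow> B \<subseteq> C \<Longrightarrow> p \<in> rspan N C"
  by (rule rspan_trans) (auto intro: rspan_base)

text \<open>Induction on the degree. The members of \<beta> of degree \<open>d\<close> are
  combinations of the \<open>f x\<close> of degree \<open>d\<close> with constant coefficients, up
  to \<open>f x\<close> of lower degree, which by induction lie in the span of lower members of
  \<beta>. The matrix of constants is square by the hypothesis on cardinalities and injective by
  independence, so each \<open>f x\<close> can be solved for.\<close>

lemma rspan_by_degrees:
  fixes f :: "'l \<Rightarrow> xpoly" and \<beta> :: "'i \<Rightarrow> xpoly" and df :: "'l \<Rightarrow> nat" and db :: "'i \<Rightarrow> nat"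
  assumes fin: "finite A" "finite T"
    and f: "\<And>x. x \<in> A \<Longrightarrow> xhom (int (df x)) (f x)"
    and b: "\<And>t. t \<in> T \<Longrightarrow> xhom (int (db t)) (\<beta> t)" "\<And>t. t \<in> T \<Longrightarrow> \<beta> t \<in> rspan N (f ` A)"
    and indep: "\<And>r t. (\<And>t. r t \<in> sym_polys N) \<Longrightarrow> (\<Sum>t\<in>T. r t * \<beta> t) = 0 \<Longrightarrow> t \<in> T \<Longrightarrow> r t = 0"
    and card: "\<And>d. card {t \<in> T. db t = d} = card {x \<in> A. df x = d}"
    and x: "x \<in> A"
  shows "f x \<in> rspan N (\<beta> ` T)"
proof -
  have "\<forall>x\<in>A. df x = d \<longrightarrow> f x \<in> rspan N (\<beta> ` {t \<in> T. db t \<le> d})" for d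
  proof (induction d rule: less_induct)
    case (less d)
    let ?I = "{t \<in> T. db t = d}" and ?\<Lambda> = "{x \<in> A. df x = d}" and ?low = "{x \<in> A. df x < d}" and ?Tlow = "{t \<in> T. db t < d}"
    have "\<exists>r. (\<forall>x. r x \<in> sym_polys N) \<and> \<beta> t = (\<Sum>x\<in>A. r x * f x)" if "t \<in> T" for t
      using rspan_sumE[OF b(2)[OF that] fin(1)] by metis
    then obtain r where r: "\<And>t x. t \<in> T \<Longrightarrow> r t x \<in> sym_polys N" "\<And>t. t \<in> T \<Longrightarrow> \<beta> t = (\<Sum>x\<in>A. r t x * f x)" by metis
    define m where "m t x = Poly_Mapping.lookup (r t x) 0" for t x
    define low where "low t = (\<Sum>x\<in>?low. hcomp (int d - int (df x)) (r t x) * f x)" for t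
    \<comment> \<open>In the component of degree \<open>d\<close> the coefficient of
      \<open>f x\<close> has degree \<open>d - df x\<close>: a constant for \<open>df x = d\<close>,
      and zero for larger \<open>df x\<close>.\<close>
    have \<beta>: "\<beta> t = (\<Sum>x\<in>?\<Lambda>. const (m t x) * f x) + low t" if t: "t \<in> ?I" for t
    proof -
      have "\<beta> t = hcomp (int d) (\<beta> t)" using hcomp_xhom[OF b(1)[of t], of "int d"] t by simp
      also have "\<dots> = (\<Sum>x\<in>A. hcomp (int d - int (df x)) (r t x) * f x)"
        using t r(2)[of t] by (simp add: hcomp_sum hcomp_mult[OF f])
      also have "\<dots> = (\<Sum>x\<in>?\<Lambda> \<union> ?low. hcomp (int d - int (df x)) (r t x) * f x)"
      proof (rule sum.mono_neutral_right)
        show "\<forall>x\<in>A - (?\<Lambda> \<union> ?low). hcomp (int d - int (df x)) (r t x) * f x = 0"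
        proof
          fix x assume "x \<in> A - (?\<Lambda> \<union> ?low)"
          then have "int d - int (df x) < 0" by auto
          then show "hcomp (int d - int (df x)) (r t x) * f x = 0" by (simp only: hcomp_neg mult_zero_left)
        qed
      qed (use fin in auto)
      also have "\<dots> = (\<Sum>x\<in>?\<Lambda>. hcomp (int d - int (df x)) (r t x) * f x) + low t"
        unfolding low_def by (rule sum.union_disjoint) (use fin in auto)
      also have "(\<Sum>x\<in>?\<Lambda>. hcomp (int d - int (df x)) (r t x) * f x) = (\<Sum>x\<in>?\<Lambda>. const (m t x) * f x)"
        by (intro sum.cong refl) (auto simp: hcomp_deg_0 m_def)
      finally show ?thesis .
    qed
    have low: "low t \<in> rspan N (\<beta> ` ?Tlow)" if t: "t \<in> ?I" for t
      unfolding low_def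
    proof (intro rspan_sum rspan_mult sym_hcomp)
      fix x assume x: "x \<in> ?low"
      then have "f x \<in> rspan N (\<beta> ` {t \<in> T. db t \<le> df x})" using less by auto
      then show "f x \<in> rspan N (\<beta> ` ?Tlow)" by (rule rspan_mono) (use x in auto)
    qed (use r t in auto)
    show ?case
    proof (intro ballI impI)
      fix y assume y: "y \<in> A" "df y = d"
      then have y': "y \<in> ?\<Lambda>" by simp
      \<comment> \<open>If a combination of these members kills the leading part, what remains lies
        in the span of lower members; independence then makes its coefficients zero.\<close>
      obtain u where u: "\<And>x. x \<in> ?\<Lambda> \<Longrightarrow> (\<Sum>i\<in>?I. u i * m i x) = (if x = y then 1 else 0)"
      proof (rule square_system[OF _ _ card _ y', of m])
        fix \<alpha> i assume \<alpha>: "\<And>x. x \<in> ?\<Lambda> \<Longrightarrow> (\<Sum>i\<in>?I. \<alpha> i * m i x) = 0" and i: "i \<in> ?I"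
        have "(\<Sum>t\<in>?I. const (\<alpha> t) * \<beta> t) = (\<Sum>t\<in>?I. \<Sum>x\<in>?\<Lambda>. const (\<alpha> t * m t x) * f x) + (\<Sum>t\<in>?I. const (\<alpha> t) * low t)"
          by (simp add: \<beta> distrib_left sum.distrib sum_distrib_left const_simps mult.assoc)
        also have "(\<Sum>t\<in>?I. \<Sum>x\<in>?\<Lambda>. const (\<alpha> t * m t x) * f x) = (\<Sum>x\<in>?\<Lambda>. const (\<Sum>t\<in>?I. \<alpha> t * m t x) * f x)"
          by (subst sum.swap) (simp only: const_simps sum_distrib_right)
        also have "\<dots> = 0" by (intro sum.neutral ballI) (simp only: \<alpha> const_0 mult_zero_left)
        finally have "(\<Sum>t\<in>?I. const (\<alpha> t) * \<beta> t) = (\<Sum>t\<in>?I. const (\<alpha> t) * low t)" by simp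
        also have "\<dots> \<in> rspan N (\<beta> ` ?Tlow)" by (intro rspan_sum rspan_mult low) auto
        finally have mem: "(\<Sum>t\<in>?I. const (\<alpha> t) * \<beta> t) \<in> rspan N (\<beta> ` ?Tlow)" .
        have "finite ?Tlow" using fin(2) by simp
        from rspan_sumE[OF mem this] obtain s where s_sym: "\<And>t. s t \<in> sym_polys N"
          and s: "(\<Sum>t\<in>?I. const (\<alpha> t) * \<beta> t) = (\<Sum>t\<in>?Tlow. s t * \<beta> t)" by blast
        define r' where "r' t = (if db t = d then const (\<alpha> t) else if db t < d then - s t else 0)" for t
        have "(\<Sum>t\<in>T. r' t * \<beta> t) = (\<Sum>t\<in>?I \<union> ?Tlow. r' t * \<beta> t)"
          by (rule sum.mono_neutral_right) (use fin in \<open>auto simp: r'_def\<close>)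
        also have "\<dots> = (\<Sum>t\<in>?I. r' t * \<beta> t) + (\<Sum>t\<in>?Tlow. r' t * \<beta> t)"
          by (rule sum.union_disjoint) (use fin in auto)
        also have "\<dots> = (\<Sum>t\<in>?I. const (\<alpha> t) * \<beta> t) - (\<Sum>t\<in>?Tlow. s t * \<beta> t)"
          unfolding diff_conv_add_uminus sum_negf[symmetric]
          by (intro arg_cong2[where f = "(+)"] sum.cong refl) (auto simp: r'_def)
        also have "\<dots> = 0" using s by simp
        finally have rel: "(\<Sum>t\<in>T. r' t * \<beta> t) = 0" .
        have "r' i = 0" by (rule indep[OF _ rel]) (use i s_sym in \<open>auto simp: r'_def sym_uminus\<close>)
        then show "\<alpha> i = 0" using i by (simp add: r'_def const_def) (metis lookup_single_eq lookup_zero)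
      qed (use fin in auto)
      have "(\<Sum>t\<in>?I. const (u t) * (\<beta> t - low t)) = (\<Sum>t\<in>?I. \<Sum>x\<in>?\<Lambda>. const (u t * m t x) * f x)"
        by (simp add: \<beta> sum_distrib_left const_simps mult.assoc)
      also have "\<dots> = (\<Sum>x\<in>?\<Lambda>. const (\<Sum>t\<in>?I. u t * m t x) * f x)"
        by (subst sum.swap) (simp only: const_simps sum_distrib_right)
      also have "\<dots> = (\<Sum>x\<in>?\<Lambda>. if x = y then f x else 0)"
        by (intro sum.cong refl) (simp only: u, simp add: const_1)
      also have "\<dots> = f y" using y' fin by simp
      finally have "f y = (\<Sum>t\<in>?I. const (u t) * (\<beta> t - low t))" by simp
      also have "\<dots> \<in> rspan N (\<beta> ` {t \<in> T. db t \<le> d})"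
        unfolding diff_conv_add_uminus
      proof (intro rspan_sum rspan_mult rspan_add rspan_uminus sym_const)
        fix t assume t: "t \<in> ?I"
        show "\<beta> t \<in> rspan N (\<beta> ` {t \<in> T. db t \<le> d})" by (rule rspan_base) (use t in auto)
        show "low t \<in> rspan N (\<beta> ` {t \<in> T. db t \<le> d})" by (rule rspan_mono[OF low[OF t]]) auto
      qed
      finally show "f y \<in> rspan N (\<beta> ` {t \<in> T. db t \<le> d})" .
    qed
  qed
  with x have "f x \<in> rspan N (\<beta> ` {t \<in> T. db t \<le> df x})" by blast
  then show ?thesis by (rule rspan_mono) auto
qed

section \<open>The basis theorem, given the numbers of elements of each degree\<close>

lemma ext_power_add: "P \<in> ext_power n l \<Longrightarrow> Q \<in> ext_power n l \<Longrightarrow> P + Q \<in> ext_power n l"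
proof -
  assume P: "P \<in> ext_power n l" and Q: "Q \<in> ext_power n l"
  have "vars_in {1..l} (P + Q)" "deg_le (2 * n) (P + Q)" "coeffs_in (sym_polys (2 * n + 1)) (P + Q)"
    using ext_powerD[OF P] ext_powerD[OF Q] by (auto intro: vars_in_add deg_le_add coeffs_in_add)
  then show ?thesis
    using ext_powerD(4)[OF P] ext_powerD(4)[OF Q]
    by (auto simp: ext_power_def vars_in_def deg_le_def coeffs_in_def rename_simps distrib_left)
qed

lemma ext_power_const_mult: "P \<in> ext_power n l \<Longrightarrow> r \<in> sym_polys (2 * n + 1) \<Longrightarrow> const r * P \<in> ext_power n l"
proof -
  assume P: "P \<in> ext_power n l" and r: "r \<in> sym_polys (2 * n + 1)"
  have "vars_in {1..l} (const r * P)" "deg_le (2 * n) (const r * P)" "coeffs_in (sym_polys (2 * n + 1)) (const r * P)"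
    using ext_powerD[OF P] r by (auto intro: vars_in_mult deg_le_const_mult coeffs_in_mult)
  then show ?thesis
    using ext_powerD(4)[OF P]
    by (auto simp: ext_power_def vars_in_def deg_le_def coeffs_in_def rename_simps mult_ac)
qed

lemma U_iff: "P \<in> U n l \<longleftrightarrow> P \<in> ext_power n l \<and>
    (\<forall>X y x s. x \<noteq> 0 \<longrightarrow> s \<in> {1, -1} \<longrightarrow> eval_Xx (X(l := s * inverse x)) (y(2 * n := x, 2 * n + 1 := - x)) P = 0)"
  unfolding U_def mem_Collect_eq ..

lemma U_add: "P \<in> U n l \<Longrightarrow> Q \<in> U n l \<Longrightarrow> P + Q \<in> U n l"
  unfolding U_iff by (simp add: ext_power_add eval_Xx_simps del: insert_iff)

lemma U_const_mult: "P \<in> U n l \<Longrightarrow> r \<in> sym_polys (2 * n + 1) \<Longrightarrow> const r * P \<in> U n l"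
  unfolding U_iff by (simp add: ext_power_const_mult eval_Xx_simps del: insert_iff)

lemma U_0: "0 \<in> U n l"
  unfolding U_iff by (simp add: ext_power_def eval_Xx_simps rename_simps del: insert_iff)

lemma U_sum: "(\<And>i. i \<in> A \<Longrightarrow> f i \<in> U n l) \<Longrightarrow> sum f A \<in> U n l"
  by (induction A rule: infinite_finite_induct) (auto intro: U_add U_0)

abbreviation bas_deg :: "index + index \<Rightarrow> nat" where
  "bas_deg \<equiv> case_sum index_deg index_deg"

text \<open>\<open>inverted\<close> raises degrees by \<open>2 * n * l\<close>, while
  \<open>schur_family\<close> has degree \<open>l * (N - l) + (l choose 2)\<close> above the sum of
  the subset. The two shifts differ by \<open>l choose 2\<close>, the shift in the hypothesis on
  cardinalities. Spanning pulls back to \<open>U n l\<close>, since \<open>inverted\<close> is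
  injective there for \<open>l \<le> 2 * n + 1\<close> and \<open>U n l\<close> is zero for larger
  \<open>l\<close>.\<close>

theorem bas_basis:
  assumes n: "n \<ge> 1" and l: "l \<ge> 1"
    and card: "\<And>d. card {t \<in> bas_index n l. bas_deg t + (l choose 2) = d} =
      card {A. A \<subseteq> {..<2 * n + 1} \<and> card A = l \<and> \<Sum>A = d}"
  shows "is_module_basis (sym_polys (2 * n + 1)) (\<lambda>c P. const c * P) (U n l) (bas_index n l) (bas n l)"
  unfolding is_module_basis_def
proof (intro conjI)
  let ?R = "sym_polys (2 * n + 1)" and ?T = "bas_index n l"
  note bp = bas_props[OF n l]
  show "finite ?T" by (rule finite_bas_index)
  show "\<forall>c. (\<forall>i\<in>?T. c i \<in> ?R) \<longrightarrow> (\<Sum>i\<in>?T. const (c i) * bas n l i) = 0 \<longrightarrow> (\<forall>i\<in>?T. c i = 0)"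
    using bas_independent[OF n l] by blast
  show "U n l = {(\<Sum>i\<in>?T. const (c i) * bas n l i) | c. \<forall>i\<in>?T. c i \<in> ?R}"
  proof (intro set_eqI iffI)
    fix P assume "P \<in> {(\<Sum>i\<in>?T. const (c i) * bas n l i) | c. \<forall>i\<in>?T. c i \<in> ?R}"
    then show "P \<in> U n l" using bp(3) by (auto intro!: U_sum U_const_mult)
  next
    fix P assume P: "P \<in> U n l"
    have inj: "Q = 0" if "Q \<in> U n l" "l \<le> 2 * n + 1 \<Longrightarrow> inverted n l Q = 0" for Q
      using inverted_eq_0D[of Q n l] that by (simp add: U_iff)
    have "\<exists>c. (\<forall>i. c i \<in> ?R) \<and> P = (\<Sum>i\<in>?T. const (c i) * bas n l i)"
    proof (cases "l \<le> 2 * n + 1")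
      case False
      then have U0: "Q = 0" if "Q \<in> U n l" for Q using inj that by blast
      show ?thesis
        by (rule exI[of _ "\<lambda>_. 0"]) (simp add: U0[OF P])
    next
      case True
      let ?N = "2 * n + 1"
      let ?A = "{A. A \<subseteq> {..<?N} \<and> card A = l}" and ?\<beta> = "\<lambda>t. inverted n l (bas n l t)"
      have fam: "schur_family ?N l x \<in> rspan ?N (?\<beta> ` ?T)" if "x \<in> ?A" for x
      proof (rule rspan_by_degrees[where A = ?A and df = "\<lambda>A. l * (?N - l) + (l choose 2) + \<Sum>A" and db = "\<lambda>t. bas_deg t + 2 * n * l"])
        show "finite ?A" by (rule finite_subset[of _ "Pow {..<?N}"]) auto
        show "xhom (int (l * (?N - l) + (l choose 2) + \<Sum>A)) (schur_family ?N l A)" if "A \<in> ?A" for A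
          using xhom_schur_family[of A ?N l] that True by auto
        show "xhom (int (bas_deg t + 2 * n * l)) (?\<beta> t)" if t: "t \<in> ?T" for t
        proof -
          have "bas n l t \<in> ext_power n l" using bp(3)[OF t] by (simp add: U_iff)
          then show ?thesis
            using xhom_inverted[OF ext_powerD(1,2) bp(4)[OF t]] by simp
        qed
        show "?\<beta> t \<in> rspan ?N (schur_family ?N l ` ?A)" if "t \<in> ?T" for t
          using inverted_rspan[OF bp(3)[OF that] n True] .
        show "r t = 0" if r: "\<And>t. r t \<in> ?R" and rel: "(\<Sum>t\<in>?T. r t * ?\<beta> t) = 0" and t: "t \<in> ?T" for r t
        proof -
          let ?Q = "\<Sum>t\<in>?T. const (r t) * bas n l t"
          have "?Q = 0"
          proof (rule inj)
            show "?Q \<in> U n l" by (intro U_sum U_const_mult r bp(3))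
            show "inverted n l ?Q = 0" using rel by (simp only: inverted_sum inverted_const_mult)
          qed
          then show ?thesis using bas_independent[OF n l] t by blast
        qed
        show "card {t \<in> ?T. bas_deg t + 2 * n * l = d} = card {x \<in> ?A. l * (?N - l) + (l choose 2) + \<Sum>x = d}" for d
        proof -
          let ?c = "l * (?N - l) + (l choose 2)"
          have "even (l * (l - 1))" by auto
          then have "2 * (l choose 2) = l * (l - 1)" by (simp add: choose_two)
          moreover have "l * (?N - l) + l * (l - 1) = 2 * n * l"
          proof -
            have "?N - l + (l - 1) = 2 * n" using True l by simp
            then show ?thesis by (metis distrib_left mult.commute)
          qed
          ultimately have c: "?c + (l choose 2) = 2 * n * l" by simp
          show ?thesis
          proof (cases "?c \<le> d")
            case True
            then have "{t \<in> ?T. bas_deg t + 2 * n * l = d} = {t \<in> ?T. bas_deg t + (l choose 2) = d - ?c}"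
              and "{x \<in> ?A. ?c + \<Sum>x = d} = {A. A \<subseteq> {..<?N} \<and> card A = l \<and> \<Sum>A = d - ?c}"
              using c by auto
            then show ?thesis using card[of "d - ?c"] by simp
          next
            case False
            then have "{t \<in> ?T. bas_deg t + 2 * n * l = d} = {}" "{x \<in> ?A. ?c + \<Sum>x = d} = {}"
              using c by auto
            then show ?thesis by (simp only: card.empty)
          qed
        qed
      qed (use that finite_bas_index in auto)
      have mem: "inverted n l P \<in> rspan ?N (?\<beta> ` ?T)"
        by (rule rspan_trans[OF inverted_rspan[OF P n True]]) (use fam in auto)
      from rspan_sumE[OF mem finite_bas_index]
      obtain r where r: "\<And>t. r t \<in> ?R" "inverted n l P = (\<Sum>t\<in>?T. r t * ?\<beta> t)" by blast
      let ?Q = "\<Sum>t\<in>?T. const (r t) * bas n l t"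
      have "P + const (-1) * ?Q = 0"
      proof (rule inj)
        show "P + const (-1) * ?Q \<in> U n l"
          by (intro U_add P U_const_mult U_sum r bp(3) sym_uminus sym_1)
        show "inverted n l (P + const (-1) * ?Q) = 0"
          by (simp only: inverted_add inverted_const_mult inverted_sum r(2)) (simp add: const_simps const_1)
      qed
      then have "P = ?Q" by (simp add: const_simps const_1)
      then show ?thesis using r(1) by blast
    qed
    then show "P \<in> {(\<Sum>i\<in>?T. const (c i) * bas n l i) | c. \<forall>i\<in>?T. c i \<in> ?R}" by blast
  qed
qed

section \<open>The generating function\<close>

lemma qfact_0 [simp]: "qfact q 0 = 1"
  by (simp add: qfact_def)

lemma qfact_Suc: "qfact q (Suc m) = qfact q m * (1 - q ^ Suc m)"
  by (simp add: qfact_def)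

text \<open>Not a root of unity: all q-factorials, in base \<open>q\<close> and in base
  \<open>q\<^sup>2\<close>, are then invertible.\<close>

definition q_generic :: "'a::field \<Rightarrow> bool" where
  "q_generic q \<longleftrightarrow> (\<forall>k>0. q ^ k \<noteq> 1)"

lemma qfact_nz: "q_generic q \<Longrightarrow> qfact q m \<noteq> 0"
  by (auto simp: qfact_def q_generic_def)

lemma q_generic_square: "q_generic q \<Longrightarrow> q_generic (q\<^sup>2)"
  by (auto simp: q_generic_def simp flip: power_mult)

lemma qbinomial_0 [simp]: "q_generic q \<Longrightarrow> qbinomial q m 0 = 1"
  by (simp add: qbinomial_def qfact_nz)

lemma qbinomial_self: "q_generic q \<Longrightarrow> qbinomial q m m = 1"
  by (simp add: qbinomial_def qfact_nz)

lemma qbinomial_eq_0: "m < l \<Longrightarrow> qbinomial q m l = 0"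
  by (simp add: qbinomial_def)

text \<open>For \<open>l < m\<close>, \<open>1 - q ^ Suc m\<close> is split as
  \<open>(1 - q ^ (m - l)) + q ^ (m - l) * (1 - q ^ Suc l)\<close>; each summand cancels one factor
  of the denominator.\<close>

lemma qbinomial_pascal:
  assumes q: "q_generic q"
  shows "qbinomial q (Suc m) (Suc l) = qbinomial q m (Suc l) + q ^ (m - l) * qbinomial q m l"
proof -
  consider "l < m" | "l = m" | "l > m" by linarith
  then show ?thesis
  proof cases
    case 1
    then obtain d where m: "m = Suc (l + d)" using less_imp_Suc_add by blast
    note nz = qfact_nz[OF q]
    have c: "1 - q ^ k \<noteq> 0" if "k > 0" for k using q that by (auto simp: q_generic_def)
    have aux: "A * (x + p * y) / (L * y * (D * x)) = A / (L * y * D) + p * (A / (L * (D * x)))"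
      if "x \<noteq> 0" "y \<noteq> 0" "L \<noteq> 0" "D \<noteq> 0" for A x y p L D :: 'a
      using that by (simp add: divide_simps) (simp add: algebra_simps)
    have "qbinomial q (Suc m) (Suc l) = qfact q m * (1 - q ^ Suc m) / (qfact q l * (1 - q ^ Suc l) * (qfact q d * (1 - q ^ Suc d)))"
      by (simp add: qbinomial_def m qfact_Suc)
    also have "1 - q ^ Suc m = (1 - q ^ Suc d) + q ^ Suc d * (1 - q ^ Suc l)"
      by (simp add: m algebra_simps power_add)
    also have "qfact q m * ((1 - q ^ Suc d) + q ^ Suc d * (1 - q ^ Suc l)) / (qfact q l * (1 - q ^ Suc l) * (qfact q d * (1 - q ^ Suc d))) =
        qfact q m / (qfact q l * (1 - q ^ Suc l) * qfact q d) + q ^ Suc d * (qfact q m / (qfact q l * (qfact q d * (1 - q ^ Suc d))))"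
      by (rule aux) (rule nz c zero_less_Suc)+
    also have "qfact q m / (qfact q l * (1 - q ^ Suc l) * qfact q d) = qbinomial q m (Suc l)"
      by (simp add: qbinomial_def m qfact_Suc)
    also have "qfact q m / (qfact q l * (qfact q d * (1 - q ^ Suc d))) = qbinomial q m l"
      by (simp add: qbinomial_def m qfact_Suc)
    also have "Suc d = m - l" by (simp add: m)
    finally show ?thesis .
  next
    case 2
    then show ?thesis using q by (simp add: qbinomial_self qbinomial_eq_0)
  next
    case 3
    then show ?thesis by (simp add: qbinomial_eq_0)
  qed
qed

lemma qbinomial_absorb:
  assumes q: "q_generic q" and "l \<le> Suc m"
  shows "(1 - q ^ (Suc m - l)) * qbinomial q (Suc m) l = (1 - q ^ Suc m) * qbinomial q m l"
proof (cases "l \<le> m")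
  case True
  then obtain d where m: "m = l + d" using le_Suc_ex by blast
  have "1 - q ^ Suc d \<noteq> 0" using q by (auto simp: q_generic_def)
  then show ?thesis
    using qfact_nz[OF q, of l] qfact_nz[OF q, of d] by (simp add: qbinomial_def m qfact_Suc field_simps Suc_diff_le del: power_Suc)
next
  case False
  then have "l = Suc m" using assms by simp
  then show ?thesis by (simp add: qbinomial_eq_0)
qed

subsection \<open>Sums over increasing sequences\<close>

text \<open>The split by whether \<open>m\<close> belongs to the set is Pascal's rule, since
  \<open>m + (l choose 2) = (Suc l choose 2) + (m - l)\<close> for \<open>l \<le> m\<close>.\<close>

lemma sum_subsets:
  assumes q: "q_generic q"
  shows "(\<Sum>A | A \<subseteq> {..<m} \<and> card A = l. q ^ (\<Sum>A)) = q ^ (l choose 2) * qbinomial q m l"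
proof (induction m arbitrary: l)
  case 0
  have "{A. A \<subseteq> {..<0::nat} \<and> card A = l} = (if l = 0 then {{}} else {})" by auto
  then show ?case using q by (auto simp: qbinomial_eq_0 numeral_2_eq_2)
next
  case (Suc m)
  show ?case
  proof (cases l)
    case 0
    have "{A. A \<subseteq> {..<Suc m} \<and> card A = 0} = {{}}" by (auto dest: finite_subset)
    then show ?thesis using 0 q by (simp add: numeral_2_eq_2)
  next
    case (Suc l')
    let ?S = "\<lambda>m l. {A. A \<subseteq> {..<m} \<and> card A = l}"
    have fin: "finite (?S m l)" for m l :: nat by (rule finite_subset[of _ "Pow {..<m}"]) auto
    have eq: "?S (Suc m) (Suc l') = ?S m (Suc l') \<union> insert m ` ?S m l'"
    proof (intro set_eqI iffI)
      fix A assume A: "A \<in> ?S (Suc m) (Suc l')"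
      show "A \<in> ?S m (Suc l') \<union> insert m ` ?S m l'"
      proof (cases "m \<in> A")
        case True
        have "finite A" using A by (auto dest: finite_subset)
        then have "A - {m} \<in> ?S m l'" using A True by (auto simp: less_Suc_eq)
        then have "insert m (A - {m}) \<in> insert m ` ?S m l'" by (rule imageI)
        then show ?thesis using True by (simp only: insert_Diff Un_iff simp_thms)
      next
        case False
        then have "A \<subseteq> {..<m}" using A by (auto simp: less_Suc_eq)
        then show ?thesis using A by auto
      qed
    next
      fix A assume "A \<in> ?S m (Suc l') \<union> insert m ` ?S m l'"
      then show "A \<in> ?S (Suc m) (Suc l')"
      proof
        assume "A \<in> insert m ` ?S m l'"
        then obtain B where B: "A = insert m B" "B \<subseteq> {..<m}" "card B = l'" by auto
        then have "finite B" "m \<notin> B" by (auto dest: finite_subset)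
        then show ?thesis using B by auto
      qed auto
    qed
    have "(\<Sum>A\<in>?S (Suc m) (Suc l'). q ^ (\<Sum>A)) = (\<Sum>A\<in>?S m (Suc l'). q ^ (\<Sum>A)) + (\<Sum>A\<in>insert m ` ?S m l'. q ^ (\<Sum>A))"
      unfolding eq by (rule sum.union_disjoint) (use fin in auto)
    also have "(\<Sum>A\<in>insert m ` ?S m l'. q ^ (\<Sum>A)) = (\<Sum>A\<in>?S m l'. q ^ m * q ^ (\<Sum>A))"
    proof (subst sum.reindex)
      show "inj_on (insert m) (?S m l')" by (rule inj_onI) (metis (no_types, lifting) insert_ident lessThan_iff less_irrefl mem_Collect_eq subsetD)
      show "sum ((\<lambda>A. q ^ \<Sum>A) \<circ> insert m) (?S m l') = (\<Sum>A\<in>?S m l'. q ^ m * q ^ (\<Sum>A))"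
      proof (intro sum.cong refl)
        fix A assume "A \<in> ?S m l'"
        then have "finite A" "m \<notin> A" by (auto dest: finite_subset)
        then show "((\<lambda>A. q ^ \<Sum>A) \<circ> insert m) A = q ^ m * q ^ (\<Sum>A)" by (simp add: power_add)
      qed
    qed
    also have "\<dots> = q ^ m * (q ^ (l' choose 2) * qbinomial q m l')" by (simp add: Suc.IH flip: sum_distrib_left)
    also have "q ^ m * (q ^ (l' choose 2) * qbinomial q m l') = q ^ (Suc l' choose 2) * (q ^ (m - l') * qbinomial q m l')"
    proof (cases "l' \<le> m")
      case True
      then have "m + (l' choose 2) = (Suc l' choose 2) + (m - l')" by (simp add: numeral_2_eq_2)
      then show ?thesis by (metis (no_types, lifting) mult.assoc power_add)
    qed (simp add: qbinomial_eq_0)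
    finally show ?thesis
      using qbinomial_pascal[OF q, of m l'] by (simp add: Suc Suc.IH distrib_left)
  qed
qed

definition strict_lists :: "nat \<Rightarrow> nat \<Rightarrow> nat list set" where
  "strict_lists n r = {xs. sorted_wrt (<) xs \<and> set xs \<subseteq> {1..n} \<and> length xs = r}"

definition weak_lists :: "nat \<Rightarrow> nat \<Rightarrow> nat list set" where
  "weak_lists n r = {xs. sorted_wrt (\<le>) xs \<and> set xs \<subseteq> {1..n} \<and> length xs = r}"

lemma finite_strict_lists: "finite (strict_lists n r)" and finite_weak_lists: "finite (weak_lists n r)"
  by (rule finite_subset[OF _ finite_lists_length_eq[of "{1..n}" r]]; force simp: strict_lists_def weak_lists_def)+

lemma lists_0:
  "strict_lists n 0 = {[]}" "weak_lists n 0 = {[]}"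
  "strict_lists 0 (Suc r) = {}" "weak_lists 0 (Suc r) = {}"
  by (auto simp: strict_lists_def weak_lists_def)

lemma strict_lists_Suc: "strict_lists (Suc n) (Suc r) = strict_lists n (Suc r) \<union> (\<lambda>xs. xs @ [Suc n]) ` strict_lists n r"
proof (intro set_eqI iffI)
  fix xs assume xs: "xs \<in> strict_lists (Suc n) (Suc r)"
  then obtain ys y where y: "xs = ys @ [y]" by (cases xs rule: rev_cases) (auto simp: strict_lists_def)
  show "xs \<in> strict_lists n (Suc r) \<union> (\<lambda>xs. xs @ [Suc n]) ` strict_lists n r"
  proof (cases "y = Suc n")
    case True
    then have "ys \<in> strict_lists n r" using xs y by (fastforce simp: strict_lists_def sorted_wrt_append)
    then show ?thesis using y True by auto
  next
    case False
    then show ?thesis using xs y by (fastforce simp: strict_lists_def sorted_wrt_append)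
  qed
qed (fastforce simp: strict_lists_def sorted_wrt_append)

lemma weak_lists_Suc: "weak_lists (Suc n) (Suc r) = weak_lists n (Suc r) \<union> (\<lambda>xs. xs @ [Suc n]) ` weak_lists (Suc n) r"
proof (intro set_eqI iffI)
  fix xs assume xs: "xs \<in> weak_lists (Suc n) (Suc r)"
  then obtain ys y where y: "xs = ys @ [y]" by (cases xs rule: rev_cases) (auto simp: weak_lists_def)
  show "xs \<in> weak_lists n (Suc r) \<union> (\<lambda>xs. xs @ [Suc n]) ` weak_lists (Suc n) r"
  proof (cases "y = Suc n")
    case True
    then have "ys \<in> weak_lists (Suc n) r" using xs y by (fastforce simp: weak_lists_def sorted_wrt_append)
    then show ?thesis using y True by auto
  next
    case False
    then show ?thesis using xs y by (fastforce simp: weak_lists_def sorted_wrt_append)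
  qed
qed (fastforce simp: weak_lists_def sorted_wrt_append)

lemma sum_strict_lists_Suc:
  fixes q :: "'a::comm_ring_1"
  shows "(\<Sum>xs\<in>strict_lists (Suc n) (Suc r). q ^ (\<Sum>i\<leftarrow>xs. e i)) =
    (\<Sum>xs\<in>strict_lists n (Suc r). q ^ (\<Sum>i\<leftarrow>xs. e i)) + q ^ e (Suc n) * (\<Sum>xs\<in>strict_lists n r. q ^ (\<Sum>i\<leftarrow>xs. e i))"
proof -
  have "strict_lists n (Suc r) \<inter> (\<lambda>xs. xs @ [Suc n]) ` strict_lists n r = {}"
    by (auto simp: strict_lists_def)
  then show ?thesis
    by (simp add: strict_lists_Suc sum.union_disjoint finite_strict_lists sum.reindex inj_on_def power_add sum_distrib_left mult_ac)
qed

lemma sum_weak_lists_Suc: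
  fixes q :: "'a::comm_ring_1"
  shows "(\<Sum>xs\<in>weak_lists (Suc n) (Suc r). q ^ (\<Sum>i\<leftarrow>xs. e i)) =
    (\<Sum>xs\<in>weak_lists n (Suc r). q ^ (\<Sum>i\<leftarrow>xs. e i)) + q ^ e (Suc n) * (\<Sum>xs\<in>weak_lists (Suc n) r. q ^ (\<Sum>i\<leftarrow>xs. e i))"
proof -
  have "weak_lists n (Suc r) \<inter> (\<lambda>xs. xs @ [Suc n]) ` weak_lists (Suc n) r = {}"
    by (auto simp: weak_lists_def)
  then show ?thesis
    by (simp add: weak_lists_Suc sum.union_disjoint finite_weak_lists sum.reindex inj_on_def power_add sum_distrib_left mult_ac)
qed

definition v_sum :: "'a::field \<Rightarrow> nat \<Rightarrow> nat \<Rightarrow> 'a" where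
  "v_sum q n r = (\<Sum>xs\<in>strict_lists n r. q ^ (\<Sum>i\<leftarrow>xs. 2 * i - 1))"

definition w_sum :: "'a::field \<Rightarrow> nat \<Rightarrow> nat \<Rightarrow> 'a" where
  "w_sum q n r = (\<Sum>xs\<in>strict_lists n r. q ^ (\<Sum>j\<leftarrow>xs. 2 * j))"

definition xi_sum :: "'a::field \<Rightarrow> nat \<Rightarrow> nat \<Rightarrow> 'a" where
  "xi_sum q n r = (\<Sum>xs\<in>weak_lists n r. q ^ (\<Sum>k\<leftarrow>xs. 2 * (k - 1)))"

text \<open>The first \<open>r\<close> odd numbers add up to \<open>r\<^sup>2\<close>; the split by
  the largest entry is Pascal's rule in base \<open>q\<^sup>2\<close>.\<close>

lemma v_sum_eq:
  assumes q: "q_generic q"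
  shows "v_sum q n r = q ^ (r\<^sup>2) * qbinomial (q\<^sup>2) n r"
proof (induction n arbitrary: r)
  case 0
  show ?case using q_generic_square[OF q] by (cases r) (simp_all add: v_sum_def lists_0 qbinomial_eq_0)
next
  case (Suc n)
  show ?case
  proof (cases r)
    case 0
    then show ?thesis using q_generic_square[OF q] by (simp add: v_sum_def lists_0)
  next
    case (Suc r')
    have "q ^ (2 * Suc n - 1) * (q ^ (r'\<^sup>2) * qbinomial (q\<^sup>2) n r') = q ^ ((Suc r')\<^sup>2) * ((q\<^sup>2) ^ (n - r') * qbinomial (q\<^sup>2) n r')"
    proof (cases "r' \<le> n")
      case True
      then have "2 * Suc n - 1 + r'\<^sup>2 = (Suc r')\<^sup>2 + 2 * (n - r')" by (simp add: power2_eq_square)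
      then show ?thesis by (metis (no_types, lifting) mult.assoc power_add power_mult)
    qed (simp add: qbinomial_eq_0)
    moreover have "v_sum q (Suc n) (Suc r') = v_sum q n (Suc r') + q ^ (2 * Suc n - 1) * v_sum q n r'"
      unfolding v_sum_def by (rule sum_strict_lists_Suc)
    ultimately show ?thesis
      using qbinomial_pascal[OF q_generic_square[OF q], of n r'] by (simp add: Suc Suc.IH distrib_left)
  qed
qed

lemma w_sum_0 [simp]: "w_sum q n 0 = 1" and w_sum_Suc0: "w_sum q 0 (Suc r) = 0"
  by (simp_all add: w_sum_def lists_0)

lemma w_sum_Suc: "w_sum q (Suc n) (Suc r) = w_sum q n (Suc r) + q ^ (2 * Suc n) * w_sum q n r"
  unfolding w_sum_def by (rule sum_strict_lists_Suc)

lemma w_sum_eq_0: "n < r \<Longrightarrow> w_sum q n r = 0"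
proof (induction n arbitrary: r)
  case 0
  then show ?case by (cases r) (auto simp: w_sum_Suc0)
next
  case (Suc n)
  then show ?case by (cases r) (auto simp: w_sum_Suc)
qed

text \<open>Splitting at the largest entry lowers either the bound or the length, hence the nested
  induction.\<close>

lemma xi_sum_eq:
  assumes q: "q_generic q"
  shows "xi_sum q n r = qbinomial (q\<^sup>2) (n + r - 1) r"
proof (induction r arbitrary: n)
  case 0
  then show ?case using q_generic_square[OF q] by (simp add: xi_sum_def lists_0)
next
  case (Suc r)
  note IH = Suc
  show ?case
  proof (induction n)
    case 0
    then show ?case by (simp add: xi_sum_def lists_0 qbinomial_eq_0)
  next
    case (Suc n)
    have "xi_sum q (Suc n) (Suc r) = xi_sum q n (Suc r) + q ^ (2 * (Suc n - 1)) * xi_sum q (Suc n) r"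
      unfolding xi_sum_def by (rule sum_weak_lists_Suc)
    then show ?case
      using qbinomial_pascal[OF q_generic_square[OF q], of "n + r" r] by (simp add: Suc IH power_mult)
  qed
qed

definition bas_gen :: "'a::field \<Rightarrow> nat \<Rightarrow> nat \<Rightarrow> 'a" where
  "bas_gen q n m = (\<Sum>t\<in>bas_minus_index n m. q ^ index_deg t)"

text \<open>Grouping by \<open>a = length I\<close> and \<open>c = length K\<close>: these determine
  the length of \<open>J\<close> and all upper bounds, so each group is a product of three sets of
  sequences.\<close>

lemma bas_gen_eq:
  "bas_gen q n m = (\<Sum>(a, c) | a + 2 * c \<le> m.
     v_sum q n a * w_sum q (n - a - c) (m - a - 2 * c) * xi_sum q (n + 1 - a - c) c)"
proof -
  let ?S = "{(a, c). a + 2 * c \<le> m}"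
  let ?B = "\<lambda>(a, c). strict_lists n a \<times> strict_lists (n - a - c) (m - a - 2 * c) \<times> weak_lists (n + 1 - a - c) c"
  have fin: "finite ?S" by (rule finite_subset[of _ "{..m} \<times> {..m}"]) auto
  have "bas_minus_index n m = (\<Union>x\<in>?S. ?B x)"
  proof (intro set_eqI iffI)
    fix t assume "t \<in> bas_minus_index n m"
    then obtain I J K where t: "t = (I, J, K)" "(I, J, K) \<in> bas_minus_index n m" by (cases t) auto
    then have "(length I, length K) \<in> ?S" "t \<in> ?B (length I, length K)"
      by (auto simp: bas_minus_index_def strict_lists_def weak_lists_def)
    then show "t \<in> (\<Union>x\<in>?S. ?B x)" by blast
  next
    fix t assume "t \<in> (\<Union>x\<in>?S. ?B x)"
    then obtain a c where ac: "a + 2 * c \<le> m" and t: "t \<in> ?B (a, c)" by blast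
    obtain I J K where t': "t = (I, J, K)" by (cases t)
    have I: "sorted_wrt (<) I" "set I \<subseteq> {1..n}" "length I = a" and
      J: "sorted_wrt (<) J" "set J \<subseteq> {1..n - a - c}" "length J = m - a - 2 * c" and
      K: "sorted_wrt (\<le>) K" "set K \<subseteq> {1..n + 1 - a - c}" "length K = c"
      using t by (auto simp: t' strict_lists_def weak_lists_def)
    have "1 \<le> j \<and> j + a + c \<le> n" if "j \<in> set J" for j using subsetD[OF J(2) that] by auto
    moreover have "1 \<le> k \<and> k + a + c \<le> n + 1" if "k \<in> set K" for k using subsetD[OF K(2) that] by auto
    ultimately show "t \<in> bas_minus_index n m"
      using I J K ac by (auto simp: t' bas_minus_index_def)
  qed
  then have "bas_gen q n m = (\<Sum>x\<in>?S. \<Sum>t\<in>?B x. q ^ index_deg t)"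
    unfolding bas_gen_def
  proof (simp only:, intro sum.UNION_disjoint)
    show "\<forall>x\<in>?S. finite (?B x)" by (auto simp: finite_strict_lists finite_weak_lists)
    show "\<forall>x\<in>?S. \<forall>y\<in>?S. x \<noteq> y \<longrightarrow> ?B x \<inter> ?B y = {}" by (auto simp: strict_lists_def weak_lists_def)
  qed (rule fin)
  also have "\<dots> = (\<Sum>(a, c)\<in>?S. v_sum q n a * w_sum q (n - a - c) (m - a - 2 * c) * xi_sum q (n + 1 - a - c) c)"
  proof (intro sum.cong refl)
    fix x assume "x \<in> ?S"
    obtain a c where x: "x = (a, c)" by (cases x)
    have "(\<Sum>t\<in>?B (a, c). q ^ index_deg t) = v_sum q n a * (w_sum q (n - a - c) (m - a - 2 * c) * xi_sum q (n + 1 - a - c) c)"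
      unfolding v_sum_def w_sum_def xi_sum_def sum_product prod.case
      by (simp add: sum.cartesian_product' sum_distrib_left power_add mult_ac)
    then show "(\<Sum>t\<in>?B x. q ^ index_deg t) = (case x of (a, c) \<Rightarrow> v_sum q n a * w_sum q (n - a - c) (m - a - 2 * c) * xi_sum q (n + 1 - a - c) c)"
      by (simp add: x mult.assoc)
  qed
  finally show ?thesis .
qed

subsection \<open>The recursion of the generating polynomials\<close>

definition bas_poly :: "'a::field \<Rightarrow> nat \<Rightarrow> 'a poly" where
  "bas_poly q n = (\<Sum>(a, c) | a + c \<le> n.
     monom (v_sum q n a * xi_sum q (n + 1 - a - c) c) (a + 2 * c) * (\<Sum>r\<le>n - a - c. monom (w_sum q (n - a - c) r) r))"

text \<open>\<open>bas_poly\<close> is cut off at \<open>a + c \<le> n\<close>. Beyond that either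
  \<open>c = 0\<close> and \<open>v_sum\<close> vanishes, or the entries of \<open>K\<close> have an
  empty range and \<open>xi_sum\<close> vanishes.\<close>

lemma coeff_bas_poly:
  assumes q: "q_generic q"
  shows "coeff (bas_poly q n) m = bas_gen q n m"
proof -
  let ?S = "{(a, c). a + 2 * c \<le> m}" and ?T = "{(a, c). a + c \<le> n}"
  let ?f = "\<lambda>(a, c). v_sum q n a * xi_sum q (n + 1 - a - c) c * w_sum q (n - a - c) (m - a - 2 * c)"
  have finT: "finite ?T" by (rule finite_subset[of _ "{..n} \<times> {..n}"]) auto
  have finS: "finite ?S" by (rule finite_subset[of _ "{..m} \<times> {..m}"]) auto
  have w: "coeff (\<Sum>r\<le>k. monom (w_sum q k r) r) j = w_sum q k j" for k j
    by (simp add: coeff_sum w_sum_eq_0)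
  have "coeff (bas_poly q n) m = (\<Sum>x\<in>?T. if x \<in> ?S then ?f x else 0)"
    unfolding bas_poly_def coeff_sum
    by (intro sum.cong refl) (auto simp: coeff_monom_mult w)
  also have "\<dots> = (\<Sum>x\<in>?T \<inter> ?S. ?f x)" by (simp only: sum.inter_restrict[OF finT])
  also have "\<dots> = (\<Sum>x\<in>?S. ?f x)"
  proof (rule sum.mono_neutral_left[OF finS])
    show "\<forall>x\<in>?S - ?T \<inter> ?S. ?f x = 0"
    proof
      fix x assume x: "x \<in> ?S - ?T \<inter> ?S"
      obtain a c where ac: "x = (a, c)" by (cases x)
      then have "\<not> a + c \<le> n" using x by auto
      moreover have "xi_sum q (n + 1 - a - c) c = 0" if "c > 0" "\<not> a + c \<le> n"
        using that by (simp add: xi_sum_eq[OF q] qbinomial_eq_0)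
      moreover have "v_sum q n a = 0" if "n < a" using that by (simp add: v_sum_eq[OF q] qbinomial_eq_0)
      ultimately have "v_sum q n a = 0 \<or> xi_sum q (n + 1 - a - c) c = 0" by (cases "c = 0") auto
      then show "?f x = 0" unfolding ac by auto
    qed
  qed simp
  also have "\<dots> = bas_gen q n m" unfolding bas_gen_eq by (intro sum.cong refl) (auto simp: mult_ac)
  finally show ?thesis .
qed

lemma smult_sum_right: "smult c (sum f A) = (\<Sum>i\<in>A. smult c (f i))"
  by (induction A rule: infinite_finite_induct) (simp_all add: smult_add_right)

definition w_poly :: "'a::field \<Rightarrow> nat \<Rightarrow> 'a poly" where
  "w_poly q k = (\<Sum>r\<le>k. monom (w_sum q k r) r)"

lemma w_poly_0 [simp]: "w_poly q 0 = 1"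
  by (simp add: w_poly_def monom_0)

lemma w_poly_Suc: "w_poly q (Suc k) = (1 + monom (q ^ (2 * Suc k)) 1) * w_poly q k"
proof (rule poly_eqI)
  fix j
  have w: "coeff (w_poly q k) j = w_sum q k j" for k j
    by (simp add: w_poly_def coeff_sum w_sum_eq_0)
  show "coeff (w_poly q (Suc k)) j = coeff ((1 + monom (q ^ (2 * Suc k)) 1) * w_poly q k) j"
    unfolding distrib_right mult_1_left coeff_add coeff_monom_mult w
    by (cases j) (simp_all add: w_sum_Suc)
qed

context
  fixes q :: "'a::field"
  assumes q: "q_generic q"
begin

abbreviation "qf \<equiv> qfact (q\<^sup>2)"

text \<open>The product of \<open>v_sum\<close> and \<open>xi_sum\<close> is
  \<open>q ^ (a\<^sup>2)\<close> times the multinomial coefficient of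
  \<open>n = a + c + (n - a - c)\<close> in base \<open>q\<^sup>2\<close>. Divided by the factorial
  of \<open>n\<close>, the double sum in \<open>bas_poly\<close> is a convolution of three
  sequences, taken here as coefficients of power series: \<open>monom\<close> carries the variable
  \<open>t\<close>, and \<open>fps_X\<close>, written \<open>z\<close> below, counts
  \<open>n\<close>.\<close>

definition alpha :: "'a poly fps" where "alpha = Abs_fps (\<lambda>j. monom (q ^ (j\<^sup>2) / qf j) j)"
definition beta :: "'a poly fps" where "beta = Abs_fps (\<lambda>j. smult (1 / qf j) (w_poly q j))"
definition gamma :: "'a poly fps" where "gamma = Abs_fps (\<lambda>j. monom (1 / qf j) (2 * j))"

text \<open>The substitution of \<open>q\<^sup>2 * z\<close> for \<open>z\<close>.\<close>

definition dilate :: "'a poly fps \<Rightarrow> 'a poly fps" where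
  "dilate f = Abs_fps (\<lambda>j. smult ((q\<^sup>2) ^ j) (fps_nth f j))"

lemma dilate_mult: "dilate (f * g) = dilate f * dilate g"
proof (rule fps_ext)
  fix k
  have "fps_nth (dilate f * dilate g) k = (\<Sum>i=0..k. smult ((q\<^sup>2) ^ k) (fps_nth f i * fps_nth g (k - i)))"
    unfolding fps_mult_nth dilate_def fps_nth_Abs_fps
    by (intro sum.cong refl) (auto simp: mult_ac simp flip: power_add)
  then show "fps_nth (dilate (f * g)) k = fps_nth (dilate f * dilate g) k"
    by (simp add: dilate_def fps_mult_nth smult_sum_right)
qed

lemma qf_Suc: "qf (Suc j) = qf j * (1 - (q\<^sup>2) ^ Suc j)"
  by (rule qfact_Suc)

lemma qf_nz: "qf j \<noteq> 0" "1 - (q\<^sup>2) ^ Suc j \<noteq> 0"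
  using qfact_nz[OF q_generic_square[OF q]] q_generic_square[OF q] by (auto simp: q_generic_def)

text \<open>Euler's expansion of the formal product of all
  \<open>1 + q ^ (2 * i + 1) * t * z\<close>: splitting off the factor for \<open>i = 0\<close>
  leaves the same product at \<open>q\<^sup>2 * z\<close>.\<close>

lemma alpha_eq: "alpha = (1 + fps_const (monom q 1) * fps_X) * dilate alpha"
proof (rule fps_ext)
  fix k
  show "fps_nth alpha k = fps_nth ((1 + fps_const (monom q 1) * fps_X) * dilate alpha) k"
  proof (cases k)
    case 0
    then show ?thesis by (simp add: alpha_def dilate_def distrib_right mult.assoc)
  next
    case (Suc j)
    have "(Suc j)\<^sup>2 = 1 + 2 * j + j\<^sup>2" by (simp add: power2_eq_square)
    then have e: "q ^ ((Suc j)\<^sup>2) = q * (q\<^sup>2) ^ j * q ^ (j\<^sup>2)" by (simp add: power_add power_mult)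
    have "q ^ ((Suc j)\<^sup>2) / qf (Suc j) = (q\<^sup>2) ^ Suc j * (q ^ ((Suc j)\<^sup>2) / qf (Suc j)) + q * ((q\<^sup>2) ^ j * (q ^ (j\<^sup>2) / qf j))"
      unfolding e qf_Suc using qf_nz[of j] by (simp add: divide_simps del: power_Suc) (simp add: algebra_simps)
    then show ?thesis
      by (simp add: Suc alpha_def dilate_def distrib_right mult.assoc smult_monom mult_monom add_monom del: power_Suc)
  qed
qed

text \<open>Euler's expansion of the inverse of the formal product of all
  \<open>1 - q ^ (2 * i) * t\<^sup>2 * z\<close>.\<close>

lemma gamma_eq: "(1 - fps_const (monom 1 2) * fps_X) * gamma = dilate gamma"
proof (rule fps_ext)
  fix k
  show "fps_nth ((1 - fps_const (monom 1 2) * fps_X) * gamma) k = fps_nth (dilate gamma) k"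
  proof (cases k)
    case 0
    then show ?thesis by (simp add: gamma_def dilate_def left_diff_distrib mult.assoc)
  next
    case (Suc j)
    have "1 / qf (Suc j) - 1 / qf j = (q\<^sup>2) ^ Suc j * (1 / qf (Suc j))"
      unfolding qf_Suc using qf_nz[of j] by (simp add: divide_simps del: power_Suc)
    then show ?thesis
      by (simp add: Suc gamma_def dilate_def left_diff_distrib mult.assoc smult_monom mult_monom diff_monom del: power_Suc)
  qed
qed

text \<open>The q-binomial theorem in base \<open>q\<^sup>2\<close>: \<open>w_poly q j\<close> is
  the product of \<open>1 + q ^ (2 * i) * t\<close> for \<open>i = 1, ..., j\<close>, so the series
  is formally the product of all \<open>1 + q ^ (2 * i + 2) * t * z\<close> divided by that of all
  \<open>1 - q ^ (2 * i) * z\<close>.\<close>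

lemma beta_eq: "(1 - fps_X) * beta = (1 + fps_const (monom (q\<^sup>2) 1) * fps_X) * dilate beta"
proof (rule fps_ext)
  fix k
  show "fps_nth ((1 - fps_X) * beta) k = fps_nth ((1 + fps_const (monom (q\<^sup>2) 1) * fps_X) * dilate beta) k"
  proof (cases k)
    case 0
    then show ?thesis by (simp add: beta_def dilate_def left_diff_distrib distrib_right mult.assoc)
  next
    case (Suc j)
    let ?W = "w_poly q j"
    define u where "u = (q\<^sup>2) ^ Suc j"
    have m: "monom (q ^ (2 * Suc j)) 1 = smult u (monom 1 1)" by (simp only: u_def smult_monom mult_1_right power_mult[symmetric])
    have m2: "monom (q\<^sup>2) 1 = smult (q\<^sup>2) (monom 1 1)" by (simp add: smult_monom)
    have c1: "1 / (qf j * (1 - u)) - 1 / qf j = u * (1 / (qf j * (1 - u)))"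
      using qf_nz[of j] by (simp add: u_def[symmetric] divide_simps del: power_Suc)
    have c2: "u * (1 / (qf j * (1 - u))) = (q\<^sup>2) * ((q\<^sup>2) ^ j * (1 / qf j)) + u * (u * (1 / (qf j * (1 - u))))"
      using qf_nz[of j] unfolding u_def[symmetric]
      by (simp add: divide_simps del: power_Suc) (simp add: u_def algebra_simps)
    have "smult (1 / (qf j * (1 - u))) ((1 + smult u (monom 1 1)) * ?W) - smult (1 / qf j) ?W =
        smult (u * (1 / (qf j * (1 - u)))) ((1 + smult u (monom 1 1)) * ?W) + smult (q\<^sup>2) (monom 1 1) * smult ((q\<^sup>2) ^ j) (smult (1 / qf j) ?W)"
    proof -
      have "smult (1 / (qf j * (1 - u))) ((1 + smult u (monom 1 1)) * ?W) - smult (1 / qf j) ?W =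
          smult (1 / (qf j * (1 - u)) - 1 / qf j) ?W + smult (u * (1 / (qf j * (1 - u)))) (monom 1 1 * ?W)"
        by (simp add: distrib_right smult_add_right smult_diff_left algebra_simps)
      also have "\<dots> = smult (u * (1 / (qf j * (1 - u)))) ?W + smult ((q\<^sup>2) * ((q\<^sup>2) ^ j * (1 / qf j)) + u * (u * (1 / (qf j * (1 - u))))) (monom 1 1 * ?W)"
        by (simp only: c1 c2[symmetric])
      also have "\<dots> = smult (u * (1 / (qf j * (1 - u)))) ((1 + smult u (monom 1 1)) * ?W) + smult (q\<^sup>2) (monom 1 1) * smult ((q\<^sup>2) ^ j) (smult (1 / qf j) ?W)"
        by (simp add: distrib_right distrib_left smult_add_right smult_add_left mult_ac add_ac)
      finally show ?thesis .
    qed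
    then show ?thesis
      unfolding Suc beta_def dilate_def left_diff_distrib distrib_right mult_1_left mult.assoc
      by (simp only: fps_sub_nth fps_add_nth fps_nth_Abs_fps fps_mult_left_const_nth fps_X_mult_nth w_poly_Suc qf_Suc m m2 
          u_def[symmetric] if_False nat.distinct diff_Suc_1 smult_smult simp_thms) (simp add: distrib_right)
  qed
qed

definition gen_fps :: "'a poly fps" where "gen_fps = alpha * beta * gamma"

lemma gen_fps_eq:
  "(1 - fps_const (monom 1 2) * fps_X) * (1 - fps_X) * gen_fps =
   (1 + fps_const (monom q 1) * fps_X) * (1 + fps_const (monom (q\<^sup>2) 1) * fps_X) * dilate gen_fps"
proof -
  have "(1 - fps_const (monom 1 2) * fps_X) * (1 - fps_X) * gen_fps =
      alpha * ((1 - fps_X) * beta) * ((1 - fps_const (monom 1 2) * fps_X) * gamma)"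
    by (simp add: gen_fps_def mult_ac)
  also have "\<dots> = ((1 + fps_const (monom q 1) * fps_X) * dilate alpha) * ((1 + fps_const (monom (q\<^sup>2) 1) * fps_X) * dilate beta) * dilate gamma"
    by (simp only: beta_eq gamma_eq alpha_eq[symmetric])
  also have "\<dots> = (1 + fps_const (monom q 1) * fps_X) * (1 + fps_const (monom (q\<^sup>2) 1) * fps_X) * dilate gen_fps"
    by (simp only: gen_fps_def dilate_mult mult_ac)
  finally show ?thesis .
qed

lemma bas_poly_gen_fps: "bas_poly q n = smult (qf n) (fps_nth gen_fps n)"
proof -
  have "fps_nth gen_fps n = (\<Sum>k\<le>n. \<Sum>a\<le>k. fps_nth alpha a * fps_nth gamma (k - a) * fps_nth beta (n - k))"
  proof -
    have "gen_fps = (alpha * gamma) * beta" by (simp only: gen_fps_def mult_ac)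
    then have "fps_nth gen_fps n = (\<Sum>k=0..n. fps_nth (alpha * gamma) k * fps_nth beta (n - k))"
      by (simp only: fps_mult_nth[of "alpha * gamma"])
    then show ?thesis unfolding fps_mult_nth[of alpha gamma] sum_distrib_right atLeast0AtMost .
  qed
  also have "\<dots> = (\<Sum>(a, c) | a + c \<le> n. fps_nth alpha a * fps_nth gamma c * fps_nth beta (n - a - c))"
    unfolding sum.Sigma[OF finite_atMost ballI[OF finite_atMost]]
    by (rule sum.reindex_bij_witness[of _ "\<lambda>(a, c). (a + c, a)" "\<lambda>(k, a). (a, k - a)"]) auto
  finally have "smult (qf n) (fps_nth gen_fps n) =
      (\<Sum>(a, c) | a + c \<le> n. smult (qf n) (fps_nth alpha a * fps_nth gamma c * fps_nth beta (n - a - c)))"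
    by (simp add: smult_sum_right case_prod_unfold)
  also have "\<dots> = bas_poly q n"
    unfolding bas_poly_def
  proof (intro sum.cong refl, clarify)
    fix a c assume ac: "a + c \<le> n"
    have "v_sum q n a * xi_sum q (n + 1 - a - c) c = qf n * (q ^ (a\<^sup>2) / qf a * (1 / qf c) * (1 / qf (n - a - c)))"
    proof (cases "n + 1 - a - c + c - 1 = n - a")
      case True
      then show ?thesis using ac qf_nz(1)
        by (simp add: v_sum_eq[OF q] xi_sum_eq[OF q] qbinomial_def) (simp add: field_simps)
    qed (use ac in auto)
    then show "smult (qf n) (fps_nth alpha a * fps_nth gamma c * fps_nth beta (n - a - c)) =
        monom (v_sum q n a * xi_sum q (n + 1 - a - c) c) (a + 2 * c) * (\<Sum>r\<le>n - a - c. monom (w_sum q (n - a - c) r) r)"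
      by (simp add: alpha_def beta_def gamma_def mult_monom w_poly_def[symmetric] smult_monom flip: mult_smult_left)
  qed
  finally show ?thesis ..
qed

lemma bas_poly_0: "bas_poly q 0 = 1"
proof -
  have "{(a, c). a + c \<le> (0::nat)} = {(0, 0)}" by auto
  then show ?thesis using q_generic_square[OF q] by (simp add: bas_poly_def v_sum_eq[OF q] xi_sum_eq[OF q] monom_0)
qed

lemma monom_mult_smult: "monom a 1 * smult b F = monom (b * a) 1 * (F :: 'a poly)"
  by (metis mult_smult_left mult_smult_right smult_monom)

lemma monom_mult_monom: "monom a 1 * (monom b 1 * F) = monom (a * b) 2 * (F :: 'a poly)"
  by (simp only: mult.assoc[symmetric] mult_monom one_add_one)

abbreviation "step_poly k \<equiv> 1 + monom 1 2 + monom (q ^ (2 * k + 1) + q ^ (2 * k + 2)) 1"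

text \<open>The coefficient of index \<open>Suc k\<close> in \<open>gen_fps_eq\<close>. The
  quadratic factors on both sides reach back to \<open>k - 1\<close>, hence the separate case
  \<open>k = 0\<close>.\<close>

lemma gen_fps_rec:
  "smult (1 - (q\<^sup>2) ^ Suc k) (fps_nth gen_fps (Suc k)) = step_poly k * fps_nth gen_fps k -
    (if k = 0 then 0 else monom (1 - q ^ (2 * k + 1)) 2 * fps_nth gen_fps (k - 1))"
proof -
  let ?f = "fps_nth gen_fps" and ?t = "monom 1 1 :: 'a poly"
  have nth2: "fps_nth (fps_X * (fps_X * F)) (Suc k) = (if k = 0 then 0 else fps_nth F (k - 1))" for F :: "'a poly fps"
    by simp
  have L: "(1 - fps_const (monom 1 2) * fps_X) * (1 - fps_X) * gen_fps =
      gen_fps - fps_X * gen_fps - fps_const (monom 1 2) * (fps_X * gen_fps) + fps_const (monom 1 2) * (fps_X * (fps_X * gen_fps))"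
    by (simp add: algebra_simps)
  have R: "(1 + fps_const (monom q 1) * fps_X) * (1 + fps_const (monom (q\<^sup>2) 1) * fps_X) * dilate gen_fps =
      dilate gen_fps + (fps_const (monom q 1) * (fps_X * dilate gen_fps)) + (fps_const (monom (q\<^sup>2) 1) * (fps_X * dilate gen_fps)) +
      fps_const (monom q 1) * (fps_const (monom (q\<^sup>2) 1) * (fps_X * (fps_X * dilate gen_fps)))"
    by (simp add: algebra_simps)
  let ?p = "if k = 0 then 0 else ?f (k - 1)"
  have "?f (Suc k) - ?f k - monom 1 2 * ?f k + monom 1 2 * ?p =
      smult ((q\<^sup>2) ^ Suc k) (?f (Suc k)) + monom q 1 * smult ((q\<^sup>2) ^ k) (?f k) + monom (q\<^sup>2) 1 * smult ((q\<^sup>2) ^ k) (?f k) +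
      monom q 1 * (monom (q\<^sup>2) 1 * (if k = 0 then 0 else smult ((q\<^sup>2) ^ (k - 1)) (?f (k - 1))))"
    using arg_cong[OF gen_fps_eq[unfolded L R], of "\<lambda>F. fps_nth F (Suc k)"]
    by (simp add: dilate_def nth2 del: power_Suc fps_X_power_mult_nth cong: if_cong)
  also have "monom q 1 * smult ((q\<^sup>2) ^ k) (?f k) = monom (q ^ (2 * k + 1)) 1 * ?f k"
    unfolding monom_mult_smult by (simp only: power_mult[symmetric] power_add power_one_right)
  also have "monom (q\<^sup>2) 1 * smult ((q\<^sup>2) ^ k) (?f k) = monom (q ^ (2 * k + 2)) 1 * ?f k"
    unfolding monom_mult_smult by (simp only: power_mult[symmetric] power_add)
  also have "monom q 1 * (monom (q\<^sup>2) 1 * (if k = 0 then 0 else smult ((q\<^sup>2) ^ (k - 1)) (?f (k - 1)))) = monom (q ^ (2 * k + 1)) 2 * ?p"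
  proof (cases k)
    case (Suc j)
    have "q * ((q\<^sup>2) ^ j * q\<^sup>2) = q ^ (2 * k + 1)"
      by (simp only: Suc power_mult[symmetric] power_add[symmetric] power_Suc[symmetric]) simp
    then show ?thesis by (simp only: Suc nat.distinct if_False diff_Suc_1 monom_mult_smult monom_mult_monom)
  qed simp
  finally have eq: "?f (Suc k) - ?f k - monom 1 2 * ?f k + monom 1 2 * ?p =
      smult ((q\<^sup>2) ^ Suc k) (?f (Suc k)) + monom (q ^ (2 * k + 1)) 1 * ?f k + monom (q ^ (2 * k + 2)) 1 * ?f k + monom (q ^ (2 * k + 1)) 2 * ?p" .
  have "smult (1 - (q\<^sup>2) ^ Suc k) (?f (Suc k)) = ?f (Suc k) - smult ((q\<^sup>2) ^ Suc k) (?f (Suc k))"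
    by (simp only: smult_diff_left smult_1_left)
  also have "\<dots> = ?f k + monom 1 2 * ?f k - monom 1 2 * ?p + monom (q ^ (2 * k + 1)) 1 * ?f k + monom (q ^ (2 * k + 2)) 1 * ?f k + monom (q ^ (2 * k + 1)) 2 * ?p"
    using eq by (simp only: diff_eq_eq add_diff_eq eq_diff_eq add_ac diff_add_eq)
  also have "\<dots> = step_poly k * ?f k - (monom 1 2 - monom (q ^ (2 * k + 1)) 2) * ?p"
    by (simp only: add_monom[symmetric] distrib_right left_diff_distrib mult_1_left) (simp only: algebra_simps)
  also have "(monom 1 2 - monom (q ^ (2 * k + 1)) 2) * ?p = (if k = 0 then 0 else monom (1 - q ^ (2 * k + 1)) 2 * ?f (k - 1))"
    by (simp only: diff_monom) simp
  finally show ?thesis .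
qed

lemma bas_poly_rec:
  "bas_poly q (Suc k) = step_poly k * bas_poly q k -
    (if k = 0 then 0 else monom ((1 - q ^ (2 * k + 1)) * (1 - q ^ (2 * k))) 2 * bas_poly q (k - 1))"
proof -
  have "bas_poly q (Suc k) = smult (qf k) (smult (1 - (q\<^sup>2) ^ Suc k) (fps_nth gen_fps (Suc k)))"
    by (simp only: bas_poly_gen_fps qf_Suc smult_smult)
  also have "\<dots> = step_poly k * bas_poly q k -
      smult (qf k) (if k = 0 then 0 else monom (1 - q ^ (2 * k + 1)) 2 * fps_nth gen_fps (k - 1))"
    unfolding gen_fps_rec by (simp only: smult_diff_right mult_smult_right bas_poly_gen_fps)
  also have "smult (qf k) (if k = 0 then 0 else monom (1 - q ^ (2 * k + 1)) 2 * fps_nth gen_fps (k - 1)) =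
      (if k = 0 then 0 else monom ((1 - q ^ (2 * k + 1)) * (1 - q ^ (2 * k))) 2 * bas_poly q (k - 1))"
  proof (cases k)
    case (Suc j)
    have "(q\<^sup>2) ^ Suc j = q ^ (2 * k)" by (simp only: Suc power_mult[symmetric])
    then have eq: "qf k = qf j * (1 - q ^ (2 * k))" by (simp only: Suc qf_Suc)
    have smult_monom_mult: "smult (a * d) (monom c 2 * F) = monom (c * d) 2 * smult a F" for a c d :: 'a and F
    proof -
      have "smult (a * d) (monom c 2 * F) = monom (a * d * c) 2 * F"
        by (simp only: mult_smult_left[symmetric] smult_monom)
      also have "a * d * c = a * (c * d)" by (simp only: mult_ac)
      also have "monom (a * (c * d)) 2 * F = monom (c * d) 2 * smult a F"
        by (simp only: smult_monom[symmetric] mult_smult_left mult_smult_right)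
      finally show ?thesis .
    qed
    have "k \<noteq> 0" "k - 1 = j" using Suc by simp_all
    then show ?thesis
      by (simp only: if_False bas_poly_gen_fps eq smult_monom_mult)
  qed simp
  finally show ?thesis .
qed

section \<open>Rogers-Szego polynomials and their three-term recursion\<close>

definition rogers_szego :: "nat \<Rightarrow> 'a poly" where
  "rogers_szego m = (\<Sum>l\<le>m. monom (qbinomial q m l) l)"

lemma coeff_rogers_szego: "coeff (rogers_szego m) l = qbinomial q m l"
  by (simp add: rogers_szego_def coeff_sum qbinomial_eq_0)

text \<open>Pascal's rule carries the weight \<open>q ^ (m - l)\<close>. Written as
  \<open>1 - (1 - q ^ (m - l))\<close> it gives the factor \<open>1 + t\<close> and a remainder that
  \<open>qbinomial_absorb\<close> turns into the polynomial of index \<open>m - 1\<close>.\<close>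

lemma rogers_szego_Suc:
  "rogers_szego (Suc m) = (1 + monom 1 1) * rogers_szego m - (if m = 0 then 0 else monom (1 - q ^ m) 1 * rogers_szego (m - 1))"
proof (rule poly_eqI)
  fix l
  show "coeff (rogers_szego (Suc m)) l = coeff ((1 + monom 1 1) * rogers_szego m - (if m = 0 then 0 else monom (1 - q ^ m) 1 * rogers_szego (m - 1))) l"
  proof (cases l)
    case 0
    then show ?thesis using q by (simp add: coeff_rogers_szego distrib_right coeff_monom_mult)
  next
    case (Suc j)
    have "(1 - q ^ (m - j)) * qbinomial q m j = (if m = 0 then 0 else (1 - q ^ m) * qbinomial q (m - 1) j)"
    proof (cases m)
      case m: (Suc m')
      show ?thesis
      proof (cases "j \<le> m")
        case True
        then show ?thesis using qbinomial_absorb[OF q, of j m'] by (simp add: m)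
      qed (simp add: m qbinomial_eq_0)
    qed simp
    then show ?thesis
      using qbinomial_pascal[OF q, of m j]
      unfolding Suc distrib_right mult_1_left coeff_add coeff_diff if_distrib[of "\<lambda>p. coeff p _"] coeff_monom_mult coeff_0 coeff_rogers_szego
      by (auto simp: left_diff_distrib algebra_simps)
  qed
qed

text \<open>Two steps of the three-term recursion lead from one odd index to the next. Eliminating
  the polynomial of even index leaves the recursion \<open>bas_poly_rec\<close>.\<close>

lemma rogers_szego_odd: "(1 + monom 1 1) * bas_poly q n = rogers_szego (2 * n + 1)"
proof (induction n rule: less_induct)
  case (less n)
  show ?case
  proof (cases n)
    case 0
    have "rogers_szego 0 = 1" using q by (simp add: rogers_szego_def monom_0)
    then show ?thesis using rogers_szego_Suc[of 0] by (simp add: 0 bas_poly_0)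
  next
    case (Suc k)
    let ?H = rogers_szego and ?t = "monom 1 1 :: 'a poly"
    have mt: "monom c 1 = smult c ?t" "monom c 2 = smult c (?t * ?t)" for c
      by (simp_all add: smult_monom mult_monom numeral_2_eq_2)
    define x y where "x = q ^ (2 * k + 1)" and "y = q ^ (2 * k + 2)"
    have H3: "?H (2 * k + 3) = (1 + ?t) * ?H (2 * k + 2) - smult (1 - y) ?t * ?H (2 * k + 1)"
      unfolding mt(1)[symmetric] using rogers_szego_Suc[of "2 * k + 2"] by (simp add: y_def numeral_3_eq_3)
    have H2: "?H (2 * k + 2) = (1 + ?t) * ?H (2 * k + 1) - smult (1 - x) ?t * ?H (2 * k)"
      unfolding mt(1)[symmetric] using rogers_szego_Suc[of "2 * k + 1"] by (simp add: x_def)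
    have "?H (2 * k + 3) = (1 + ?t * ?t + smult (x + y) ?t) * ?H (2 * k + 1) -
        (if k = 0 then 0 else smult ((1 - x) * (1 - q ^ (2 * k))) (?t * ?t) * ?H (2 * k - 1))"
    proof -
      \<comment> \<open>The recursion read backwards, which eliminates the polynomial of index
        \<open>2 * k\<close>.\<close>
      have H1: "(1 + ?t) * ?H (2 * k) = ?H (2 * k + 1) + (if k = 0 then 0 else smult (1 - q ^ (2 * k)) ?t * ?H (2 * k - 1))"
        unfolding mt(1)[symmetric] using rogers_szego_Suc[of "2 * k"] by simp
      have "?H (2 * k + 3) = (1 + ?t) * (1 + ?t) * ?H (2 * k + 1) - smult (1 - x) ?t * ((1 + ?t) * ?H (2 * k)) - smult (1 - y) ?t * ?H (2 * k + 1)"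
        unfolding H3 H2 by (simp only: right_diff_distrib mult_ac)
      also have "\<dots> = (1 + ?t * ?t + smult (x + y) ?t) * ?H (2 * k + 1) -
        (if k = 0 then 0 else smult ((1 - x) * (1 - q ^ (2 * k))) (?t * ?t) * ?H (2 * k - 1))"
        unfolding H1 by (simp add: algebra_simps smult_add_left smult_diff_left smult_add_right smult_diff_right)
      finally show ?thesis .
    qed
    moreover have "(1 + ?t) * bas_poly q n = (1 + ?t * ?t + smult (x + y) ?t) * ((1 + ?t) * bas_poly q k) -
        (if k = 0 then 0 else smult ((1 - x) * (1 - q ^ (2 * k))) (?t * ?t) * ((1 + ?t) * bas_poly q (k - 1)))"
      unfolding Suc bas_poly_rec x_def[symmetric] y_def[symmetric] mt(1)[of "x + y"] mt(2)[of 1] mt(2)[of "(1 - x) * (1 - q ^ (2 * k))"] smult_1_left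
      by (cases "k = 0") (simp_all only: if_True if_False simp_thms algebra_simps mult_1_left mult_1_right mult_zero_left add_0_left add_0_right diff_0_right)
    moreover have "(1 + ?t) * bas_poly q k = ?H (2 * k + 1)" using less.IH[of k] Suc by simp
    moreover have "(1 + ?t) * bas_poly q (k - 1) = ?H (2 * k - 1)" if "k \<noteq> 0"
    proof -
      have "2 * (k - 1) + 1 = 2 * k - 1" using that by simp
      then show ?thesis using less.IH[of "k - 1"] Suc by (metis less_Suc_eq less_imp_diff_less)
    qed
    ultimately have "(1 + ?t) * bas_poly q n = ?H (2 * k + 3)" by (cases "k = 0") (simp_all only: if_True if_False simp_thms)
    then show ?thesis by (simp add: Suc numeral_3_eq_3)
  qed
qed

theorem bas_gen_sum:
  assumes "l \<ge> 1"
  shows "bas_gen q n (l - 1) + bas_gen q n l = qbinomial q (2 * n + 1) l"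
proof -
  obtain j where l: "l = Suc j" using assms by (cases l) auto
  have "qbinomial q (2 * n + 1) l = coeff ((1 + monom 1 1) * bas_poly q n) l"
    by (simp only: rogers_szego_odd coeff_rogers_szego)
  then show ?thesis
    by (simp add: l distrib_right coeff_monom_mult coeff_bas_poly[OF q])
qed

end

section \<open>The indeterminate of the field of rational functions\<close>

lemma q_indet_power: "q_indet ^ k = Fract (monom 1 k) 1"
proof (induction k)
  case 0
  then show ?case by (simp add: monom_0 One_fract_def one_pCons)
next
  case (Suc k)
  have "[:0, 1:] * monom 1 k = monom (1::rat) (Suc k)" by (simp add: monom_Suc)
  then show ?case
    unfolding power_Suc Suc.IH by (simp add: q_indet_def del: mult_pCons_left)
qed

lemma sum_Fract: "(\<Sum>i\<in>A. Fract (f i) 1) = Fract (\<Sum>i\<in>A. f i) (1 :: rat poly)"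
  by (induction A rule: infinite_finite_induct) (simp_all add: Zero_fract_def)

lemma q_generic_q_indet: "q_generic q_indet"
  unfolding q_generic_def
proof (intro allI impI notI)
  fix k :: nat assume "k > 0" "q_indet ^ k = 1"
  then have "monom 1 k = (1 :: rat poly)" by (simp add: q_indet_power One_fract_def eq_fract)
  then have "coeff (monom (1::rat) k) k = coeff 1 k" by (rule arg_cong)
  then show False using \<open>k > 0\<close> by simp
qed

theorem theorem10:
  fixes n l :: nat
  assumes "n \<ge> 1" and "l \<ge> 1"
  shows "(is_module_basis (sym_polys (2 * n + 1)) (\<lambda>c P. const c * P) (U n l)
            (bas_index n l) (bas n l) \<and>
          card (bas_index n l) = (2 * n + 1) choose l) \<and>
         ((\<forall>t\<in>bas_index n l. \<exists>d. deg1_homogeneous d (bas n l t)) \<and>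
          ch n l = qbinomial q_indet (2 * n + 1) l)"
proof -
  let ?T = "bas_index n l" and ?c = "l choose 2"
  let ?S = "{A. A \<subseteq> {..<2 * n + 1} \<and> card A = l}"
  note q = q_generic_q_indet
  have finT: "finite ?T" by (rule finite_bas_index)
  have finS: "finite ?S" by (rule finite_subset[of _ "Pow {..<2 * n + 1}"]) auto
  have gen: "(\<Sum>t\<in>?T. q_indet ^ bas_deg t) = qbinomial q_indet (2 * n + 1) l"
    using bas_gen_sum[OF q assms(2), of n]
    by (simp add: bas_index_def bas_gen_def sum.Plus finite_bas_minus_index del: One_nat_def)
  \<comment> \<open>Both sides are \<open>q_indet ^ ?c\<close> times the Gaussian binomial
    coefficient.\<close>
  have "(\<Sum>t\<in>?T. q_indet ^ (bas_deg t + ?c)) = (\<Sum>A\<in>?S. q_indet ^ (\<Sum>A))"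
    unfolding sum_subsets[OF q] gen[symmetric] by (simp add: power_add sum_distrib_left mult.commute)
  \<comment> \<open>Back from the fraction field to polynomials, whose coefficients count the
    elements of each degree.\<close>
  then have eq: "(\<Sum>t\<in>?T. monom (1::rat) (bas_deg t + ?c)) = (\<Sum>A\<in>?S. monom 1 (\<Sum>A))"
    unfolding q_indet_power sum_Fract by (simp add: eq_fract)
  have card: "card {t \<in> ?T. bas_deg t + ?c = d} = card {A. A \<subseteq> {..<2 * n + 1} \<and> card A = l \<and> \<Sum>A = d}" for d
  proof -
    have "of_nat (card {t \<in> ?T. bas_deg t + ?c = d}) = (of_nat (card {A \<in> ?S. \<Sum>A = d}) :: rat)"
      using arg_cong[OF eq, of "\<lambda>p. coeff p d"]
      by (simp only: coeff_sum coeff_monom sum.inter_filter[OF finT, symmetric] sum.inter_filter[OF finS, symmetric] of_nat_sum[symmetric] sum_constant mult_1_right)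
    moreover have "{A \<in> ?S. \<Sum>A = d} = {A. A \<subseteq> {..<2 * n + 1} \<and> card A = l \<and> \<Sum>A = d}" by blast
    ultimately show ?thesis by (simp only: of_nat_eq_iff)
  qed
  \<comment> \<open>At the argument 1 the same identity counts all elements.\<close>
  have "of_nat (card ?T) = (of_nat (card ?S) :: rat)"
    using arg_cong[OF eq, of "\<lambda>p. poly p 1"] by (simp only: poly_sum poly_monom power_one mult_1_right sum_constant)
  then have card_T: "card ?T = (2 * n + 1) choose l"
    using n_subsets[of "{..<2 * n + 1}" l] by (simp only: of_nat_eq_iff finite_lessThan card_lessThan)
  have basis: "is_module_basis (sym_polys (2 * n + 1)) (\<lambda>c P. const c * P) (U n l) ?T (bas n l)"
    by (rule bas_basis[OF assms card])
  have hom: "deg1_homogeneous (int (bas_deg t)) (bas n l t)" if "t \<in> ?T" for t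
    by (rule bas_props(4)[OF assms that])
  have deg: "deg1 (bas n l t) = int (bas_deg t)" if t: "t \<in> ?T" for t
  proof (rule deg1_eqI[OF hom[OF t]])
    show "bas n l t \<noteq> 0"
    proof
      assume z: "bas n l t = 0"
      \<comment> \<open>The indicator of \<open>t\<close> would give a nontrivial relation.\<close>
      define r where "r s = (if s = t then 1 else 0 :: xpoly)" for s
      have "(\<Sum>s\<in>?T. const (r s) * bas n l s) = 0"
        by (rule sum.neutral) (simp add: z const_def r_def)
      moreover have "\<forall>s\<in>?T. r s \<in> sym_polys (2 * n + 1)" by (simp add: r_def)
      moreover have "\<forall>c. (\<forall>s\<in>?T. c s \<in> sym_polys (2 * n + 1)) \<longrightarrow> (\<Sum>s\<in>?T. const (c s) * bas n l s) = 0 \<longrightarrow> (\<forall>s\<in>?T. c s = 0)"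
        using basis unfolding is_module_basis_def by (elim conjE)
      ultimately have "r t = 0" using t by blast
      then show False by (simp add: r_def)
    qed
  qed
  have "ch n l = (\<Sum>t\<in>?T. q_indet ^ bas_deg t)"
    unfolding ch_def by (intro sum.cong refl) (simp add: deg)
  then have "ch n l = qbinomial q_indet (2 * n + 1) l" by (simp only: gen)
  then show ?thesis
    by (intro conjI basis card_T ballI exI) (rule hom)
qed

end
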